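(* Let $C>0$ be a constant and let $I\subset\mathbb{R}$ be a closed interval of length strictly less than $1$. Then the Ising free energy density $F$ is a local function on $\mathcal{G}_{I,C}$, i.e. $F\in\mathcal{L}(\mathcal{G}_{I,C})$.
   Context: A weighted graph $G=(\mathbf{A},\mathbf{h})$ on vertex set $[N]=\{1,\dots,N\}$, $N\ge1$, consists of a symmetric matrix $\mathbf{A}=(a_{ij})\in\mathbb{R}^{N\times N}$ (edge weights; diagonal entries allowed) and a vector $\mathbf{h}=(h_1,\dots,h_N)\in\mathbb{R}^N$ (vertex weights, i.e. external field). A test graph $X=(\mathbf{W},\mathbf{d})$ on $[n]$, $n\ge 1$, is a multigraph given by a symmetric matrix $\mathbf{W}=(w_{ij})\in\mathbb{Z}_{\ge0}^{n\times n}$ ($w_{ij}$ is the number of edges between $i$ and $j$, loops allowed) together with vertex weights $\mathbf{d}=(d_1,\dots,d_n)\in\mathbb{Z}_{\ge0}^n$. Let $c(X)$ be its number of connected components. The weighted homomorphism density is $$t(X,G)=\frac{1}{N^{c(X)}}\sum_{f:[n]\to[N]}\Big(\prod_{i\in[n]}h_{f(i)}^{d_i}\Big)\Big(\prod_{1\le i\le j\le n}a_{f(i)f(j)}^{w_{ij}}\Big),$$ with the convention $0^0=1$. For a closed interval $J\subset\mathbb{R}$ and $C>0$, $\mathcal{G}_{J,C}$ is the set of all finite weighted graphs $G=(\mathbf{A},\mathbf{h})$ (of any size $N$) such that all eigenvalues of $\mathbf{A}$ lie in $J$, $\|\mathbf{A}\|_{\infty\to\infty}=\max_i\sum_j|a_{ij}|\le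 C$, and $\|\mathbf{h}\|_\infty=\max_i|h_i|\le C$. For a set $\mathcal{G}$ of weighted graphs, $\mathcal{L}(\mathcal{G})$ (the local functions on $\mathcal{G}$) is the completion, with respect to the uniform norm on $\mathcal{G}$, of the algebra of functions on $\mathcal{G}$ spanned by $t(X,\cdot)$ over all test graphs $X$; that is, the set of functions on $\mathcal{G}$ that are uniform limits on $\mathcal{G}$ of finite real linear combinations of functions $t(X,\cdot)$. The Ising free energy density of $G=(\mathbf{A},\mathbf{h})$ on $[N]$ is $$F(G)=\frac1N\log Z(G),\qquad Z(G)=\sum_{\boldsymbol\sigma\in\{-1,1\}^N}\exp\Big(\tfrac12\langle\boldsymbol\sigma,\mathbf{A}\boldsymbol\sigma\rangle+\langle\mathbf{h},\boldsymbol\sigma\rangle\Big).$$ *)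

theory Defs
  imports
    "HOL-Library.FuncSet"
    "HOL-Analysis.Uniform_Limit"
    "Jordan_Normal_Form.Char_Poly"
begin

(* Vertices are numbered from 0: the vertex set [N] is rendered as {0..<N}, with N the
   dimension of the matrix. *)

datatype wgraph = WGraph (edge_weights: "real mat") (vertex_weights: "real vec")

definition wgraph_size :: "wgraph \<Rightarrow> nat" where
  "wgraph_size G = dim_row (edge_weights G)"

definition weighted_graph :: "wgraph \<Rightarrow> bool" where
  "weighted_graph G \<longleftrightarrow>
     wgraph_size G \<ge> 1 \<and>
     edge_weights G \<in> carrier_mat (wgraph_size G) (wgraph_size G) \<and>
     transpose_mat (edge_weights G) = edge_weights G \<and>
     vertex_weights G \<in> carrier_vec (wgraph_size G)"

datatype tgraph = TGraph (multiplicities: "nat mat") (degrees: "nat vec")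

definition tgraph_size :: "tgraph \<Rightarrow> nat" where
  "tgraph_size X = dim_row (multiplicities X)"

definition test_graph :: "tgraph \<Rightarrow> bool" where
  "test_graph X \<longleftrightarrow>
     tgraph_size X \<ge> 1 \<and>
     multiplicities X \<in> carrier_mat (tgraph_size X) (tgraph_size X) \<and>
     transpose_mat (multiplicities X) = multiplicities X \<and>
     degrees X \<in> carrier_vec (tgraph_size X)"

definition adjacency :: "tgraph \<Rightarrow> (nat \<times> nat) set" where
  "adjacency X = {(i, j). i < tgraph_size X \<and> j < tgraph_size X \<and> multiplicities X $$ (i, j) > 0}"

(* The adjacency relation of a test graph is symmetric, so its reflexive transitive closure
   is the relation of being connected, and its classes are the connected components. *)
definition num_components :: "tgraph \<Rightarrow> nat" where
  "num_components X = card ({0..<tgraph_size X} // (adjacency X)\<^sup>*)"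

definition hom_density :: "tgraph \<Rightarrow> wgraph \<Rightarrow> real" where
  "hom_density X G =
     (let n = tgraph_size X; W = multiplicities X; d = degrees X;
          N = wgraph_size G; A = edge_weights G; h = vertex_weights G
      in (1 / real N ^ num_components X) *
         (\<Sum>f \<in> {0..<n} \<rightarrow>\<^sub>E {0..<N}.
            (\<Prod>i \<in> {0..<n}. (h $ f i) ^ (d $ i)) *
            (\<Prod>(i, j) \<in> {(i, j). i \<le> j \<and> j < n}. (A $$ (f i, f j)) ^ (W $$ (i, j)))))"

definition mat_inf_norm :: "real mat \<Rightarrow> real" where
  "mat_inf_norm A = Max ((\<lambda>i. \<Sum>j \<in> {0..<dim_col A}. \<bar>A $$ (i, j)\<bar>) ` {0..<dim_row A})"

definition vec_inf_norm :: "real vec \<Rightarrow> real" where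
  "vec_inf_norm v = Max ((\<lambda>i. \<bar>v $ i\<bar>) ` {0..<dim_vec v})"

(* The matrices are real symmetric, so the real eigenvalues are all the eigenvalues. *)
definition graph_class :: "real set \<Rightarrow> real \<Rightarrow> wgraph set" where
  "graph_class J C =
     {G. weighted_graph G \<and>
         (\<forall>k. eigenvalue (edge_weights G) k \<longrightarrow> k \<in> J) \<and>
         mat_inf_norm (edge_weights G) \<le> C \<and>
         vec_inf_norm (vertex_weights G) \<le> C}"

(* The linear span is already an algebra: a product of densities is the density of the
   disjoint union of the test graphs. *)
definition density_span :: "(wgraph \<Rightarrow> real) set" where
  "density_span =
     {\<phi>. \<exists>S c. finite S \<and> S \<subseteq> Collect test_graph \<and>
               \<phi> = (\<lambda>G. \<Sum>X\<in>S. c X * hom_density X G)}"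

(* A function on GG is represented by any total function extending it; membership in
   local_functions GG depends only on the values on GG. *)
definition local_functions :: "wgraph set \<Rightarrow> (wgraph \<Rightarrow> real) set" where
  "local_functions GG =
     {\<phi>. \<exists>p :: nat \<Rightarrow> wgraph \<Rightarrow> real.
            (\<forall>k. p k \<in> density_span) \<and> uniform_limit GG p \<phi> sequentially}"

definition spin_configurations :: "nat \<Rightarrow> real vec set" where
  "spin_configurations N = {\<sigma> \<in> carrier_vec N. \<forall>i<N. \<sigma> $ i \<in> {-1, 1}}"

definition partition_function :: "wgraph \<Rightarrow> real" where
  "partition_function G =
     (\<Sum>\<sigma> \<in> spin_configurations (wgraph_size G).
        exp (1 / 2 * (\<sigma> \<bullet> (edge_weights G *\<^sub>v \<sigma>)) + vertex_weights G \<bullet> \<sigma>))"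

definition free_energy :: "wgraph \<Rightarrow> real" where
  "free_energy G = 1 / real (wgraph_size G) * ln (partition_function G)"

end

theory Submission
  imports Defs "HOL-Analysis.Analysis" "HOL-Real_Asymp.Real_Asymp"
begin

text \<open>
Adding a multiple \<open>t\<close> of the identity to \<open>A\<close> changes the free energy by the constant \<open>t / 2\<close>, as spins have
square one. An interval of length less than one can therefore be moved into \<open>[\<delta>, 1 - \<delta>]\<close> with
\<open>\<delta> > 0\<close>, and then the Gaussian (Hubbard-Stratonovich) transform applies:
with \<open>A' = A + t\<close>, the factor \<open>exp (\<langle>\<sigma>, A' \<sigma>\<rangle> / 2)\<close> is proportional to the integral of
\<open>exp (\<langle>\<sigma>, x\<rangle> - \<langle>x, A'\<^sup>-\<^sup>1 x\<rangle> / 2)\<close> over \<open>x\<close>.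
Summing over \<open>\<sigma>\<close> gives the product of the \<open>2 cosh (x\<^sub>i + h\<^sub>i)\<close>. Since the second derivative
of \<open>ln cosh\<close> is at most one and \<open>A'\<^sup>-\<^sup>1\<close> exceeds one strictly, the result is a uniformly log-concave
measure on \<open>x\<close>. This is where length less than one enters; the contraction below then
works at a rate that does not depend on the number of vertices.

Locality needs \<open>A'\<^sup>-\<^sup>1\<close> expressed through \<open>A\<close>. With \<open>c = 2 / \<delta>\<close> and a polynomial \<open>p\<close> for which
\<open>p\<^sup>2\<close> is close to \<open>c - 1 / (\<lambda> + t)\<close> on the spectrum (Weierstrass), \<open>B = p(A)\<close> satisfies
\<open>\<langle>x, A'\<^sup>-\<^sup>1 x\<rangle> \<approx> c |x|\<^sup>2 - |B x|\<^sup>2\<close>. So both the transformed Ising sum and the Gaussian normalisation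
have the form \<open>\<Sum>\<^sub>x (\<Prod>\<^sub>i r(h\<^sub>i, x\<^sub>i)) exp (|B x|\<^sup>2 / 2)\<close> with site weights \<open>r\<close> of log-concavity \<open>c - 1\<close> and
\<open>B\<^sup>2\<close> bounded by a constant less than \<open>c - 1\<close>. The integral over \<open>x\<close> is replaced by a sum over a fine
bounded lattice: shifting the lattice by a rounded copy of \<open>A' \<sigma>\<close> completes the square up to
small errors, and an average over several box sizes makes the boundary effects telescope
(\<open>log_ratio_average\<close>).

It remains that the logarithm of such a lattice sum, divided by the number of vertices, is local
(\<open>log_partition_near_span\<close>). Linearise \<open>exp (|B x|\<^sup>2 / 2)\<close> once more, now with rescaled binomial
variables \<open>w\<close> instead of Gaussian ones, to a bond term \<open>exp (\<langle>w, B x\<rangle>)\<close>. Given one layer, the sites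
of the other are independent. The free energy is the integral over a coupling \<open>s \<in> [0, 1]\<close> of
the expected bond term (\<open>free_energy_Riemann_sum\<close>). By log-concavity, resampling the two layers
alternately contracts Lipschitz constants in the normalised Euclidean norm by the factor
\<open>|B|\<^sup>2 / (\<kappa> \<kappa>') < 1\<close> (\<open>gibbs_contraction\<close>), so finitely many resamplings started from the zero
configuration determine the expectation up to a uniformly small error (\<open>chain_forgets\<close>).

A finite number of resamplings is local (\<open>lapprox_gibbs\<close>): sums over maps of a tree
into \<open>G\<close>, with continuous functions of the field and of the polynomial observables at the vertices,
are closed under conditional expectation after splitting the maps by their coincidences. The
bound on row sums makes all tree sums uniformly bounded (\<open>tree_sum_bound\<close>), which allows
continuous functions to be replaced by polynomials; and tree sums with polynomials in the
field are combinations of densities of connected test graphs (\<open>msum_is_density\<close>).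
\<close>

section \<open>Symmetric operators and their spectrum\<close>

definition ip :: "nat \<Rightarrow> (nat \<Rightarrow> real) \<Rightarrow> (nat \<Rightarrow> real) \<Rightarrow> real" where
  "ip N u v = (\<Sum>i<N. u i * v i)"

definition mv :: "nat \<Rightarrow> (nat \<Rightarrow> nat \<Rightarrow> real) \<Rightarrow> (nat \<Rightarrow> real) \<Rightarrow> nat \<Rightarrow> real" where
  "mv N A x i = (\<Sum>j<N. A i j * x j)"

lemma ip_commute: "ip N u v = ip N v u"
  by (simp add: ip_def mult.commute)

lemma ip_lin: "ip N u (\<lambda>i. a * v i + b * w i) = a * ip N u v + b * ip N u w"
  by (simp add: ip_def distrib_left sum.distrib sum_distrib_left mult_ac)

lemma ip_lin_left: "ip N (\<lambda>i. a * v i + b * w i) u = a * ip N v u + b * ip N w u"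
  by (simp add: ip_commute[of N _ u] ip_lin)

lemma ip_self_nonneg: "0 \<le> ip N v v"
  by (simp add: ip_def sum_nonneg)

lemma ip_self_zero: "ip N v v = 0 \<Longrightarrow> i < N \<Longrightarrow> v i = 0"
  by (simp add: ip_def sum_nonneg_eq_0_iff)

lemma ip_cong: "(\<And>i. i < N \<Longrightarrow> u i = u' i) \<Longrightarrow> (\<And>i. i < N \<Longrightarrow> v i = v' i) \<Longrightarrow> ip N u v = ip N u' v'"
  by (simp add: ip_def)

lemma mv_cong: "(\<And>j. j < N \<Longrightarrow> u j = v j) \<Longrightarrow> mv N A u i = mv N A v i"
  by (simp add: mv_def)

lemma mv_lin: "mv N A (\<lambda>j. a * u j + b * v j) i = a * mv N A u i + b * mv N A v i"
  by (simp add: mv_def distrib_left sum.distrib sum_distrib_left mult_ac)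

lemma mv_scale: "mv N A (\<lambda>j. a * u j) i = a * mv N A u i"
  using mv_lin[of N A a u 0 u i] by simp

lemma ip_mv_sym:
  assumes "\<And>i j. i < N \<Longrightarrow> j < N \<Longrightarrow> A i j = A j i"
  shows "ip N u (mv N A v) = ip N v (mv N A u)"
proof -
  have "ip N u (mv N A v) = (\<Sum>i<N. \<Sum>j<N. u i * A i j * v j)"
    by (simp add: ip_def mv_def sum_distrib_left mult_ac)
  also have "\<dots> = (\<Sum>j<N. \<Sum>i<N. u i * A i j * v j)" by (rule sum.swap)
  also have "\<dots> = (\<Sum>j<N. \<Sum>i<N. v j * (A j i * u i))"
    using assms by (intro sum.cong) (auto simp: mult_ac)
  also have "\<dots> = ip N v (mv N A u)"
    by (simp add: ip_def mv_def sum_distrib_left)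
  finally show ?thesis .
qed

lemma quadratic_nonneg_imp_linear_zero:
  fixes b c :: real
  assumes "\<And>t. 0 \<le> t * b + t\<^sup>2 * c"
  shows "b = 0"
proof (rule ccontr)
  assume b: "b \<noteq> 0"
  \<comment> \<open>At \<open>t = - b / k\<close> with \<open>k > c\<close> the quadratic is negative unless \<open>b = 0\<close>.\<close>
  define k where "k = \<bar>c\<bar> + 1"
  have k: "k > 0" "c < k" by (auto simp: k_def)
  have "0 \<le> (- b / k) * b + (- b / k)\<^sup>2 * c" by (rule assms)
  also have "\<dots> = b\<^sup>2 / k * (c / k - 1)"
    using k by (simp add: power2_eq_square field_simps)
  also have "\<dots> < 0"
    using b k by (intro mult_pos_neg) auto
  finally show False by simp
qed

text \<open>Vectors of length \<open>N\<close> are functions on \<open>nat\<close>; requiring the value zero beyond \<open>N\<close> makes the sphere a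
closed subset of a product of compact intervals.\<close>

lemma compact_unit_sphere_of_kernel:
  "compact {v :: nat \<Rightarrow> real. (\<forall>i\<ge>N. v i = 0) \<and> ip N v v = 1 \<and> (\<forall>i<N. mv N K v i = 0)}"
    (is "compact ?C")
proof -
  let ?box = "PiE UNIV (\<lambda>i. if i < N then {-1..1::real} else {0})"
  have "compactin (product_topology (\<lambda>i::nat. euclidean :: real topology) UNIV) ?box"
    unfolding compactin_PiE by (auto simp: compactin_euclidean_iff)
  then have box: "compact ?box"
    by (simp add: euclidean_product_topology compactin_euclidean_iff)
  have "closed {v :: nat \<Rightarrow> real. ip N v v = 1}"
    unfolding ip_def by (intro closed_Collect_eq continuous_intros continuous_on_product_coordinates)
  moreover have "closed {v :: nat \<Rightarrow> real. \<forall>i<N. mv N K v i = 0}"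
    unfolding mv_def
    by (intro closed_Collect_all closed_Collect_imp closed_Collect_eq open_Collect_const
        continuous_intros continuous_on_product_coordinates)
  ultimately have cl: "closed ({v :: nat \<Rightarrow> real. ip N v v = 1} \<inter> {v. \<forall>i<N. mv N K v i = 0})"
    by (rule closed_Int)
  have "?C = ?box \<inter> ({v. ip N v v = 1} \<inter> {v. \<forall>i<N. mv N K v i = 0})"
  proof (intro equalityI subsetI)
    fix v assume v: "v \<in> ?C"
    have "v i \<in> {-1..1}" if "i < N" for i
    proof -
      have "(v i)\<^sup>2 \<le> ip N v v"
        using member_le_sum[of i "{..<N}" "\<lambda>i. v i * v i"] that
        by (simp add: ip_def power2_eq_square)
      then have "\<bar>v i\<bar> \<le> 1" using v by (simp add: abs_square_le_1)
      then show ?thesis by auto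
    qed
    then show "v \<in> ?box \<inter> ({v. ip N v v = 1} \<inter> {v. \<forall>i<N. mv N K v i = 0})"
      using v by auto
  next
    fix v assume "v \<in> ?box \<inter> ({v. ip N v v = 1} \<inter> {v. \<forall>i<N. mv N K v i = 0})"
    moreover from this have "v i = 0" if "\<not> i < N" for i
      using that by (auto simp: PiE_def Pi_def dest!: spec[of _ i])
    ultimately show "v \<in> ?C" by auto
  qed
  then show ?thesis using compact_Int_closed[OF box cl] by simp
qed

text \<open>The Rayleigh quotient of \<open>M\<close>, restricted to the kernel of a second matrix \<open>K\<close> which \<open>M\<close> preserves,
attains its maximum at an eigenvector of \<open>M\<close>. The restriction allows to diagonalise
two commuting matrices simultaneously, one eigenvector at a time.\<close>

lemma Rayleigh_maximizer:
  assumes sym: "\<And>i j. i < N \<Longrightarrow> j < N \<Longrightarrow> M i j = M j i"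
    and inv: "\<And>v. (\<And>i. i < N \<Longrightarrow> mv N K v i = 0) \<Longrightarrow> (\<And>i. i < N \<Longrightarrow> mv N K (mv N M v) i = 0)"
    and ex: "\<And>i. i < N \<Longrightarrow> mv N K w i = 0" "ip N w w > 0"
  obtains v mu where "ip N v v = 1" "\<And>i. i < N \<Longrightarrow> mv N K v i = 0"
    "\<And>i. i < N \<Longrightarrow> mv N M v i = mu * v i"
    "\<And>u. (\<And>i. i < N \<Longrightarrow> mv N K u i = 0) \<Longrightarrow> ip N u (mv N M u) \<le> mu * ip N u u"
proof -
  let ?C = "{v :: nat \<Rightarrow> real. (\<forall>i\<ge>N. v i = 0) \<and> ip N v v = 1 \<and> (\<forall>i<N. mv N K v i = 0)}"
  let ?q = "\<lambda>v. ip N v (mv N M v)"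
  \<comment> \<open>Normalisation, which also makes the vector vanish beyond \<open>N\<close>.\<close>
  define unit where "unit u = (\<lambda>i. if i < N then u i / sqrt (ip N u u) else 0)" for u :: "nat \<Rightarrow> real"
  have unit_in: "unit u \<in> ?C" and unit_q: "?q u = ?q (unit u) * ip N u u"
    if K: "\<And>i. i < N \<Longrightarrow> mv N K u i = 0" and p: "ip N u u > 0" for u
  proof -
    let ?c = "1 / sqrt (ip N u u)"
    have sc: "mv N Y (unit u) i = ?c * mv N Y u i" for Y i
    proof -
      have "mv N Y (unit u) i = mv N Y (\<lambda>j. ?c * u j + 0 * u j) i"
        by (intro mv_cong) (simp add: unit_def)
      also have "\<dots> = ?c * mv N Y u i" unfolding mv_lin by simp
      finally show ?thesis .
    qed
    have "ip N (unit u) (unit u) = ip N (\<lambda>j. ?c * u j + 0 * u j) (\<lambda>j. ?c * u j + 0 * u j)"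
      by (intro ip_cong) (simp_all add: unit_def)
    also have "\<dots> = ?c * ?c * ip N u u" by (simp only: ip_lin ip_lin_left) simp
    also have "\<dots> = 1" using p by (simp flip: power2_eq_square add: power_divide)
    finally show "unit u \<in> ?C" using K by (auto simp: sc) (simp add: unit_def)
    have "?q (unit u) = ip N (\<lambda>j. ?c * u j + 0 * u j) (\<lambda>i. ?c * mv N M u i + 0 * u i)"
      by (intro ip_cong) (simp_all add: unit_def sc[of M, unfolded unit_def])
    also have "\<dots> = ?c * ?c * ?q u" by (simp only: ip_lin ip_lin_left) simp
    finally show "?q u = ?q (unit u) * ip N u u"
      using p by (simp flip: power2_eq_square add: power_divide)
  qed
  have "?C \<noteq> {}" using unit_in[OF ex] by blast
  moreover have "continuous_on ?C ?q"
    unfolding ip_def mv_def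
    by (intro continuous_intros continuous_on_subset[OF continuous_on_product_coordinates]) auto
  ultimately have "\<exists>v\<in>?C. \<forall>u\<in>?C. ?q u \<le> ?q v"
    by (rule continuous_attains_sup[OF compact_unit_sphere_of_kernel])
  then obtain v where v: "v \<in> ?C" and v_max: "\<forall>u\<in>?C. ?q u \<le> ?q v" by (rule bexE)
  have max: "?q u \<le> ?q v" if "u \<in> ?C" for u using v_max that by (rule bspec)
  define mu where "mu = ?q v"
  have v1: "ip N v v = 1" and vK: "\<And>i. i < N \<Longrightarrow> mv N K v i = 0" using v by auto
  have M_sym: "ip N a (mv N M b) = ip N b (mv N M a)" for a b
    by (rule ip_mv_sym) (rule sym)
  have le: "?q u \<le> mu * ip N u u" if K: "\<And>i. i < N \<Longrightarrow> mv N K u i = 0" for u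
  proof (cases "ip N u u = 0")
    case True
    then have "ip N u (mv N M u) = ip N (\<lambda>_. 0) (mv N M u)"
      by (intro ip_cong) (auto dest: ip_self_zero)
    with True show ?thesis by (simp add: ip_def)
  next
    case False
    then have p: "ip N u u > 0" using ip_self_nonneg[of N u] by linarith
    have "?q u = ?q (unit u) * ip N u u" by (rule unit_q[OF K p])
    also have "\<dots> \<le> mu * ip N u u"
      unfolding mu_def using max[OF unit_in[OF K p]] p by (intro mult_right_mono) auto
    finally show ?thesis .
  qed
  have eig: "mv N M v i = mu * v i" if i: "i < N" for i
  proof -
    \<comment> \<open>First variation of the quotient in the direction of the defect \<open>mu v - M v\<close>, which lies in the kernel of \<open>K\<close>; its coefficient is twice the squared length of the defect.\<close>
    let ?u = "\<lambda>i. mu * v i + (-1) * mv N M v i"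
    have uK: "mv N K ?u i = 0" if "i < N" for i
      using vK inv[OF vK] that by (simp only: mv_lin)
    have "0 \<le> t * (2 * ip N ?u ?u) + t\<^sup>2 * (mu * ip N ?u ?u - ?q ?u)" for t
    proof -
      let ?w = "\<lambda>i. 1 * v i + t * ?u i"
      have "mv N K ?w i = 0" if "i < N" for i
        using vK uK that by (simp only: mv_lin)
      then have "0 \<le> mu * ip N ?w ?w - ?q ?w" using le by simp
      also have "?q ?w = ip N ?w (\<lambda>i. 1 * mv N M v i + t * mv N M ?u i)"
        by (intro ip_cong refl mv_lin)
      also have "mu * ip N ?w ?w - \<dots> = (mu - ?q v) + t * (2 * (mu * ip N ?u v - ip N ?u (mv N M v)))
           + t\<^sup>2 * (mu * ip N ?u ?u - ?q ?u)"
        unfolding ip_lin[of N _ 1 v t ?u] ip_lin_left[of N 1 v t ?u] ip_lin[of N _ 1 "mv N M v" t "mv N M ?u"]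
        using v1 M_sym[of v ?u] ip_commute[of N v ?u]
        by (simp add: algebra_simps power2_eq_square)
      also have "mu * ip N ?u v - ip N ?u (mv N M v) = ip N ?u ?u"
        using ip_lin[of N ?u mu v "-1" "mv N M v"] by simp
      finally show ?thesis by (simp add: mu_def)
    qed
    then have "2 * ip N ?u ?u = 0" by (rule quadratic_nonneg_imp_linear_zero)
    then have "ip N ?u ?u = 0" by simp
    from ip_self_zero[OF this i] show ?thesis by simp
  qed
  show thesis by (rule that[of v mu]) (use v1 vK eig le in auto)
qed

text \<open>Linearity on the first \<open>N\<close> coordinates. The second conjunct states that the values there depend
only on the first \<open>N\<close> coordinates of the argument, which is not automatic for functions on \<open>nat\<close>.\<close>

definition linear_op :: "nat \<Rightarrow> ((nat \<Rightarrow> real) \<Rightarrow> nat \<Rightarrow> real) \<Rightarrow> bool" where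
  "linear_op N T \<longleftrightarrow> (\<forall>u v a b i. i < N \<longrightarrow> T (\<lambda>j. a * u j + b * v j) i = a * T u i + b * T v i) \<and>
     (\<forall>u v. (\<forall>i<N. u i = v i) \<longrightarrow> (\<forall>i<N. T u i = T v i))"

lemma linear_opD:
  assumes "linear_op N T"
  shows "i < N \<Longrightarrow> T (\<lambda>j. a * u j + b * v j) i = a * T u i + b * T v i"
    "(\<And>i. i < N \<Longrightarrow> u i = v i) \<Longrightarrow> i < N \<Longrightarrow> T u i = T v i"
  using assms unfolding linear_op_def by blast+

lemma linear_op_matrix:
  assumes T: "linear_op N T" and i: "i < N"
  shows "T v i = mv N (\<lambda>i j. T (\<lambda>k. if k = j then 1 else 0) i) v i"
proof -
  let ?e = "\<lambda>j k. if k = j then 1 else (0::real)"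
  have part: "T (\<lambda>k. \<Sum>j<m. v j * ?e j k) i = (\<Sum>j<m. T (?e j) i * v j)" for m
  proof (induction m)
    case 0
    have "T (\<lambda>k. 0 * v k + 0 * v k) i = 0 * T v i + 0 * T v i" by (rule linear_opD(1)[OF T i])
    then show ?case by simp
  next
    case (Suc m)
    have "T (\<lambda>k. 1 * (\<Sum>j<m. v j * ?e j k) + v m * ?e m k) i
        = 1 * T (\<lambda>k. \<Sum>j<m. v j * ?e j k) i + v m * T (?e m) i"
      by (rule linear_opD(1)[OF T i])
    then show ?case using Suc by (simp add: mult.commute)
  qed
  have "T v i = T (\<lambda>k. \<Sum>j<N. v j * ?e j k) i"
  proof (rule linear_opD(2)[OF T _ i])
    fix k assume "k < N"
    then have "v k = (\<Sum>j<N. if k = j then v j else 0)" by simp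
    also have "\<dots> = (\<Sum>j<N. v j * ?e j k)" by (intro sum.cong) auto
    finally show "v k = (\<Sum>j<N. v j * ?e j k)" .
  qed
  then show ?thesis by (simp add: part mv_def)
qed

text \<open>A symmetric operator \<open>T\<close> that commutes with \<open>A\<close> is bounded by its values on the eigenvectors of \<open>A\<close>:
the eigenspace of \<open>T\<^sup>2\<close> for its largest eigenvalue is preserved by \<open>A\<close>, hence contains an eigenvector
of \<open>A\<close>. This replaces the spectral theorem in all norm estimates below.\<close>

theorem symmetric_op_norm_le_spectrum:
  assumes A: "\<And>i j. i < N \<Longrightarrow> j < N \<Longrightarrow> A i j = A j i"
    and T: "linear_op N T" and Tsym: "\<And>u v. ip N u (T v) = ip N v (T u)"
    and comm: "\<And>v i. i < N \<Longrightarrow> mv N A (T v) i = T (mv N A v) i"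
    and spec: "\<And>a v. ip N v v > 0 \<Longrightarrow> (\<And>i. i < N \<Longrightarrow> mv N A v i = a * v i)
           \<Longrightarrow> \<exists>t. \<bar>t\<bar> \<le> D \<and> (\<forall>i<N. T v i = t * v i)"
  shows "ip N (T v) (T v) \<le> D\<^sup>2 * ip N v v"
proof (cases "N = 0")
  case True
  then show ?thesis by (simp add: ip_def)
next
  case False
  let ?M = "\<lambda>i j. T (T (\<lambda>k. if k = j then 1 else 0)) i"
  have TT: "linear_op N (\<lambda>v. T (T v))"
    unfolding linear_op_def
  proof (intro conjI allI impI)
    fix u v :: "nat \<Rightarrow> real" and a b i assume i: "i < N"
    have "T (T (\<lambda>j. a * u j + b * v j)) i = T (\<lambda>j. a * T u j + b * T v j) i"
      by (rule linear_opD(2)[OF T _ i]) (rule linear_opD(1)[OF T])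
    also have "\<dots> = a * T (T u) i + b * T (T v) i" by (rule linear_opD(1)[OF T i])
    finally show "T (T (\<lambda>j. a * u j + b * v j)) i = a * T (T u) i + b * T (T v) i" .
  next
    fix u v :: "nat \<Rightarrow> real" and i assume uv: "\<forall>i<N. u i = v i" and i: "i < N"
    show "T (T u) i = T (T v) i"
      by (rule linear_opD(2)[OF T _ i]) (rule linear_opD(2)[OF T], use uv in auto)
  qed
  have M: "mv N ?M v i = T (T v) i" if "i < N" for v i
    using linear_op_matrix[OF TT that, of v] by simp
  have Mq: "ip N u (mv N ?M w) = ip N (T u) (T w)" for u w
  proof -
    have "ip N u (mv N ?M w) = ip N u (T (T w))" by (intro ip_cong) (auto simp: M)
    also have "\<dots> = ip N (T w) (T u)" by (rule Tsym)
    finally show ?thesis by (simp add: ip_commute)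
  qed
  have Msym: "?M i j = ?M j i" if ij: "i < N" "j < N" for i j
  proof -
    let ?e = "\<lambda>j k. if k = j then 1 else (0::real)"
    have pick: "ip N (?e i) w = w i" if "i < N" for i w
    proof -
      have "(\<Sum>k<N. ?e i k * w k) = (\<Sum>k<N. if k = i then w k else 0)"
        by (intro sum.cong) auto
      also have "\<dots> = w i" using that by simp
      finally show ?thesis by (simp add: ip_def)
    qed
    have "?M i j = ip N (?e i) (T (T (?e j)))" using pick[OF ij(1)] by simp
    also have "\<dots> = ip N (T (?e j)) (T (?e i))" by (rule Tsym)
    also have "\<dots> = ip N (T (?e i)) (T (?e j))" by (rule ip_commute)
    also have "\<dots> = ip N (?e j) (T (T (?e i)))" by (rule Tsym)
    also have "\<dots> = ?M j i" using pick[OF ij(2)] by simp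
    finally show ?thesis .
  qed
  have nz: "ip N (\<lambda>_. 1) (\<lambda>_. 1) > 0" using False by (simp add: ip_def)
  obtain w mu where w: "ip N w w = 1" "\<And>i. i < N \<Longrightarrow> mv N ?M w i = mu * w i"
      and top: "\<And>u. ip N u (mv N ?M u) \<le> mu * ip N u u"
  proof (rule Rayleigh_maximizer[of N ?M "\<lambda>_ _. 0" "\<lambda>_. 1"])
    show "?M i j = ?M j i" if "i < N" "j < N" for i j by (rule Msym[OF that])
  qed (use nz in \<open>auto simp: mv_def\<close>)
  \<comment> \<open>The kernel of \<open>?K\<close> is the eigenspace of \<open>T\<^sup>2\<close> for its largest eigenvalue.\<close>
  let ?K = "\<lambda>i j. ?M i j - (if j = i then mu else 0)"
  have K: "mv N ?K u i = T (T u) i - mu * u i" if "i < N" for u i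
  proof -
    have "mv N ?K u i = mv N ?M u i - (\<Sum>j<N. if j = i then mu * u j else 0)"
      unfolding mv_def sum_subtractf[symmetric] by (intro sum.cong) (auto simp: left_diff_distrib)
    then show ?thesis using that M by simp
  qed
  obtain v a where v: "ip N v v = 1" "\<And>i. i < N \<Longrightarrow> mv N ?K v i = 0" "\<And>i. i < N \<Longrightarrow> mv N A v i = a * v i"
  proof (rule Rayleigh_maximizer[of N A ?K w])
    fix u i assume u: "\<And>i. i < N \<Longrightarrow> mv N ?K u i = 0" and i: "i < N"
    have "T (T (mv N A u)) i = T (mv N A (T u)) i"
      by (rule linear_opD(2)[OF T _ i]) (simp add: comm)
    also have "\<dots> = mv N A (T (T u)) i" by (simp add: comm i)
    also have "\<dots> = mv N A (\<lambda>j. mu * u j + 0 * u j) i"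
      using u by (intro mv_cong) (simp add: K)
    also have "\<dots> = mu * mv N A u i" by (simp only: mv_lin)
    finally show "mv N ?K (mv N A u) i = 0" by (simp add: K i)
  next
    show "mv N ?K w i = 0" if "i < N" for i
      using w(2)[OF that] M[OF that] K[OF that] by simp
  qed (use A w in auto)
  obtain t where t: "\<bar>t\<bar> \<le> D" "\<And>i. i < N \<Longrightarrow> T v i = t * v i"
    using spec[of v a] v by auto
  have "ip N v (T (T v)) = mu * ip N v v"
  proof -
    have "ip N v (T (T v)) = ip N v (\<lambda>i. mu * v i + 0 * v i)"
      using v(2) K by (intro ip_cong) auto
    then show ?thesis by (simp only: ip_lin)
  qed
  moreover have "ip N v (T (T v)) = t\<^sup>2 * ip N v v"
  proof -
    have "ip N v (T (T v)) = ip N (T v) (T v)" by (rule Tsym)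
    also have "\<dots> = ip N (\<lambda>i. t * v i + 0 * v i) (\<lambda>i. t * v i + 0 * v i)"
      using t(2) by (intro ip_cong) auto
    finally show ?thesis by (simp only: ip_lin ip_lin_left) (simp add: power2_eq_square)
  qed
  ultimately have "mu = t\<^sup>2" using v(1) by simp
  also have "\<dots> \<le> D\<^sup>2" using t(1) by (simp add: abs_le_square_iff[symmetric])
  finally have "mu \<le> D\<^sup>2" .
  then have "mu * ip N u u \<le> D\<^sup>2 * ip N u u" for u by (intro mult_right_mono ip_self_nonneg)
  then show ?thesis using top Mq by (metis order_trans)
qed

text \<open>A polynomial, given by its coefficients from the constant term upwards, is evaluated
at a matrix by Horner's scheme; each coefficient costs one step along the edges of the graph.\<close>

fun op_poly :: "nat \<Rightarrow> (nat \<Rightarrow> nat \<Rightarrow> real) \<Rightarrow> real list \<Rightarrow> (nat \<Rightarrow> real) \<Rightarrow> nat \<Rightarrow> real" where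
  "op_poly N A [] x = (\<lambda>i. 0)"
| "op_poly N A (c # cs) x = (\<lambda>i. c * x i + mv N A (op_poly N A cs x) i)"

fun val_poly :: "real list \<Rightarrow> real \<Rightarrow> real" where
  "val_poly [] a = 0"
| "val_poly (c # cs) a = c + a * val_poly cs a"

lemma linear_op_comb:
  assumes "linear_op N T" "linear_op N U"
  shows "linear_op N (\<lambda>v i. a * T v i + b * U v i)"
  unfolding linear_op_def
proof (intro conjI allI impI)
  fix u v :: "nat \<Rightarrow> real" and x y i assume i: "i < N"
  show "a * T (\<lambda>j. x * u j + y * v j) i + b * U (\<lambda>j. x * u j + y * v j) i
      = x * (a * T u i + b * U u i) + y * (a * T v i + b * U v i)"
    by (simp add: linear_opD(1)[OF assms(1) i] linear_opD(1)[OF assms(2) i] algebra_simps)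
next
  fix u v :: "nat \<Rightarrow> real" and i assume "\<forall>i<N. u i = v i" "i < N"
  then show "a * T u i + b * U u i = a * T v i + b * U v i"
    using linear_opD(2)[OF assms(1), of u v i] linear_opD(2)[OF assms(2), of u v i] by simp
qed

lemma linear_op_comp:
  assumes T: "linear_op N T" and U: "linear_op N U"
  shows "linear_op N (\<lambda>v. T (U v))"
  unfolding linear_op_def
proof (intro conjI allI impI)
  fix u v :: "nat \<Rightarrow> real" and a b i assume i: "i < N"
  have "T (U (\<lambda>j. a * u j + b * v j)) i = T (\<lambda>j. a * U u j + b * U v j) i"
    by (rule linear_opD(2)[OF T _ i]) (rule linear_opD(1)[OF U])
  also have "\<dots> = a * T (U u) i + b * T (U v) i" by (rule linear_opD(1)[OF T i])
  finally show "T (U (\<lambda>j. a * u j + b * v j)) i = a * T (U u) i + b * T (U v) i" .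
next
  fix u v :: "nat \<Rightarrow> real" and i assume uv: "\<forall>i<N. u i = v i" and i: "i < N"
  show "T (U u) i = T (U v) i"
    by (rule linear_opD(2)[OF T _ i]) (rule linear_opD(2)[OF U], use uv in auto)
qed

lemma linear_op_id: "linear_op N (\<lambda>v. v)"
  by (simp add: linear_op_def)

lemma linear_op_mv: "linear_op N (mv N A)"
  by (simp add: linear_op_def mv_lin) (auto intro!: mv_cong)

lemma linear_op_poly: "linear_op N (op_poly N A p)"
proof (induction p)
  case Nil
  then show ?case by (simp add: linear_op_def)
next
  case (Cons c p)
  from linear_op_comb[OF linear_op_id linear_op_comp[OF linear_op_mv Cons], of c 1 A]
  show ?case by simp
qed

lemma op_poly_eigenvector:
  assumes "\<And>i. i < N \<Longrightarrow> mv N A v i = a * v i" and "i < N"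
  shows "op_poly N A p v i = val_poly p a * v i"
  using assms(2)
proof (induction p arbitrary: i)
  case (Cons c p)
  have "mv N A (op_poly N A p v) i = mv N A (\<lambda>j. val_poly p a * v j + 0 * v j) i"
    using Cons.IH by (intro mv_cong) simp
  also have "\<dots> = val_poly p a * (a * v i)"
    by (simp add: mv_scale assms(1)[OF Cons.prems])
  finally show ?case by (simp add: algebra_simps)
qed simp

lemma op_poly_commutes:
  assumes "i < N"
  shows "mv N A (op_poly N A p v) i = op_poly N A p (mv N A v) i"
  using assms
proof (induction p arbitrary: i)
  case Nil
  then show ?case by (simp add: mv_def)
next
  case (Cons c p)
  have "mv N A (op_poly N A (c # p) v) i = mv N A (\<lambda>j. c * v j + 1 * mv N A (op_poly N A p v) j) i"
    by simp
  also have "\<dots> = c * mv N A v i + 1 * mv N A (mv N A (op_poly N A p v)) i"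
    by (rule mv_lin)
  also have "\<dots> = c * mv N A v i + mv N A (mv N A (op_poly N A p v)) i" by simp
  also have "mv N A (mv N A (op_poly N A p v)) i = mv N A (op_poly N A p (mv N A v)) i"
    using Cons.IH by (intro mv_cong) simp
  finally show ?case by simp
qed

lemma op_poly_symmetric:
  assumes "\<And>i j. i < N \<Longrightarrow> j < N \<Longrightarrow> A i j = A j i"
  shows "ip N u (op_poly N A p v) = ip N v (op_poly N A p u)"
proof (induction p arbitrary: u v)
  case Nil
  then show ?case by (simp add: ip_def)
next
  case (Cons c p)
  have exp: "ip N u (op_poly N A (c # p) v) = c * ip N u v + ip N u (mv N A (op_poly N A p v))" for u v
    using ip_lin[of N u c v 1 "mv N A (op_poly N A p v)"] by simp
  have "ip N u (mv N A (op_poly N A p v)) = ip N (op_poly N A p v) (mv N A u)"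
    by (rule ip_mv_sym[OF assms])
  also have "\<dots> = ip N (mv N A u) (op_poly N A p v)" by (rule ip_commute)
  also have "\<dots> = ip N v (op_poly N A p (mv N A u))" by (rule Cons.IH)
  also have "\<dots> = ip N v (mv N A (op_poly N A p u))"
    by (intro ip_cong) (simp_all add: op_poly_commutes)
  finally show ?case by (simp only: exp ip_commute[of N u v])
qed

section \<open>Couplings of exponentially tilted lattice measures\<close>

definition cdf_below :: "real set \<Rightarrow> (real \<Rightarrow> real) \<Rightarrow> real \<Rightarrow> real" where
  "cdf_below S p t = (\<Sum>x\<in>{x\<in>S. x < t}. p x)"

lemma cdf_below_telescope:
  fixes q :: "real \<Rightarrow> real" and \<phi> :: "real \<Rightarrow> real"
  assumes "finite S"
  shows "(\<Sum>b\<in>S. \<phi> (cdf_below S q b + q b) - \<phi> (cdf_below S q b)) = \<phi> (sum q S) - \<phi> 0"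
  using assms
proof (induction S rule: finite_linorder_max_induct)
  case empty
  then show ?case by simp
next
  case (insert m S)
  have old: "cdf_below (insert m S) q b = cdf_below S q b" if "b \<in> S" for b
  proof -
    have "{x \<in> insert m S. x < b} = {x \<in> S. x < b}"
      using insert.hyps(2) that by force
    then show ?thesis by (simp add: cdf_below_def)
  qed
  have new: "cdf_below (insert m S) q m = sum q S"
  proof -
    have "{x \<in> insert m S. x < m} = S"
      using insert.hyps(2) by force
    then show ?thesis by (simp add: cdf_below_def)
  qed
  have "m \<notin> S" using insert.hyps(2) by blast
  then have "(\<Sum>b\<in>insert m S. \<phi> (cdf_below (insert m S) q b + q b) - \<phi> (cdf_below (insert m S) q b))
      = (\<phi> (sum q S + q m) - \<phi> (sum q S))
        + (\<Sum>b\<in>S. \<phi> (cdf_below S q b + q b) - \<phi> (cdf_below S q b))"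
    using insert.hyps(1) by (simp add: old new)
  also have "\<dots> = \<phi> (sum q (insert m S)) - \<phi> 0"
    using insert.IH insert.hyps(1) \<open>m \<notin> S\<close> by (simp add: add.commute)
  finally show ?case .
qed

lemma cdf_below_plus_le:
  assumes "finite S" "\<And>x. x \<in> S \<Longrightarrow> 0 \<le> p x" "b \<in> S" "b < t"
  shows "cdf_below S p b + p b \<le> cdf_below S p t"
proof -
  have "cdf_below S p b + p b = sum p (insert b {x\<in>S. x < b})"
    using assms(1) by (simp add: cdf_below_def)
  also have "\<dots> \<le> cdf_below S p t"
    unfolding cdf_below_def using assms by (intro sum_mono2) auto
  finally show ?thesis .
qed

lemma cdf_below_bounds:
  assumes "finite S" "\<And>x. x \<in> S \<Longrightarrow> 0 \<le> p x" "sum p S = 1" "b \<in> S"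
  shows "0 \<le> cdf_below S p b" "cdf_below S p b + p b \<le> 1"
proof -
  show "0 \<le> cdf_below S p b"
    unfolding cdf_below_def using assms by (intro sum_nonneg) auto
  have "cdf_below S p b + p b = sum p (insert b {x\<in>S. x < b})"
    using assms(1) by (simp add: cdf_below_def)
  also have "\<dots> \<le> sum p S"
    using assms by (intro sum_mono2) auto
  finally show "cdf_below S p b + p b \<le> 1" using assms(3) by simp
qed

text \<open>The quantile coupling. If the two distribution functions are ordered and one is ordered the other
way after a shift by \<open>d\<close>, then the coupled points differ by at most \<open>d\<close>.\<close>

lemma monotone_coupling:
  fixes p q :: "real \<Rightarrow> real"
  assumes fin: "finite S"
    and p0: "\<And>x. x \<in> S \<Longrightarrow> 0 \<le> p x" and q0: "\<And>x. x \<in> S \<Longrightarrow> 0 \<le> q x"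
    and p1: "sum p S = 1" and q1: "sum q S = 1"
    and dom: "\<And>t. cdf_below S q t \<le> cdf_below S p t"
    and shift: "\<And>t. cdf_below S p t \<le> cdf_below S q (t + d)"
  obtains J :: "real \<Rightarrow> real \<Rightarrow> real" where
    "\<And>a b. a \<in> S \<Longrightarrow> b \<in> S \<Longrightarrow> 0 \<le> J a b"
    "\<And>a. a \<in> S \<Longrightarrow> (\<Sum>b\<in>S. J a b) = p a"
    "\<And>b. b \<in> S \<Longrightarrow> (\<Sum>a\<in>S. J a b) = q b"
    "\<And>a b. a \<in> S \<Longrightarrow> b \<in> S \<Longrightarrow> J a b \<noteq> 0 \<Longrightarrow> a \<le> b \<and> b \<le> a + d"
proof -
  let ?F = "cdf_below S p" and ?G = "cdf_below S q"
  \<comment> \<open>The length of the intersection of the intervals \<open>[F a, F a + p a]\<close> and \<open>[G b, G b + q b]\<close>.\<close>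
  define J where "J = (\<lambda>a b. min (?F a + p a) (?G b + q b) - min (?F a) (?G b + q b)
                     - (min (?F a + p a) (?G b) - min (?F a) (?G b)))"
  have nonneg: "0 \<le> J a b" if "a \<in> S" "b \<in> S" for a b
    using p0[OF that(1)] q0[OF that(2)] unfolding J_def by (simp add: min_def)
  have m1: "(\<Sum>b\<in>S. J a b) = p a" if a: "a \<in> S" for a
  proof -
    have "(\<Sum>b\<in>S. J a b) = (\<Sum>b\<in>S. (\<lambda>s. min (?F a + p a) s - min (?F a) s) (?G b + q b)
             - (\<lambda>s. min (?F a + p a) s - min (?F a) s) (?G b))"
      by (simp add: J_def)
    also have "\<dots> = (min (?F a + p a) 1 - min (?F a) 1) - (min (?F a + p a) 0 - min (?F a) 0)"
      by (subst cdf_below_telescope[OF fin]) (simp add: q1)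
    also have "\<dots> = p a"
      using cdf_below_bounds[OF fin p0 p1 a] p0[OF a] by (simp add: min_def)
    finally show ?thesis .
  qed
  have m2: "(\<Sum>a\<in>S. J a b) = q b" if b: "b \<in> S" for b
  proof -
    have "(\<Sum>a\<in>S. J a b) = (\<Sum>a\<in>S. (\<lambda>s. min s (?G b + q b) - min s (?G b)) (?F a + p a)
             - (\<lambda>s. min s (?G b + q b) - min s (?G b)) (?F a))"
      by (intro sum.cong) (simp_all add: J_def)
    also have "\<dots> = (min 1 (?G b + q b) - min 1 (?G b)) - (min 0 (?G b + q b) - min 0 (?G b))"
      by (subst cdf_below_telescope[OF fin]) (simp add: p1)
    also have "\<dots> = q b"
      using cdf_below_bounds[OF fin q0 q1 b] q0[OF b] by (simp add: min_def)
    finally show ?thesis .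
  qed
  have supp: "a \<le> b \<and> b \<le> a + d" if a: "a \<in> S" and b: "b \<in> S" and nz: "J a b \<noteq> 0" for a b
  proof -
    have lt1: "?F a < ?G b + q b"
    proof (rule ccontr)
      assume "\<not> ?F a < ?G b + q b"
      then have "J a b = 0" using p0[OF a] q0[OF b] by (simp add: J_def min_def)
      with nz show False by simp
    qed
    have lt2: "?G b < ?F a + p a"
    proof (rule ccontr)
      assume "\<not> ?G b < ?F a + p a"
      then have "J a b = 0" using p0[OF a] q0[OF b] by (simp add: J_def min_def)
      with nz show False by simp
    qed
    have "\<not> b < a"
    proof
      assume "b < a"
      from cdf_below_plus_le[of S q b a, OF fin q0 b this] dom[of a] lt1 show False by linarith
    qed
    moreover have "\<not> a + d < b"
    proof
      assume "a + d < b"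
      then have "a < b - d" by simp
      from cdf_below_plus_le[of S p a "b - d", OF fin p0 a this] shift[of "b - d"] lt2
      show False by simp
    qed
    ultimately show ?thesis by simp
  qed
  show thesis by (rule that[of J]) (use nonneg m1 m2 supp in auto)
qed

definition tilt :: "real set \<Rightarrow> (real \<Rightarrow> real) \<Rightarrow> real \<Rightarrow> real \<Rightarrow> real" where
  "tilt S r z x = r x * exp (z * x) / (\<Sum>y\<in>S. r y * exp (z * y))"

text \<open>Closed under moving two points towards each other by a multiple of the spacing \<open>e\<close>; intervals of an
arithmetic progression with difference \<open>e\<close> have this property.\<close>

definition lattice_segment :: "real \<Rightarrow> real set \<Rightarrow> bool" where
  "lattice_segment e S \<longleftrightarrow> finite S \<and> S \<noteq> {} \<and> e > 0 \<and>
     (\<forall>x\<in>S. \<forall>y\<in>S. \<forall>l::nat. x + e * real l \<le> y \<longrightarrow> x + e * real l \<in> S \<and> y - e * real l \<in> S)"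

text \<open>A discrete form of uniform log-concavity: second differences of \<open>- ln r\<close> with step \<open>e l\<close> are at least
those of \<open>\<kappa> x\<^sup>2 / 2\<close>.\<close>

definition curved_weight :: "real \<Rightarrow> real \<Rightarrow> real set \<Rightarrow> (real \<Rightarrow> real) \<Rightarrow> bool" where
  "curved_weight \<kappa> e S r \<longleftrightarrow> (\<forall>x\<in>S. r x > 0) \<and>
     (\<forall>u\<in>S. \<forall>v\<in>S. \<forall>l::nat. u \<le> v \<longrightarrow> u + e * real l \<in> S \<longrightarrow> v + e * real l \<in> S \<longrightarrow>
        r u * r (v + e * real l) * exp (\<kappa> * (e * real l) * (v - u)) \<le> r v * r (u + e * real l))"

lemma lattice_segment_shift:
  assumes "lattice_segment e S" "x \<in> S" "y \<in> S" "x + e * real l \<le> y"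
  shows "x + e * real l \<in> S" "y - e * real l \<in> S"
  using assms unfolding lattice_segment_def by blast+

lemma curved_weightD:
  assumes "curved_weight \<kappa> e S r" "u \<in> S" "v \<in> S" "u \<le> v"
    "u + e * real l \<in> S" "v + e * real l \<in> S"
  shows "r u * r (v + e * real l) * exp (\<kappa> * (e * real l) * (v - u)) \<le> r v * r (u + e * real l)"
  using assms unfolding curved_weight_def by blast

lemma ratio_le_ratio_if_cross:
  fixes p q :: "real \<Rightarrow> real"
  assumes fin: "finite S" and AB: "A \<subseteq> S" "B \<subseteq> S" and pos: "sum p S > 0" "sum q S > 0"
    and cross: "sum p A * sum q (S - B) \<le> sum p (S - A) * sum q B"
  shows "sum p A / sum p S \<le> sum q B / sum q S"
proof -
  have 1: "sum p S = sum p A + sum p (S - A)" "sum q S = sum q B + sum q (S - B)"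
    using sum.subset_diff[OF AB(1) fin, of p] sum.subset_diff[OF AB(2) fin, of q] by simp_all
  have "sum p A * sum q S \<le> sum q B * sum p S"
    using cross by (simp add: 1 algebra_simps)
  then show ?thesis using pos by (simp add: frac_le_eq divide_le_0_iff mult.commute)
qed

lemma tilt_sum: 
  assumes "finite S" "S \<noteq> {}" "\<And>x. x \<in> S \<Longrightarrow> r x > 0"
  shows "(\<Sum>x\<in>S. tilt S r z x) = 1" and "x \<in> S \<Longrightarrow> tilt S r z x > 0"
    and "(\<Sum>y\<in>S. r y * exp (z * y)) > 0"
proof -
  show pos: "(\<Sum>y\<in>S. r y * exp (z * y)) > 0"
    using assms by (intro sum_pos) auto
  then show "(\<Sum>x\<in>S. tilt S r z x) = 1"
    unfolding tilt_def by (simp flip: sum_divide_distrib)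
  show "x \<in> S \<Longrightarrow> tilt S r z x > 0"
    using pos assms(3) by (simp add: tilt_def)
qed

lemma cdf_tilt:
  "cdf_below S (tilt S r z) t
     = (\<Sum>x\<in>{x\<in>S. x < t}. r x * exp (z * x)) / (\<Sum>x\<in>S. r x * exp (z * x))"
  by (simp add: cdf_below_def tilt_def sum_divide_distrib)

text \<open>Exponential tilting by a larger parameter moves mass to the right, whatever the weight.\<close>

lemma cdf_tilt_antimono:
  assumes S: "finite S" "S \<noteq> {}" and r: "\<And>x. x \<in> S \<Longrightarrow> r x > 0" and z: "z \<le> z'"
  shows "cdf_below S (tilt S r z') t \<le> cdf_below S (tilt S r z) t"
proof -
  let ?p = "\<lambda>x. r x * exp (z' * x)" and ?q = "\<lambda>x. r x * exp (z * x)"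
  let ?A = "{x\<in>S. x < t}"
  have "sum ?p ?A * sum ?q (S - ?A) = (\<Sum>x\<in>?A. \<Sum>y\<in>S-?A. ?p x * ?q y)"
    by (simp add: sum_product)
  also have "\<dots> \<le> (\<Sum>x\<in>?A. \<Sum>y\<in>S-?A. ?q x * ?p y)"
  proof (intro sum_mono)
    fix x y assume xy: "x \<in> ?A" "y \<in> S - ?A"
    then have "0 \<le> (z' - z) * (y - x)" using z by auto
    then have "z' * x + z * y \<le> z * x + z' * y" by (simp add: algebra_simps)
    then have "exp (z' * x + z * y) \<le> exp (z * x + z' * y)" by simp
    moreover have "0 \<le> r x * r y" using r xy by (simp add: less_imp_le)
    ultimately have "r x * r y * exp (z' * x + z * y) \<le> r x * r y * exp (z * x + z' * y)"
      by (rule mult_left_mono)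
    then show "?p x * ?q y \<le> ?q x * ?p y" by (simp add: exp_add mult_ac)
  qed
  also have "\<dots> = sum ?p (S - ?A) * sum ?q ?A"
    by (simp add: sum_product mult.commute)
  finally have "sum ?p ?A / sum ?p S \<le> sum ?q ?A / sum ?q S"
    using S tilt_sum(3)[OF S r] by (intro ratio_le_ratio_if_cross) auto
  then show ?thesis by (simp add: cdf_tilt)
qed

text \<open>For a \<open>\<kappa>\<close>-log-concave weight, tilting by an additional \<open>\<kappa> d\<close> moves the measure by at most \<open>d\<close>. For the
Gaussian weight it is exactly a translation by \<open>d\<close>.\<close>

lemma cdf_tilt_shift:
  assumes S: "lattice_segment e S" and r: "curved_weight \<kappa> e S r" and z: "z \<le> z'"
    and l: "z' - z \<le> \<kappa> * (e * real l)"
  shows "cdf_below S (tilt S r z) t \<le> cdf_below S (tilt S r z') (t + e * real l)"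
proof -
  let ?p = "\<lambda>x. r x * exp (z * x)" and ?q = "\<lambda>x. r x * exp (z' * x)"
  let ?d = "e * real l"
  let ?A = "{x\<in>S. x < t}" and ?B = "{x\<in>S. x < t + ?d}"
  have fin: "finite S" "S \<noteq> {}" and rpos: "\<And>x. x \<in> S \<Longrightarrow> r x > 0"
    using S r by (auto simp: lattice_segment_def curved_weight_def)
  \<comment> \<open>A pair on the wrong sides of the thresholds \<open>t\<close> and \<open>t + d\<close> is exchanged for one on the right sides, which has larger weight.\<close>
  let ?\<phi> = "\<lambda>(x, y). (y - ?d, x + ?d)"
  have lat: "x + ?d \<in> S" "y - ?d \<in> S" if "x \<in> ?A" "y \<in> S - ?B" for x y
    using lattice_segment_shift[OF S, of x y l] that by auto
  have "sum ?p ?A * sum ?q (S - ?B) = (\<Sum>(x, y)\<in>?A \<times> (S - ?B). ?p x * ?q y)"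
    by (simp add: sum_product sum.cartesian_product)
  also have "\<dots> \<le> (\<Sum>(x, y)\<in>?A \<times> (S - ?B). ?p (y - ?d) * ?q (x + ?d))"
  proof (rule sum_mono)
    fix xy assume "xy \<in> ?A \<times> (S - ?B)"
    then obtain x y where xy_eq: "xy = (x, y)" and m: "x \<in> ?A" "y \<in> S - ?B" by auto
    then have xy: "x \<in> S" "x < t" "y \<in> S" "\<not> (y \<in> S \<and> y < t + ?d)" by auto
    have le: "x \<le> y - ?d" using xy by auto
    have "r x * r (y - ?d + ?d) * exp (\<kappa> * ?d * (y - ?d - x)) \<le> r (y - ?d) * r (x + ?d)"
      using lat[OF m] xy le by (intro curved_weightD[OF r]) auto
    then have "r x * r y * exp (\<kappa> * ?d * (y - ?d - x)) \<le> r (y - ?d) * r (x + ?d)" by simp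
    moreover have "(z' - z) * (y - ?d - x) \<le> \<kappa> * ?d * (y - ?d - x)"
      using l le by (intro mult_right_mono) auto
    then have "r x * r y * exp ((z' - z) * (y - ?d - x)) \<le> r x * r y * exp (\<kappa> * ?d * (y - ?d - x))"
      using rpos xy by (intro mult_left_mono) (auto simp: less_imp_le)
    ultimately have "r x * r y * exp ((z' - z) * (y - ?d - x)) \<le> r (y - ?d) * r (x + ?d)" by linarith
    then have "r x * r y * exp ((z' - z) * (y - ?d - x)) * exp (z * (y - ?d) + z' * (x + ?d))
        \<le> r (y - ?d) * r (x + ?d) * exp (z * (y - ?d) + z' * (x + ?d))"
      by (rule mult_right_mono) simp
    then have "r x * r y * (exp ((z' - z) * (y - ?d - x)) * exp (z * (y - ?d) + z' * (x + ?d)))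
        \<le> r (y - ?d) * r (x + ?d) * exp (z * (y - ?d) + z' * (x + ?d))"
      by (simp only: mult.assoc)
    moreover have "exp ((z' - z) * (y - ?d - x)) * exp (z * (y - ?d) + z' * (x + ?d)) = exp (z * x + z' * y)"
      by (simp add: algebra_simps flip: exp_add)
    ultimately have "r x * r y * exp (z * x + z' * y)
        \<le> r (y - ?d) * r (x + ?d) * exp (z * (y - ?d) + z' * (x + ?d))"
      by (simp only:)
    then show "(case xy of (x, y) \<Rightarrow> ?p x * ?q y) \<le> (case xy of (x, y) \<Rightarrow> ?p (y - ?d) * ?q (x + ?d))"
      unfolding xy_eq prod.case by (simp only: exp_add mult_ac)
  qed
  also have "\<dots> = (\<Sum>(a, b)\<in>?\<phi> ` (?A \<times> (S - ?B)). ?p a * ?q b)"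
    by (subst sum.reindex) (auto simp: inj_on_def case_prod_beta)
  also have "\<dots> \<le> (\<Sum>(a, b)\<in>(S - ?A) \<times> ?B. ?p a * ?q b)"
  proof (intro sum_mono2)
    show "finite ((S - ?A) \<times> ?B)" using fin by auto
    show "?\<phi> ` (?A \<times> (S - ?B)) \<subseteq> (S - ?A) \<times> ?B" using lat by fastforce
    show "0 \<le> (case i of (a, b) \<Rightarrow> ?p a * ?q b)" if "i \<in> (S - ?A) \<times> ?B - ?\<phi> ` (?A \<times> (S - ?B))" for i
      using that rpos by (auto intro!: mult_nonneg_nonneg simp: less_imp_le)
  qed
  also have "\<dots> = sum ?p (S - ?A) * sum ?q ?B"
    by (simp add: sum_product sum.cartesian_product)
  finally have "sum ?p ?A / sum ?p S \<le> sum ?q ?B / sum ?q S"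
    using fin tilt_sum(3)[OF fin rpos] by (intro ratio_le_ratio_if_cross) auto
  then show ?thesis by (simp add: cdf_tilt)
qed

text \<open>The external field \<open>z\<close> acts on a \<open>\<kappa>\<close>-log-concave measure with Lipschitz constant \<open>1 / \<kappa>\<close> in the
supremum Wasserstein distance, up to the lattice spacing.\<close>

lemma tilt_coupling:
  assumes S: "lattice_segment e S" and r: "curved_weight \<kappa> e S r" and k: "\<kappa> > 0"
  obtains J :: "real \<Rightarrow> real \<Rightarrow> real" where
    "\<And>a b. a \<in> S \<Longrightarrow> b \<in> S \<Longrightarrow> 0 \<le> J a b"
    "\<And>a. a \<in> S \<Longrightarrow> (\<Sum>b\<in>S. J a b) = tilt S r z a"
    "\<And>b. b \<in> S \<Longrightarrow> (\<Sum>a\<in>S. J a b) = tilt S r z' b"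
    "\<And>a b. a \<in> S \<Longrightarrow> b \<in> S \<Longrightarrow> J a b \<noteq> 0 \<Longrightarrow> \<bar>a - b\<bar> \<le> \<bar>z - z'\<bar> / \<kappa> + e"
proof -
  have fin: "finite S" "S \<noteq> {}" and rpos: "\<And>x. x \<in> S \<Longrightarrow> r x > 0" and e: "e > 0"
    using S r by (auto simp: lattice_segment_def curved_weight_def)
  have main: "\<exists>J. (\<forall>a\<in>S. \<forall>b\<in>S. 0 \<le> J a b) \<and> (\<forall>a\<in>S. (\<Sum>b\<in>S. J a b) = tilt S r x a)
      \<and> (\<forall>b\<in>S. (\<Sum>a\<in>S. J a b) = tilt S r y b)
      \<and> (\<forall>a\<in>S. \<forall>b\<in>S. J a b \<noteq> 0 \<longrightarrow> \<bar>a - b\<bar> \<le> \<bar>x - y\<bar> / \<kappa> + e)" if xy: "x \<le> y" for x y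
  proof -
    \<comment> \<open>Rounding the distance up to a multiple of \<open>e\<close> causes the summand \<open>e\<close> in the bound.\<close>
    define l where "l = nat \<lceil>(y - x) / (\<kappa> * e)\<rceil>"
    have nn: "0 \<le> (y - x) / (\<kappa> * e)" using xy k e by simp
    have "real l = of_int \<lceil>(y - x) / (\<kappa> * e)\<rceil>"
      unfolding l_def using nn by (simp add: ceiling_mono)
    then have l1: "(y - x) / (\<kappa> * e) \<le> real l" and l2: "real l \<le> (y - x) / (\<kappa> * e) + 1"
      by linarith+
    have l3: "y - x \<le> \<kappa> * (e * real l)"
      using l1 k e by (simp add: field_simps)
    have l4: "e * real l \<le> \<bar>x - y\<bar> / \<kappa> + e"
    proof -
      have "e * real l \<le> e * ((y - x) / (\<kappa> * e) + 1)"
        using l2 e by (intro mult_left_mono) auto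
      also have "\<dots> = \<bar>x - y\<bar> / \<kappa> + e" using e k xy by (simp add: field_simps)
      finally show ?thesis .
    qed
    obtain J where J: "\<And>a b. a \<in> S \<Longrightarrow> b \<in> S \<Longrightarrow> 0 \<le> J a b"
      "\<And>a. a \<in> S \<Longrightarrow> (\<Sum>b\<in>S. J a b) = tilt S r x a"
      "\<And>b. b \<in> S \<Longrightarrow> (\<Sum>a\<in>S. J a b) = tilt S r y b"
      "\<And>a b. a \<in> S \<Longrightarrow> b \<in> S \<Longrightarrow> J a b \<noteq> 0 \<Longrightarrow> a \<le> b \<and> b \<le> a + e * real l"
    proof (rule monotone_coupling[of S "tilt S r x" "tilt S r y" "e * real l"])
      show "cdf_below S (tilt S r y) t \<le> cdf_below S (tilt S r x) t" for t
        by (rule cdf_tilt_antimono[OF fin rpos xy])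
      show "cdf_below S (tilt S r x) t \<le> cdf_below S (tilt S r y) (t + e * real l)" for t
        by (rule cdf_tilt_shift[OF S r xy l3])
    qed (use fin tilt_sum(1)[OF fin rpos] tilt_sum(2)[OF fin rpos] in \<open>auto simp: less_imp_le\<close>)
    have "\<bar>a - b\<bar> \<le> \<bar>x - y\<bar> / \<kappa> + e" if "a \<in> S" "b \<in> S" "J a b \<noteq> 0" for a b
      using J(4)[OF that] l4 by linarith
    with J(1-3) show ?thesis by (intro exI[of _ J]) auto
  qed
  show thesis
  proof (cases "z \<le> z'")
    case True
    from main[OF this] that show thesis by blast
  next
    case False
    then have "z' \<le> z" by simp
    from main[OF this] obtain J where J: "\<forall>a\<in>S. \<forall>b\<in>S. 0 \<le> J a b"
      "\<forall>a\<in>S. (\<Sum>b\<in>S. J a b) = tilt S r z' a" "\<forall>b\<in>S. (\<Sum>a\<in>S. J a b) = tilt S r z b"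
      "\<forall>a\<in>S. \<forall>b\<in>S. J a b \<noteq> 0 \<longrightarrow> \<bar>a - b\<bar> \<le> \<bar>z' - z\<bar> / \<kappa> + e" by blast
    show thesis
    proof (rule that[of "\<lambda>a b. J b a"])
      show "\<bar>a - b\<bar> \<le> \<bar>z - z'\<bar> / \<kappa> + e" if "a \<in> S" "b \<in> S" "J b a \<noteq> 0" for a b
        using J(4) that by (metis abs_minus_commute)
    qed (use J in auto)
  qed
qed

section \<open>Two conditionally independent layers: contraction of the alternating chain\<close>

text \<open>The Euclidean norm normalised so that constant vectors have norm independent of \<open>N\<close>; all estimates
below are uniform in \<open>N\<close> in this norm.\<close>

definition l2n :: "nat \<Rightarrow> (nat \<Rightarrow> real) \<Rightarrow> real" where
  "l2n N v = L2_set v {..<N} / sqrt (real N)"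

lemma l2n_nonneg [simp]: "0 \<le> l2n N v"
  by (simp add: l2n_def)

lemma l2n_triangle: "l2n N (\<lambda>i. u i + v i) \<le> l2n N u + l2n N v"
  unfolding l2n_def add_divide_distrib[symmetric]
  by (intro divide_right_mono L2_set_triangle_ineq) auto

lemma l2n_mono: "(\<And>i. i < N \<Longrightarrow> \<bar>u i\<bar> \<le> \<bar>v i\<bar>) \<Longrightarrow> l2n N u \<le> l2n N v"
  unfolding l2n_def L2_set_def
  by (intro divide_right_mono real_sqrt_le_mono sum_mono) (auto simp: abs_le_square_iff)

lemma l2n_const: "N > 0 \<Longrightarrow> l2n N (\<lambda>i. c) = \<bar>c\<bar>"
  by (simp add: l2n_def L2_set_constant)

lemma l2n_scale: "l2n N (\<lambda>i. c * v i) = \<bar>c\<bar> * l2n N v"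
  by (simp add: l2n_def L2_set_def power_mult_distrib real_sqrt_mult flip: sum_distrib_left)

lemma l2n_bound: "N > 0 \<Longrightarrow> 0 \<le> c \<Longrightarrow> (\<And>i. i < N \<Longrightarrow> \<bar>v i\<bar> \<le> c) \<Longrightarrow> l2n N v \<le> c"
  using l2n_mono[of N v "\<lambda>_. c"] l2n_const[of N c] by simp

lemma l2n_cong: "(\<And>i. i < N \<Longrightarrow> u i = v i) \<Longrightarrow> l2n N u = l2n N v"
  unfolding l2n_def by (subst L2_set_cong[of "{..<N}" "{..<N}" u v]) auto

lemma l2n_abs: "l2n N (\<lambda>i. \<bar>v i\<bar>) = l2n N v"
  by (simp add: l2n_def L2_set_def)

lemma l2n_Cauchy_Schwarz: "N > 0 \<Longrightarrow> \<bar>\<Sum>i<N. u i * v i\<bar> \<le> real N * (l2n N u * l2n N v)"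
proof -
  assume N: "N > 0"
  have "\<bar>\<Sum>i<N. u i * v i\<bar> \<le> (\<Sum>i<N. \<bar>u i\<bar> * \<bar>v i\<bar>)"
    by (rule order_trans[OF sum_abs]) (simp add: abs_mult)
  also have "\<dots> \<le> L2_set u {..<N} * L2_set v {..<N}"
    by (rule L2_set_mult_ineq)
  also have "\<dots> = real N * (l2n N u * l2n N v)"
    using N by (simp add: l2n_def)
  finally show ?thesis .
qed

text \<open>Expectation under independent sites, site \<open>i\<close> having weight \<open>\<rho> i\<close> and external field \<open>z i\<close>.\<close>

definition gibbs :: "nat \<Rightarrow> real set \<Rightarrow> (nat \<Rightarrow> real \<Rightarrow> real) \<Rightarrow> (nat \<Rightarrow> real) \<Rightarrow> ((nat \<Rightarrow> real) \<Rightarrow> real) \<Rightarrow> real"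
  where "gibbs N S \<rho> z F = (\<Sum>x\<in>{..<N} \<rightarrow>\<^sub>E S. (\<Prod>i<N. tilt S (\<rho> i) (z i) (x i)) * F x)"

lemma gibbs_as_quotient:
  assumes "finite S"
  shows "gibbs N S \<rho> z F =
    (\<Sum>x\<in>{..<N} \<rightarrow>\<^sub>E S. (\<Prod>i<N. \<rho> i (x i) * exp (z i * x i)) * F x)
     / (\<Sum>x\<in>{..<N} \<rightarrow>\<^sub>E S. \<Prod>i<N. \<rho> i (x i) * exp (z i * x i))"
proof -
  have "(\<Prod>i<N. \<Sum>y\<in>S. \<rho> i y * exp (z i * y)) = (\<Sum>x\<in>{..<N} \<rightarrow>\<^sub>E S. \<Prod>i<N. \<rho> i (x i) * exp (z i * x i))"
    using assms by (intro prod_sum_PiE) auto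
  then show ?thesis
    by (simp add: gibbs_def tilt_def prod_dividef sum_divide_distrib)
qed

lemma gibbs_coupled:
  fixes J :: "nat \<Rightarrow> real \<Rightarrow> real \<Rightarrow> real"
  assumes S: "finite S" and J: "\<And>i a. i < N \<Longrightarrow> a \<in> S \<Longrightarrow> (\<Sum>b\<in>S. J i a b) = tilt S (\<rho> i) (z i) a"
  shows "gibbs N S \<rho> z F = (\<Sum>x\<in>{..<N} \<rightarrow>\<^sub>E S. \<Sum>y\<in>{..<N} \<rightarrow>\<^sub>E S. (\<Prod>i<N. J i (x i) (y i)) * F x)"
  unfolding gibbs_def
proof (rule sum.cong)
  fix x assume x: "x \<in> {..<N} \<rightarrow>\<^sub>E S"
  have "(\<Prod>i<N. tilt S (\<rho> i) (z i) (x i)) = (\<Prod>i<N. \<Sum>b\<in>S. J i (x i) b)"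
    using x by (intro prod.cong refl J[symmetric]) auto
  also have "\<dots> = (\<Sum>y\<in>{..<N} \<rightarrow>\<^sub>E S. \<Prod>i<N. J i (x i) (y i))"
    using S by (intro prod_sum_PiE) auto
  finally show "(\<Prod>i<N. tilt S (\<rho> i) (z i) (x i)) * F x
      = (\<Sum>y\<in>{..<N} \<rightarrow>\<^sub>E S. (\<Prod>i<N. J i (x i) (y i)) * F x)"
    by (simp add: sum_distrib_right)
qed simp

lemma gibbs_const:
  assumes "finite S" "S \<noteq> {}" "\<And>i x. i < N \<Longrightarrow> x \<in> S \<Longrightarrow> \<rho> i x > 0"
  shows "gibbs N S \<rho> z (\<lambda>_. c) = c"
proof -
  have "(\<Sum>x\<in>{..<N} \<rightarrow>\<^sub>E S. \<Prod>i<N. tilt S (\<rho> i) (z i) (x i)) = (\<Prod>i<N. \<Sum>a\<in>S. tilt S (\<rho> i) (z i) a)"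
    using assms by (intro prod_sum_PiE[symmetric]) auto
  also have "\<dots> = 1"
    using assms by (intro prod.neutral) (auto simp: tilt_sum(1))
  finally show ?thesis unfolding gibbs_def by (simp flip: sum_distrib_right)
qed

lemma gibbs_diff: "gibbs N S \<rho> z (\<lambda>x. F x - F' x) = gibbs N S \<rho> z F - gibbs N S \<rho> z F'"
  by (simp add: gibbs_def algebra_simps sum_subtractf)

lemma gibbs_mono:
  assumes "finite S" "S \<noteq> {}" "\<And>i x. i < N \<Longrightarrow> x \<in> S \<Longrightarrow> \<rho> i x > 0"
    "\<And>x. x \<in> {..<N} \<rightarrow>\<^sub>E S \<Longrightarrow> F x \<le> F' x"
  shows "gibbs N S \<rho> z F \<le> gibbs N S \<rho> z F'"
  unfolding gibbs_def
proof (intro sum_mono mult_left_mono prod_nonneg)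
  fix x i assume "x \<in> {..<N} \<rightarrow>\<^sub>E S" "i \<in> {..<N}"
  then show "0 \<le> tilt S (\<rho> i) (z i) (x i)"
    using assms by (intro less_imp_le tilt_sum(2)) auto
qed (use assms in auto)

lemma gibbs_close:
  assumes "finite S" "S \<noteq> {}" "\<And>i x. i < N \<Longrightarrow> x \<in> S \<Longrightarrow> \<rho> i x > 0"
    "\<And>x. x \<in> {..<N} \<rightarrow>\<^sub>E S \<Longrightarrow> \<bar>F x - F' x\<bar> \<le> c"
  shows "\<bar>gibbs N S \<rho> z F - gibbs N S \<rho> z F'\<bar> \<le> c"
proof -
  have b: "F x - F' x \<le> c" "- c \<le> F x - F' x" if "x \<in> {..<N} \<rightarrow>\<^sub>E S" for x
    using assms(4)[OF that] by linarith+
  have "gibbs N S \<rho> z (\<lambda>x. F x - F' x) \<le> c"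
    using gibbs_mono[of S N \<rho> "\<lambda>x. F x - F' x" "\<lambda>_. c" z] gibbs_const[of S N \<rho> z c] assms(1-3) b
    by auto
  moreover have "- c \<le> gibbs N S \<rho> z (\<lambda>x. F x - F' x)"
    using gibbs_mono[of S N \<rho> "\<lambda>_. - c" "\<lambda>x. F x - F' x" z] gibbs_const[of S N \<rho> z "- c"] assms(1-3) b
    by auto
  ultimately show ?thesis by (simp add: gibbs_diff)
qed

text \<open>The additive error \<open>\<delta>\<close> collects the contributions of the lattice spacing.\<close>

definition lip_upto :: "nat \<Rightarrow> real set \<Rightarrow> real \<Rightarrow> real \<Rightarrow> ((nat \<Rightarrow> real) \<Rightarrow> real) \<Rightarrow> bool" where
  "lip_upto N S L \<delta> F \<longleftrightarrow> (\<forall>x\<in>{..<N} \<rightarrow>\<^sub>E S. \<forall>y\<in>{..<N} \<rightarrow>\<^sub>E S.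
     \<bar>F x - F y\<bar> \<le> L * l2n N (\<lambda>i. x i - y i) + \<delta>)"

text \<open>The product of the couplings of the individual sites moves each coordinate by at most
\<open>|z i - z' i| / \<kappa> + e\<close>.\<close>

lemma gibbs_contraction:
  assumes S: "lattice_segment e S" and r: "\<And>i. i < N \<Longrightarrow> curved_weight \<kappa> e S (\<rho> i)" and k: "\<kappa> > 0"
    and N: "N > 0" and L: "L \<ge> 0" and F: "lip_upto N S L \<delta> F"
  shows "\<bar>gibbs N S \<rho> z F - gibbs N S \<rho> z' F\<bar> \<le> L * (l2n N (\<lambda>i. z i - z' i) / \<kappa> + e) + \<delta>"
proof -
  have fin: "finite S" "S \<noteq> {}" and e: "e > 0" using S by (simp_all add: lattice_segment_def)
  have pos: "\<rho> i x > 0" if "i < N" "x \<in> S" for i x using r[OF that(1)] that by (auto simp: curved_weight_def)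
  let ?X = "{..<N} \<rightarrow>\<^sub>E S"
  define coupling where "coupling i J \<longleftrightarrow>
     (\<forall>a\<in>S. \<forall>b\<in>S. 0 \<le> J a b) \<and> (\<forall>a\<in>S. (\<Sum>b\<in>S. J a b) = tilt S (\<rho> i) (z i) a) \<and>
     (\<forall>b\<in>S. (\<Sum>a\<in>S. J a b) = tilt S (\<rho> i) (z' i) b) \<and>
     (\<forall>a\<in>S. \<forall>b\<in>S. J a b \<noteq> 0 \<longrightarrow> \<bar>a - b\<bar> \<le> \<bar>z i - z' i\<bar> / \<kappa> + e)" for i J
  have "\<exists>J. coupling i J" if "i < N" for i
  proof (rule tilt_coupling[OF S r[OF that] k, of "z i" "z' i"])
    fix J assume "\<And>a b. a \<in> S \<Longrightarrow> b \<in> S \<Longrightarrow> 0 \<le> J a b"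
      "\<And>a. a \<in> S \<Longrightarrow> (\<Sum>b\<in>S. J a b) = tilt S (\<rho> i) (z i) a"
      "\<And>b. b \<in> S \<Longrightarrow> (\<Sum>a\<in>S. J a b) = tilt S (\<rho> i) (z' i) b"
      "\<And>a b. a \<in> S \<Longrightarrow> b \<in> S \<Longrightarrow> J a b \<noteq> 0 \<Longrightarrow> \<bar>a - b\<bar> \<le> \<bar>z i - z' i\<bar> / \<kappa> + e"
    then show "\<exists>J. coupling i J" unfolding coupling_def by (intro exI[of _ J]) blast
  qed
  then obtain J where "\<And>i. i < N \<Longrightarrow> coupling i (J i)" by metis
  then have J: "\<And>i a b. i < N \<Longrightarrow> a \<in> S \<Longrightarrow> b \<in> S \<Longrightarrow> 0 \<le> J i a b"
    "\<And>i a. i < N \<Longrightarrow> a \<in> S \<Longrightarrow> (\<Sum>b\<in>S. J i a b) = tilt S (\<rho> i) (z i) a"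
    "\<And>i b. i < N \<Longrightarrow> b \<in> S \<Longrightarrow> (\<Sum>a\<in>S. J i a b) = tilt S (\<rho> i) (z' i) b"
    "\<And>i a b. i < N \<Longrightarrow> a \<in> S \<Longrightarrow> b \<in> S \<Longrightarrow> J i a b \<noteq> 0 \<Longrightarrow> \<bar>a - b\<bar> \<le> \<bar>z i - z' i\<bar> / \<kappa> + e"
    unfolding coupling_def by blast+
  let ?j = "\<lambda>x y. \<Prod>i<N. J i (x i) (y i)"
  let ?D = "L * (l2n N (\<lambda>i. z i - z' i) / \<kappa> + e) + \<delta>"
  have j0: "0 \<le> ?j x y" if "x \<in> ?X" "y \<in> ?X" for x y
    using that by (intro prod_nonneg J(1) ballI) auto
  have g1: "gibbs N S \<rho> z G = (\<Sum>x\<in>?X. \<Sum>y\<in>?X. ?j x y * G x)" for G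
    by (rule gibbs_coupled[OF fin(1) J(2)])
  have g2: "gibbs N S \<rho> z' F = (\<Sum>x\<in>?X. \<Sum>y\<in>?X. ?j x y * F y)"
    by (subst gibbs_coupled[of S N "\<lambda>i a b. J i b a"]) (auto simp: fin J(3) intro: sum.swap)
  have close: "\<bar>F x - F y\<bar> \<le> ?D" if xy: "x \<in> ?X" "y \<in> ?X" and nz: "?j x y \<noteq> 0" for x y
  proof -
    have d: "\<bar>x i - y i\<bar> \<le> \<bar>z i - z' i\<bar> / \<kappa> + e" if "i < N" for i
      using nz that xy by (intro J(4)) (auto simp: prod_zero_iff)
    have "l2n N (\<lambda>i. x i - y i) \<le> l2n N (\<lambda>i. (1/\<kappa>) * \<bar>z i - z' i\<bar> + e)"
      using d k e by (intro l2n_mono) (simp add: order_trans[OF _ abs_ge_self])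
    also have "\<dots> \<le> l2n N (\<lambda>i. (1/\<kappa>) * \<bar>z i - z' i\<bar>) + l2n N (\<lambda>i. e)"
      by (rule l2n_triangle)
    also have "\<dots> = l2n N (\<lambda>i. z i - z' i) / \<kappa> + e"
      using k e N by (simp only: l2n_scale l2n_abs l2n_const) simp
    finally have "L * l2n N (\<lambda>i. x i - y i) \<le> L * (l2n N (\<lambda>i. z i - z' i) / \<kappa> + e)"
      using L by (rule mult_left_mono)
    moreover have "\<bar>F x - F y\<bar> \<le> L * l2n N (\<lambda>i. x i - y i) + \<delta>"
      using F xy by (auto simp: lip_upto_def)
    ultimately show ?thesis by linarith
  qed
  have "\<bar>gibbs N S \<rho> z F - gibbs N S \<rho> z' F\<bar> = \<bar>\<Sum>x\<in>?X. \<Sum>y\<in>?X. ?j x y * (F x - F y)\<bar>"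
    by (simp add: g1 g2 algebra_simps sum_subtractf)
  also have "\<dots> \<le> (\<Sum>x\<in>?X. \<Sum>y\<in>?X. \<bar>?j x y * (F x - F y)\<bar>)"
    by (rule order_trans[OF sum_abs sum_mono[OF sum_abs]])
  also have "\<dots> \<le> (\<Sum>x\<in>?X. \<Sum>y\<in>?X. ?j x y * ?D)"
  proof (intro sum_mono)
    fix x y assume xy: "x \<in> ?X" "y \<in> ?X"
    show "\<bar>?j x y * (F x - F y)\<bar> \<le> ?j x y * ?D"
    proof (cases "?j x y = 0")
      case False
      then show ?thesis
        using close[OF xy False] j0[OF xy] by (simp add: abs_mult mult_left_mono)
    qed (simp only: mult_zero_left abs_zero)
  qed
  also have "\<dots> = gibbs N S \<rho> z (\<lambda>_. ?D)" by (simp add: g1)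
  also have "\<dots> = ?D" by (rule gibbs_const[OF fin pos])
  finally show ?thesis .
qed

text \<open>Two layers of real spins \<open>x\<close> and \<open>w\<close>, coupled only through the bond term \<open>\<langle>w, B x\<rangle>\<close>. The condition
\<open>\<beta>\<^sup>2 < \<kappa> \<kappa>'\<close> makes the quadratic form \<open>\<kappa> |x|\<^sup>2 / 2 + \<kappa>' |w|\<^sup>2 / 2 - \<langle>w, B x\<rangle>\<close> positive definite.\<close>

locale two_layer =
  fixes N :: nat and S T :: "real set" and \<rho> \<gamma> :: "nat \<Rightarrow> real \<Rightarrow> real"
    and B :: "(nat \<Rightarrow> real) \<Rightarrow> nat \<Rightarrow> real" and e e' \<kappa> \<kappa>' \<beta> :: real
  assumes N: "N > 0"
    and S: "lattice_segment e S" and T: "lattice_segment e' T"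
    and \<rho>: "\<And>i. i < N \<Longrightarrow> curved_weight \<kappa> e S (\<rho> i)"
    and \<gamma>: "\<And>i. i < N \<Longrightarrow> curved_weight \<kappa>' e' T (\<gamma> i)"
    and \<kappa>: "\<kappa> > 0" and \<kappa>': "\<kappa>' > 0" and \<beta>0: "0 \<le> \<beta>" and q: "\<beta>\<^sup>2 < \<kappa> * \<kappa>'"
    and B_diff: "\<And>u v i. i < N \<Longrightarrow> B u i - B v i = B (\<lambda>j. u j - v j) i"
    and B_sym: "\<And>u v. (\<Sum>i<N. u i * B v i) = (\<Sum>i<N. v i * B u i)"
    and B_norm: "\<And>v. l2n N (B v) \<le> \<beta> * l2n N v"
begin

abbreviation "X \<equiv> {..<N} \<rightarrow>\<^sub>E S"
abbreviation "W \<equiv> {..<N} \<rightarrow>\<^sub>E T"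

definition wt :: "real \<Rightarrow> (nat \<Rightarrow> real) \<Rightarrow> (nat \<Rightarrow> real) \<Rightarrow> real" where
  "wt s x w = (\<Prod>i<N. \<rho> i (x i)) * (\<Prod>i<N. \<gamma> i (w i)) * exp (s * (\<Sum>i<N. w i * B x i))"

text \<open>Expectation over \<open>x\<close> given \<open>w\<close>, as a function of \<open>w\<close>; below \<open>down\<close> is the expectation over \<open>w\<close> given \<open>x\<close>.\<close>

definition up :: "real \<Rightarrow> ((nat \<Rightarrow> real) \<Rightarrow> real) \<Rightarrow> (nat \<Rightarrow> real) \<Rightarrow> real" where
  "up s F = (\<lambda>w. gibbs N S \<rho> (\<lambda>i. s * B w i) F)"

definition down :: "real \<Rightarrow> ((nat \<Rightarrow> real) \<Rightarrow> real) \<Rightarrow> (nat \<Rightarrow> real) \<Rightarrow> real" where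
  "down s F = (\<lambda>x. gibbs N T \<gamma> (\<lambda>i. s * B x i) F)"

lemma layers_finite: "finite S" "S \<noteq> {}" "finite T" "T \<noteq> {}" "finite X" "finite W" "X \<noteq> {}" "W \<noteq> {}"
proof -
  show "finite S" "S \<noteq> {}" "finite T" "T \<noteq> {}"
    using S T by (simp_all add: lattice_segment_def)
  then show "finite X" "finite W" "X \<noteq> {}" "W \<noteq> {}"
    by (simp_all add: finite_PiE PiE_eq_empty_iff)
qed

lemma pos: "i < N \<Longrightarrow> a \<in> S \<Longrightarrow> \<rho> i a > 0" "i < N \<Longrightarrow> b \<in> T \<Longrightarrow> \<gamma> i b > 0"
  using \<rho> \<gamma> by (simp_all add: curved_weight_def)

lemma wt_pos: "x \<in> X \<Longrightarrow> w \<in> W \<Longrightarrow> wt s x w > 0"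
  unfolding wt_def by (intro mult_pos_pos prod_pos exp_gt_zero) (auto intro!: pos)

lemma eq_mult_quotient:
  fixes a b c d u v :: real
  assumes "0 < v" "d = u / v" "a = c * u" "b = c * v"
  shows "a = b * d"
  using assms by simp

lemma wt_down: "(\<Sum>w\<in>W. wt s x w * \<phi> w) = (\<Sum>w\<in>W. wt s x w) * down s \<phi> x" if "x \<in> X"
proof -
  have eq: "wt s x w = (\<Prod>i<N. \<rho> i (x i)) * (\<Prod>i<N. \<gamma> i (w i) * exp (s * B x i * w i))" for w
    by (simp add: wt_def prod.distrib exp_sum sum_distrib_left mult_ac)
  let ?c = "\<Prod>i<N. \<rho> i (x i)" and ?g = "\<lambda>w. \<Prod>i<N. \<gamma> i (w i) * exp (s * B x i * w i)"
  have "sum ?g W > 0"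
  proof (rule sum_pos[OF layers_finite(6,8)])
    fix w assume w: "w \<in> W"
    show "0 < ?g w"
    proof (rule prod_pos, rule mult_pos_pos[OF _ exp_gt_zero])
      fix i assume "i \<in> {..<N}"
      then show "0 < \<gamma> i (w i)" using w by (intro pos(2)) auto
    qed
  qed
  moreover have "down s \<phi> x = (\<Sum>w\<in>W. ?g w * \<phi> w) / sum ?g W"
    unfolding down_def by (rule gibbs_as_quotient[OF layers_finite(3)])
  moreover have "(\<Sum>w\<in>W. wt s x w * \<phi> w) = ?c * (\<Sum>w\<in>W. ?g w * \<phi> w)"
    "(\<Sum>w\<in>W. wt s x w) = ?c * sum ?g W"
    by (simp_all only: eq sum_distrib_left mult.assoc)
  ultimately show ?thesis by (rule eq_mult_quotient)
qed

lemma wt_up: "(\<Sum>x\<in>X. wt s x w * \<phi> x) = (\<Sum>x\<in>X. wt s x w) * up s \<phi> w" if "w \<in> W"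
proof -
  have eq: "wt s x w = (\<Prod>i<N. \<gamma> i (w i)) * (\<Prod>i<N. \<rho> i (x i) * exp (s * B w i * x i))" for x
    unfolding wt_def B_sym[of w x] by (simp add: prod.distrib exp_sum sum_distrib_left mult_ac)
  let ?c = "\<Prod>i<N. \<gamma> i (w i)" and ?g = "\<lambda>x. \<Prod>i<N. \<rho> i (x i) * exp (s * B w i * x i)"
  have "sum ?g X > 0"
  proof (rule sum_pos[OF layers_finite(5,7)])
    fix x assume x: "x \<in> X"
    show "0 < ?g x"
    proof (rule prod_pos, rule mult_pos_pos[OF _ exp_gt_zero])
      fix i assume "i \<in> {..<N}"
      then show "0 < \<rho> i (x i)" using x by (intro pos(1)) auto
    qed
  qed
  moreover have "up s \<phi> w = (\<Sum>x\<in>X. ?g x * \<phi> x) / sum ?g X"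
    unfolding up_def by (rule gibbs_as_quotient[OF layers_finite(1)])
  moreover have "(\<Sum>x\<in>X. wt s x w * \<phi> x) = ?c * (\<Sum>x\<in>X. ?g x * \<phi> x)"
    "(\<Sum>x\<in>X. wt s x w) = ?c * sum ?g X"
    by (simp_all only: eq sum_distrib_left mult.assoc)
  ultimately show ?thesis by (rule eq_mult_quotient)
qed

definition expct :: "real \<Rightarrow> ((nat \<Rightarrow> real) \<Rightarrow> (nat \<Rightarrow> real) \<Rightarrow> real) \<Rightarrow> real" where
  "expct s \<phi> = (\<Sum>x\<in>X. \<Sum>w\<in>W. wt s x w * \<phi> x w) / (\<Sum>x\<in>X. \<Sum>w\<in>W. wt s x w)"

lemma expct_down: "expct s \<phi> = expct s (\<lambda>x _. down s (\<phi> x) x)"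
proof -
  have "(\<Sum>x\<in>X. \<Sum>w\<in>W. wt s x w * \<phi> x w) = (\<Sum>x\<in>X. \<Sum>w\<in>W. wt s x w * down s (\<phi> x) x)"
  proof (rule sum.cong[OF refl])
    fix x assume "x \<in> X"
    from wt_down[OF this] show "(\<Sum>w\<in>W. wt s x w * \<phi> x w) = (\<Sum>w\<in>W. wt s x w * down s (\<phi> x) x)"
      by (simp only: sum_distrib_right[symmetric])
  qed
  then show ?thesis by (simp only: expct_def)
qed

lemma expct_up: "expct s (\<lambda>_ w. up s \<phi> w) = expct s (\<lambda>x _. \<phi> x)"
proof -
  have "(\<Sum>x\<in>X. \<Sum>w\<in>W. wt s x w * \<phi> x) = (\<Sum>w\<in>W. \<Sum>x\<in>X. wt s x w * \<phi> x)" by (rule sum.swap)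
  also have "\<dots> = (\<Sum>w\<in>W. \<Sum>x\<in>X. wt s x w * up s \<phi> w)"
  proof (rule sum.cong[OF refl])
    fix w assume "w \<in> W"
    from wt_up[OF this] show "(\<Sum>x\<in>X. wt s x w * \<phi> x) = (\<Sum>x\<in>X. wt s x w * up s \<phi> w)"
      by (simp only: sum_distrib_right[symmetric])
  qed
  also have "\<dots> = (\<Sum>x\<in>X. \<Sum>w\<in>W. wt s x w * up s \<phi> w)" by (rule sum.swap)
  finally show ?thesis by (simp only: expct_def)
qed

lemma expct_close:
  assumes "\<And>x w. x \<in> X \<Longrightarrow> w \<in> W \<Longrightarrow> \<bar>\<phi> x w - c\<bar> \<le> d"
  shows "\<bar>expct s \<phi> - c\<bar> \<le> d"
proof -
  have Z: "(\<Sum>x\<in>X. \<Sum>w\<in>W. wt s x w) > 0"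
    by (intro sum_pos layers_finite wt_pos)
  have "\<bar>(\<Sum>x\<in>X. \<Sum>w\<in>W. wt s x w * \<phi> x w) - c * (\<Sum>x\<in>X. \<Sum>w\<in>W. wt s x w)\<bar>
     = \<bar>\<Sum>x\<in>X. \<Sum>w\<in>W. wt s x w * (\<phi> x w - c)\<bar>"
    by (simp only: right_diff_distrib sum_subtractf sum_distrib_left mult.commute[of c])
  also have "\<dots> \<le> (\<Sum>x\<in>X. \<Sum>w\<in>W. \<bar>wt s x w * (\<phi> x w - c)\<bar>)"
    by (rule order_trans[OF sum_abs sum_mono[OF sum_abs]])
  also have "\<dots> \<le> (\<Sum>x\<in>X. \<Sum>w\<in>W. wt s x w * d)"
    by (intro sum_mono) (simp add: abs_mult wt_pos less_imp_le assms mult_left_mono)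
  also have "\<dots> = d * (\<Sum>x\<in>X. \<Sum>w\<in>W. wt s x w)"
    by (simp add: sum_distrib_left mult.commute)
  finally show ?thesis using Z
    by (simp add: expct_def abs_le_iff field_simps)
qed

text \<open>Alternating conditional expectations preserve the joint expectation.\<close>

lemma chain_stationary: "expct s (\<lambda>x _. ((\<lambda>F. down s (up s F)) ^^ k) F x) = expct s (\<lambda>x _. F x)"
proof (induction k arbitrary: F)
  case (Suc k)
  have "expct s (\<lambda>x _. ((\<lambda>F. down s (up s F)) ^^ Suc k) F x)
      = expct s (\<lambda>x _. ((\<lambda>F. down s (up s F)) ^^ k) (down s (up s F)) x)"
    by (simp only: funpow_Suc_right o_apply)
  also have "\<dots> = expct s (\<lambda>x _. down s (up s F) x)" by (rule Suc.IH)
  also have "\<dots> = expct s (\<lambda>x w. up s F w)" by (rule expct_down[symmetric])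
  also have "\<dots> = expct s (\<lambda>x _. F x)" by (rule expct_up)
  finally show ?case .
qed simp

lemma B_lip: "\<bar>s\<bar> \<le> 1 \<Longrightarrow> l2n N (\<lambda>i. s * B u i - s * B v i) \<le> \<beta> * l2n N (\<lambda>i. u i - v i)"
proof -
  assume s: "\<bar>s\<bar> \<le> 1"
  have "l2n N (\<lambda>i. s * B u i - s * B v i) = l2n N (\<lambda>i. s * B (\<lambda>j. u j - v j) i)"
    by (intro l2n_cong) (simp flip: right_diff_distrib B_diff)
  also have "\<dots> = \<bar>s\<bar> * l2n N (B (\<lambda>j. u j - v j))" by (rule l2n_scale)
  also have "\<dots> \<le> 1 * l2n N (B (\<lambda>j. u j - v j))" using s by (intro mult_right_mono) auto
  also have "\<dots> \<le> \<beta> * l2n N (\<lambda>i. u i - v i)" using B_norm by simp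
  finally show ?thesis .
qed

lemma up_lip:
  assumes s: "\<bar>s\<bar> \<le> 1" and L: "L \<ge> 0" and F: "lip_upto N S L \<delta> F"
  shows "lip_upto N T (L * \<beta> / \<kappa>) (L * e + \<delta>) (up s F)"
  unfolding lip_upto_def up_def
proof (intro ballI)
  fix u v
  have "L * (l2n N (\<lambda>i. s * B u i - s * B v i) / \<kappa> + e) \<le> L * (\<beta> * l2n N (\<lambda>i. u i - v i) / \<kappa> + e)"
    using B_lip[OF s] \<kappa> L by (intro mult_left_mono add_right_mono divide_right_mono) auto
  moreover have "\<bar>gibbs N S \<rho> (\<lambda>i. s * B u i) F - gibbs N S \<rho> (\<lambda>i. s * B v i) F\<bar>
      \<le> L * (l2n N (\<lambda>i. s * B u i - s * B v i) / \<kappa> + e) + \<delta>"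
    by (rule gibbs_contraction[OF S \<rho> \<kappa> N L F])
  ultimately   show "\<bar>gibbs N S \<rho> (\<lambda>i. s * B u i) F - gibbs N S \<rho> (\<lambda>i. s * B v i) F\<bar>
    \<le> L * \<beta> / \<kappa> * l2n N (\<lambda>i. u i - v i) + (L * e + \<delta>)"
    by (simp add: algebra_simps)
qed

lemma down_lip:
  assumes s: "\<bar>s\<bar> \<le> 1" and L: "L \<ge> 0" and F: "lip_upto N T L \<delta> F"
  shows "lip_upto N S (L * \<beta> / \<kappa>') (L * e' + \<delta>) (down s F)"
  unfolding lip_upto_def down_def
proof (intro ballI)
  fix u v
  have "L * (l2n N (\<lambda>i. s * B u i - s * B v i) / \<kappa>' + e') \<le> L * (\<beta> * l2n N (\<lambda>i. u i - v i) / \<kappa>' + e')"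
    using B_lip[OF s] \<kappa>' L by (intro mult_left_mono add_right_mono divide_right_mono) auto
  moreover have "\<bar>gibbs N T \<gamma> (\<lambda>i. s * B u i) F - gibbs N T \<gamma> (\<lambda>i. s * B v i) F\<bar>
      \<le> L * (l2n N (\<lambda>i. s * B u i - s * B v i) / \<kappa>' + e') + \<delta>"
    by (rule gibbs_contraction[OF T \<gamma> \<kappa>' N L F])
  ultimately   show "\<bar>gibbs N T \<gamma> (\<lambda>i. s * B u i) F - gibbs N T \<gamma> (\<lambda>i. s * B v i) F\<bar>
    \<le> L * \<beta> / \<kappa>' * l2n N (\<lambda>i. u i - v i) + (L * e' + \<delta>)"
    by (simp add: algebra_simps)
qed

text \<open>Each of the two half steps divides the Lipschitz constant by \<open>\<kappa> / \<beta>\<close> or \<open>\<kappa>' / \<beta>\<close>; the lattice errors add up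
to a geometric series.\<close>

lemma chain_lip:
  assumes s: "\<bar>s\<bar> \<le> 1" and L: "L \<ge> 0" and F: "lip_upto N S L \<delta> F"
  shows "lip_upto N S (L * (\<beta>\<^sup>2 / (\<kappa> * \<kappa>')) ^ k)
    (\<delta> + L * (e + \<beta> * e' / \<kappa>) * (\<Sum>j<k. (\<beta>\<^sup>2 / (\<kappa> * \<kappa>')) ^ j)) (((\<lambda>F. down s (up s F)) ^^ k) F)"
proof (induction k)
  case 0
  then show ?case using F by simp
next
  case (Suc k)
  let ?q = "\<beta>\<^sup>2 / (\<kappa> * \<kappa>')"
  have q0: "0 \<le> ?q" using \<kappa> \<kappa>' by simp
  let ?L = "L * ?q ^ k"
  have L': "0 \<le> ?L" using L q0 by simp
  have L'': "0 \<le> ?L * \<beta> / \<kappa>" using L' \<kappa> \<beta>0 by simp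
  note down_lip[OF s L'' up_lip[OF s L' Suc.IH]]
  moreover have "?L * \<beta> / \<kappa> * \<beta> / \<kappa>' = L * ?q ^ Suc k"
    by (simp add: power2_eq_square)
  moreover have "?L * \<beta> / \<kappa> * e' + (?L * e + (\<delta> + L * (e + \<beta> * e' / \<kappa>) * (\<Sum>j<k. ?q ^ j)))
     = \<delta> + L * (e + \<beta> * e' / \<kappa>) * (\<Sum>j<Suc k. ?q ^ j)"
    by (simp add: algebra_simps)
  ultimately show ?case by (simp only: funpow.simps o_apply)
qed

text \<open>After \<open>k\<close> double steps the Lipschitz constant is so small that the function is nearly constant; by
stationarity the constant is the joint expectation.\<close>

lemma chain_forgets:
  assumes s: "\<bar>s\<bar> \<le> 1" and L: "L \<ge> 0" and F: "lip_upto N S L \<delta> F"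
    and R: "\<And>a. a \<in> S \<Longrightarrow> \<bar>a\<bar> \<le> R" and x0: "x0 \<in> X"
  shows "\<bar>expct s (\<lambda>x _. F x) - ((\<lambda>F. down s (up s F)) ^^ k) F x0\<bar>
     \<le> 2 * R * L * (\<beta>\<^sup>2 / (\<kappa> * \<kappa>')) ^ k + \<delta> + L * (e + \<beta> * e' / \<kappa>) / (1 - \<beta>\<^sup>2 / (\<kappa> * \<kappa>'))"
proof -
  let ?q = "\<beta>\<^sup>2 / (\<kappa> * \<kappa>')" and ?P = "((\<lambda>F. down s (up s F)) ^^ k) F"
  have q0: "0 \<le> ?q" "?q < 1" using \<kappa> \<kappa>' q by simp_all
  have e: "e > 0" "e' > 0" using S T by (simp_all add: lattice_segment_def)
  have geo: "(\<Sum>j<k. ?q ^ j) \<le> 1 / (1 - ?q)"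
  proof -
    have "(\<Sum>j<k. ?q ^ j) = (1 - ?q ^ k) / (1 - ?q)"
      using q0 by (subst sum_gp_strict) auto
    also have "\<dots> \<le> 1 / (1 - ?q)" using q0 by (intro divide_right_mono) auto
    finally show ?thesis .
  qed
  obtain a0 where "a0 \<in> S" using layers_finite by auto
  then have R0: "0 \<le> R" using R[of a0] by linarith
  have "\<bar>?P x - ?P x0\<bar> \<le> 2 * R * L * ?q ^ k + \<delta> + L * (e + \<beta> * e' / \<kappa>) / (1 - ?q)" if x: "x \<in> X" for x
  proof -
    have "l2n N (\<lambda>i. x i - x0 i) \<le> 2 * R"
    proof (rule l2n_bound[OF N])
      fix i assume "i < N"
      then have "\<bar>x i\<bar> \<le> R" "\<bar>x0 i\<bar> \<le> R" using x x0 by (auto intro!: R)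
      then show "\<bar>x i - x0 i\<bar> \<le> 2 * R" by linarith
    qed (use R0 in auto)
    then have 1: "L * ?q ^ k * l2n N (\<lambda>i. x i - x0 i) \<le> L * ?q ^ k * (2 * R)"
      using L q0 by (intro mult_left_mono) auto
    have 2: "L * (e + \<beta> * e' / \<kappa>) * (\<Sum>j<k. ?q ^ j) \<le> L * (e + \<beta> * e' / \<kappa>) * (1 / (1 - ?q))"
      using geo L e \<beta>0 \<kappa> by (intro mult_left_mono) auto
    from chain_lip[OF s L F, of k] x x0
    have "\<bar>?P x - ?P x0\<bar> \<le> L * ?q ^ k * l2n N (\<lambda>i. x i - x0 i)
        + (\<delta> + L * (e + \<beta> * e' / \<kappa>) * (\<Sum>j<k. ?q ^ j))"
      unfolding lip_upto_def by blast
    with 1 2 show ?thesis by (simp add: algebra_simps)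
  qed
  then have "\<bar>expct s (\<lambda>x _. ?P x) - ?P x0\<bar> \<le> 2 * R * L * ?q ^ k + \<delta> + L * (e + \<beta> * e' / \<kappa>) / (1 - ?q)"
    by (intro expct_close) auto
  then show ?thesis by (simp add: chain_stationary)
qed

end

section \<open>The free energy as an integral of bond expectations\<close>

lemma abs_diff_le_trans:
  fixes x y z a b :: real
  shows "\<bar>x - y\<bar> \<le> a \<Longrightarrow> \<bar>y - z\<bar> \<le> b \<Longrightarrow> \<bar>x - z\<bar> \<le> a + b"
  by linarith

context two_layer
begin

definition Zs :: "real \<Rightarrow> real" where
  "Zs s = (\<Sum>x\<in>X. \<Sum>w\<in>W. wt s x w)"

definition bond :: "(nat \<Rightarrow> real) \<Rightarrow> (nat \<Rightarrow> real) \<Rightarrow> real" where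
  "bond x w = (\<Sum>i<N. w i * B x i) / real N"

lemma Zs_pos: "Zs s > 0"
  unfolding Zs_def by (intro sum_pos layers_finite wt_pos)

lemma expct_mono:
  assumes "\<And>x w. x \<in> X \<Longrightarrow> w \<in> W \<Longrightarrow> \<phi> x w \<le> \<psi> x w"
  shows "expct s \<phi> \<le> expct s \<psi>"
  unfolding expct_def Zs_def[symmetric]
  using Zs_pos[of s] wt_pos assms
  by (intro divide_right_mono sum_mono mult_left_mono) (auto simp: less_imp_le)

lemma expct_affine: "expct s (\<lambda>x w. a + b * \<phi> x w) = a + b * expct s \<phi>"
proof -
  have "(\<Sum>x\<in>X. \<Sum>w\<in>W. wt s x w * (a + b * \<phi> x w))
     = (\<Sum>x\<in>X. \<Sum>w\<in>W. a * wt s x w + b * (wt s x w * \<phi> x w))"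
    by (intro sum.cong refl) (simp add: algebra_simps)
  also have "\<dots> = a * (\<Sum>x\<in>X. \<Sum>w\<in>W. wt s x w) + b * (\<Sum>x\<in>X. \<Sum>w\<in>W. wt s x w * \<phi> x w)"
    by (simp only: sum.distrib sum_distrib_left)
  finally show ?thesis
    using Zs_pos[of s] by (simp add: expct_def Zs_def[symmetric] add_divide_distrib)
qed

text \<open>Convexity of the logarithm of the partition function in the coupling \<open>s\<close>; its
derivative is \<open>N\<close> times the expected bond term.\<close>

lemma ln_Zs_above_tangent:
  "ln (Zs s') - ln (Zs s) \<ge> (s' - s) * (real N * expct s bond)"
proof -
  let ?h = "\<lambda>x w. (s' - s) * (real N * bond x w)"
  let ?m = "(s' - s) * (real N * expct s bond)"
  have wt: "wt s' x w = wt s x w * exp (?h x w)" for x w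
    using N by (simp add: wt_def bond_def algebra_simps flip: exp_add)
  have "exp ?m = exp ?m * (1 - ?m) + (exp ?m * (s' - s) * real N) * expct s bond"
    by (simp add: algebra_simps)
  also have "\<dots> = expct s (\<lambda>x w. exp ?m * (1 - ?m) + (exp ?m * (s' - s) * real N) * bond x w)"
    by (rule expct_affine[symmetric])
  also have "\<dots> \<le> expct s (\<lambda>x w. exp (?h x w))"
  proof (rule expct_mono)
    fix x w
    have "exp ?m * (1 + (?h x w - ?m)) \<le> exp ?m * exp (?h x w - ?m)"
      by (intro mult_left_mono exp_ge_add_one_self) auto
    then show "exp ?m * (1 - ?m) + (exp ?m * (s' - s) * real N) * bond x w \<le> exp (?h x w)"
      by (simp add: algebra_simps flip: exp_add)
  qed
  also have "\<dots> = Zs s' / Zs s"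
    by (simp only: expct_def Zs_def wt)
  finally have "?m \<le> ln (Zs s' / Zs s)"
    using Zs_pos by (subst ln_ge_iff) auto
  then show ?thesis using Zs_pos[of s] Zs_pos[of s'] by (simp add: ln_div)
qed

text \<open>Tangent lines at both endpoints of each subinterval bracket the increment of \<open>ln Zs\<close>, so the lower
and upper Riemann sums differ only in their extreme terms.\<close>

lemma free_energy_Riemann_sum:
  assumes m: "m > 0" and M: "\<And>x w. x \<in> X \<Longrightarrow> w \<in> W \<Longrightarrow> \<bar>bond x w\<bar> \<le> M"
  shows "\<bar>(ln (Zs 1) - ln (Zs 0)) / real N - (\<Sum>j<m. expct (real j / real m) bond) / real m\<bar> \<le> 2 * M / real m"
proof -
  let ?a = "\<lambda>j. expct (real j / real m) bond" and ?l = "\<lambda>j. ln (Zs (real j / real m))"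
  have lo: "real N / real m * ?a j \<le> ?l (Suc j) - ?l j" for j
  proof -
    have e: "real (Suc j) / real m - real j / real m = 1 / real m" by (simp add: add_divide_distrib)
    show ?thesis
      using ln_Zs_above_tangent[of "real (Suc j) / real m" "real j / real m"] unfolding e by simp
  qed
  have hi: "?l (Suc j) - ?l j \<le> real N / real m * ?a (Suc j)" for j
  proof -
    have e: "real j / real m - real (Suc j) / real m = - (1 / real m)" by (simp add: add_divide_distrib)
    have "- (1 / real m) * (real N * ?a (Suc j)) \<le> ?l j - ?l (Suc j)"
      using ln_Zs_above_tangent[of "real j / real m" "real (Suc j) / real m"] unfolding e .
    then have "- (real N / real m * ?a (Suc j)) \<le> ?l j - ?l (Suc j)" by (simp only: mult_ac) simp
    then show ?thesis by linarith
  qed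
  have tel: "ln (Zs 1) - ln (Zs 0) = (\<Sum>j<m. ?l (Suc j) - ?l j)"
    using m by (subst sum_lessThan_telescope) simp
  have L: "real N / real m * (\<Sum>j<m. ?a j) \<le> ln (Zs 1) - ln (Zs 0)"
    unfolding tel sum_distrib_left by (intro sum_mono lo)
  have U: "ln (Zs 1) - ln (Zs 0) \<le> real N / real m * (\<Sum>j<m. ?a (Suc j))"
    unfolding tel sum_distrib_left by (intro sum_mono hi)
  have d: "(\<Sum>j<m. ?a (Suc j)) = (\<Sum>j<m. ?a j) + (?a m - ?a 0)"
    using sum_lessThan_telescope[of ?a m] by (simp add: sum_subtractf)
  have "\<bar>?a j\<bar> \<le> M" for j using expct_close[of bond 0 M] M by simp
  from this[of m] this[of 0] have "?a m - ?a 0 \<le> 2 * M" "0 \<le> M" by linarith+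
  with U d have "ln (Zs 1) - ln (Zs 0) \<le> real N / real m * ((\<Sum>j<m. ?a j) + 2 * M)"
    using m by (smt (verit) divide_nonneg_nonneg mult_left_mono of_nat_0_le_iff)
  then have "(ln (Zs 1) - ln (Zs 0)) / real N \<le> (\<Sum>j<m. ?a j) / real m + 2 * M / real m"
    using N m by (simp add: field_simps)
  moreover have "(\<Sum>j<m. ?a j) / real m \<le> (ln (Zs 1) - ln (Zs 0)) / real N"
    using L N m by (simp add: field_simps)
  ultimately show ?thesis using \<open>0 \<le> M\<close> by (simp add: abs_le_iff)
qed

lemma bond_bound: "\<bar>bond x w\<bar> \<le> l2n N w * l2n N (B x)"
  using l2n_Cauchy_Schwarz[OF N, of w "B x"] N by (simp add: bond_def field_simps)

lemma bond_lip:
  assumes "l2n N (B x) \<le> L"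
  shows "lip_upto N T L 0 (bond x)"
  unfolding lip_upto_def
proof (intro ballI)
  fix u v
  have "bond x u - bond x v = bond x (\<lambda>i. u i - v i)"
    by (simp only: bond_def left_diff_distrib sum_subtractf diff_divide_distrib)
  moreover have "l2n N (\<lambda>i. u i - v i) * l2n N (B x) \<le> l2n N (\<lambda>i. u i - v i) * L"
    using assms by (intro mult_left_mono) auto
  ultimately show "\<bar>bond x u - bond x v\<bar> \<le> L * l2n N (\<lambda>i. u i - v i) + 0"
    using bond_bound[of x "\<lambda>i. u i - v i"] by (simp add: mult.commute)
qed

text \<open>The binomial layer is symmetric under \<open>w \<mapsto> - w\<close>.\<close>

lemma gibbs_bond_at_zero:
  assumes sym: "\<And>t. t \<in> T \<Longrightarrow> - t \<in> T" and ev: "\<And>i t. i < N \<Longrightarrow> t \<in> T \<Longrightarrow> \<gamma> i (- t) = \<gamma> i t"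
  shows "gibbs N T \<gamma> (\<lambda>_. 0) (bond x) = 0"
proof -
  let ?neg = "\<lambda>w. \<lambda>i\<in>{..<N}. - w i"
  have "gibbs N T \<gamma> (\<lambda>_. 0) (bond x) = gibbs N T \<gamma> (\<lambda>_. 0) (\<lambda>w. - bond x w)"
    unfolding gibbs_def
  proof (rule sum.reindex_bij_witness[of _ ?neg ?neg])
    fix w assume w: "w \<in> W"
    then show "?neg (?neg w) = w" "?neg w \<in> W"
      by (auto simp: fun_eq_iff PiE_def extensional_def Pi_def sym)
    then show "?neg (?neg w) = w" "?neg w \<in> W" by -
    have "tilt T (\<gamma> i) 0 (- w i) = tilt T (\<gamma> i) 0 (w i)" if "i < N" for i
    proof -
      have "w i \<in> T" using w that by auto
      then show ?thesis using ev that by (simp add: tilt_def)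
    qed
    then have "(\<Prod>i<N. tilt T (\<gamma> i) 0 (?neg w i)) = (\<Prod>i<N. tilt T (\<gamma> i) 0 (w i))"
      by (intro prod.cong) auto
    moreover have "bond x (?neg w) = - bond x w"
      by (simp add: bond_def sum_negf)
    ultimately show "(\<Prod>i<N. tilt T (\<gamma> i) 0 (?neg w i)) * - bond x (?neg w)
        = (\<Prod>i<N. tilt T (\<gamma> i) 0 (w i)) * bond x w" by simp
  qed
  also have "\<dots> = - gibbs N T \<gamma> (\<lambda>_. 0) (bond x)"
    by (simp add: gibbs_def sum_negf)
  finally show ?thesis by simp
qed

text \<open>The bond observable depends on both layers. Its expectation over \<open>w\<close> depends on \<open>x\<close> through the law of
\<open>w\<close> and through the integrand, which is linear in \<open>x\<close>. Pointwise bounds on the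
second part would involve the diameter of \<open>T\<close>, which grows with the number of binomial summands;
comparison with zero field avoids that.\<close>

lemma down_bond_lip:
  assumes s: "\<bar>s\<bar> \<le> 1" and R: "\<And>a. a \<in> S \<Longrightarrow> \<bar>a\<bar> \<le> R"
    and sym: "\<And>t. t \<in> T \<Longrightarrow> - t \<in> T" and ev: "\<And>i t. i < N \<Longrightarrow> t \<in> T \<Longrightarrow> \<gamma> i (- t) = \<gamma> i t"
  shows "lip_upto N S (\<beta> * (2 * \<beta> * R / \<kappa>' + e')) (\<beta> * R * e') (\<lambda>x. down s (bond x) x)"
  unfolding lip_upto_def
proof (intro ballI)
  fix x y assume x: "x \<in> X" and y: "y \<in> X"
  obtain a0 where "a0 \<in> S" using layers_finite by auto
  then have R0: "0 \<le> R" using R[of a0] by linarith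
  have e': "e' > 0" using T by (simp add: lattice_segment_def)
  have Bx: "l2n N (B u) \<le> \<beta> * R" if u: "u \<in> X" for u
  proof -
    have "l2n N u \<le> R" using u by (intro l2n_bound N R0 R) auto
    then show ?thesis using B_norm[of u] \<beta>0 by (smt (verit) mult_left_mono)
  qed
  let ?d = "\<lambda>i. x i - y i"
  let ?G = "\<lambda>z. gibbs N T \<gamma> z"
  have 1: "\<bar>?G (\<lambda>i. s * B x i) (bond x) - ?G (\<lambda>i. s * B y i) (bond x)\<bar>
     \<le> \<beta> * R * (\<beta> * l2n N ?d / \<kappa>' + e')"
  proof -
    have "\<bar>?G (\<lambda>i. s * B x i) (bond x) - ?G (\<lambda>i. s * B y i) (bond x)\<bar>
     \<le> \<beta> * R * (l2n N (\<lambda>i. s * B x i - s * B y i) / \<kappa>' + e') + 0"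
      using \<beta>0 R0 by (intro gibbs_contraction[OF T \<gamma> \<kappa>' N _ bond_lip[OF Bx[OF x]]]) auto
    also have "\<dots> \<le> \<beta> * R * (\<beta> * l2n N ?d / \<kappa>' + e') + 0"
      using \<beta>0 R0 \<kappa>' B_lip[OF s, of x y]
      by (intro add_right_mono mult_left_mono divide_right_mono) auto
    finally show ?thesis by simp
  qed
  have bd: "bond x w - bond y w = bond ?d w" for w
  proof -
    have "w i * B x i - w i * B y i = w i * B ?d i" if "i < N" for i
      unfolding right_diff_distrib[symmetric] using B_diff[OF that, of x y] by (simp only:)
    then have "(\<Sum>i<N. w i * B x i) - (\<Sum>i<N. w i * B y i) = (\<Sum>i<N. w i * B ?d i)"
      unfolding sum_subtractf[symmetric] by (intro sum.cong) auto
    then show ?thesis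
      unfolding bond_def diff_divide_distrib[symmetric] by (simp only:)
  qed
  have 2: "\<bar>?G (\<lambda>i. s * B y i) (bond x) - ?G (\<lambda>i. s * B y i) (bond y)\<bar>
     \<le> \<beta> * l2n N ?d * (\<beta> * R / \<kappa>' + e')"
  proof -
    have "?G (\<lambda>i. s * B y i) (bond x) - ?G (\<lambda>i. s * B y i) (bond y) = ?G (\<lambda>i. s * B y i) (bond ?d)"
      unfolding gibbs_diff[symmetric] bd ..
    \<comment> \<open>The subtracted term is zero by symmetry; the difference is controlled by the contraction estimate.\<close>
    also have "\<dots> = ?G (\<lambda>i. s * B y i) (bond ?d) - ?G (\<lambda>_. 0) (bond ?d)"
      using gibbs_bond_at_zero[OF sym ev] by simp
    finally have "\<bar>?G (\<lambda>i. s * B y i) (bond x) - ?G (\<lambda>i. s * B y i) (bond y)\<bar>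
      = \<bar>?G (\<lambda>i. s * B y i) (bond ?d) - ?G (\<lambda>_. 0) (bond ?d)\<bar>" by (rule arg_cong)
    also have "\<dots> \<le> \<beta> * l2n N ?d * (l2n N (\<lambda>i. s * B y i - 0) / \<kappa>' + e') + 0"
      using \<beta>0 by (intro gibbs_contraction[OF T \<gamma> \<kappa>' N _ bond_lip[OF B_norm]]) auto
    also have "\<dots> \<le> \<beta> * l2n N ?d * (\<beta> * R / \<kappa>' + e') + 0"
    proof -
      have "l2n N (\<lambda>i. s * B y i - 0) = \<bar>s\<bar> * l2n N (B y)"
        unfolding diff_0_right by (rule l2n_scale)
      also have "\<dots> \<le> 1 * (\<beta> * R)" by (rule mult_mono[OF s Bx[OF y]]) simp_all
      finally have "l2n N (\<lambda>i. s * B y i - 0) \<le> \<beta> * R" by simp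
      then show ?thesis using \<beta>0 \<kappa>'
        by (intro add_right_mono mult_left_mono divide_right_mono) (simp_all only: mult_nonneg_nonneg l2n_nonneg less_imp_le)
    qed
    finally show ?thesis by simp
  qed
  have eq: "\<beta> * R * (\<beta> * D / \<kappa>' + e') + \<beta> * D * (\<beta> * R / \<kappa>' + e')
     = \<beta> * (2 * \<beta> * R / \<kappa>' + e') * D + \<beta> * R * e'" for D
    by (simp add: algebra_simps)
  show "\<bar>down s (bond x) x - down s (bond y) y\<bar>
     \<le> \<beta> * (2 * \<beta> * R / \<kappa>' + e') * l2n N ?d + \<beta> * R * e'"
    unfolding down_def eq[symmetric] by (rule abs_diff_le_trans[OF 1 2])
qed

text \<open>The right-hand quantity involves only finitely many conditional expectations, evaluated at
one fixed configuration \<open>x0\<close>.\<close>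

lemma free_energy_by_chain:
  assumes m: "m > 0" and R: "\<And>a. a \<in> S \<Longrightarrow> \<bar>a\<bar> \<le> R" and RT: "\<And>t. t \<in> T \<Longrightarrow> \<bar>t\<bar> \<le> RT"
    and sym: "\<And>t. t \<in> T \<Longrightarrow> - t \<in> T" and ev: "\<And>i t. i < N \<Longrightarrow> t \<in> T \<Longrightarrow> \<gamma> i (- t) = \<gamma> i t"
    and x0: "x0 \<in> X"
  defines "L \<equiv> \<beta> * (2 * \<beta> * R / \<kappa>' + e')"
  shows "\<bar>(ln (Zs 1) - ln (Zs 0)) / real N
     - (\<Sum>j<m. ((\<lambda>F. down (real j / real m) (up (real j / real m) F)) ^^ k)
           (\<lambda>x. down (real j / real m) (bond x) x) x0) / real m\<bar>
     \<le> 2 * (RT * (\<beta> * R)) / real m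
        + (2 * R * L * (\<beta>\<^sup>2 / (\<kappa> * \<kappa>')) ^ k + \<beta> * R * e'
           + L * (e + \<beta> * e' / \<kappa>) / (1 - \<beta>\<^sup>2 / (\<kappa> * \<kappa>')))"
proof -
  let ?s = "\<lambda>j. real j / real m"
  let ?c = "\<lambda>j. ((\<lambda>F. down (?s j) (up (?s j) F)) ^^ k) (\<lambda>x. down (?s j) (bond x) x) x0"
  let ?D = "2 * R * L * (\<beta>\<^sup>2 / (\<kappa> * \<kappa>')) ^ k + \<beta> * R * e'
           + L * (e + \<beta> * e' / \<kappa>) / (1 - \<beta>\<^sup>2 / (\<kappa> * \<kappa>'))"
  obtain a0 where "a0 \<in> S" using layers_finite by auto
  then have R0: "0 \<le> R" using R[of a0] by linarith
  obtain t0 where "t0 \<in> T" using layers_finite by auto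
  then have RT0: "0 \<le> RT" using RT[of t0] by linarith
  have L0: "L \<ge> 0" unfolding L_def using \<beta>0 R0 \<kappa>' T by (simp add: lattice_segment_def)
  have M: "\<bar>bond x w\<bar> \<le> RT * (\<beta> * R)" if "x \<in> X" "w \<in> W" for x w
  proof -
    have "l2n N x \<le> R" using that by (intro l2n_bound N R0 R) auto
    then have "l2n N (B x) \<le> \<beta> * R" using B_norm[of x] \<beta>0 by (smt (verit) mult_left_mono)
    moreover have "l2n N w \<le> RT" using that by (intro l2n_bound N RT0 RT) auto
    ultimately have "l2n N w * l2n N (B x) \<le> RT * (\<beta> * R)" using RT0 by (intro mult_mono) auto
    with bond_bound[of x w] show ?thesis by linarith
  qed
  have each: "\<bar>expct (?s j) bond - ?c j\<bar> \<le> ?D" if "j < m" for j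
  proof -
    have s: "\<bar>?s j\<bar> \<le> 1" using that by simp
    have "expct (?s j) bond = expct (?s j) (\<lambda>x _. down (?s j) (bond x) x)"
      by (rule expct_down)
    then show ?thesis
      using chain_forgets[OF s L0 down_bond_lip[OF s R sym ev, folded L_def] R x0, of k]
      by (simp only:)
  qed
  have "\<bar>(\<Sum>j<m. expct (?s j) bond) / real m - (\<Sum>j<m. ?c j) / real m\<bar>
     = \<bar>\<Sum>j<m. expct (?s j) bond - ?c j\<bar> / real m"
    by (simp add: sum_subtractf diff_divide_distrib[symmetric])
  also have "\<dots> \<le> (\<Sum>j<m. \<bar>expct (?s j) bond - ?c j\<bar>) / real m"
    by (intro divide_right_mono sum_abs) auto
  also have "\<dots> \<le> (\<Sum>j<m. ?D) / real m"
    using each by (intro divide_right_mono sum_mono) auto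
  also have "\<dots> = ?D" using m by simp
  finally show ?thesis
    by (rule abs_diff_le_trans[rotated]) (rule free_energy_Riemann_sum[OF m M])
qed

end

section \<open>Tree sums over weighted graphs\<close>

lemma sum_PiE_insert:
  assumes "x \<notin> V"
  shows "(\<Sum>f\<in>insert x V \<rightarrow>\<^sub>E B. F f) = (\<Sum>g\<in>V \<rightarrow>\<^sub>E B. \<Sum>y\<in>B. F (g(x := y)))"
proof -
  have "(\<Sum>f\<in>insert x V \<rightarrow>\<^sub>E B. F f) = (\<Sum>f\<in>(\<lambda>(y, g). g(x := y)) ` (B \<times> (V \<rightarrow>\<^sub>E B)). F f)"
    by (simp add: PiE_insert_eq)
  also have "\<dots> = (\<Sum>p\<in>B \<times> (V \<rightarrow>\<^sub>E B). F ((\<lambda>(y, g). g(x := y)) p))"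
    by (subst sum.reindex[OF inj_combinator[OF assms]]) simp
  also have "\<dots> = (\<Sum>y\<in>B. \<Sum>g\<in>V \<rightarrow>\<^sub>E B. F (g(x := y)))"
    by (simp add: sum.cartesian_product case_prod_beta)
  also have "\<dots> = (\<Sum>g\<in>V \<rightarrow>\<^sub>E B. \<Sum>y\<in>B. F (g(x := y)))" by (rule sum.swap)
  finally show ?thesis .
qed

text \<open>Canonical labels for the partitions of \<open>V\<close>: each vertex is sent to the least element of its block.\<close>

definition retractions :: "nat set \<Rightarrow> (nat \<Rightarrow> nat) set" where
  "retractions V = {r \<in> V \<rightarrow>\<^sub>E V. \<forall>v\<in>V. r v \<le> v \<and> r (r v) = r v}"

text \<open>A map is determined by its partition into fibres and an injective map on the blocks.\<close>

lemma sum_by_retraction: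
  assumes V: "finite V" and B: "finite B"
  shows "(\<Sum>f\<in>V \<rightarrow>\<^sub>E B. F f)
    = (\<Sum>r\<in>retractions V. \<Sum>g\<in>{g \<in> r ` V \<rightarrow>\<^sub>E B. inj_on g (r ` V)}. F (\<lambda>v\<in>V. g (r v)))"
proof -
  let ?I = "\<lambda>r. {g \<in> r ` V \<rightarrow>\<^sub>E B. inj_on g (r ` V)}"
  \<comment> \<open>The partition of \<open>V\<close> into the fibres of \<open>f\<close>.\<close>
  define kmin where "kmin f = (\<lambda>v\<in>V. Min {u\<in>V. f u = f v})" for f :: "nat \<Rightarrow> 'a"
  have km: "kmin f v \<in> V" "f (kmin f v) = f v" "kmin f v \<le> v" if "v \<in> V" for f v
  proof -
    have "Min {u\<in>V. f u = f v} \<in> {u\<in>V. f u = f v}"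
      using V that by (intro Min_in) auto
    then show "kmin f v \<in> V" "f (kmin f v) = f v" using that by (auto simp: kmin_def)
    show "kmin f v \<le> v" using V that by (auto simp: kmin_def intro!: Min_le)
  qed
  have km_cong: "kmin f u = kmin f v" if "u \<in> V" "v \<in> V" "f u = f v" for f u v
    using that by (simp add: kmin_def)
  have finR: "finite (retractions V)"
    unfolding retractions_def using V by (intro finite_subset[OF _ finite_PiE[of V "\<lambda>_. V"]]) auto
  have finI: "finite (?I r)" for r
    using V B by (intro finite_subset[OF _ finite_PiE[of "r ` V" "\<lambda>_. B"]]) auto
  have kr: "kmin (\<lambda>v\<in>V. g (r v)) = r" if r: "r \<in> retractions V" and g: "g \<in> ?I r" for r g
  proof
    fix v show "kmin (\<lambda>v\<in>V. g (r v)) v = r v"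
    proof (cases "v \<in> V")
      case True
      have rV: "r u \<in> V" if "u \<in> V" for u using r that by (auto simp: retractions_def)
      have "{u\<in>V. (\<lambda>v\<in>V. g (r v)) u = (\<lambda>v\<in>V. g (r v)) v} = {u\<in>V. r u = r v}"
        using g True by (auto simp: inj_on_def)
      moreover have "Min {u\<in>V. r u = r v} = r v"
      proof (rule Min_eqI)
        show "r v \<le> u" if "u \<in> {u\<in>V. r u = r v}" for u
          using r that by (auto simp: retractions_def)
        show "r v \<in> {u\<in>V. r u = r v}" using r True rV by (auto simp: retractions_def)
      qed (use V in auto)
      ultimately show ?thesis using True by (simp add: kmin_def)
    next
      case False
      then show ?thesis using r by (simp add: kmin_def retractions_def PiE_def extensional_def)
    qed
  qed
  have "(\<Sum>r\<in>retractions V. \<Sum>g\<in>?I r. F (\<lambda>v\<in>V. g (r v)))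
      = (\<Sum>(r, g)\<in>Sigma (retractions V) ?I. F (\<lambda>v\<in>V. g (r v)))"
    using finR finI by (subst sum.Sigma) auto
  also have "\<dots> = (\<Sum>f\<in>V \<rightarrow>\<^sub>E B. F f)"
  proof (rule sum.reindex_bij_witness[of _ "\<lambda>f. (kmin f, restrict f (kmin f ` V))" "\<lambda>(r, g). \<lambda>v\<in>V. g (r v)"])
    fix p assume p: "p \<in> Sigma (retractions V) ?I"
    then obtain r g where rg: "p = (r, g)" "r \<in> retractions V" "g \<in> ?I r" by auto
    let ?f = "\<lambda>v\<in>V. g (r v)"
    have k: "kmin ?f = r" by (rule kr[OF rg(2,3)])
    have "restrict ?f (r ` V) = g"
    proof
      fix x show "restrict ?f (r ` V) x = g x"
      proof (cases "x \<in> r ` V")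
        case True
        then obtain v where v: "v \<in> V" "x = r v" by auto
        then have "x \<in> V" "r x = x" using rg(2) by (auto simp: retractions_def)
        then show ?thesis using True by simp
      next
        case False
        then show ?thesis using rg(3) by (simp add: PiE_def extensional_def)
      qed
    qed
    then show "(\<lambda>f. (kmin f, restrict f (kmin f ` V))) ((\<lambda>(r, g). \<lambda>v\<in>V. g (r v)) p) = p"
      using k rg(1) by simp
    show "(\<lambda>(r, g). \<lambda>v\<in>V. g (r v)) p \<in> V \<rightarrow>\<^sub>E B" using rg by auto
    show "F ((\<lambda>(r, g). \<lambda>v\<in>V. g (r v)) p) = (case p of (r, g) \<Rightarrow> F (\<lambda>v\<in>V. g (r v)))"
      by (simp add: rg(1))
  next
    fix f assume f: "f \<in> V \<rightarrow>\<^sub>E B"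
    have r: "kmin f \<in> retractions V"
    proof -
      have "kmin f (kmin f v) = kmin f v" if "v \<in> V" for v
        using km[OF that] that by (intro km_cong) auto
      moreover have "kmin f \<in> V \<rightarrow>\<^sub>E V" using km(1) by (auto simp: kmin_def)
      ultimately show ?thesis using km(3) by (auto simp: retractions_def)
    qed
    have "restrict f (kmin f ` V) \<in> ?I (kmin f)"
    proof -
      have "inj_on f (kmin f ` V)"
      proof (rule inj_onI)
        fix x y assume "x \<in> kmin f ` V" "y \<in> kmin f ` V" and e: "f x = f y"
        then obtain u v where uv: "u \<in> V" "v \<in> V" "x = kmin f u" "y = kmin f v" by auto
        then have "f u = f v" using e km(2) by metis
        then show "x = y" using uv km_cong by metis
      qed
      moreover have "restrict f (kmin f ` V) \<in> kmin f ` V \<rightarrow>\<^sub>E B" using f km(1) by fastforce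
      ultimately show ?thesis by (simp add: inj_on_def)
    qed
    then show "(kmin f, restrict f (kmin f ` V)) \<in> Sigma (retractions V) ?I" using r by simp
    show "(\<lambda>(r, g). \<lambda>v\<in>V. g (r v)) (kmin f, restrict f (kmin f ` V)) = f"
    proof
      fix v show "(\<lambda>(r, g). \<lambda>v\<in>V. g (r v)) (kmin f, restrict f (kmin f ` V)) v = f v"
        using f km(2) by (cases "v \<in> V") (auto simp: PiE_def extensional_def)
    qed
  qed
  finally show ?thesis by simp
qed

lemma prod_close:
  fixes M e :: real
  assumes "finite V" "e > 0"
  obtains \<delta> where "\<delta> > 0"
    "\<And>p q :: 'a \<Rightarrow> real. (\<And>v. v \<in> V \<Longrightarrow> \<bar>p v\<bar> \<le> M) \<Longrightarrow> (\<And>v. v \<in> V \<Longrightarrow> \<bar>p v - q v\<bar> \<le> \<delta>)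
        \<Longrightarrow> \<bar>prod p V - prod q V\<bar> \<le> e"
proof -
  define D where "D = \<bar>M\<bar> + 1"
  have D: "D > 0" "\<bar>M\<bar> < D" by (auto simp: D_def)
  define \<delta> where "\<delta> = min 1 (e * D / (D ^ card V * (real (card V) + 1)))"
  have d: "\<delta> > 0" "\<delta> \<le> 1" "\<delta> \<le> e * D / (D ^ card V * (real (card V) + 1))"
    unfolding \<delta>_def using D assms by auto
  show thesis
  proof (rule that[OF d(1)])
    fix p q :: "'a \<Rightarrow> real"
    assume p: "\<And>v. v \<in> V \<Longrightarrow> \<bar>p v\<bar> \<le> M" and pq: "\<And>v. v \<in> V \<Longrightarrow> \<bar>p v - q v\<bar> \<le> \<delta>"
    have pD: "\<bar>p v\<bar> \<le> D" if "v \<in> V" for v using p[OF that] D by linarith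
    have qD: "\<bar>q v\<bar> \<le> D" if "v \<in> V" for v using p[OF that] pq[OF that] d(2) by (simp add: D_def)
    have "\<bar>(\<Prod>v\<in>V. p v / D) - (\<Prod>v\<in>V. q v / D)\<bar> \<le> (\<Sum>v\<in>V. \<bar>p v / D - q v / D\<bar>)"
      using norm_prod_diff[of V "\<lambda>v. p v / D" "\<lambda>v. q v / D"] pD qD D by simp
    also have "\<dots> \<le> (\<Sum>v\<in>V. \<delta> / D)"
      using pq D by (intro sum_mono) (simp add: divide_right_mono flip: diff_divide_distrib)
    also have "\<dots> = card V * \<delta> / D" by simp
    finally have *: "\<bar>prod p V - prod q V\<bar> / D ^ card V \<le> card V * \<delta> / D"
      using D by (simp add: prod_dividef flip: diff_divide_distrib)
    have "card V * \<delta> \<le> (real (card V) + 1) * (e * D / (D ^ card V * (real (card V) + 1)))"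
      using d by (intro mult_mono) auto
    also have "\<dots> = e * D / D ^ card V" by (simp add: add_nonneg_eq_0_iff)
    finally have "card V * \<delta> / D \<le> e / D ^ card V" using D by (simp add: field_simps)
    with * have "\<bar>prod p V - prod q V\<bar> / D ^ card V \<le> e / D ^ card V" by linarith
    then show "\<bar>prod p V - prod q V\<bar> \<le> e" using D by (simp add: divide_le_cancel)
  qed
qed

abbreviation "sz \<equiv> wgraph_size"

definition ew :: "wgraph \<Rightarrow> nat \<Rightarrow> nat \<Rightarrow> real" where
  "ew G i j = edge_weights G $$ (i, j)"

definition vw :: "wgraph \<Rightarrow> nat \<Rightarrow> real" where
  "vw G i = vertex_weights G $ i"

definition eprod :: "wgraph \<Rightarrow> (nat \<times> nat) list \<Rightarrow> (nat \<Rightarrow> nat) \<Rightarrow> real" where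
  "eprod G es f = (\<Prod>(u, v)\<leftarrow>es. ew G (f u) (f v))"

lemma eprod_simps [simp]:
  "eprod G [] f = 1" "eprod G (e # es) f = ew G (f (fst e)) (f (snd e)) * eprod G es f"
  "eprod G (es @ es') f = eprod G es f * eprod G es' f"
  by (simp_all add: eprod_def case_prod_beta)

lemma eprod_cong:
  "(\<And>v. v \<in> V \<Longrightarrow> f v = f' v) \<Longrightarrow> set es \<subseteq> V \<times> V \<Longrightarrow> eprod G es f = eprod G es f'"
  by (induction es) auto

lemma eprod_map: "eprod G (map (map_prod r r) es) f = eprod G es (f \<circ> r)"
  by (induction es) auto

text \<open>Every vertex except the root \<open>0\<close> is joined to a smaller vertex, so the graph is connected; additional
edges and loops are permitted. The order provides the induction from the leaves.\<close>

definition rooted_tree :: "nat set \<Rightarrow> (nat \<times> nat) list \<Rightarrow> bool" where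
  "rooted_tree V es \<longleftrightarrow> finite V \<and> 0 \<in> V \<and> set es \<subseteq> V \<times> V \<and>
     (\<forall>v\<in>V. v \<noteq> 0 \<longrightarrow> (\<exists>u\<in>V. u < v \<and> ((u, v) \<in> set es \<or> (v, u) \<in> set es)))"

text \<open>Identifying vertices preserves connectedness, and labelling blocks by their least elements keeps
the parents smaller.\<close>

lemma rooted_tree_retract:
  assumes "rooted_tree V es" "r \<in> retractions V"
  shows "rooted_tree (r ` V) (map (map_prod r r) es)"
proof -
  have V: "finite V" "0 \<in> V" "set es \<subseteq> V \<times> V" using assms(1) by (auto simp: rooted_tree_def)
  have r: "r v \<in> V" "r v \<le> v" "r (r v) = r v" if "v \<in> V" for v
    using assms(2) that by (auto simp: retractions_def)
  have "\<exists>u\<in>r ` V. u < v \<and> ((u, v) \<in> set (map (map_prod r r) es) \<or> (v, u) \<in> set (map (map_prod r r) es))"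
    if v: "v \<in> r ` V" "v \<noteq> 0" for v
  proof -
    have "v \<in> V" "r v = v" using v r by auto
    then obtain u where u: "u \<in> V" "u < v" "(u, v) \<in> set es \<or> (v, u) \<in> set es"
      using assms(1) v(2) unfolding rooted_tree_def by blast
    have "(r u, v) \<in> set (map (map_prod r r) es) \<or> (v, r u) \<in> set (map (map_prod r r) es)"
      using u(3) \<open>r v = v\<close> by (force simp: map_prod_def image_iff)
    moreover have "r u < v" using r(2)[OF u(1)] u(2) by simp
    ultimately show ?thesis using u(1) by blast
  qed
  moreover have "0 \<in> r ` V" using r[OF V(2)] V(2) by force
  moreover have "set (map (map_prod r r) es) \<subseteq> r ` V \<times> r ` V" using V(3) by auto
  ultimately show ?thesis using V(1) by (simp add: rooted_tree_def)
qed

locale bounded_graphs =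
  fixes GG :: "wgraph set" and C :: real
  assumes C_pos: "C > 0"
    and graph: "\<And>G. G \<in> GG \<Longrightarrow> weighted_graph G"
    and row: "\<And>G. G \<in> GG \<Longrightarrow> mat_inf_norm (edge_weights G) \<le> C"
    and field: "\<And>G. G \<in> GG \<Longrightarrow> vec_inf_norm (vertex_weights G) \<le> C"
begin

lemma size_pos: "G \<in> GG \<Longrightarrow> sz G > 0"
  using graph by (fastforce simp: weighted_graph_def)

lemma ew_sym: "G \<in> GG \<Longrightarrow> i < sz G \<Longrightarrow> j < sz G \<Longrightarrow> ew G i j = ew G j i"
  using graph[of G] unfolding weighted_graph_def ew_def
  by (metis carrier_matD(1) carrier_matD(2) index_transpose_mat(1))

lemma row_sum: "G \<in> GG \<Longrightarrow> i < sz G \<Longrightarrow> (\<Sum>j<sz G. \<bar>ew G i j\<bar>) \<le> C"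
proof -
  assume G: "G \<in> GG" and i: "i < sz G"
  have d: "dim_row (edge_weights G) = sz G" "dim_col (edge_weights G) = sz G"
    using graph[OF G] by (auto simp: weighted_graph_def)
  have "(\<Sum>j<sz G. \<bar>ew G i j\<bar>) \<le> mat_inf_norm (edge_weights G)"
    unfolding mat_inf_norm_def ew_def d atLeast0LessThan using i by (intro Max_ge) auto
  with row[OF G] show ?thesis by simp
qed

lemma vw_le: "G \<in> GG \<Longrightarrow> i < sz G \<Longrightarrow> \<bar>vw G i\<bar> \<le> C"
proof -
  assume G: "G \<in> GG" and i: "i < sz G"
  have "\<bar>vw G i\<bar> \<le> vec_inf_norm (vertex_weights G)"
    using graph[OF G] i unfolding vec_inf_norm_def vw_def weighted_graph_def
    by (intro Max_ge) auto
  with field[OF G] show ?thesis by simp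
qed

lemma ew_le: "G \<in> GG \<Longrightarrow> i < sz G \<Longrightarrow> j < sz G \<Longrightarrow> \<bar>ew G i j\<bar> \<le> C"
  using row_sum[of G i] member_le_sum[of j "{..<sz G}" "\<lambda>j. \<bar>ew G i j\<bar>"] by force

abbreviation "D \<equiv> max 1 C"

lemma eprod_le:
  "G \<in> GG \<Longrightarrow> f \<in> V \<rightarrow> {..<sz G} \<Longrightarrow> set es \<subseteq> V \<times> V \<Longrightarrow> \<bar>eprod G es f\<bar> \<le> D ^ length es"
proof (induction es)
  case (Cons e es)
  have "\<bar>ew G (f (fst e)) (f (snd e))\<bar> \<le> D"
    using Cons.prems ew_le[of G "f (fst e)" "f (snd e)"] by (fastforce simp: Pi_def)
  moreover have "\<bar>eprod G es f\<bar> \<le> D ^ length es" using Cons by simp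
  ultimately show ?case by (simp add: abs_mult mult_mono)
qed simp

lemma eprod_partition:
  "eprod G es f = eprod G (filter P es) f * eprod G (filter (\<lambda>e. \<not> P e) es) f"
  by (induction es) auto

text \<open>Summing out the largest vertex costs a factor \<open>C\<close> for the edge to its parent, by the bound on row
sums. Only the root sum contributes the number of vertices.\<close>

lemma tree_sum_bound:
  assumes "G \<in> GG"
  shows "rooted_tree V es \<Longrightarrow> (\<Sum>f\<in>V \<rightarrow>\<^sub>E {..<sz G}. \<bar>eprod G es f\<bar>) \<le> D ^ length es * real (sz G)"
proof (induction "card V" arbitrary: V es rule: less_induct)
  case less
  have V: "finite V" "0 \<in> V" and es: "set es \<subseteq> V \<times> V" using less.prems by (auto simp: rooted_tree_def)
  show ?case
  proof (cases "V = {0}")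
    case True
    have "(\<Sum>f\<in>V \<rightarrow>\<^sub>E {..<sz G}. \<bar>eprod G es f\<bar>) \<le> (\<Sum>f\<in>V \<rightarrow>\<^sub>E {..<sz G}. D ^ length es)"
      using es assms by (intro sum_mono eprod_le[where V = V]) auto
    also have "\<dots> = D ^ length es * real (sz G)"
      using True by (simp add: card_PiE)
    finally show ?thesis .
  next
    case False
    define m where "m = Max V"
    have "m \<in> V" unfolding m_def using V by (intro Max_in) auto
    then have m: "m \<in> V" "\<And>v. v \<in> V \<Longrightarrow> v \<le> m" using V by (auto simp: m_def)
    have m0: "m \<noteq> 0" using False V m(2) by fastforce
    then obtain u where u: "u \<in> V" "u < m" "(u, m) \<in> set es \<or> (m, u) \<in> set es"
      using less.prems m(1) unfolding rooted_tree_def by blast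
    \<comment> \<open>One edge \<open>e0\<close> to the parent is summed with the bound on row sums; all other edges at \<open>m\<close> are bounded by \<open>D\<close>.\<close>
    then obtain e0 where e0: "e0 \<in> set es" "e0 = (u, m) \<or> e0 = (m, u)" by auto
    then obtain xs ys where es_eq: "es = xs @ e0 # ys" by (meson split_list)
    let ?P = "\<lambda>e. fst e \<noteq> m \<and> snd e \<noteq> m"
    let ?es' = "filter ?P (xs @ ys)" and ?es'' = "filter (\<lambda>e. \<not> ?P e) (xs @ ys)"
    let ?V' = "V - {m}"
    have V': "insert m ?V' = V" "m \<notin> ?V'" using m by auto
    have card: "card ?V' < card V" using V m(1) by (intro card_Diff1_less)
    have tree': "rooted_tree ?V' ?es'"
      unfolding rooted_tree_def
    proof (intro conjI ballI impI)
      show "finite ?V'" "0 \<in> ?V'" using V m0 by auto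
      show "set ?es' \<subseteq> ?V' \<times> ?V'" using es es_eq by auto
      fix v assume v: "v \<in> ?V'" "v \<noteq> 0"
      then obtain w where w: "w \<in> V" "w < v" "(w, v) \<in> set es \<or> (v, w) \<in> set es"
        using less.prems unfolding rooted_tree_def by blast
      have "w \<noteq> m" using w v m(2)[of v] by auto
      then show "\<exists>u\<in>?V'. u < v \<and> ((u, v) \<in> set ?es' \<or> (v, u) \<in> set ?es')"
        using w v e0 es_eq u by (intro bexI[of _ w]) auto
    qed
    have len: "length es = Suc (length ?es' + length ?es'')"
      using sum_length_filter_compl[of ?P "xs @ ys"] es_eq by simp
    have bound: "(\<Sum>y<sz G. \<bar>eprod G es (g(m := y))\<bar>) \<le> \<bar>eprod G ?es' g\<bar> * (D ^ length ?es'' * C)"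
      if g: "g \<in> ?V' \<rightarrow>\<^sub>E {..<sz G}" for g
    proof -
      have gu: "g u < sz G" using g u by auto
      have "\<bar>eprod G es (g(m := y))\<bar> \<le> \<bar>eprod G ?es' g\<bar> * (D ^ length ?es'' * \<bar>ew G (g u) y\<bar>)"
        if y: "y < sz G" for y
      proof -
        let ?f = "g(m := y)"
        have e0v: "ew G (?f (fst e0)) (?f (snd e0)) = ew G (g u) y"
          using e0(2) u(2) ew_sym[OF assms gu y] by auto
        have "eprod G es ?f = ew G (g u) y * eprod G (xs @ ys) ?f"
          using e0v by (simp add: es_eq)
        also have "eprod G (xs @ ys) ?f = eprod G ?es' ?f * eprod G ?es'' ?f"
          by (rule eprod_partition)
        also have "eprod G ?es' ?f = eprod G ?es' g"
          by (rule eprod_cong[of ?V']) (use tree' in \<open>auto simp: rooted_tree_def\<close>)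
        finally have "\<bar>eprod G es ?f\<bar> = \<bar>ew G (g u) y * (eprod G ?es' g * eprod G ?es'' ?f)\<bar>"
          by (rule arg_cong)
        also have "\<dots> = \<bar>eprod G ?es' g\<bar> * (\<bar>eprod G ?es'' ?f\<bar> * \<bar>ew G (g u) y\<bar>)"
          by (simp only: abs_mult mult_ac)
        also have "\<bar>eprod G ?es'' ?f\<bar> \<le> D ^ length ?es''"
          using g y es es_eq by (intro eprod_le[OF assms, of _ V]) auto
        finally show ?thesis by - (simp add: mult_left_mono mult_right_mono)
      qed
      then have "(\<Sum>y<sz G. \<bar>eprod G es (g(m := y))\<bar>)
          \<le> (\<Sum>y<sz G. \<bar>eprod G ?es' g\<bar> * (D ^ length ?es'' * \<bar>ew G (g u) y\<bar>))"
        by (intro sum_mono) auto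
      also have "\<dots> = \<bar>eprod G ?es' g\<bar> * (D ^ length ?es'' * (\<Sum>y<sz G. \<bar>ew G (g u) y\<bar>))"
        by (simp add: sum_distrib_left)
      also have "\<dots> \<le> \<bar>eprod G ?es' g\<bar> * (D ^ length ?es'' * C)"
        using row_sum[OF assms gu] by (intro mult_left_mono) auto
      finally show ?thesis .
    qed
    have "(\<Sum>f\<in>V \<rightarrow>\<^sub>E {..<sz G}. \<bar>eprod G es f\<bar>)
        = (\<Sum>g\<in>?V' \<rightarrow>\<^sub>E {..<sz G}. \<Sum>y<sz G. \<bar>eprod G es (g(m := y))\<bar>)"
      using sum_PiE_insert[OF V'(2), where B = "{..<sz G}"] V'(1) by simp
    also have "\<dots> \<le> (\<Sum>g\<in>?V' \<rightarrow>\<^sub>E {..<sz G}. \<bar>eprod G ?es' g\<bar> * (D ^ length ?es'' * C))"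
      by (intro sum_mono bound)
    also have "\<dots> = (\<Sum>g\<in>?V' \<rightarrow>\<^sub>E {..<sz G}. \<bar>eprod G ?es' g\<bar>) * (D ^ length ?es'' * C)"
      by (simp add: sum_distrib_right)
    also have "\<dots> \<le> (D ^ length ?es' * real (sz G)) * (D ^ length ?es'' * D)"
      using less.hyps[OF card tree'] C_pos by (intro mult_mono) auto
    also have "\<dots> = D ^ length es * real (sz G)"
      by (simp add: len power_add)
    finally show ?thesis .
  qed
qed

end

section \<open>Products of local observables expand into tree sums\<close>

definition kern :: "wgraph \<Rightarrow> (nat \<Rightarrow> real) \<Rightarrow> nat set \<Rightarrow> (nat \<times> nat) list \<Rightarrow>
    (nat \<Rightarrow> real \<Rightarrow> real \<Rightarrow> real) \<Rightarrow> (nat \<Rightarrow> nat) \<Rightarrow> real" where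
  "kern G x V es \<psi> f = eprod G es f * (\<Prod>v\<in>V. \<psi> v (vw G (f v)) (x (f v)))"

abbreviation cont2 :: "(real \<Rightarrow> real \<Rightarrow> real) \<Rightarrow> bool" where
  "cont2 \<psi> \<equiv> continuous_on UNIV (\<lambda>p. \<psi> (fst p) (snd p))"

definition tsum :: "nat set \<Rightarrow> (nat \<times> nat) list \<Rightarrow> (nat \<Rightarrow> real \<Rightarrow> real \<Rightarrow> real) \<Rightarrow>
    wgraph \<Rightarrow> (nat \<Rightarrow> real) \<Rightarrow> real" where
  "tsum V es \<psi> G x = (\<Sum>f\<in>V \<rightarrow>\<^sub>E {..<sz G}. kern G x V es \<psi> f) / real (sz G)"

text \<open>Local observables of a spin configuration \<open>x\<close>: the combinations of tree sums with continuous vertex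
functions.\<close>

inductive lspan :: "(wgraph \<Rightarrow> (nat \<Rightarrow> real) \<Rightarrow> real) \<Rightarrow> bool" where
  base: "rooted_tree V es \<Longrightarrow> (\<And>v. cont2 (\<psi> v)) \<Longrightarrow> lspan (tsum V es \<psi>)"
| add: "lspan F \<Longrightarrow> lspan F' \<Longrightarrow> lspan (\<lambda>G x. F G x + F' G x)"
| scale: "lspan F \<Longrightarrow> lspan (\<lambda>G x. c * F G x)"

lemma lspan_zero: "lspan (\<lambda>G x. 0)"
proof -
  have "rooted_tree {0} []" by (simp add: rooted_tree_def)
  from lspan.scale[OF lspan.base[OF this, of "\<lambda>_ _ _. 0"], of 0] show ?thesis by simp
qed

text \<open>\<open>V'\<close> arises from \<open>V\<close> by attaching vertices, each to a smaller one.\<close>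

definition tree_extension :: "nat set \<Rightarrow> nat set \<Rightarrow> (nat \<times> nat) list \<Rightarrow> bool" where
  "tree_extension V V' es \<longleftrightarrow> finite V' \<and> V \<subseteq> V' \<and> set es \<subseteq> V' \<times> V' \<and>
     (\<forall>v\<in>V'-V. \<exists>u\<in>V'. u < v \<and> ((u, v) \<in> set es \<or> (v, u) \<in> set es))"

lemma tree_extension_trans:
  assumes "tree_extension V V' es" "tree_extension V' V'' es'"
  shows "tree_extension V V'' (es @ es')"
  unfolding tree_extension_def
proof (intro conjI ballI)
  have 1: "V \<subseteq> V'" "set es \<subseteq> V' \<times> V'" using assms(1) unfolding tree_extension_def by blast+
  have 2: "finite V''" "V' \<subseteq> V''" "set es' \<subseteq> V'' \<times> V''"
    using assms(2) unfolding tree_extension_def by blast+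
  show "finite V''" by (rule 2)
  show "V \<subseteq> V''" using 1(1) 2(2) by (rule subset_trans)
  have "V' \<times> V' \<subseteq> V'' \<times> V''" using 2(2) by (intro Sigma_mono)
  then have "set es \<subseteq> V'' \<times> V''" using 1(2) by (intro subset_trans[OF 1(2)])
  then show "set (es @ es') \<subseteq> V'' \<times> V''" using 2(3) by simp
  fix v assume v: "v \<in> V'' - V"
  show "\<exists>u\<in>V''. u < v \<and> ((u, v) \<in> set (es @ es') \<or> (v, u) \<in> set (es @ es'))"
  proof (cases "v \<in> V'")
    case True
    then obtain u where "u \<in> V'" "u < v" "(u, v) \<in> set es \<or> (v, u) \<in> set es"
      using assms(1) v unfolding tree_extension_def by blast
    moreover have "V' \<subseteq> V''" using assms(2) unfolding tree_extension_def by blast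
    ultimately show ?thesis by (intro bexI[of _ u]) auto
  next
    case False
    then obtain u where "u \<in> V''" "u < v" "(u, v) \<in> set es' \<or> (v, u) \<in> set es'"
      using assms(2) v unfolding tree_extension_def by blast
    then show ?thesis by (intro bexI[of _ u]) auto
  qed
qed

lemma rooted_tree_iff_extension: "rooted_tree V es \<longleftrightarrow> 0 \<in> V \<and> tree_extension {0} V es"
  unfolding rooted_tree_def tree_extension_def by blast

lemma rooted_tree_extend:
  assumes "rooted_tree V es" "tree_extension V V' es'"
  shows "rooted_tree V' (es @ es')"
proof -
  have "V \<subseteq> V'" using assms(2) unfolding tree_extension_def by blast
  then show ?thesis
    using assms tree_extension_trans unfolding rooted_tree_iff_extension by blast
qed

text \<open>Linear functionals of \<open>\<Theta>\<close>, a function of the labels on \<open>V\<close>, which sum \<open>\<Theta>\<close> against a tree attached to \<open>V\<close>. The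
placeholder \<open>\<Theta>\<close> stands for everything else that a sum over labels contains, which lets expansions
be substituted into each other.\<close>

inductive espan :: "nat set \<Rightarrow> (wgraph \<Rightarrow> (nat \<Rightarrow> real) \<Rightarrow> ((nat \<Rightarrow> nat) \<Rightarrow> real) \<Rightarrow> real) \<Rightarrow> bool"
  for V where
  base: "tree_extension V V' es \<Longrightarrow> (\<And>v. cont2 (\<psi> v)) \<Longrightarrow>
    espan V (\<lambda>G x \<Theta>. \<Sum>f\<in>V' \<rightarrow>\<^sub>E {..<sz G}. \<Theta> f * kern G x V' es \<psi> f)"
| add: "espan V E \<Longrightarrow> espan V E' \<Longrightarrow> espan V (\<lambda>G x \<Theta>. E G x \<Theta> + E' G x \<Theta>)"
| scale: "espan V E \<Longrightarrow> espan V (\<lambda>G x \<Theta>. c * E G x \<Theta>)"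

lemma kern_mult:
  assumes "finite V'" "V \<subseteq> V'"
  shows "kern G x V es \<psi> f * kern G x V' es' \<psi>' f
    = kern G x V' (es @ es') (\<lambda>v s t. (if v \<in> V then \<psi> v s t else 1) * \<psi>' v s t) f"
proof -
  have "(\<Prod>v\<in>V'. if v \<in> V then \<psi> v (vw G (f v)) (x (f v)) else 1)
      = (\<Prod>v\<in>V. \<psi> v (vw G (f v)) (x (f v)))"
    using assms by (subst prod.inter_restrict[symmetric]) (auto simp: Int_absorb1)
  then show ?thesis by (simp add: kern_def prod.distrib)
qed

lemma cont2_mult: "cont2 \<psi> \<Longrightarrow> cont2 \<psi>' \<Longrightarrow> cont2 (\<lambda>s t. \<psi> s t * \<psi>' s t)"
  by (intro continuous_intros)

lemma cont2_if1: "(v \<in> V \<Longrightarrow> cont2 (\<psi> v)) \<Longrightarrow> cont2 (\<lambda>s t. if v \<in> V then \<psi> v s t else 1)"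
  by (cases "v \<in> V") auto

lemma espan_comp:
  assumes "espan V' E" "tree_extension V V' es" "\<And>v. cont2 (\<psi> v)"
  shows "espan V (\<lambda>G x \<Theta>. E G x (\<lambda>f. \<Theta> f * kern G x V' es \<psi> f))"
  using assms(1)
proof induction
  case (base V'' es' \<psi>')
  have sub: "finite V''" "V' \<subseteq> V''" using base(1) unfolding tree_extension_def by blast+
  let ?\<psi> = "\<lambda>v s t. (if v \<in> V' then \<psi> v s t else 1) * \<psi>' v s t"
  have "espan V (\<lambda>G x \<Theta>. \<Sum>f\<in>V'' \<rightarrow>\<^sub>E {..<sz G}. \<Theta> f * kern G x V'' (es @ es') ?\<psi> f)"
  proof (rule espan.base[OF tree_extension_trans[OF assms(2) base(1)]])
    show "cont2 (?\<psi> v)" for v by (rule cont2_mult[OF cont2_if1[OF assms(3)] base(2)])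
  qed
  then show ?case by (simp only: mult.assoc kern_mult[OF sub])
next
  case (add E E')
  from espan.add[OF add.IH] show ?case .
next
  case (scale E c)
  from espan.scale[OF scale.IH] show ?case .
qed

definition depends_on :: "nat set \<Rightarrow> ((nat \<Rightarrow> nat) \<Rightarrow> real) \<Rightarrow> bool" where
  "depends_on V \<Theta> \<longleftrightarrow> (\<forall>f f'. (\<forall>v\<in>V. f v = f' v) \<longrightarrow> \<Theta> f = \<Theta> f')"

lemma depends_on_mono: "depends_on V \<Theta> \<Longrightarrow> V \<subseteq> V' \<Longrightarrow> depends_on V' \<Theta>"
  unfolding depends_on_def by (meson subsetD)

lemma depends_on_mult: "depends_on V \<Theta> \<Longrightarrow> depends_on V \<Theta>' \<Longrightarrow> depends_on V (\<lambda>f. \<Theta> f * \<Theta>' f)"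
  unfolding depends_on_def by metis

lemma depends_on_eval: "v \<in> V \<Longrightarrow> depends_on V (\<lambda>f. u (f v))"
  unfolding depends_on_def by metis

lemma depends_on_kern:
  assumes es: "set es \<subseteq> V \<times> V"
  shows "depends_on V (kern G x V es \<psi>)"
  unfolding depends_on_def
proof (intro allI impI)
  fix f f' :: "nat \<Rightarrow> nat" assume f: "\<forall>v\<in>V. f v = f' v"
  have "eprod G es f = eprod G es f'" using es f by (intro eprod_cong) auto
  moreover have "(\<Prod>v\<in>V. \<psi> v (vw G (f v)) (x (f v))) = (\<Prod>v\<in>V. \<psi> v (vw G (f' v)) (x (f' v)))"
    using f by (intro prod.cong) auto
  ultimately show "kern G x V es \<psi> f = kern G x V es \<psi> f'" by (simp only: kern_def)
qed

context bounded_graphs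
begin

text \<open>A kernel on the labels of \<open>V\<close> is expandable if it can be replaced by trees attached to \<open>V\<close> under every sum.\<close>

definition expandable :: "nat set \<Rightarrow> (wgraph \<Rightarrow> (nat \<Rightarrow> real) \<Rightarrow> (nat \<Rightarrow> nat) \<Rightarrow> real) \<Rightarrow> bool" where
  "expandable V K \<longleftrightarrow> (\<exists>E. espan V E \<and> (\<forall>G x \<Theta>. G \<in> GG \<longrightarrow> depends_on V \<Theta> \<longrightarrow>
      (\<Sum>f\<in>V \<rightarrow>\<^sub>E {..<sz G}. \<Theta> f * K G x f) = E G x \<Theta>))"

text \<open>An observable attached to one site, expandable wherever the site occurs.\<close>

definition site_expandable :: "(wgraph \<Rightarrow> (nat \<Rightarrow> real) \<Rightarrow> nat \<Rightarrow> real) \<Rightarrow> bool" where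
  "site_expandable u \<longleftrightarrow> (\<forall>V v. finite V \<longrightarrow> v \<in> V \<longrightarrow> expandable V (\<lambda>G x f. u G x (f v)))"

lemma expandableI:
  assumes "espan V E" "\<And>G x \<Theta>. G \<in> GG \<Longrightarrow> depends_on V \<Theta> \<Longrightarrow>
    (\<Sum>f\<in>V \<rightarrow>\<^sub>E {..<sz G}. \<Theta> f * K G x f) = E G x \<Theta>"
  shows "expandable V K"
  unfolding expandable_def using assms by blast

lemma expandableE:
  assumes "expandable V K"
  obtains E where "espan V E" "\<And>G x \<Theta>. G \<in> GG \<Longrightarrow> depends_on V \<Theta> \<Longrightarrow>
    (\<Sum>f\<in>V \<rightarrow>\<^sub>E {..<sz G}. \<Theta> f * K G x f) = E G x \<Theta>"
  using assms unfolding expandable_def by blast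

lemma site_expandableI: "(\<And>V v. finite V \<Longrightarrow> v \<in> V \<Longrightarrow> expandable V (\<lambda>G x f. u G x (f v))) \<Longrightarrow> site_expandable u"
  unfolding site_expandable_def by blast

lemma site_expandableD: "site_expandable u \<Longrightarrow> finite V \<Longrightarrow> v \<in> V \<Longrightarrow> expandable V (\<lambda>G x f. u G x (f v))"
  unfolding site_expandable_def by blast

lemma site_expandable_local:
  assumes "cont2 \<psi>"
  shows "site_expandable (\<lambda>G x i. \<psi> (vw G i) (x i))"
proof (rule site_expandableI)
  fix V :: "nat set" and v assume V: "finite V" "v \<in> V"
  let ?\<psi> = "\<lambda>w s t. if w \<in> {v} then \<psi> s t else 1"
  have k: "\<psi> (vw G (f v)) (x (f v)) = kern G x V [] ?\<psi> f" for G x f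
  proof -
    have "(\<Prod>w\<in>V. ?\<psi> w (vw G (f w)) (x (f w))) = (\<Prod>w\<in>V. if w = v then \<psi> (vw G (f w)) (x (f w)) else 1)"
      by (intro prod.cong) auto
    then show ?thesis using V by (simp add: kern_def)
  qed
  have "espan V (\<lambda>G x \<Theta>. \<Sum>f\<in>V \<rightarrow>\<^sub>E {..<sz G}. \<Theta> f * kern G x V [] ?\<psi> f)"
  proof (rule espan.base)
    show "tree_extension V V []" using V by (simp add: tree_extension_def)
    show "cont2 (?\<psi> w)" for w by (intro cont2_if1 assms)
  qed
  then show "expandable V (\<lambda>G x f. \<psi> (vw G (f v)) (x (f v)))"
    by (rule expandableI) (simp only: k)
qed

lemma site_expandable_add:
  assumes "site_expandable u" "site_expandable u'"
  shows "site_expandable (\<lambda>G x i. u G x i + u' G x i)"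
proof (rule site_expandableI)
  fix V :: "nat set" and v assume V: "finite V" "v \<in> V"
  from site_expandableD[OF assms(1) V] obtain E where E: "espan V E"
    "\<And>G x \<Theta>. G \<in> GG \<Longrightarrow> depends_on V \<Theta> \<Longrightarrow> (\<Sum>f\<in>V \<rightarrow>\<^sub>E {..<sz G}. \<Theta> f * u G x (f v)) = E G x \<Theta>"
    by (rule expandableE) (rule that)
  from site_expandableD[OF assms(2) V] obtain E' where E': "espan V E'"
    "\<And>G x \<Theta>. G \<in> GG \<Longrightarrow> depends_on V \<Theta> \<Longrightarrow> (\<Sum>f\<in>V \<rightarrow>\<^sub>E {..<sz G}. \<Theta> f * u' G x (f v)) = E' G x \<Theta>"
    by (rule expandableE) (rule that)
  show "expandable V (\<lambda>G x f. u G x (f v) + u' G x (f v))"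
  proof (rule expandableI[OF espan.add[OF E(1) E'(1)]])
    fix G x \<Theta> assume "G \<in> GG" "depends_on V \<Theta>"
    from E(2)[OF this] E'(2)[OF this]
    show "(\<Sum>f\<in>V \<rightarrow>\<^sub>E {..<sz G}. \<Theta> f * (u G x (f v) + u' G x (f v))) = E G x \<Theta> + E' G x \<Theta>"
      by (simp only: distrib_left sum.distrib)
  qed
qed

lemma site_expandable_scale:
  assumes "site_expandable u"
  shows "site_expandable (\<lambda>G x i. c * u G x i)"
proof (rule site_expandableI)
  fix V :: "nat set" and v assume V: "finite V" "v \<in> V"
  from site_expandableD[OF assms(1) V] obtain E where E: "espan V E"
    "\<And>G x \<Theta>. G \<in> GG \<Longrightarrow> depends_on V \<Theta> \<Longrightarrow> (\<Sum>f\<in>V \<rightarrow>\<^sub>E {..<sz G}. \<Theta> f * u G x (f v)) = E G x \<Theta>"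
    by (rule expandableE) (rule that)
  show "expandable V (\<lambda>G x f. c * u G x (f v))"
  proof (rule expandableI[OF espan.scale[OF E(1)]])
    fix G x \<Theta> assume that: "G \<in> GG" "depends_on V \<Theta>"
    show "(\<Sum>f\<in>V \<rightarrow>\<^sub>E {..<sz G}. \<Theta> f * (c * u G x (f v))) = c * E G x \<Theta>"
      unfolding E(2)[OF that, symmetric] sum_distrib_left by (intro sum.cong refl) (simp only: mult_ac)
  qed
qed

definition absorbs :: "nat set \<Rightarrow> (wgraph \<Rightarrow> (nat \<Rightarrow> real) \<Rightarrow> nat \<Rightarrow> real) \<Rightarrow> nat \<Rightarrow>
    (wgraph \<Rightarrow> (nat \<Rightarrow> real) \<Rightarrow> ((nat \<Rightarrow> nat) \<Rightarrow> real) \<Rightarrow> real) \<Rightarrow> bool" where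
  "absorbs V u v E \<longleftrightarrow> (\<exists>E'. espan V E' \<and> (\<forall>G x \<Theta>. G \<in> GG \<longrightarrow> depends_on V \<Theta> \<longrightarrow>
     E G x (\<lambda>f. \<Theta> f * u G x (f v)) = E' G x \<Theta>))"

lemma absorbsI:
  assumes "espan V E'" "\<And>G x \<Theta>. G \<in> GG \<Longrightarrow> depends_on V \<Theta> \<Longrightarrow> E G x (\<lambda>f. \<Theta> f * u G x (f v)) = E' G x \<Theta>"
  shows "absorbs V u v E"
  unfolding absorbs_def using assms by blast

lemma absorbsE:
  assumes "absorbs V u v E"
  obtains E' where "espan V E'"
    "\<And>G x \<Theta>. G \<in> GG \<Longrightarrow> depends_on V \<Theta> \<Longrightarrow> E G x (\<lambda>f. \<Theta> f * u G x (f v)) = E' G x \<Theta>"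
  using assms unfolding absorbs_def by blast

text \<open>The trees that expand \<open>u\<close> are attached to the larger vertex set on which \<open>E\<close> already lives.\<close>

lemma espan_absorbs:
  assumes "espan V E" and u: "site_expandable u" and v: "v \<in> V"
  shows "absorbs V u v E"
  using assms(1)
proof induction
  case (base V' es \<psi>)
  have V': "finite V'" "v \<in> V'" "V \<subseteq> V'" "set es \<subseteq> V' \<times> V'"
    using base(1) v by (auto simp: tree_extension_def)
  from site_expandableD[OF u V'(1,2)] obtain E where E: "espan V' E"
    "\<And>G x \<Theta>. G \<in> GG \<Longrightarrow> depends_on V' \<Theta> \<Longrightarrow> (\<Sum>f\<in>V' \<rightarrow>\<^sub>E {..<sz G}. \<Theta> f * u G x (f v)) = E G x \<Theta>"
    by (rule expandableE) (rule that)
  show ?case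
  proof (rule absorbsI[OF espan_comp[OF E(1) base(1,2)]])
    fix G x \<Theta> assume G: "G \<in> GG" and d: "depends_on V \<Theta>"
    have "(\<Sum>f\<in>V' \<rightarrow>\<^sub>E {..<sz G}. \<Theta> f * u G x (f v) * kern G x V' es \<psi> f)
        = (\<Sum>f\<in>V' \<rightarrow>\<^sub>E {..<sz G}. (\<Theta> f * kern G x V' es \<psi> f) * u G x (f v))"
      by (simp only: mult_ac)
    also have "\<dots> = E G x (\<lambda>f. \<Theta> f * kern G x V' es \<psi> f)"
      by (intro E(2)[OF G] depends_on_mult depends_on_mono[OF d V'(3)] depends_on_kern V'(4))
    finally show "(\<Sum>f\<in>V' \<rightarrow>\<^sub>E {..<sz G}. \<Theta> f * u G x (f v) * kern G x V' es \<psi> f)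
        = E G x (\<lambda>f. \<Theta> f * kern G x V' es \<psi> f)" .
  qed
next
  case (add E1 E2)
  from add.IH(1) obtain E1' where 1: "espan V E1'"
    "\<And>G x \<Theta>. G \<in> GG \<Longrightarrow> depends_on V \<Theta> \<Longrightarrow> E1 G x (\<lambda>f. \<Theta> f * u G x (f v)) = E1' G x \<Theta>"
    by (rule absorbsE) (rule that)
  from add.IH(2) obtain E2' where 2: "espan V E2'"
    "\<And>G x \<Theta>. G \<in> GG \<Longrightarrow> depends_on V \<Theta> \<Longrightarrow> E2 G x (\<lambda>f. \<Theta> f * u G x (f v)) = E2' G x \<Theta>"
    by (rule absorbsE) (rule that)
  show ?case by (rule absorbsI[OF espan.add[OF 1(1) 2(1)]]) (simp only: 1(2) 2(2))
next
  case (scale E c)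
  from scale.IH obtain E' where 1: "espan V E'"
    "\<And>G x \<Theta>. G \<in> GG \<Longrightarrow> depends_on V \<Theta> \<Longrightarrow> E G x (\<lambda>f. \<Theta> f * u G x (f v)) = E' G x \<Theta>"
    by (rule absorbsE) (rule that)
  show ?case by (rule absorbsI[OF espan.scale[OF 1(1)]]) (simp only: 1(2))
qed

lemma expandable_mult:
  assumes K: "expandable V K" and u: "site_expandable u" and v: "v \<in> V"
  shows "expandable V (\<lambda>G x f. u G x (f v) * K G x f)"
proof -
  from K obtain E where E: "espan V E"
    "\<And>G x \<Theta>. G \<in> GG \<Longrightarrow> depends_on V \<Theta> \<Longrightarrow> (\<Sum>f\<in>V \<rightarrow>\<^sub>E {..<sz G}. \<Theta> f * K G x f) = E G x \<Theta>"
    by (rule expandableE) (rule that)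
  from espan_absorbs[OF E(1) u v] obtain E' where E': "espan V E'"
    "\<And>G x \<Theta>. G \<in> GG \<Longrightarrow> depends_on V \<Theta> \<Longrightarrow> E G x (\<lambda>f. \<Theta> f * u G x (f v)) = E' G x \<Theta>"
    by (rule absorbsE) (rule that)
  show ?thesis
  proof (rule expandableI[OF E'(1)])
    fix G x \<Theta> assume G: "G \<in> GG" and d: "depends_on V \<Theta>"
    have "(\<Sum>f\<in>V \<rightarrow>\<^sub>E {..<sz G}. (\<Theta> f * u G x (f v)) * K G x f) = E G x (\<lambda>f. \<Theta> f * u G x (f v))"
      by (rule E(2)[OF G depends_on_mult[OF d depends_on_eval[OF v]]])
    also have "\<dots> = E' G x \<Theta>" by (rule E'(2)[OF G d])
    finally show "(\<Sum>f\<in>V \<rightarrow>\<^sub>E {..<sz G}. \<Theta> f * (u G x (f v) * K G x f)) = E' G x \<Theta>"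
      by (simp only: mult.assoc)
  qed
qed

lemma site_expandable_mult:
  assumes "site_expandable u" "site_expandable u'"
  shows "site_expandable (\<lambda>G x i. u G x i * u' G x i)"
proof (rule site_expandableI)
  fix V :: "nat set" and v assume V: "finite V" "v \<in> V"
  show "expandable V (\<lambda>G x f. u G x (f v) * u' G x (f v))"
    by (rule expandable_mult[OF site_expandableD[OF assms(2) V] assms(1) V(2)])
qed

text \<open>Summation over neighbours attaches one new leaf; a label larger than all present ones makes its
neighbour the parent.\<close>

lemma site_expandable_neighbour_sum:
  assumes "site_expandable u"
  shows "site_expandable (\<lambda>G x i. \<Sum>j<sz G. ew G i j * u G x j)"
proof (rule site_expandableI)
  fix V :: "nat set" and v assume V: "finite V" "v \<in> V"
  define m where "m = Suc (Max V)"
  have le: "w < m" if "w \<in> V" for w using V(1) that by (simp add: m_def less_Suc_eq_le)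
  then have m: "m \<notin> V" "v < m" using V by auto
  let ?V = "insert m V"
  have V': "finite ?V" "m \<in> ?V" using V by auto
  from site_expandableD[OF assms V'] obtain E where E: "espan ?V E"
    "\<And>G x \<Theta>. G \<in> GG \<Longrightarrow> depends_on ?V \<Theta> \<Longrightarrow> (\<Sum>f\<in>?V \<rightarrow>\<^sub>E {..<sz G}. \<Theta> f * u G x (f m)) = E G x \<Theta>"
    by (rule expandableE) (rule that)
  have ext: "tree_extension V ?V [(v, m)]" using V m by (auto simp: tree_extension_def)
  let ?\<psi> = "\<lambda>_ _ _. 1 :: real"
  have k: "kern G x ?V [(v, m)] ?\<psi> f = ew G (f v) (f m)" for G x f by (simp add: kern_def)
  have cont: "cont2 (?\<psi> w)" for w :: nat by simp
  show "expandable V (\<lambda>G x f. \<Sum>j<sz G. ew G (f v) j * u G x j)"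
  proof (rule expandableI[OF espan_comp[OF E(1) ext cont]])
    fix G x \<Theta> assume G: "G \<in> GG" and d: "depends_on V \<Theta>"
    have "(\<Sum>f\<in>V \<rightarrow>\<^sub>E {..<sz G}. \<Theta> f * (\<Sum>j<sz G. ew G (f v) j * u G x j))
        = (\<Sum>f\<in>V \<rightarrow>\<^sub>E {..<sz G}. \<Sum>j<sz G. (\<lambda>f. \<Theta> f * ew G (f v) (f m) * u G x (f m)) (f(m := j)))"
    proof (intro sum.cong refl)
      fix f assume "f \<in> V \<rightarrow>\<^sub>E {..<sz G}"
      have "\<Theta> (f(m := j)) = \<Theta> f" for j
        using d m(1) unfolding depends_on_def by (metis fun_upd_other)
      then show "\<Theta> f * (\<Sum>j<sz G. ew G (f v) j * u G x j)
         = (\<Sum>j<sz G. (\<lambda>f. \<Theta> f * ew G (f v) (f m) * u G x (f m)) (f(m := j)))"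
        using m by (simp add: sum_distrib_left mult.assoc)
    qed
    also have "\<dots> = (\<Sum>f\<in>?V \<rightarrow>\<^sub>E {..<sz G}. \<Theta> f * ew G (f v) (f m) * u G x (f m))"
      by (rule sum_PiE_insert[OF m(1), symmetric])
    also have "\<dots> = (\<Sum>f\<in>?V \<rightarrow>\<^sub>E {..<sz G}. \<Theta> f * kern G x ?V [(v, m)] ?\<psi> f * u G x (f m))"
      by (simp only: k)
    also have "\<dots> = E G x (\<lambda>f. \<Theta> f * kern G x ?V [(v, m)] ?\<psi> f)"
    proof (rule E(2)[OF G depends_on_mult[OF depends_on_mono[OF d] depends_on_kern]])
      show "V \<subseteq> ?V" "set [(v, m)] \<subseteq> ?V \<times> ?V" using V by auto
    qed
    finally show "(\<Sum>f\<in>V \<rightarrow>\<^sub>E {..<sz G}. \<Theta> f * (\<Sum>j<sz G. ew G (f v) j * u G x j))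
        = E G x (\<lambda>f. \<Theta> f * kern G x ?V [(v, m)] ?\<psi> f)" .
  qed
qed

lemma site_expandable_op_poly: "site_expandable (\<lambda>G x i. op_poly (sz G) (ew G) p x i)"
proof (induction p)
  case Nil
  show ?case using site_expandable_local[of "\<lambda>_ _. 0"] by simp
next
  case (Cons c p)
  have "site_expandable (\<lambda>G x i. x i)"
    using site_expandable_local[of "\<lambda>s t. t"] by (simp add: continuous_on_snd)
  from site_expandable_add[OF site_expandable_scale[OF this, of c] site_expandable_neighbour_sum[OF Cons]]
  show ?case by (simp add: mv_def)
qed

text \<open>Products over distinct vertices, one factor at a time.\<close>

lemma expandable_prod:
  assumes "finite U" "\<And>v. v \<in> U \<Longrightarrow> site_expandable (g v)"
  shows "finite V \<Longrightarrow> U \<subseteq> V \<Longrightarrow> expandable V (\<lambda>G x f. \<Prod>v\<in>U. g v G x (f v))"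
  using assms
proof (induction U)
  case empty
  have "espan V (\<lambda>G x \<Theta>. \<Sum>f\<in>V \<rightarrow>\<^sub>E {..<sz G}. \<Theta> f * kern G x V [] (\<lambda>_ _ _. 1) f)"
    using empty by (intro espan.base) (auto simp: tree_extension_def)
  then show ?case by (rule expandableI) (simp add: kern_def)
next
  case (insert w U)
  have "expandable V (\<lambda>G x f. g w G x (f w) * (\<Prod>v\<in>U. g v G x (f v)))"
  proof (rule expandable_mult)
    show "expandable V (\<lambda>G x f. \<Prod>v\<in>U. g v G x (f v))" using insert by auto
    show "site_expandable (g w)" "w \<in> V" using insert by auto
  qed
  then show ?case using insert.hyps by simp
qed

lemma espan_lspan:
  assumes "espan V E" and tree: "rooted_tree V es"
  shows "\<exists>F. lspan F \<and> (\<forall>G x. E G x (\<lambda>f. eprod G es f) / real (sz G) = F G x)"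
  using assms(1)
proof induction
  case (base V' es' \<psi>)
  have "(\<Sum>f\<in>V' \<rightarrow>\<^sub>E {..<sz G}. eprod G es f * kern G x V' es' \<psi> f) / real (sz G)
      = tsum V' (es @ es') \<psi> G x" for G x
    by (simp add: tsum_def kern_def mult.assoc)
  then show ?case
    using lspan.base[OF rooted_tree_extend[OF tree base(1)], of \<psi>] base(2) by blast
next
  case (add E E')
  then obtain F F' where "lspan F" "\<And>G x. E G x (\<lambda>f. eprod G es f) / real (sz G) = F G x"
    "lspan F'" "\<And>G x. E' G x (\<lambda>f. eprod G es f) / real (sz G) = F' G x" by (elim exE conjE) simp
  then show ?case
    by (intro exI[of _ "\<lambda>G x. F G x + F' G x"]) (simp add: lspan.add add_divide_distrib)
next
  case (scale E c)
  then obtain F where "lspan F" "\<And>G x. E G x (\<lambda>f. eprod G es f) / real (sz G) = F G x"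
    by (elim exE conjE) simp
  then show ?case
    by (intro exI[of _ "\<lambda>G x. c * F G x"]) (simp add: lspan.scale flip: times_divide_eq_right)
qed

text \<open>A tree sum whose vertex functions may depend on the whole configuration.\<close>

definition gsum :: "nat set \<Rightarrow> (nat \<times> nat) list \<Rightarrow> (nat \<Rightarrow> wgraph \<Rightarrow> (nat \<Rightarrow> real) \<Rightarrow> nat \<Rightarrow> real) \<Rightarrow>
    wgraph \<Rightarrow> (nat \<Rightarrow> real) \<Rightarrow> real" where
  "gsum V es g G x = (\<Sum>f\<in>V \<rightarrow>\<^sub>E {..<sz G}. eprod G es f * (\<Prod>v\<in>V. g v G x (f v))) / real (sz G)"

lemma gsum_expandable:
  assumes tree: "rooted_tree V es" and g: "\<And>v. v \<in> V \<Longrightarrow> site_expandable (g v)"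
  obtains F where "lspan F" "\<And>G x. G \<in> GG \<Longrightarrow> gsum V es g G x = F G x"
proof -
  have V: "finite V" "set es \<subseteq> V \<times> V" using tree by (simp_all add: rooted_tree_def)
  have "expandable V (\<lambda>G x f. \<Prod>v\<in>V. g v G x (f v))"
    using expandable_prod[where g = g and U = V and V = V] V(1) g by simp
  then obtain E where E: "espan V E" "\<And>G x \<Theta>. G \<in> GG \<Longrightarrow> depends_on V \<Theta> \<Longrightarrow>
     (\<Sum>f\<in>V \<rightarrow>\<^sub>E {..<sz G}. \<Theta> f * (\<Prod>v\<in>V. g v G x (f v))) = E G x \<Theta>" by (rule expandableE) (rule that)
  have dep: "depends_on V (\<lambda>f. eprod G es f)" for G
    unfolding depends_on_def
  proof (intro allI impI)
    fix f f' :: "nat \<Rightarrow> nat" assume "\<forall>v\<in>V. f v = f' v"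
    then show "eprod G es f = eprod G es f'" using V(2) by (intro eprod_cong) auto
  qed
  have eq: "gsum V es g G x = E G x (\<lambda>f. eprod G es f) / real (sz G)" if "G \<in> GG" for G x
  proof -
    have "(\<Sum>f\<in>V \<rightarrow>\<^sub>E {..<sz G}. eprod G es f * (\<Prod>v\<in>V. g v G x (f v))) = E G x (\<lambda>f. eprod G es f)"
      by (rule E(2)[OF that dep])
    then show ?thesis by (simp only: gsum_def)
  qed
  from espan_lspan[OF E(1) tree] obtain F
    where F: "lspan F" "\<forall>G x. E G x (\<lambda>f. eprod G es f) / real (sz G) = F G x" by (elim exE conjE)
  show thesis
  proof (rule that[OF F(1)])
    fix G x assume "G \<in> GG"
    then show "gsum V es g G x = F G x" using eq[of G x] F(2) by simp
  qed
qed

end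

section \<open>Observables approximated by tree sums\<close>

lemma solve_for_summand: "a = b + c \<Longrightarrow> b = a + (-1) * c" for a b c :: real
  by simp

lemma gibbs_sum: "gibbs N S \<rho> z (\<lambda>x. \<Sum>k\<in>K. F k x) = (\<Sum>k\<in>K. gibbs N S \<rho> z (F k))"
  unfolding gibbs_def sum_distrib_left by (rule sum.swap)

lemma gibbs_scale: "gibbs N S \<rho> z (\<lambda>x. c * F x) = c * gibbs N S \<rho> z F"
  unfolding gibbs_def sum_distrib_left by (simp only: mult_ac)

text \<open>Independence: a product of functions of distinct sites.\<close>

lemma gibbs_inj_prod:
  assumes S: "finite S" "S \<noteq> {}" and pos: "\<And>i x. i < N \<Longrightarrow> x \<in> S \<Longrightarrow> \<rho> i x > 0"
    and U: "finite U" and g: "inj_on g U" "g ` U \<subseteq> {..<N}"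
  shows "gibbs N S \<rho> z (\<lambda>x. \<Prod>u\<in>U. \<phi> u (x (g u)))
    = (\<Prod>u\<in>U. \<Sum>a\<in>S. tilt S (\<rho> (g u)) (z (g u)) a * \<phi> u a)"
proof -
  define \<phi>' where "\<phi>' i a = (if i \<in> g ` U then \<phi> (inv_into U g i) a else 1)" for i a
  have inv: "\<phi>' (g u) a = \<phi> u a" if "u \<in> U" for u a
    using that g(1) by (simp add: \<phi>'_def inv_into_f_f)
  have split: "(\<Prod>i<N. c i) = (\<Prod>u\<in>U. c (g u))" if "\<And>i. i < N \<Longrightarrow> i \<notin> g ` U \<Longrightarrow> c i = 1" for c :: "nat \<Rightarrow> real"
  proof -
    have "(\<Prod>u\<in>U. c (g u)) = prod c (g ` U)" by (simp add: prod.reindex[OF g(1)])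
    also have "\<dots> = (\<Prod>i<N. c i)" using that g(2) by (intro prod.mono_neutral_left) auto
    finally show ?thesis by simp
  qed
  have e: "(\<Prod>u\<in>U. \<phi> u (x (g u))) = (\<Prod>i<N. \<phi>' i (x i))" for x
  proof -
    have "(\<Prod>i<N. \<phi>' i (x i)) = (\<Prod>u\<in>U. \<phi>' (g u) (x (g u)))"
      by (rule split) (simp add: \<phi>'_def)
    also have "\<dots> = (\<Prod>u\<in>U. \<phi> u (x (g u)))" by (intro prod.cong refl) (simp add: inv)
    finally show ?thesis by simp
  qed
  have "gibbs N S \<rho> z (\<lambda>x. \<Prod>u\<in>U. \<phi> u (x (g u)))
      = (\<Sum>x\<in>{..<N} \<rightarrow>\<^sub>E S. \<Prod>i<N. tilt S (\<rho> i) (z i) (x i) * \<phi>' i (x i))"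
    by (simp only: gibbs_def e prod.distrib)
  also have "\<dots> = (\<Prod>i<N. \<Sum>a\<in>S. tilt S (\<rho> i) (z i) a * \<phi>' i a)"
    using S by (intro prod_sum_PiE[symmetric]) auto
  also have "\<dots> = (\<Prod>u\<in>U. \<Sum>a\<in>S. tilt S (\<rho> (g u)) (z (g u)) a * \<phi>' (g u) a)"
    by (rule split) (simp add: \<phi>'_def tilt_sum(1)[OF S pos])
  also have "\<dots> = (\<Prod>u\<in>U. \<Sum>a\<in>S. tilt S (\<rho> (g u)) (z (g u)) a * \<phi> u a)"
    by (intro prod.cong refl) (simp add: inv)
  finally show ?thesis .
qed

lemma cont2_tilt:
  assumes S: "finite S" "S \<noteq> {}" and pos: "\<And>h x. x \<in> S \<Longrightarrow> r h x > 0"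
    and cont: "\<And>x. x \<in> S \<Longrightarrow> continuous_on UNIV (\<lambda>h. r h x)"
    and \<phi>: "\<And>a. a \<in> S \<Longrightarrow> continuous_on UNIV (\<lambda>h. \<phi> h a)"
  shows "cont2 (\<lambda>h z. \<Sum>a\<in>S. tilt S (r h) z a * \<phi> h a)"
proof -
  have r: "continuous_on UNIV (\<lambda>p :: real \<times> real. r (fst p) x)" if "x \<in> S" for x
    by (rule continuous_on_compose2[OF cont[OF that]]) (auto intro!: continuous_intros)
  have f: "continuous_on UNIV (\<lambda>p :: real \<times> real. \<phi> (fst p) x)" if "x \<in> S" for x
    by (rule continuous_on_compose2[OF \<phi>[OF that]]) (auto intro!: continuous_intros)
  have nz: "(\<Sum>y\<in>S. r h y * exp (z * y)) \<noteq> 0" for h z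
    using tilt_sum(3)[of S "r h" z] S pos by fastforce
  show ?thesis unfolding tilt_def by (intro continuous_intros r f nz ballI) auto
qed

lemma identity_retraction:
  assumes "finite V"
  shows "restrict id V \<in> retractions V"
    and "r \<in> retractions V \<Longrightarrow> r \<noteq> restrict id V \<Longrightarrow> card (r ` V) < card V"
proof -
  show "restrict id V \<in> retractions V" by (auto simp: retractions_def)
  assume r: "r \<in> retractions V" and ne: "r \<noteq> restrict id V"
  have sub: "r ` V \<subseteq> V" using r by (auto simp: retractions_def)
  have "r ` V \<noteq> V"
  proof
    assume eq: "r ` V = V"
    have "r v = restrict id V v" for v
    proof (cases "v \<in> V")
      case True
      then obtain w where "w \<in> V" "v = r w" using eq by auto
      then show ?thesis using r True by (simp add: retractions_def)
    next
      case False
      then show ?thesis using r by (simp add: retractions_def PiE_def extensional_def)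
    qed
    then show False using ne by auto
  qed
  then show "card (r ` V) < card V" using sub assms by (intro psubset_card_mono) auto
qed

lemma finite_retractions: "finite V \<Longrightarrow> finite (retractions V)"
  unfolding retractions_def by (intro finite_subset[OF _ finite_PiE[of V "\<lambda>_. V"]]) auto

context bounded_graphs
begin

definition lapprox :: "real set \<Rightarrow> (wgraph \<Rightarrow> (nat \<Rightarrow> real) \<Rightarrow> real) \<Rightarrow> bool" where
  "lapprox S F \<longleftrightarrow> (\<forall>e>0. \<exists>F'. lspan F' \<and>
     (\<forall>G\<in>GG. \<forall>x\<in>{..<sz G} \<rightarrow>\<^sub>E S. \<bar>F G x - F' G x\<bar> \<le> e))"

lemma lapproxI:
  assumes "\<And>e. e > 0 \<Longrightarrow> \<exists>F'. lspan F' \<and> (\<forall>G\<in>GG. \<forall>x\<in>{..<sz G} \<rightarrow>\<^sub>E S. \<bar>F G x - F' G x\<bar> \<le> e)"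
  shows "lapprox S F"
  unfolding lapprox_def using assms by blast

lemma lapproxE:
  assumes "lapprox S F" "e > 0"
  obtains F' where "lspan F'" "\<And>G x. G \<in> GG \<Longrightarrow> x \<in> {..<sz G} \<rightarrow>\<^sub>E S \<Longrightarrow> \<bar>F G x - F' G x\<bar> \<le> e"
proof -
  from assms obtain F' where "lspan F' \<and> (\<forall>G\<in>GG. \<forall>x\<in>{..<sz G} \<rightarrow>\<^sub>E S. \<bar>F G x - F' G x\<bar> \<le> e)"
    unfolding lapprox_def by blast
  then show thesis by (intro that[of F']) blast+
qed

lemma lapprox_lspan: "lspan F \<Longrightarrow> lapprox S F"
  by (rule lapproxI) (intro exI[of _ F] conjI, assumption, simp)

lemma lapprox_cong:
  assumes "lapprox S F" "\<And>G x. G \<in> GG \<Longrightarrow> x \<in> {..<sz G} \<rightarrow>\<^sub>E S \<Longrightarrow> F' G x = F G x"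
  shows "lapprox S F'"
proof (rule lapproxI)
  fix e :: real assume e: "e > 0"
  obtain H where H: "lspan H"
    "\<And>G x. G \<in> GG \<Longrightarrow> x \<in> {..<sz G} \<rightarrow>\<^sub>E S \<Longrightarrow> \<bar>F G x - H G x\<bar> \<le> e"
    by (rule lapproxE[OF assms(1) e]) (rule that)
  show "\<exists>H. lspan H \<and> (\<forall>G\<in>GG. \<forall>x\<in>{..<sz G} \<rightarrow>\<^sub>E S. \<bar>F' G x - H G x\<bar> \<le> e)"
  proof (intro exI conjI ballI)
    show "lspan H" by fact
    fix G x assume "G \<in> GG" "x \<in> {..<sz G} \<rightarrow>\<^sub>E S"
    then show "\<bar>F' G x - H G x\<bar> \<le> e" using H(2) assms(2) by simp
  qed
qed

lemma lapprox_limit: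
  assumes "\<And>e. e > 0 \<Longrightarrow> \<exists>F'. lapprox S F' \<and> (\<forall>G\<in>GG. \<forall>x\<in>{..<sz G} \<rightarrow>\<^sub>E S. \<bar>F G x - F' G x\<bar> \<le> e)"
  shows "lapprox S F"
proof (rule lapproxI)
  fix e :: real assume "e > 0"
  then have e2: "e / 2 > 0" by simp
  from assms[OF this] obtain F' where F': "lapprox S F'"
    "\<forall>G\<in>GG. \<forall>x\<in>{..<sz G} \<rightarrow>\<^sub>E S. \<bar>F G x - F' G x\<bar> \<le> e / 2" by (elim exE conjE)
  obtain H where H: "lspan H"
    "\<And>G x. G \<in> GG \<Longrightarrow> x \<in> {..<sz G} \<rightarrow>\<^sub>E S \<Longrightarrow> \<bar>F' G x - H G x\<bar> \<le> e / 2"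
    by (rule lapproxE[OF F'(1) e2]) (rule that)
  show "\<exists>H. lspan H \<and> (\<forall>G\<in>GG. \<forall>x\<in>{..<sz G} \<rightarrow>\<^sub>E S. \<bar>F G x - H G x\<bar> \<le> e)"
  proof (intro exI conjI ballI)
    show "lspan H" by fact
    fix G x assume G: "G \<in> GG" and x: "x \<in> {..<sz G} \<rightarrow>\<^sub>E S"
    have "\<bar>F G x - F' G x\<bar> \<le> e / 2" using F'(2) G x by blast
    with H(2)[OF G x] show "\<bar>F G x - H G x\<bar> \<le> e" by linarith
  qed
qed

lemma lapprox_add:
  assumes "lapprox S F" "lapprox S F'"
  shows "lapprox S (\<lambda>G x. F G x + F' G x)"
proof (rule lapproxI)
  fix e :: real assume "e > 0"
  then have e2: "e / 2 > 0" by simp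
  obtain H where H: "lspan H"
    "\<And>G x. G \<in> GG \<Longrightarrow> x \<in> {..<sz G} \<rightarrow>\<^sub>E S \<Longrightarrow> \<bar>F G x - H G x\<bar> \<le> e / 2"
    by (rule lapproxE[OF assms(1) e2]) (rule that)
  obtain H' where H': "lspan H'"
    "\<And>G x. G \<in> GG \<Longrightarrow> x \<in> {..<sz G} \<rightarrow>\<^sub>E S \<Longrightarrow> \<bar>F' G x - H' G x\<bar> \<le> e / 2"
    by (rule lapproxE[OF assms(2) e2]) (rule that)
  show "\<exists>H. lspan H \<and> (\<forall>G\<in>GG. \<forall>x\<in>{..<sz G} \<rightarrow>\<^sub>E S. \<bar>F G x + F' G x - H G x\<bar> \<le> e)"
  proof (intro exI conjI ballI)
    show "lspan (\<lambda>G x. H G x + H' G x)" by (rule lspan.add[OF H(1) H'(1)])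
    fix G x assume G: "G \<in> GG" and x: "x \<in> {..<sz G} \<rightarrow>\<^sub>E S"
    show "\<bar>F G x + F' G x - (H G x + H' G x)\<bar> \<le> e"
      using H(2)[OF G x] H'(2)[OF G x] by linarith
  qed
qed

lemma lapprox_scale:
  assumes "lapprox S F"
  shows "lapprox S (\<lambda>G x. c * F G x)"
proof (rule lapproxI)
  fix e :: real assume e: "e > 0"
  then have e2: "e / (\<bar>c\<bar> + 1) > 0" by simp
  obtain H where H: "lspan H"
    "\<And>G x. G \<in> GG \<Longrightarrow> x \<in> {..<sz G} \<rightarrow>\<^sub>E S \<Longrightarrow> \<bar>F G x - H G x\<bar> \<le> e / (\<bar>c\<bar> + 1)"
    by (rule lapproxE[OF assms(1) e2]) (rule that)
  show "\<exists>H. lspan H \<and> (\<forall>G\<in>GG. \<forall>x\<in>{..<sz G} \<rightarrow>\<^sub>E S. \<bar>c * F G x - H G x\<bar> \<le> e)"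
  proof (intro exI conjI ballI)
    show "lspan (\<lambda>G x. c * H G x)" by (rule lspan.scale[OF H(1)])
    fix G x assume G: "G \<in> GG" and x: "x \<in> {..<sz G} \<rightarrow>\<^sub>E S"
    have "\<bar>c * F G x - c * H G x\<bar> = \<bar>c\<bar> * \<bar>F G x - H G x\<bar>"
      by (simp only: right_diff_distrib[symmetric] abs_mult)
    also have "\<dots> \<le> (\<bar>c\<bar> + 1) * (e / (\<bar>c\<bar> + 1))"
      using H(2)[OF G x] by (intro mult_mono) auto
    also have "\<dots> = e" by (simp add: add_nonneg_eq_0_iff)
    finally show "\<bar>c * F G x - c * H G x\<bar> \<le> e" .
  qed
qed

lemma lapprox_zero: "lapprox S (\<lambda>G x. 0)"
  by (rule lapprox_lspan[OF lspan_zero])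

lemma lapprox_sum:
  assumes "finite K" "\<And>k. k \<in> K \<Longrightarrow> lapprox S (F k)"
  shows "lapprox S (\<lambda>G x. \<Sum>k\<in>K. F k G x)"
  using assms
proof (induction K)
  case empty
  show ?case by (simp add: lapprox_zero)
next
  case (insert k K)
  have "lapprox S (\<lambda>G x. F k G x + (\<Sum>k\<in>K. F k G x))"
    using insert by (intro lapprox_add) auto
  then show ?case using insert.hyps by simp
qed

text \<open>The field \<open>s p(A) x\<close> that one layer exerts on the other.\<close>

definition zval :: "real \<Rightarrow> real list \<Rightarrow> wgraph \<Rightarrow> (nat \<Rightarrow> real) \<Rightarrow> nat \<Rightarrow> real" where
  "zval s p G x i = s * op_poly (sz G) (ew G) p x i"

text \<open>The row sums bound the operator norm of \<open>A\<close> for the supremum norm, and hence that of every polynomial in \<open>A\<close>.\<close>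

lemma op_poly_bounded:
  "\<exists>Y\<ge>0. \<forall>G\<in>GG. \<forall>x. (\<forall>i<sz G. \<bar>x i\<bar> \<le> R) \<longrightarrow> (\<forall>i<sz G. \<bar>op_poly (sz G) (ew G) p x i\<bar> \<le> Y)"
proof (induction p)
  case Nil
  show ?case by (intro exI[of _ 0]) simp
next
  case (Cons c p)
  then obtain Y where Y: "Y \<ge> 0"
    "\<And>G x i. G \<in> GG \<Longrightarrow> \<forall>i<sz G. \<bar>x i\<bar> \<le> R \<Longrightarrow> i < sz G \<Longrightarrow> \<bar>op_poly (sz G) (ew G) p x i\<bar> \<le> Y" by blast
  show ?case
  proof (intro exI[of _ "\<bar>c\<bar> * \<bar>R\<bar> + C * Y"] conjI ballI allI impI)
    show "0 \<le> \<bar>c\<bar> * \<bar>R\<bar> + C * Y" using C_pos Y(1) by simp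
    fix G x i assume G: "G \<in> GG" and x: "\<forall>i<sz G. \<bar>x i\<bar> \<le> R" and i: "i < sz G"
    have "\<bar>mv (sz G) (ew G) (op_poly (sz G) (ew G) p x) i\<bar> \<le> (\<Sum>j<sz G. \<bar>ew G i j\<bar> * \<bar>op_poly (sz G) (ew G) p x j\<bar>)"
      unfolding mv_def by (rule order_trans[OF sum_abs]) (simp add: abs_mult)
    also have "\<dots> \<le> (\<Sum>j<sz G. \<bar>ew G i j\<bar> * Y)"
      using Y(2)[OF G x] by (intro sum_mono mult_left_mono) auto
    also have "\<dots> = (\<Sum>j<sz G. \<bar>ew G i j\<bar>) * Y" by (rule sum_distrib_right[symmetric])
    also have "\<dots> \<le> C * Y" using row_sum[OF G i] Y(1) by (intro mult_right_mono)
    finally have 1: "\<bar>mv (sz G) (ew G) (op_poly (sz G) (ew G) p x) i\<bar> \<le> C * Y" .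
    have "\<bar>c * x i\<bar> \<le> \<bar>c\<bar> * \<bar>R\<bar>" using x i unfolding abs_mult by (intro mult_left_mono) force+
    with 1 show "\<bar>op_poly (sz G) (ew G) (c # p) x i\<bar> \<le> \<bar>c\<bar> * \<bar>R\<bar> + C * Y"
      using abs_triangle_ineq[of "c * x i" "mv (sz G) (ew G) (op_poly (sz G) (ew G) p x) i"] by simp
  qed
qed

lemma zval_bounded:
  assumes "finite S"
  obtains Y where "Y \<ge> 0"
    "\<And>G x i. G \<in> GG \<Longrightarrow> x \<in> {..<sz G} \<rightarrow>\<^sub>E S \<Longrightarrow> i < sz G \<Longrightarrow> \<bar>zval s p G x i\<bar> \<le> Y"
proof -
  obtain R where R: "\<And>a. a \<in> S \<Longrightarrow> \<bar>a\<bar> \<le> R"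
    using finite_imp_bounded[OF assms] by (auto simp: bounded_iff)
  from op_poly_bounded[of R p] obtain Y where Y: "Y \<ge> 0"
    "\<And>G x i. G \<in> GG \<Longrightarrow> \<forall>i<sz G. \<bar>x i\<bar> \<le> R \<Longrightarrow> i < sz G \<Longrightarrow> \<bar>op_poly (sz G) (ew G) p x i\<bar> \<le> Y" by blast
  show thesis
  proof (rule that[of "\<bar>s\<bar> * Y"])
    show "0 \<le> \<bar>s\<bar> * Y" using Y(1) by simp
    fix G x i assume G: "G \<in> GG" and x: "x \<in> {..<sz G} \<rightarrow>\<^sub>E S" and i: "i < sz G"
    have "\<forall>i<sz G. \<bar>x i\<bar> \<le> R" using x R by auto
    from Y(2)[OF G this i] show "\<bar>zval s p G x i\<bar> \<le> \<bar>s\<bar> * Y"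
      unfolding zval_def abs_mult by (rule mult_left_mono) simp
  qed
qed

lemma site_expandable_zval: "site_expandable (zval s p)"
proof -
  have "zval s p = (\<lambda>G x i. s * op_poly (sz G) (ew G) p x i)" by (simp add: fun_eq_iff zval_def)
  then show ?thesis using site_expandable_scale[OF site_expandable_op_poly] by simp
qed

lemma site_expandable_polynomial:
  fixes P :: "real \<times> real \<Rightarrow> real"
  assumes "real_polynomial_function P"
  shows "site_expandable (\<lambda>G x i. P (vw G i, zval s p G x i))"
  using assms
proof induction
  case (linear f)
  have lin: "f (h, z) = f (1, 0) * h + f (0, 1) * z" for h z
  proof -
    have "f (h, z) = f (h *\<^sub>R (1, 0) + z *\<^sub>R (0, 1))" by simp
    also have "\<dots> = h * f (1, 0) + z * f (0, 1)"
      using linear by (simp only: bounded_linear.linear[THEN linear_add] bounded_linear.linear[THEN linear_scale] real_scaleR_def)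
    finally show ?thesis by (simp add: mult.commute)
  qed
  have "site_expandable (\<lambda>G x i. vw G i)"
    using site_expandable_local[of "\<lambda>h t. h"] by (simp add: continuous_on_fst)
  from site_expandable_add[OF site_expandable_scale[OF this, of "f (1, 0)"] site_expandable_scale[OF site_expandable_zval, of "f (0, 1)" s p]]
  show ?case unfolding lin[of "vw _ _"] .
next
  case (const c)
  show ?case using site_expandable_local[of "\<lambda>h t. c"] by simp
next
  case (add f g)
  from site_expandable_add[OF add.IH] show ?case .
next
  case (mult f g)
  from site_expandable_mult[OF mult.IH] show ?case .
qed

text \<open>Field and layer field stay in a compact box, where Weierstrass approximation turns a continuous
function into a polynomial, and polynomials of them are expandable.\<close>

lemma zsite_approx:
  assumes S: "finite S" and m: "cont2 m"
  obtains M where "\<And>G x i. G \<in> GG \<Longrightarrow> x \<in> {..<sz G} \<rightarrow>\<^sub>E S \<Longrightarrow> i < sz G \<Longrightarrow> \<bar>m (vw G i) (zval s p G x i)\<bar> \<le> M"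
    "\<And>e. e > 0 \<Longrightarrow> \<exists>u. site_expandable u \<and> (\<forall>G x i. G \<in> GG \<longrightarrow> x \<in> {..<sz G} \<rightarrow>\<^sub>E S \<longrightarrow> i < sz G \<longrightarrow>
        \<bar>m (vw G i) (zval s p G x i) - u G x i\<bar> \<le> e)"
proof -
  from zval_bounded[OF S, of s p] obtain Y where Y: "Y \<ge> 0"
    "\<And>G x i. G \<in> GG \<Longrightarrow> x \<in> {..<sz G} \<rightarrow>\<^sub>E S \<Longrightarrow> i < sz G \<Longrightarrow> \<bar>zval s p G x i\<bar> \<le> Y" by blast
  let ?K = "{-C..C} \<times> {-Y..Y}"
  have K: "compact ?K" by (intro compact_Times compact_Icc)
  have cK: "continuous_on ?K (\<lambda>q. m (fst q) (snd q))" by (rule continuous_on_subset[OF m]) simp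
  have inK: "(vw G i, zval s p G x i) \<in> ?K" if "G \<in> GG" "x \<in> {..<sz G} \<rightarrow>\<^sub>E S" "i < sz G" for G x i
    using vw_le[OF that(1,3)] Y(2)[OF that] by auto
  obtain M where M0: "\<forall>y\<in>(\<lambda>q. m (fst q) (snd q)) ` ?K. norm y \<le> M"
    using compact_imp_bounded[OF compact_continuous_image[OF cK K]] unfolding bounded_iff by (elim exE)
  have M: "\<bar>m (fst q) (snd q)\<bar> \<le> M" if "q \<in> ?K" for q
    using bspec[OF M0 imageI[OF that]] by simp
  show thesis
  proof (rule that[of M])
    show "\<bar>m (vw G i) (zval s p G x i)\<bar> \<le> M" if "G \<in> GG" "x \<in> {..<sz G} \<rightarrow>\<^sub>E S" "i < sz G" for G x i
      using M[OF inK[OF that]] by simp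
    fix e :: real assume e: "e > 0"
    obtain P where P: "real_polynomial_function P" "\<And>q. q \<in> ?K \<Longrightarrow> \<bar>m (fst q) (snd q) - P q\<bar> < e"
      by (rule Stone_Weierstrass_real_polynomial_function[OF K cK e]) (rule that)
    show "\<exists>u. site_expandable u \<and> (\<forall>G x i. G \<in> GG \<longrightarrow> x \<in> {..<sz G} \<rightarrow>\<^sub>E S \<longrightarrow> i < sz G \<longrightarrow>
        \<bar>m (vw G i) (zval s p G x i) - u G x i\<bar> \<le> e)"
    proof (intro exI[of _ "\<lambda>G x i. P (vw G i, zval s p G x i)"] conjI allI impI)
      show "site_expandable (\<lambda>G x i. P (vw G i, zval s p G x i))" by (rule site_expandable_polynomial[OF P(1)])
      fix G x i assume "G \<in> GG" "x \<in> {..<sz G} \<rightarrow>\<^sub>E S" "i < sz G"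
      from P(2)[OF inK[OF this]] show "\<bar>m (vw G i) (zval s p G x i) - P (vw G i, zval s p G x i)\<bar> \<le> e" by simp
    qed
  qed
qed

lemma weighted_tree_average:
  assumes G: "G \<in> GG" and tree: "rooted_tree V es"
    and c: "\<And>f. f \<in> V \<rightarrow>\<^sub>E {..<sz G} \<Longrightarrow> \<bar>c f\<bar> \<le> e"
  shows "\<bar>(\<Sum>f\<in>V \<rightarrow>\<^sub>E {..<sz G}. eprod G es f * c f) / real (sz G)\<bar> \<le> D ^ length es * e"
proof -
  have e: "0 \<le> e"
  proof -
    have "(\<lambda>v\<in>V. 0) \<in> V \<rightarrow>\<^sub>E {..<sz G}" using size_pos[OF G] by auto
    from c[OF this] show ?thesis by linarith
  qed
  have "\<bar>\<Sum>f\<in>V \<rightarrow>\<^sub>E {..<sz G}. eprod G es f * c f\<bar> \<le> (\<Sum>f\<in>V \<rightarrow>\<^sub>E {..<sz G}. \<bar>eprod G es f\<bar> * e)"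
    using c by (intro order_trans[OF sum_abs] sum_mono) (simp add: abs_mult mult_left_mono)
  also have "\<dots> = (\<Sum>f\<in>V \<rightarrow>\<^sub>E {..<sz G}. \<bar>eprod G es f\<bar>) * e" by (rule sum_distrib_right[symmetric])
  also have "\<dots> \<le> D ^ length es * real (sz G) * e"
    by (rule mult_right_mono[OF tree_sum_bound[OF G tree] e])
  finally show ?thesis using size_pos[OF G] by (simp add: divide_le_eq mult_ac)
qed

abbreviation zsites :: "real \<Rightarrow> real list \<Rightarrow> (nat \<Rightarrow> real \<Rightarrow> real \<Rightarrow> real) \<Rightarrow> nat \<Rightarrow> wgraph \<Rightarrow> (nat \<Rightarrow> real) \<Rightarrow> nat \<Rightarrow> real"
  where "zsites s p m v \<equiv> \<lambda>G x i. m v (vw G i) (zval s p G x i)"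

lemma lapprox_gsum:
  assumes S: "finite S" and tree: "rooted_tree V es" and m: "\<And>v. cont2 (m v)"
  shows "lapprox S (gsum V es (zsites s p m))"
proof (rule lapproxI)
  fix e :: real assume e: "e > 0"
  have V: "finite V" using tree by (simp add: rooted_tree_def)
  define K where "K = D ^ length es"
  have K: "K > 0" by (simp add: K_def)
  have "\<exists>M. \<forall>G x i. G \<in> GG \<longrightarrow> x \<in> {..<sz G} \<rightarrow>\<^sub>E S \<longrightarrow> i < sz G \<longrightarrow> \<bar>m v (vw G i) (zval s p G x i)\<bar> \<le> M" for v
    using zsite_approx[OF S m[of v], of s p] by metis
  then obtain M where M: "\<And>v G x i. G \<in> GG \<Longrightarrow> x \<in> {..<sz G} \<rightarrow>\<^sub>E S \<Longrightarrow> i < sz G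
      \<Longrightarrow> \<bar>m v (vw G i) (zval s p G x i)\<bar> \<le> M v" by metis
  define M' where "M' = (\<Sum>v\<in>V. \<bar>M v\<bar>)"
  have M': "M v \<le> M'" if "v \<in> V" for v
    using member_le_sum[OF that, of "\<lambda>v. \<bar>M v\<bar>"] V by (simp add: M'_def)
  obtain \<delta> where \<delta>: "\<delta> > 0"
    "\<And>a b :: nat \<Rightarrow> real. (\<And>v. v \<in> V \<Longrightarrow> \<bar>a v\<bar> \<le> M') \<Longrightarrow> (\<And>v. v \<in> V \<Longrightarrow> \<bar>a v - b v\<bar> \<le> \<delta>)
        \<Longrightarrow> \<bar>prod a V - prod b V\<bar> \<le> e / K"
    using prod_close[of V "e / K" M'] V e K by (metis divide_pos_pos)
  have "\<exists>u. site_expandable u \<and> (\<forall>G x i. G \<in> GG \<longrightarrow> x \<in> {..<sz G} \<rightarrow>\<^sub>E S \<longrightarrow> i < sz G \<longrightarrow>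
        \<bar>m v (vw G i) (zval s p G x i) - u G x i\<bar> \<le> \<delta>)" for v
    using zsite_approx[OF S m[of v], of s p] \<delta>(1) by metis
  then obtain u where u: "\<And>v. site_expandable (u v)" "\<And>v G x i. G \<in> GG \<Longrightarrow> x \<in> {..<sz G} \<rightarrow>\<^sub>E S \<Longrightarrow> i < sz G \<Longrightarrow>
        \<bar>m v (vw G i) (zval s p G x i) - u v G x i\<bar> \<le> \<delta>" by metis
  obtain F where F: "lspan F" "\<And>G x. G \<in> GG \<Longrightarrow> gsum V es u G x = F G x"
    by (rule gsum_expandable[of V es u, OF tree u(1)]) (rule that)
  show "\<exists>F'. lspan F' \<and> (\<forall>G\<in>GG. \<forall>x\<in>{..<sz G} \<rightarrow>\<^sub>E S. \<bar>gsum V es (zsites s p m) G x - F' G x\<bar> \<le> e)"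
  proof (intro exI conjI ballI)
    show "lspan F" by fact
    fix G x assume G: "G \<in> GG" and x: "x \<in> {..<sz G} \<rightarrow>\<^sub>E S"
    let ?a = "\<lambda>f v. m v (vw G (f v)) (zval s p G x (f v))" and ?b = "\<lambda>f v. u v G x (f v)"
    have ab: "\<bar>prod (?a f) V - prod (?b f) V\<bar> \<le> e / K" if f: "f \<in> V \<rightarrow>\<^sub>E {..<sz G}" for f
    proof (rule \<delta>(2))
      fix v assume v: "v \<in> V"
      then have fv: "f v < sz G" using f by auto
      show "\<bar>?a f v\<bar> \<le> M'" using M[OF G x fv, of v] M'[OF v] by linarith
      show "\<bar>?a f v - ?b f v\<bar> \<le> \<delta>" by (rule u(2)[OF G x fv])
    qed
    have "gsum V es (zsites s p m) G x - F G x = gsum V es (zsites s p m) G x - gsum V es u G x"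
      using F(2)[OF G] by simp
    also have "\<dots> = (\<Sum>f\<in>V \<rightarrow>\<^sub>E {..<sz G}. eprod G es f * (prod (?a f) V - prod (?b f) V)) / real (sz G)"
      by (simp only: gsum_def right_diff_distrib sum_subtractf diff_divide_distrib)
    finally have "\<bar>gsum V es (zsites s p m) G x - F G x\<bar>
       = \<bar>(\<Sum>f\<in>V \<rightarrow>\<^sub>E {..<sz G}. eprod G es f * (prod (?a f) V - prod (?b f) V)) / real (sz G)\<bar>"
      by (rule arg_cong)
    also have "\<dots> \<le> K * (e / K)" unfolding K_def
      by (rule weighted_tree_average[OF G tree ab[unfolded K_def]])
    also have "\<dots> = e" using K by simp
    finally show "\<bar>gsum V es (zsites s p m) G x - F G x\<bar> \<le> e" .
  qed
qed

text \<open>The tree sum restricted to injective labellings. Under independent sites the expectation of a product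
factorises only when the sites are distinct.\<close>

definition isum :: "nat set \<Rightarrow> (nat \<times> nat) list \<Rightarrow> (nat \<Rightarrow> wgraph \<Rightarrow> (nat \<Rightarrow> real) \<Rightarrow> nat \<Rightarrow> real) \<Rightarrow>
    wgraph \<Rightarrow> (nat \<Rightarrow> real) \<Rightarrow> real" where
  "isum V es g G x =
    (\<Sum>f\<in>{f \<in> V \<rightarrow>\<^sub>E {..<sz G}. inj_on f V}. eprod G es f * (\<Prod>v\<in>V. g v G x (f v))) / real (sz G)"

lemma eprod_retract:
  assumes "set es \<subseteq> V \<times> V"
  shows "eprod G es (\<lambda>v\<in>V. g (r v)) = eprod G (map (map_prod r r) es) g"
proof -
  have "eprod G es (\<lambda>v\<in>V. g (r v)) = eprod G es (g \<circ> r)" 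
    by (rule eprod_cong[of V "\<lambda>v\<in>V. g (r v)" "g \<circ> r", OF _ assms]) simp
  then show ?thesis by (simp only: eprod_map)
qed

lemma gsum_by_retraction:
  assumes V: "finite V" and es: "set es \<subseteq> V \<times> V"
  shows "gsum V es g G x = (\<Sum>r\<in>retractions V.
     isum (r ` V) (map (map_prod r r) es) (\<lambda>u G x i. \<Prod>v\<in>{v\<in>V. r v = u}. g v G x i) G x)"
proof -
  have e: "(\<Prod>v\<in>V. g v G x ((\<lambda>v\<in>V. f (r v)) v)) = (\<Prod>u\<in>r ` V. \<Prod>v\<in>{v\<in>V. r v = u}. g v G x (f u))" for f r
  proof -
    have "(\<Prod>v\<in>V. g v G x ((\<lambda>v\<in>V. f (r v)) v)) = (\<Prod>v\<in>V. g v G x (f (r v)))" by simp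
    also have "\<dots> = (\<Prod>u\<in>r ` V. \<Prod>v\<in>{v\<in>V. r v = u}. g v G x (f (r v)))" by (rule prod.image_gen[OF V])
    also have "\<dots> = (\<Prod>u\<in>r ` V. \<Prod>v\<in>{v\<in>V. r v = u}. g v G x (f u))" by (intro prod.cong) auto
    finally show ?thesis .
  qed
  show ?thesis
    unfolding gsum_def isum_def sum_by_retraction[OF V finite_lessThan] eprod_retract[OF es] sum_divide_distrib
  proof (intro sum.cong refl)
    fix r f
    show "eprod G (map (map_prod r r) es) f * (\<Prod>v\<in>V. g v G x ((\<lambda>v\<in>V. f (r v)) v)) / real (sz G)
      = eprod G (map (map_prod r r) es) f * (\<Prod>u\<in>r ` V. \<Prod>v\<in>{v\<in>V. r v = u}. g v G x (f u)) / real (sz G)"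
      by (simp only: e[of f r])
  qed
qed

lemma cont2_prod: "(\<And>v. v \<in> A \<Longrightarrow> cont2 (m v)) \<Longrightarrow> cont2 (\<lambda>s t. \<Prod>v\<in>A. m v s t)"
  by (intro continuous_intros)

text \<open>Induction on the number of vertices: the unrestricted sum is the injective sum plus injective sums
over proper quotients, which are trees with fewer vertices.\<close>

lemma lapprox_isum:
  assumes S: "finite S"
  shows "rooted_tree V es \<Longrightarrow> (\<And>v. cont2 (m v)) \<Longrightarrow> lapprox S (isum V es (zsites s p m))"
proof (induction "card V" arbitrary: V es m rule: less_induct)
  case less
  have V: "finite V" and es: "set es \<subseteq> V \<times> V" using less.prems by (simp_all add: rooted_tree_def)
  let ?r0 = "restrict id V"
  let ?m = "\<lambda>r u h z. \<Prod>v\<in>{v\<in>V. r v = u}. m v h z"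
  let ?I = "\<lambda>r. isum (r ` V) (map (map_prod r r) es) (zsites s p (?m r))"
  have I: "lapprox S (?I r)" if r: "r \<in> retractions V" "r \<noteq> ?r0" for r
  proof -
    have "cont2 (?m r u)" for u by (rule cont2_prod) (rule less.prems(2))
    then show ?thesis
      using less.hyps[of "r ` V" "map (map_prod r r) es" "?m r"] identity_retraction(2)[OF V r]
        rooted_tree_retract[OF less.prems(1) r(1)] by (simp only:)
  qed
  \<comment> \<open>The identity retraction contributes the injective sum itself.\<close>
  have I0: "?I ?r0 = isum V es (zsites s p m)"
  proof -
    have "map (map_prod ?r0 ?r0) es = es" using es by (intro map_idI) auto
    moreover have "?r0 ` V = V" by simp
    moreover have "(\<Prod>u\<in>V. \<Prod>v\<in>{v\<in>V. ?r0 v = u}. m v (vw G (f u)) (zval s p G x (f u)))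
        = (\<Prod>u\<in>V. m u (vw G (f u)) (zval s p G x (f u)))" for G x f
    proof (intro prod.cong refl)
      fix u assume "u \<in> V"
      then have "{v\<in>V. ?r0 v = u} = {u}" by auto
      then show "(\<Prod>v\<in>{v\<in>V. ?r0 v = u}. m v (vw G (f u)) (zval s p G x (f u)))
        = m u (vw G (f u)) (zval s p G x (f u))" by (simp only: prod.insert finite.emptyI empty_iff not_False_eq_True prod.empty mult_1_right)
    qed
    ultimately show ?thesis by (simp only: isum_def fun_eq_iff simp_thms)
  qed
  have eq: "isum V es (zsites s p m) G x = gsum V es (zsites s p m) G x + (-1) * (\<Sum>r\<in>retractions V - {?r0}. ?I r G x)" for G x
  proof -
    have "gsum V es (zsites s p m) G x = (\<Sum>r\<in>retractions V. ?I r G x)"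
      by (rule gsum_by_retraction[OF V es])
    also have "\<dots> = ?I ?r0 G x + (\<Sum>r\<in>retractions V - {?r0}. ?I r G x)"
      by (rule sum.remove[OF finite_retractions[OF V] identity_retraction(1)[OF V]])
    also have "?I ?r0 G x = isum V es (zsites s p m) G x" by (simp only: I0)
    finally show ?thesis by (rule solve_for_summand)
  qed
  have L: "lapprox S (\<lambda>G x. gsum V es (zsites s p m) G x + (-1) * (\<Sum>r\<in>retractions V - {?r0}. ?I r G x))"
  proof (rule lapprox_add[OF lapprox_gsum[OF S less.prems] lapprox_scale[OF lapprox_sum]])
    show "finite (retractions V - {?r0})" using finite_retractions[OF V] by simp
    show "lapprox S (?I r)" if "r \<in> retractions V - {?r0}" for r using I that by simp
  qed
  show ?case by (rule lapprox_cong[OF L]) (rule eq)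
qed

end

section \<open>Conditional expectations preserve approximability\<close>

context bounded_graphs
begin

text \<open>After splitting by coincidences, the expectation of each injective term is a product
of one-site expectations, which are continuous functions of the field and the layer field.\<close>

lemma lapprox_gibbs_tsum:
  assumes S: "finite S" "S \<noteq> {}" and S': "finite S'"
    and pos: "\<And>h x. x \<in> S \<Longrightarrow> r h x > 0"
    and cont: "\<And>x. x \<in> S \<Longrightarrow> continuous_on UNIV (\<lambda>h. r h x)"
    and tree: "rooted_tree V es" and \<psi>: "\<And>v. cont2 (\<psi> v)"
  shows "lapprox S' (\<lambda>G y. gibbs (sz G) S (\<lambda>i. r (vw G i)) (zval s p G y) (tsum V es \<psi> G))"
proof -
  have V: "finite V" and es: "set es \<subseteq> V \<times> V" using tree by (simp_all add: rooted_tree_def)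
  let ?m = "\<lambda>q u h z. \<Sum>a\<in>S. tilt S (r h) z a * (\<Prod>v\<in>{v\<in>V. q v = u}. \<psi> v h a)"
  let ?I = "\<lambda>q. isum (q ` V) (map (map_prod q q) es) (zsites s p (?m q))"
  have m: "cont2 (?m q u)" for q u
  proof (rule cont2_tilt[OF S pos cont])
    fix a
    have "continuous_on UNIV (\<lambda>h. \<psi> v h a)" for v
      by (rule continuous_on_compose2[OF \<psi>[of v], of UNIV "\<lambda>h. (h, a)", simplified])
         (intro continuous_intros)
    then show "continuous_on UNIV (\<lambda>h. \<Prod>v\<in>{v\<in>V. q v = u}. \<psi> v h a)"
      by (intro continuous_intros)
  qed
  have "lapprox S' (\<lambda>G y. \<Sum>q\<in>retractions V. ?I q G y)"
  proof (rule lapprox_sum[OF finite_retractions[OF V]])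
    fix q assume q: "q \<in> retractions V"
    show "lapprox S' (?I q)"
      by (rule lapprox_isum[OF S' rooted_tree_retract[OF tree q] m])
  qed
  then show ?thesis
  proof (rule lapprox_cong)
    fix G y assume G: "G \<in> GG"
    let ?z = "zval s p G y" and ?\<rho> = "\<lambda>i. r (vw G i)"
    let ?P = "\<lambda>f x. \<Prod>v\<in>V. \<psi> v (vw G (f v)) (x (f v))"
    have one: "gibbs (sz G) S ?\<rho> ?z (?P (\<lambda>v\<in>V. g (q v)))
        = (\<Prod>u\<in>q ` V. ?m q u (vw G (g u)) (?z (g u)))"
      if g: "g \<in> q ` V \<rightarrow>\<^sub>E {..<sz G}" "inj_on g (q ` V)" for g q
    proof -
      have "?P (\<lambda>v\<in>V. g (q v)) x = (\<Prod>u\<in>q ` V. \<Prod>v\<in>{v\<in>V. q v = u}. \<psi> v (vw G (g u)) (x (g u)))" for x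
      proof -
        have "?P (\<lambda>v\<in>V. g (q v)) x = (\<Prod>v\<in>V. \<psi> v (vw G (g (q v))) (x (g (q v))))"
          by (intro prod.cong refl) simp
        also have "\<dots> = (\<Prod>u\<in>q ` V. \<Prod>v\<in>{v\<in>V. q v = u}. \<psi> v (vw G (g (q v))) (x (g (q v))))"
          by (rule prod.image_gen[OF V])
        also have "\<dots> = (\<Prod>u\<in>q ` V. \<Prod>v\<in>{v\<in>V. q v = u}. \<psi> v (vw G (g u)) (x (g u)))"
          by (intro prod.cong refl) auto
        finally show ?thesis .
      qed
      then have "gibbs (sz G) S ?\<rho> ?z (?P (\<lambda>v\<in>V. g (q v)))
          = gibbs (sz G) S ?\<rho> ?z (\<lambda>x. \<Prod>u\<in>q ` V. \<Prod>v\<in>{v\<in>V. q v = u}. \<psi> v (vw G (g u)) (x (g u)))"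
        by (simp only:)
      also have "\<dots> = (\<Prod>u\<in>q ` V. \<Sum>a\<in>S. tilt S (?\<rho> (g u)) (?z (g u)) a *
            (\<Prod>v\<in>{v\<in>V. q v = u}. \<psi> v (vw G (g u)) a))"
        by (rule gibbs_inj_prod[where \<phi> = "\<lambda>u a. \<Prod>v\<in>{v\<in>V. q v = u}. \<psi> v (vw G (g u)) a", OF S])
           (use pos V g in auto)
      finally show ?thesis .
    qed
    have "gibbs (sz G) S ?\<rho> ?z (tsum V es \<psi> G)
        = (\<Sum>f\<in>V \<rightarrow>\<^sub>E {..<sz G}. eprod G es f * gibbs (sz G) S ?\<rho> ?z (?P f)) / real (sz G)"
    proof -
      have "tsum V es \<psi> G = (\<lambda>x. \<Sum>f\<in>V \<rightarrow>\<^sub>E {..<sz G}. (eprod G es f / real (sz G)) * ?P f x)"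
        by (simp add: fun_eq_iff tsum_def kern_def sum_divide_distrib)
      then have "gibbs (sz G) S ?\<rho> ?z (tsum V es \<psi> G)
          = (\<Sum>f\<in>V \<rightarrow>\<^sub>E {..<sz G}. (eprod G es f / real (sz G)) * gibbs (sz G) S ?\<rho> ?z (?P f))"
        by (simp only: gibbs_sum gibbs_scale)
      then show ?thesis by (simp only: sum_divide_distrib times_divide_eq_left)
    qed
    also have "\<dots> = (\<Sum>q\<in>retractions V. ?I q G y)"
      unfolding isum_def sum_by_retraction[OF V finite_lessThan] eprod_retract[OF es] sum_divide_distrib
    proof (intro sum.cong refl)
      fix q g :: "nat \<Rightarrow> nat" assume "g \<in> {f \<in> q ` V \<rightarrow>\<^sub>E {..<sz G}. inj_on f (q ` V)}"
      then have "g \<in> q ` V \<rightarrow>\<^sub>E {..<sz G}" "inj_on g (q ` V)" by auto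
      from one[OF this]
      show "eprod G (map (map_prod q q) es) g * gibbs (sz G) S ?\<rho> ?z (?P (\<lambda>v\<in>V. g (q v))) / real (sz G)
         = eprod G (map (map_prod q q) es) g * (\<Prod>u\<in>q ` V. ?m q u (vw G (g u)) (?z (g u))) / real (sz G)"
        by (simp only:)
    qed
    finally show "gibbs (sz G) S ?\<rho> ?z (tsum V es \<psi> G) = (\<Sum>q\<in>retractions V. ?I q G y)" .
  qed
qed

lemma gibbs_add: "gibbs N S \<rho> z (\<lambda>x. F x + F' x) = gibbs N S \<rho> z F + gibbs N S \<rho> z F'"
  by (simp add: gibbs_def distrib_left sum.distrib)

text \<open>One conditional expectation keeps observables local. The constants of the approximation may get
worse with every step, but only finitely many steps are needed.\<close>

theorem lapprox_gibbs:
  assumes S: "finite S" "S \<noteq> {}" and S': "finite S'"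
    and pos: "\<And>h x. x \<in> S \<Longrightarrow> r h x > 0"
    and cont: "\<And>x. x \<in> S \<Longrightarrow> continuous_on UNIV (\<lambda>h. r h x)"
    and F: "lapprox S F"
  shows "lapprox S' (\<lambda>G y. gibbs (sz G) S (\<lambda>i. r (vw G i)) (zval s p G y) (F G))"
proof (rule lapprox_limit)
  fix e :: real assume e: "e > 0"
  obtain F' where F': "lspan F'" "\<And>G x. G \<in> GG \<Longrightarrow> x \<in> {..<sz G} \<rightarrow>\<^sub>E S \<Longrightarrow> \<bar>F G x - F' G x\<bar> \<le> e"
    by (rule lapproxE[OF F e]) (rule that)
  have L: "lapprox S' (\<lambda>G y. gibbs (sz G) S (\<lambda>i. r (vw G i)) (zval s p G y) (F' G))"
    using F'(1)
  proof induction
    case (base V es \<psi>)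
    show ?case by (rule lapprox_gibbs_tsum[OF S S' pos cont base])
  next
    case (add F F')
    from lapprox_add[OF add.IH] show ?case by (simp only: gibbs_add)
  next
    case (scale F c)
    from lapprox_scale[OF scale.IH, of c] show ?case by (simp only: gibbs_scale)
  qed
  show "\<exists>F'. lapprox S' F' \<and> (\<forall>G\<in>GG. \<forall>x\<in>{..<sz G} \<rightarrow>\<^sub>E S'.
      \<bar>gibbs (sz G) S (\<lambda>i. r (vw G i)) (zval s p G x) (F G) - F' G x\<bar> \<le> e)"
  proof (rule exI, rule conjI[OF L], intro ballI)
    fix G y assume G: "G \<in> GG"
    show "\<bar>gibbs (sz G) S (\<lambda>i. r (vw G i)) (zval s p G y) (F G)
        - gibbs (sz G) S (\<lambda>i. r (vw G i)) (zval s p G y) (F' G)\<bar> \<le> e"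
      by (rule gibbs_close[OF S pos F'(2)[OF G]])
  qed
qed

lemma lapprox_site_average:
  assumes S: "finite S" and m: "cont2 m"
  shows "lapprox S (\<lambda>G x. (\<Sum>i<sz G. m (vw G i) (zval s p G x i)) / real (sz G))"
proof -
  have tree: "rooted_tree {0} []" by (simp add: rooted_tree_def)
  have "gsum {0} [] (zsites s p (\<lambda>_. m)) G x = (\<Sum>i<sz G. m (vw G i) (zval s p G x i)) / real (sz G)" for G x
  proof -
    have "(\<Sum>f\<in>{0::nat} \<rightarrow>\<^sub>E {..<sz G}. m (vw G (f 0)) (zval s p G x (f 0)))
        = (\<Sum>g\<in>{} \<rightarrow>\<^sub>E {..<sz G}. \<Sum>i<sz G. m (vw G ((g(0 := i)) 0)) (zval s p G x ((g(0 := i)) 0)))"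
      using sum_PiE_insert[of 0 "{}" "\<lambda>f. m (vw G (f 0)) (zval s p G x (f 0))" "{..<sz G}"] by simp
    then show ?thesis by (simp add: gsum_def)
  qed
  then show ?thesis
    by (intro lapprox_cong[OF lapprox_gsum[OF S tree, of "\<lambda>_. m" s p]] m) simp
qed

end

section \<open>Tree sums and homomorphism densities\<close>

text \<open>The span is given by sums over finite sets of test graphs, so coefficients have to be merged
on the union.\<close>

lemma density_span_add:
  assumes "\<phi> \<in> density_span" "\<phi>' \<in> density_span"
  shows "(\<lambda>G. \<phi> G + \<phi>' G) \<in> density_span"
proof -
  obtain S c where S: "finite S" "S \<subseteq> Collect test_graph" "\<phi> = (\<lambda>G. \<Sum>X\<in>S. c X * hom_density X G)"
    using assms(1) unfolding density_span_def by blast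
  obtain S' c' where S': "finite S'" "S' \<subseteq> Collect test_graph" "\<phi>' = (\<lambda>G. \<Sum>X\<in>S'. c' X * hom_density X G)"
    using assms(2) unfolding density_span_def by blast
  let ?c = "\<lambda>X. (if X \<in> S then c X else 0) + (if X \<in> S' then c' X else 0)"
  have e: "(\<Sum>X\<in>T. c X * hom_density X G) = (\<Sum>X\<in>S \<union> S'. (if X \<in> T then c X else 0) * hom_density X G)"
    if "T = S \<or> T = S'" for T c G
  proof -
    have "(\<Sum>X\<in>T. c X * hom_density X G) = (\<Sum>X\<in>T. (if X \<in> T then c X else 0) * hom_density X G)"
      by (intro sum.cong) auto
    also have "\<dots> = (\<Sum>X\<in>S \<union> S'. (if X \<in> T then c X else 0) * hom_density X G)"
      using that S(1) S'(1) by (intro sum.mono_neutral_left) auto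
    finally show ?thesis .
  qed
  have "(\<lambda>G. \<phi> G + \<phi>' G) = (\<lambda>G. \<Sum>X\<in>S \<union> S'. ?c X * hom_density X G)"
    by (simp only: S(3) S'(3) e[of S] e[of S'] distrib_right sum.distrib simp_thms)
  then show ?thesis unfolding density_span_def using S(1,2) S'(1,2)
    by (intro CollectI exI[of _ "S \<union> S'"] exI[of _ ?c] conjI) auto
qed

lemma density_span_scale:
  assumes "\<phi> \<in> density_span"
  shows "(\<lambda>G. a * \<phi> G) \<in> density_span"
proof -
  obtain S c where S: "finite S" "S \<subseteq> Collect test_graph" "\<phi> = (\<lambda>G. \<Sum>X\<in>S. c X * hom_density X G)"
    using assms(1) unfolding density_span_def by blast
  then have "(\<lambda>G. a * \<phi> G) = (\<lambda>G. \<Sum>X\<in>S. (a * c X) * hom_density X G)"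
    by (simp add: sum_distrib_left mult.assoc)
  then show ?thesis unfolding density_span_def using S(1,2)
    by (intro CollectI exI[of _ S] exI[of _ "\<lambda>X. a * c X"] conjI) auto
qed

lemma density_span_zero: "(\<lambda>G. 0) \<in> density_span"
  unfolding density_span_def
  by (intro CollectI exI[of _ "{}"] exI[of _ "\<lambda>X. 0"] conjI) auto

lemma density_span_sum:
  assumes "finite K" "\<And>k. k \<in> K \<Longrightarrow> \<phi> k \<in> density_span"
  shows "(\<lambda>G. \<Sum>k\<in>K. \<phi> k G) \<in> density_span"
  using assms
proof (induction K)
  case empty
  show ?case by (simp add: density_span_zero)
next
  case (insert k K)
  have "(\<lambda>G. \<phi> k G + (\<Sum>k\<in>K. \<phi> k G)) \<in> density_span"
    using insert by (intro density_span_add) auto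
  then show ?case using insert.hyps by simp
qed

lemma hom_density_in_span: "test_graph X \<Longrightarrow> hom_density X \<in> density_span"
  unfolding density_span_def
  by (intro CollectI exI[of _ "{X}"] exI[of _ "\<lambda>X. 1"] conjI) (auto simp: fun_eq_iff)

definition joins :: "(nat \<Rightarrow> nat) \<Rightarrow> nat \<Rightarrow> nat \<Rightarrow> nat \<times> nat \<Rightarrow> bool" where
  "joins b i j e \<longleftrightarrow> e = (b i, b j) \<or> e = (b j, b i)"

text \<open>The tree \<open>V\<close>, renumbered by \<open>b\<close> to the vertices \<open>0, \<dots>, n - 1\<close>, with multiplicities from the edge list.\<close>

definition test_graph_of :: "nat \<Rightarrow> (nat \<Rightarrow> nat) \<Rightarrow> (nat \<times> nat) list \<Rightarrow> (nat \<Rightarrow> nat) \<Rightarrow> tgraph" where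
  "test_graph_of n b es d = TGraph (mat n n (\<lambda>(i, j). length (filter (joins b i j) es))) (vec n (\<lambda>i. d (b i)))"

lemma joins_commute: "joins b i j = joins b j i"
  by (auto simp: joins_def fun_eq_iff)

lemma test_graph_test_graph_of: "n \<ge> 1 \<Longrightarrow> test_graph (test_graph_of n b es d)"
  unfolding test_graph_def tgraph_size_def test_graph_of_def
  by (auto intro!: eq_matI simp: joins_commute)

lemma num_components_connected:
  assumes n: "tgraph_size X \<ge> 1" and sym: "sym (adjacency X)" and i0: "i0 < tgraph_size X"
    and con: "\<And>i. i < tgraph_size X \<Longrightarrow> (i, i0) \<in> (adjacency X)\<^sup>*"
  shows "num_components X = 1"
proof -
  let ?n = "tgraph_size X" and ?r = "(adjacency X)\<^sup>*"
  have symr: "sym ?r" using sym by (rule sym_rtrancl)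
  have stay: "j < ?n" if "(i, j) \<in> ?r" "i < ?n" for i j
    using that by (induction rule: rtrancl_induct) (auto simp: adjacency_def)
  have cls: "?r `` {i} = {0..<?n}" if i: "i < ?n" for i
  proof (intro equalityI subsetI)
    fix j assume "j \<in> ?r `` {i}"
    then show "j \<in> {0..<?n}" using stay i by auto
  next
    fix j assume "j \<in> {0..<?n}"
    then have "(i0, j) \<in> ?r" using con[of j] symr by (auto dest: symD)
    then show "j \<in> ?r `` {i}" using con[OF i] by (auto intro: rtrancl_trans)
  qed
  have "{0..<?n} // ?r = {{0..<?n}}"
    unfolding quotient_def using cls n by (force simp: Image_singleton)
  then show ?thesis by (simp add: num_components_def)
qed

lemma test_graph_of_connected:
  assumes b: "bij_betw b {0..<n} V" and tree: "rooted_tree V es"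
  shows "num_components (test_graph_of n b es d) = 1"
proof -
  let ?X = "test_graph_of n b es d"
  have sz: "tgraph_size ?X = n" by (simp add: tgraph_size_def test_graph_of_def)
  have adj: "(i, j) \<in> adjacency ?X \<longleftrightarrow> i < n \<and> j < n \<and> (\<exists>e\<in>set es. joins b i j e)" for i j
    unfolding adjacency_def sz by (auto simp: test_graph_of_def filter_empty_conv)
  have V: "0 \<in> V" "finite V" using tree by (simp_all add: rooted_tree_def)
  obtain i0 where i0: "i0 < n" "b i0 = 0"
    using V(1) b unfolding bij_betw_def by (metis atLeastLessThan_iff imageE)
  have n: "n \<ge> 1" using i0 by simp
  have con: "(i, i0) \<in> (adjacency ?X)\<^sup>*" if "i < n" for i
    using that
  proof (induction "b i" arbitrary: i rule: less_induct)
    case less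
    show ?case
    proof (cases "b i = 0")
      case True
      then have "i = i0" using b less.prems i0 unfolding bij_betw_def inj_on_def by auto
      then show ?thesis by simp
    next
      case False
      have "b i \<in> V" using b less.prems unfolding bij_betw_def by auto
      then obtain u where u: "u \<in> V" "u < b i" "(u, b i) \<in> set es \<or> (b i, u) \<in> set es"
        using tree False unfolding rooted_tree_def by blast
      then obtain j where j: "j < n" "u = b j"
        using b unfolding bij_betw_def by (metis atLeastLessThan_iff imageE)
      have "(i, j) \<in> adjacency ?X"
        unfolding adj joins_def using u(3) j less.prems by auto
      moreover have "(j, i0) \<in> (adjacency ?X)\<^sup>*" using less.hyps[of j] u(2) j by simp
      ultimately show ?thesis by (rule converse_rtrancl_into_rtrancl)
    qed
  qed
  have sym: "sym (adjacency ?X)"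
  proof (rule symI)
    fix i j assume "(i, j) \<in> adjacency ?X"
    then show "(j, i) \<in> adjacency ?X" unfolding adj using joins_commute[of b i j] by auto
  qed
  show ?thesis
    by (rule num_components_connected[of _ i0]) (use n i0 con sym sz in auto)
qed

context bounded_graphs
begin

definition msum :: "nat set \<Rightarrow> (nat \<times> nat) list \<Rightarrow> (nat \<Rightarrow> nat) \<Rightarrow> wgraph \<Rightarrow> real" where
  "msum V es d G = (\<Sum>f\<in>V \<rightarrow>\<^sub>E {..<sz G}. eprod G es f * (\<Prod>v\<in>V. vw G (f v) ^ d v)) / real (sz G)"

text \<open>The edge list, ordered arbitrarily, is grouped by unordered pairs of endpoints.\<close>

lemma eprod_as_matrix_product:
  assumes G: "G \<in> GG" and f: "\<And>i. i < n \<Longrightarrow> f (b i) < sz G" and b: "inj_on b {0..<n}"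
  shows "set es \<subseteq> b ` {0..<n} \<times> b ` {0..<n} \<Longrightarrow>
    (\<Prod>(i, j)\<in>{(i, j). i \<le> j \<and> j < n}. ew G (f (b i)) (f (b j)) ^ length (filter (joins b i j) es)) = eprod G es f"
proof (induction es)
  case Nil
  then show ?case by (simp add: case_prod_beta)
next
  case (Cons e es)
  let ?P = "{(i, j). i \<le> j \<and> j < n}"
  have finP: "finite ?P" by (rule finite_subset[of _ "{..n} \<times> {..n}"]) auto
  obtain i0 j0 where ij: "i0 < n" "j0 < n" "e = (b i0, b j0)" using Cons.prems by auto
  define p0 where "p0 = (min i0 j0, max i0 j0)"
  have p0: "p0 \<in> ?P" using ij by (auto simp: p0_def)
  have J: "joins b i j e \<longleftrightarrow> (i, j) = p0" if "(i, j) \<in> ?P" for i j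
  proof -
    have lt: "i \<le> j" "i < n" "j < n" using that by auto
    have eq: "b k = b l \<longleftrightarrow> k = l" if "k < n" "l < n" for k l using b that by (auto dest: inj_onD)
    have "joins b i j e \<longleftrightarrow> (i0 = i \<and> j0 = j) \<or> (i0 = j \<and> j0 = i)"
      using ij lt by (simp add: joins_def eq)
    then show ?thesis using lt by (auto simp: p0_def min_def max_def)
  qed
  have val: "ew G (f (b (fst p0))) (f (b (snd p0))) = ew G (f (fst e)) (f (snd e))"
    using ij f ew_sym[OF G] by (auto simp: p0_def min_def max_def)
  have "(\<Prod>(i, j)\<in>?P. ew G (f (b i)) (f (b j)) ^ length (filter (joins b i j) (e # es)))
      = (\<Prod>q\<in>?P. (if q = p0 then ew G (f (fst e)) (f (snd e)) else 1) *
          (case q of (i, j) \<Rightarrow> ew G (f (b i)) (f (b j)) ^ length (filter (joins b i j) es)))"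
  proof (intro prod.cong refl)
    fix q assume q: "q \<in> ?P"
    obtain i j where ijq: "q = (i, j)" by (cases q)
    show "(case q of (i, j) \<Rightarrow> ew G (f (b i)) (f (b j)) ^ length (filter (joins b i j) (e # es)))
      = (if q = p0 then ew G (f (fst e)) (f (snd e)) else 1) *
          (case q of (i, j) \<Rightarrow> ew G (f (b i)) (f (b j)) ^ length (filter (joins b i j) es))"
      using J[of i j] q val unfolding ijq by (cases "(i, j) = p0") auto
  qed
  also have "\<dots> = (\<Prod>q\<in>?P. if q = p0 then ew G (f (fst e)) (f (snd e)) else 1) * eprod G es f"
    using Cons by (simp add: prod.distrib)
  also have "(\<Prod>q\<in>?P. if q = p0 then ew G (f (fst e)) (f (snd e)) else 1) = ew G (f (fst e)) (f (snd e))"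
    using finP p0 by (subst prod.delta) auto
  finally show ?case by simp
qed

text \<open>A tree has one component, so its density is normalised by exactly one factor \<open>N\<close>.\<close>

lemma msum_is_density:
  assumes tree: "rooted_tree V es"
  obtains X where "test_graph X" "\<And>G. G \<in> GG \<Longrightarrow> hom_density X G = msum V es d G"
proof -
  have V: "finite V" "0 \<in> V" "set es \<subseteq> V \<times> V" using tree by (simp_all add: rooted_tree_def)
  obtain b where b: "bij_betw b {0..<card V} V" using ex_bij_betw_nat_finite[OF V(1)] by blast
  let ?n = "card V"
  let ?X = "test_graph_of ?n b es d"
  have n: "?n \<ge> 1" using V by (simp add: Suc_le_eq card_gt_0_iff) auto
  have inj: "inj_on b {0..<?n}" and img: "b ` {0..<?n} = V" using b by (auto simp: bij_betw_def)
  have over_V: "(\<Prod>v\<in>V. h v) = (\<Prod>i\<in>{0..<?n}. h (b i))" for h :: "nat \<Rightarrow> real"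
    using prod.reindex[OF inj, of h] by (simp only: img o_def)
  have sz: "tgraph_size ?X = ?n" by (simp add: tgraph_size_def test_graph_of_def)
  have "hom_density ?X G = msum V es d G" if G: "G \<in> GG" for G
  proof -
    let ?F = "\<lambda>f. (\<Prod>i\<in>{0..<?n}. vw G (f i) ^ d (b i)) *
        (\<Prod>(i, j)\<in>{(i, j). i \<le> j \<and> j < ?n}. ew G (f i) (f j) ^ length (filter (joins b i j) es))"
    have "(\<Sum>f\<in>{0..<?n} \<rightarrow>\<^sub>E {0..<sz G}. ?F f)
        = (\<Sum>f\<in>V \<rightarrow>\<^sub>E {..<sz G}. eprod G es f * (\<Prod>v\<in>V. vw G (f v) ^ d v))"
    proof (rule sum.reindex_bij_witness[of _ "\<lambda>g. \<lambda>i\<in>{0..<?n}. g (b i)" "\<lambda>f. \<lambda>v\<in>V. f (inv_into {0..<?n} b v)"])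
      fix f assume f: "f \<in> {0..<?n} \<rightarrow>\<^sub>E {0..<sz G}"
      let ?g = "\<lambda>v\<in>V. f (inv_into {0..<?n} b v)"
      have gb: "?g (b i) = f i" if "i < ?n" for i
        using that inj img by (auto simp: inv_into_f_f)
      show "(\<lambda>i\<in>{0..<?n}. ?g (b i)) = f"
      proof
        fix i show "(\<lambda>i\<in>{0..<?n}. ?g (b i)) i = f i"
        proof (cases "i < ?n")
          case True
          then show ?thesis using gb by simp
        next
          case False
          then show ?thesis using f by (simp add: PiE_def extensional_def)
        qed
      qed
      have inv: "inv_into {0..<?n} b v \<in> {0..<?n}" if "v \<in> V" for v
        using that img by (intro inv_into_into) simp
      show gP: "?g \<in> V \<rightarrow>\<^sub>E {..<sz G}"
      proof (rule restrict_PiE_iff[THEN iffD2], intro ballI)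
        fix v assume "v \<in> V"
        from inv[OF this] f show "f (inv_into {0..<?n} b v) \<in> {..<sz G}" by (auto simp: PiE_iff)
      qed
      have lt: "?g (b i) < sz G" if "i < ?n" for i
      proof -
        have "b i \<in> V" using that img by auto
        then show ?thesis using gP by (auto simp: PiE_iff)
      qed
      have "eprod G es ?g = (\<Prod>(i, j)\<in>{(i, j). i \<le> j \<and> j < ?n}. ew G (?g (b i)) (?g (b j)) ^ length (filter (joins b i j) es))"
        by (rule eprod_as_matrix_product[where f = ?g and b = b and n = ?n and es = es, symmetric])
           (use G lt inj V(3) img in simp_all)
      also have "\<dots> = (\<Prod>(i, j)\<in>{(i, j). i \<le> j \<and> j < ?n}. ew G (f i) (f j) ^ length (filter (joins b i j) es))"
      proof (intro prod.cong refl)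
        fix q assume "q \<in> {(i, j). i \<le> j \<and> j < ?n}"
        then obtain i j where q: "q = (i, j)" "i < ?n" "j < ?n" by auto
        show "(case q of (i, j) \<Rightarrow> ew G (?g (b i)) (?g (b j)) ^ length (filter (joins b i j) es))
          = (case q of (i, j) \<Rightarrow> ew G (f i) (f j) ^ length (filter (joins b i j) es))"
          unfolding q(1) prod.case gb[OF q(2)] gb[OF q(3)] ..
      qed
      finally have 1: "eprod G es ?g = \<dots>" .
      have "(\<Prod>v\<in>V. vw G (?g v) ^ d v) = (\<Prod>i\<in>{0..<?n}. vw G (?g (b i)) ^ d (b i))"
        by (rule over_V)
      also have "\<dots> = (\<Prod>i\<in>{0..<?n}. vw G (f i) ^ d (b i))"
        by (intro prod.cong refl) (simp only: atLeastLessThan_iff gb)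
      finally have 2: "(\<Prod>v\<in>V. vw G (?g v) ^ d v) = \<dots>" .
      show "eprod G es ?g * (\<Prod>v\<in>V. vw G (?g v) ^ d v) = ?F f"
        by (simp only: 1 2 mult.commute)
    next
      fix g assume g: "g \<in> V \<rightarrow>\<^sub>E {..<sz G}"
      let ?f = "\<lambda>i\<in>{0..<?n}. g (b i)"
      show "(\<lambda>v\<in>V. ?f (inv_into {0..<?n} b v)) = g"
      proof
        fix v show "(\<lambda>v\<in>V. ?f (inv_into {0..<?n} b v)) v = g v"
        proof (cases "v \<in> V")
          case True
          then have "v \<in> b ` {0..<?n}" by (simp only: img)
          then have "inv_into {0..<?n} b v \<in> {0..<?n}" "b (inv_into {0..<?n} b v) = v"
            by (rule inv_into_into, rule f_inv_into_f)
          then show ?thesis using True by simp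
        next
          case False
          then show ?thesis using g by (simp add: PiE_def extensional_def)
        qed
      qed
      show "?f \<in> {0..<?n} \<rightarrow>\<^sub>E {0..<sz G}"
        using g img by (auto simp: PiE_iff)
    qed
    moreover have "hom_density ?X G = (\<Sum>f\<in>{0..<?n} \<rightarrow>\<^sub>E {0..<sz G}. ?F f) / real (sz G)"
    proof -
      have W: "multiplicities ?X $$ (i, j) = length (filter (joins b i j) es)" if "i \<le> j" "j < ?n" for i j
        using that by (simp add: test_graph_of_def)
      have dd: "degrees ?X $ i = d (b i)" if "i < ?n" for i
        using that by (simp add: test_graph_of_def)
      have "(\<Prod>i\<in>{0..<?n}. vertex_weights G $ f i ^ (degrees ?X $ i)) *
          (\<Prod>(i, j)\<in>{(i, j). i \<le> j \<and> j < ?n}. edge_weights G $$ (f i, f j) ^ (multiplicities ?X $$ (i, j)))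
        = ?F f" for f
        unfolding vw_def ew_def
        by (intro arg_cong2[where f = "(*)"] prod.cong refl) (auto simp: W dd)
      then show ?thesis
        unfolding hom_density_def Let_def sz test_graph_of_connected[OF b tree] by simp
    qed
    ultimately show ?thesis by (simp only: msum_def)
  qed
  then show thesis by (intro that[OF test_graph_test_graph_of[OF n]])
qed

text \<open>The product of polynomials is expanded into monomials, and the exponents become vertex weights of
test graphs.\<close>

lemma polynomial_tree_sum_in_span:
  fixes c :: "nat \<Rightarrow> nat \<Rightarrow> real"
  assumes tree: "rooted_tree V es"
  obtains \<phi> where "\<phi> \<in> density_span"
    "\<And>G. G \<in> GG \<Longrightarrow> \<phi> G = (\<Sum>f\<in>V \<rightarrow>\<^sub>E {..<sz G}. eprod G es f * (\<Prod>v\<in>V. \<Sum>k\<le>K. c v k * vw G (f v) ^ k)) / real (sz G)"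
proof -
  have V: "finite V" using tree by (simp add: rooted_tree_def)
  have "\<forall>d. \<exists>X. test_graph X \<and> (\<forall>G\<in>GG. hom_density X G = msum V es d G)"
  proof
    fix d
    obtain X where "test_graph X" "\<And>G. G \<in> GG \<Longrightarrow> hom_density X G = msum V es d G"
      by (rule msum_is_density[OF tree, of d]) (rule that)
    then show "\<exists>X. test_graph X \<and> (\<forall>G\<in>GG. hom_density X G = msum V es d G)"
      by (intro exI[of _ X] conjI ballI)
  qed
  from choice[OF this] obtain X where
    XX: "\<forall>d. test_graph (X d) \<and> (\<forall>G\<in>GG. hom_density (X d) G = msum V es d G)" by (elim exE)
  have X: "test_graph (X d)" "G \<in> GG \<Longrightarrow> hom_density (X d) G = msum V es d G" for d G
    using XX by simp_all
  let ?Q = "V \<rightarrow>\<^sub>E {..K}"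
  have Q: "finite ?Q" using V by (intro finite_PiE) auto
  show thesis
  proof (rule that)
    show "(\<lambda>G. \<Sum>d\<in>?Q. (\<Prod>v\<in>V. c v (d v)) * hom_density (X d) G) \<in> density_span"
      by (intro density_span_sum[OF Q] density_span_scale hom_density_in_span X(1))
    fix G assume G: "G \<in> GG"
    have ex: "(\<Prod>v\<in>V. \<Sum>k\<le>K. c v k * vw G (f v) ^ k) = (\<Sum>d\<in>?Q. (\<Prod>v\<in>V. c v (d v)) * (\<Prod>v\<in>V. vw G (f v) ^ d v))" for f
      using prod_sum_PiE[OF V, of "\<lambda>_. {..K}" "\<lambda>v k. c v k * vw G (f v) ^ k"] by (simp add: prod.distrib)
    have "(\<Sum>f\<in>V \<rightarrow>\<^sub>E {..<sz G}. eprod G es f * (\<Prod>v\<in>V. \<Sum>k\<le>K. c v k * vw G (f v) ^ k))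
       = (\<Sum>f\<in>V \<rightarrow>\<^sub>E {..<sz G}. \<Sum>d\<in>?Q. (\<Prod>v\<in>V. c v (d v)) * (eprod G es f * (\<Prod>v\<in>V. vw G (f v) ^ d v)))"
      unfolding ex sum_distrib_left by (intro sum.cong refl) (simp only: mult_ac)
    also have "\<dots> = (\<Sum>d\<in>?Q. \<Sum>f\<in>V \<rightarrow>\<^sub>E {..<sz G}. (\<Prod>v\<in>V. c v (d v)) * (eprod G es f * (\<Prod>v\<in>V. vw G (f v) ^ d v)))"
      by (rule sum.swap)
    finally have e: "(\<Sum>f\<in>V \<rightarrow>\<^sub>E {..<sz G}. eprod G es f * (\<Prod>v\<in>V. \<Sum>k\<le>K. c v k * vw G (f v) ^ k))
      = (\<Sum>d\<in>?Q. (\<Prod>v\<in>V. c v (d v)) * (\<Sum>f\<in>V \<rightarrow>\<^sub>E {..<sz G}. eprod G es f * (\<Prod>v\<in>V. vw G (f v) ^ d v)))"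
      by (simp only: sum_distrib_left)
    show "(\<Sum>d\<in>?Q. (\<Prod>v\<in>V. c v (d v)) * hom_density (X d) G)
       = (\<Sum>f\<in>V \<rightarrow>\<^sub>E {..<sz G}. eprod G es f * (\<Prod>v\<in>V. \<Sum>k\<le>K. c v k * vw G (f v) ^ k)) / real (sz G)"
      unfolding e X(2)[OF G] msum_def by (simp only: times_divide_eq_right sum_divide_distrib[of _ ?Q])
  qed
qed

definition span_approximable :: "(wgraph \<Rightarrow> real) \<Rightarrow> bool" where
  "span_approximable F \<longleftrightarrow> (\<forall>e>0. \<exists>\<phi>\<in>density_span. \<forall>G\<in>GG. \<bar>F G - \<phi> G\<bar> \<le> e)"

text \<open>At a constant configuration the vertex functions depend on the external field alone, and on
\<open>[- C, C]\<close> they are approximated by polynomials.\<close>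

lemma span_approximable_tsum:
  assumes tree: "rooted_tree V es" and \<psi>: "\<And>v. cont2 (\<psi> v)"
  shows "span_approximable (\<lambda>G. tsum V es \<psi> G (\<lambda>i\<in>{..<sz G}. a))"
  unfolding span_approximable_def
proof (intro allI impI)
  fix e :: real assume e: "e > 0"
  have V: "finite V" using tree by (simp add: rooted_tree_def)
  define K where "K = D ^ length es"
  have K: "K > 0" by (simp add: K_def)
  have cont: "continuous_on {-C..C} (\<lambda>h. \<psi> v h a)" for v
  proof -
    have "continuous_on UNIV (\<lambda>h. \<psi> v h a)"
      by (rule continuous_on_compose2[OF \<psi>[of v], of UNIV "\<lambda>h. (h, a)", simplified])
         (intro continuous_intros)
    then show ?thesis by (rule continuous_on_subset) simp
  qed
  have "\<exists>M. \<forall>h\<in>{-C..C}. \<bar>\<psi> v h a\<bar> \<le> M" for v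
    using compact_imp_bounded[OF compact_continuous_image[OF cont[of v] compact_Icc]]
    unfolding bounded_iff by simp
  then obtain M where M: "\<And>v h. h \<in> {-C..C} \<Longrightarrow> \<bar>\<psi> v h a\<bar> \<le> M v" by metis
  define M' where "M' = (\<Sum>v\<in>V. \<bar>M v\<bar>)"
  have M': "M v \<le> M'" if "v \<in> V" for v
    using member_le_sum[OF that, of "\<lambda>v. \<bar>M v\<bar>"] V by (simp add: M'_def)
  obtain \<delta> where \<delta>: "\<delta> > 0"
    "\<And>a b :: nat \<Rightarrow> real. (\<And>v. v \<in> V \<Longrightarrow> \<bar>a v\<bar> \<le> M') \<Longrightarrow> (\<And>v. v \<in> V \<Longrightarrow> \<bar>a v - b v\<bar> \<le> \<delta>)
        \<Longrightarrow> \<bar>prod a V - prod b V\<bar> \<le> e / K"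
    using prod_close[of V "e / K" M'] V e K by (metis divide_pos_pos)
  have "\<exists>c n. \<forall>h\<in>{-C..C}. \<bar>\<psi> v h a - (\<Sum>k\<le>n. c k * h ^ k)\<bar> \<le> \<delta>" for v
  proof -
    obtain P where P: "real_polynomial_function P" "\<And>h. h \<in> {-C..C} \<Longrightarrow> \<bar>\<psi> v h a - P h\<bar> < \<delta>"
      by (rule Stone_Weierstrass_real_polynomial_function[OF compact_Icc cont \<delta>(1)]) (rule that)
    then obtain c n where "P = (\<lambda>h. \<Sum>k\<le>n. c k * h ^ k)" unfolding real_polynomial_function_iff_sum by blast
    with P(2) show ?thesis by (intro exI[of _ c] exI[of _ n]) (auto intro: less_imp_le)
  qed
  then obtain c n where c: "\<And>v h. h \<in> {-C..C} \<Longrightarrow> \<bar>\<psi> v h a - (\<Sum>k\<le>n v. c v k * h ^ k)\<bar> \<le> \<delta>" by metis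
  define K' where "K' = (\<Sum>v\<in>V. n v)"
  \<comment> \<open>A common degree bound for all vertices.\<close>
  define c' where "c' v k = (if k \<le> n v then c v k else 0)" for v k
  have c': "(\<Sum>k\<le>K'. c' v k * h ^ k) = (\<Sum>k\<le>n v. c v k * h ^ k)" if "v \<in> V" for v h
  proof -
    have le: "n v \<le> K'" using member_le_sum[OF that, of n] V by (simp add: K'_def)
    have "(\<Sum>k\<le>n v. c v k * h ^ k) = (\<Sum>k\<le>n v. c' v k * h ^ k)" by (simp add: c'_def)
    also have "\<dots> = (\<Sum>k\<le>K'. c' v k * h ^ k)"
      using le by (intro sum.mono_neutral_left) (auto simp: c'_def)
    finally show ?thesis by simp
  qed
  obtain \<phi> where \<phi>: "\<phi> \<in> density_span"
    "\<And>G. G \<in> GG \<Longrightarrow> \<phi> G = (\<Sum>f\<in>V \<rightarrow>\<^sub>E {..<sz G}. eprod G es f * (\<Prod>v\<in>V. \<Sum>k\<le>K'. c' v k * vw G (f v) ^ k)) / real (sz G)"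
    by (rule polynomial_tree_sum_in_span[OF tree, where K = K' and c = c']) (rule that)
  show "\<exists>\<phi>\<in>density_span. \<forall>G\<in>GG. \<bar>tsum V es \<psi> G (\<lambda>i\<in>{..<sz G}. a) - \<phi> G\<bar> \<le> e"
  proof (intro bexI[OF _ \<phi>(1)] ballI)
    fix G assume G: "G \<in> GG"
    let ?a = "\<lambda>f v. \<psi> v (vw G (f v)) a" and ?b = "\<lambda>f v. \<Sum>k\<le>K'. c' v k * vw G (f v) ^ k"
    have ab: "\<bar>prod (?a f) V - prod (?b f) V\<bar> \<le> e / K" if f: "f \<in> V \<rightarrow>\<^sub>E {..<sz G}" for f
    proof (rule \<delta>(2))
      fix v assume v: "v \<in> V"
      then have "f v < sz G" using f by auto
      from vw_le[OF G this] have h: "vw G (f v) \<in> {-C..C}" by (simp add: abs_le_iff minus_le_iff)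
      show "\<bar>?a f v\<bar> \<le> M'" using M[OF h, of v] M'[OF v] by linarith
      show "\<bar>?a f v - ?b f v\<bar> \<le> \<delta>" unfolding c'[OF v] by (rule c[OF h])
    qed
    have "tsum V es \<psi> G (\<lambda>i\<in>{..<sz G}. a) = (\<Sum>f\<in>V \<rightarrow>\<^sub>E {..<sz G}. eprod G es f * prod (?a f) V) / real (sz G)"
    proof -
      have "prod (\<lambda>v. \<psi> v (vw G (f v)) ((\<lambda>i\<in>{..<sz G}. a) (f v))) V = prod (?a f) V"
        if "f \<in> V \<rightarrow>\<^sub>E {..<sz G}" for f
        using that by (intro prod.cong) auto
      then show ?thesis by (simp add: tsum_def kern_def)
    qed
    then have "tsum V es \<psi> G (\<lambda>i\<in>{..<sz G}. a) - \<phi> G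
       = (\<Sum>f\<in>V \<rightarrow>\<^sub>E {..<sz G}. eprod G es f * (prod (?a f) V - prod (?b f) V)) / real (sz G)"
      unfolding \<phi>(2)[OF G] by (simp only: right_diff_distrib sum_subtractf diff_divide_distrib)
    then have "\<bar>tsum V es \<psi> G (\<lambda>i\<in>{..<sz G}. a) - \<phi> G\<bar>
       = \<bar>(\<Sum>f\<in>V \<rightarrow>\<^sub>E {..<sz G}. eprod G es f * (prod (?a f) V - prod (?b f) V)) / real (sz G)\<bar>"
      by (rule arg_cong)
    also have "\<dots> \<le> K * (e / K)" unfolding K_def
      by (rule weighted_tree_average[OF G tree ab[unfolded K_def]])
    also have "\<dots> = e" using K by simp
    finally show "\<bar>tsum V es \<psi> G (\<lambda>i\<in>{..<sz G}. a) - \<phi> G\<bar> \<le> e" .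
  qed
qed

lemma span_approximableE:
  assumes "span_approximable F" "e > 0"
  obtains \<phi> where "\<phi> \<in> density_span" "\<And>G. G \<in> GG \<Longrightarrow> \<bar>F G - \<phi> G\<bar> \<le> e"
  using assms unfolding span_approximable_def by blast

lemma span_approximable_add:
  assumes "span_approximable F" "span_approximable F'"
  shows "span_approximable (\<lambda>G. F G + F' G)"
  unfolding span_approximable_def
proof (intro allI impI)
  fix e :: real assume "e > 0"
  then have e: "e / 2 > 0" by simp
  obtain \<phi> where 1: "\<phi> \<in> density_span" "\<And>G. G \<in> GG \<Longrightarrow> \<bar>F G - \<phi> G\<bar> \<le> e / 2"
    by (rule span_approximableE[OF assms(1) e]) (rule that)
  obtain \<phi>' where 2: "\<phi>' \<in> density_span" "\<And>G. G \<in> GG \<Longrightarrow> \<bar>F' G - \<phi>' G\<bar> \<le> e / 2"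
    by (rule span_approximableE[OF assms(2) e]) (rule that)
  show "\<exists>\<phi>\<in>density_span. \<forall>G\<in>GG. \<bar>F G + F' G - \<phi> G\<bar> \<le> e"
  proof (intro bexI[OF _ density_span_add[OF 1(1) 2(1)]] ballI)
    fix G assume "G \<in> GG"
    from 1(2)[OF this] 2(2)[OF this] show "\<bar>F G + F' G - (\<phi> G + \<phi>' G)\<bar> \<le> e" by linarith
  qed
qed

lemma span_approximable_scale:
  assumes "span_approximable F"
  shows "span_approximable (\<lambda>G. c * F G)"
  unfolding span_approximable_def
proof (intro allI impI)
  fix e :: real assume "e > 0"
  then have e: "e / (\<bar>c\<bar> + 1) > 0" by simp
  obtain \<phi> where 1: "\<phi> \<in> density_span" "\<And>G. G \<in> GG \<Longrightarrow> \<bar>F G - \<phi> G\<bar> \<le> e / (\<bar>c\<bar> + 1)"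
    by (rule span_approximableE[OF assms(1) e]) (rule that)
  show "\<exists>\<phi>\<in>density_span. \<forall>G\<in>GG. \<bar>c * F G - \<phi> G\<bar> \<le> e"
  proof (intro bexI[OF _ density_span_scale[OF 1(1)]] ballI)
    fix G assume G: "G \<in> GG"
    have "\<bar>c * F G - c * \<phi> G\<bar> = \<bar>c\<bar> * \<bar>F G - \<phi> G\<bar>" by (simp only: right_diff_distrib[symmetric] abs_mult)
    also have "\<dots> \<le> (\<bar>c\<bar> + 1) * (e / (\<bar>c\<bar> + 1))" using 1(2)[OF G] by (intro mult_mono) auto
    also have "\<dots> = e" by (simp add: add_nonneg_eq_0_iff)
    finally show "\<bar>c * F G - c * \<phi> G\<bar> \<le> e" .
  qed
qed

lemma span_approximable_limit:
  assumes "\<And>e. e > 0 \<Longrightarrow> \<exists>F'. span_approximable F' \<and> (\<forall>G\<in>GG. \<bar>F G - F' G\<bar> \<le> e)"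
  shows "span_approximable F"
  unfolding span_approximable_def
proof (intro allI impI)
  fix e :: real assume "e > 0"
  then have e: "e / 2 > 0" by simp
  obtain F' where F': "span_approximable F'" "\<forall>G\<in>GG. \<bar>F G - F' G\<bar> \<le> e / 2"
    using assms[OF e] by blast
  obtain \<phi> where 1: "\<phi> \<in> density_span" "\<And>G. G \<in> GG \<Longrightarrow> \<bar>F' G - \<phi> G\<bar> \<le> e / 2"
    by (rule span_approximableE[OF F'(1) e]) (rule that)
  show "\<exists>\<phi>\<in>density_span. \<forall>G\<in>GG. \<bar>F G - \<phi> G\<bar> \<le> e"
  proof (intro bexI[OF _ 1(1)] ballI)
    fix G assume G: "G \<in> GG"
    have "\<bar>F G - F' G\<bar> \<le> e / 2" using F'(2) G by blast
    with 1(2)[OF G] show "\<bar>F G - \<phi> G\<bar> \<le> e" by linarith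
  qed
qed

text \<open>This is how observables of configurations become functions of graphs.\<close>

theorem lapprox_evaluated:
  assumes F: "lapprox S F" and a: "a \<in> S"
  shows "span_approximable (\<lambda>G. F G (\<lambda>i\<in>{..<sz G}. a))"
proof (rule span_approximable_limit)
  fix e :: real assume e: "e > 0"
  obtain F' where F': "lspan F'" "\<And>G x. G \<in> GG \<Longrightarrow> x \<in> {..<sz G} \<rightarrow>\<^sub>E S \<Longrightarrow> \<bar>F G x - F' G x\<bar> \<le> e"
    by (rule lapproxE[OF F e]) (rule that)
  have L: "span_approximable (\<lambda>G. F' G (\<lambda>i\<in>{..<sz G}. a))"
    using F'(1)
  proof induction
    case (base V es \<psi>)
    show ?case by (rule span_approximable_tsum[OF base])
  next
    case (add F F')
    from span_approximable_add[OF add.IH] show ?case .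
  next
    case (scale F c)
    from span_approximable_scale[OF scale.IH] show ?case .
  qed
  have "(\<lambda>i\<in>{..<sz G}. a) \<in> {..<sz G} \<rightarrow>\<^sub>E S" for G using a by auto
  then show "\<exists>F'. span_approximable F' \<and> (\<forall>G\<in>GG. \<bar>F G (\<lambda>i\<in>{..<sz G}. a) - F' G\<bar> \<le> e)"
    using F'(2) by (intro exI[of _ "\<lambda>G. F' G (\<lambda>i\<in>{..<sz G}. a)"] conjI L ballI) blast
qed

text \<open>A sequence of combinations converging uniformly can be replaced by the existence of one combination
for each error.\<close>

lemma local_functions_iff: "F \<in> local_functions GG \<longleftrightarrow> span_approximable F"
proof
  assume "F \<in> local_functions GG"
  then obtain p where p: "\<And>k::nat. p k \<in> density_span" "uniform_limit GG p F sequentially"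
    unfolding local_functions_def by blast
  show "span_approximable F"
    unfolding span_approximable_def
  proof (intro allI impI)
    fix e :: real assume "e > 0"
    from uniform_limitD[OF p(2) this] obtain k where "\<forall>G\<in>GG. dist (p k G) (F G) < e"
      unfolding eventually_sequentially by blast
    then show "\<exists>\<phi>\<in>density_span. \<forall>G\<in>GG. \<bar>F G - \<phi> G\<bar> \<le> e"
      using p(1) by (intro bexI[of _ "p k"]) (auto simp: dist_real_def abs_minus_commute less_imp_le)
  qed
next
  assume F: "span_approximable F"
  have "\<exists>\<phi>\<in>density_span. \<forall>G\<in>GG. \<bar>F G - \<phi> G\<bar> \<le> 1 / real (Suc k)" for k
    using F unfolding span_approximable_def by simp
  then obtain p where p: "\<And>k. p k \<in> density_span" "\<And>k G. G \<in> GG \<Longrightarrow> \<bar>F G - p k G\<bar> \<le> 1 / real (Suc k)" by metis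
  have "uniform_limit GG p F sequentially"
  proof (rule uniform_limitI)
    fix e :: real assume "e > 0"
    then obtain n where n: "1 / real (Suc n) < e" using nat_approx_posE by blast
    have "dist (p k G) (F G) < e" if "k \<ge> n" "G \<in> GG" for k G
    proof -
      have "1 / real (Suc k) \<le> 1 / real (Suc n)" using that(1) by (simp add: frac_le)
      then show ?thesis using p(2)[OF that(2), of k] n by (simp add: dist_real_def abs_minus_commute)
    qed
    then show "\<forall>\<^sub>F k in sequentially. \<forall>G\<in>GG. dist (p k G) (F G) < e"
      unfolding eventually_sequentially by blast
  qed
  then show "F \<in> local_functions GG" using p(1) unfolding local_functions_def by blast
qed

end

section \<open>Log-concave site weights\<close>

definition lat :: "real \<Rightarrow> nat \<Rightarrow> real set" where
  "lat \<epsilon> K = (\<lambda>k::int. \<epsilon> * of_int k) ` {- int K..int K}"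

lemma lat_iff: "x \<in> lat \<epsilon> K \<longleftrightarrow> (\<exists>k::int. x = \<epsilon> * of_int k \<and> \<bar>k\<bar> \<le> int K)"
proof
  assume "x \<in> lat \<epsilon> K"
  then show "\<exists>k::int. x = \<epsilon> * of_int k \<and> \<bar>k\<bar> \<le> int K" unfolding lat_def by force
next
  assume "\<exists>k::int. x = \<epsilon> * of_int k \<and> \<bar>k\<bar> \<le> int K"
  then obtain k :: int where "x = \<epsilon> * of_int k" "\<bar>k\<bar> \<le> int K" by blast
  then show "x \<in> lat \<epsilon> K" unfolding lat_def by (intro image_eqI[of _ _ k]) auto
qed

lemma finite_lat: "finite (lat \<epsilon> K)"
  by (simp add: lat_def)

lemma zero_in_lat: "0 \<in> lat \<epsilon> K"
  unfolding lat_iff by (intro exI[of _ 0]) simp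

lemma lat_bound: "\<epsilon> \<ge> 0 \<Longrightarrow> x \<in> lat \<epsilon> K \<Longrightarrow> \<bar>x\<bar> \<le> \<epsilon> * real K"
proof -
  assume e: "\<epsilon> \<ge> 0" and "x \<in> lat \<epsilon> K"
  then obtain k :: int where k: "x = \<epsilon> * of_int k" "\<bar>k\<bar> \<le> int K" unfolding lat_iff by blast
  have "\<bar>real_of_int k\<bar> \<le> real K" using k(2) by linarith
  then show ?thesis using e by (simp add: k(1) abs_mult mult_left_mono)
qed

lemma lattice_segment_lat:
  assumes "\<epsilon> > 0"
  shows "lattice_segment \<epsilon> (lat \<epsilon> K)"
  unfolding lattice_segment_def
proof (intro conjI ballI allI impI)
  show "finite (lat \<epsilon> K)" "lat \<epsilon> K \<noteq> {}" "\<epsilon> > 0" using finite_lat zero_in_lat[of \<epsilon> K] assms by auto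
  fix x y l assume "x \<in> lat \<epsilon> K" "y \<in> lat \<epsilon> K" and le: "x + \<epsilon> * real l \<le> y"
  then obtain k k' :: int where k: "x = \<epsilon> * of_int k" "\<bar>k\<bar> \<le> int K" "y = \<epsilon> * of_int k'" "\<bar>k'\<bar> \<le> int K"
    unfolding lat_iff by auto
  have "\<epsilon> * (of_int k + real l) \<le> \<epsilon> * of_int k'" using le k by (simp add: algebra_simps)
  then have "of_int k + real l \<le> of_int k'" using assms by simp
  then have "k + int l \<le> k'" by linarith
  then have "\<bar>k + int l\<bar> \<le> int K" "\<bar>k' - int l\<bar> \<le> int K" using k by linarith+
  moreover have "x + \<epsilon> * real l = \<epsilon> * of_int (k + int l)" "y - \<epsilon> * real l = \<epsilon> * of_int (k' - int l)"
    using k by (simp_all add: algebra_simps)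
  ultimately show "x + \<epsilon> * real l \<in> lat \<epsilon> K" "y - \<epsilon> * real l \<in> lat \<epsilon> K" unfolding lat_iff by blast+
qed

lemma tanh_lipschitz: "u \<le> v \<Longrightarrow> tanh v - tanh u \<le> v - (u::real)"
proof -
  assume "u \<le> v"
  have "(\<lambda>x. x - tanh x) u \<le> (\<lambda>x. x - tanh x) v"
  proof (rule DERIV_nonneg_imp_nondecreasing[OF \<open>u \<le> v\<close>])
    fix x :: real
    have "((\<lambda>x. x - tanh x) has_real_derivative 1 - (1 - tanh x ^ 2) * 1) (at x)"
      by (auto intro!: derivative_eq_intros)
    then show "\<exists>y. ((\<lambda>x. x - tanh x) has_real_derivative y) (at x) \<and> 0 \<le> y" by (intro exI conjI) auto
  qed
  then show ?thesis by simp
qed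

lemma cosh_le_exp_half_square: "cosh (x::real) \<le> exp (x\<^sup>2 / 2)"
proof -
  have main: "cosh x \<le> exp (x\<^sup>2 / 2)" if x: "0 \<le> x" for x :: real
  proof -
    let ?f = "\<lambda>x. x\<^sup>2 / 2 - ln (cosh x)"
    have "?f 0 \<le> ?f x"
    proof (rule DERIV_nonneg_imp_nondecreasing[OF x])
      fix y :: real assume y: "0 \<le> y" "y \<le> x"
      have "(?f has_real_derivative y - sinh y / cosh y) (at y)"
        by (auto intro!: derivative_eq_intros)
      then have "(?f has_real_derivative y - tanh y) (at y)" by (simp only: tanh_def)
      moreover have "0 \<le> y - tanh y" using tanh_lipschitz[of 0 y] y by simp
      ultimately show "\<exists>z. (?f has_real_derivative z) (at y) \<and> 0 \<le> z" by blast
    qed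
    then have "exp (ln (cosh x)) \<le> exp (x\<^sup>2 / 2)" unfolding exp_le_cancel_iff by simp
    then show ?thesis by (simp only: exp_ln cosh_real_pos)
  qed
  show ?thesis using main[of x] main[of "- x"] by (cases "0 \<le> x") auto
qed

lemma cosh_ge_quadratic: "1 + x\<^sup>2 / 2 \<le> cosh (x::real)"
proof -
  have sinh_ge: "x \<le> sinh x" if x: "0 \<le> x" for x :: real
  proof -
    have "sinh 0 - 0 \<le> sinh x - x"
    proof (rule DERIV_nonneg_imp_nondecreasing[OF x])
      fix y :: real
      have "((\<lambda>x. sinh x - x) has_real_derivative cosh y - 1) (at y)"
        by (auto intro!: derivative_eq_intros)
      then show "\<exists>z. ((\<lambda>x. sinh x - x) has_real_derivative z) (at y) \<and> 0 \<le> z"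
        using cosh_real_ge_1[of y] by (intro exI conjI) auto
    qed
    then show ?thesis by simp
  qed
  have main: "1 + x\<^sup>2 / 2 \<le> cosh x" if x: "0 \<le> x" for x :: real
  proof -
    have "cosh 0 - 1 - 0\<^sup>2 / 2 \<le> cosh x - 1 - x\<^sup>2 / 2"
    proof (rule DERIV_nonneg_imp_nondecreasing[OF x])
      fix y :: real assume y: "0 \<le> y" "y \<le> x"
      have "((\<lambda>x. cosh x - 1 - x\<^sup>2 / 2) has_real_derivative sinh y - y) (at y)"
        by (auto intro!: derivative_eq_intros)
      then show "\<exists>z. ((\<lambda>x. cosh x - 1 - x\<^sup>2 / 2) has_real_derivative z) (at y) \<and> 0 \<le> z"
        using sinh_ge[OF y(1)] by (intro exI conjI) auto
    qed
    then show ?thesis by simp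
  qed
  show ?thesis using main[of x] main[of "- x"] by (cases "0 \<le> x") auto
qed

lemma ln_one_plus_ge_quadratic: "0 \<le> x \<Longrightarrow> x - x\<^sup>2 / 2 \<le> ln (1 + x :: real)"
proof -
  assume x: "0 \<le> x"
  let ?f = "\<lambda>x. ln (1 + x) - x + x\<^sup>2 / 2"
  have "?f 0 \<le> ?f x"
  proof (rule DERIV_nonneg_imp_nondecreasing[OF x])
    fix y :: real assume y: "0 \<le> y" "y \<le> x"
    have "(?f has_real_derivative 1 / (1 + y) - 1 + y) (at y)"
      using y by (auto intro!: derivative_eq_intros)
    moreover have "1 / (1 + y) - 1 + y = y\<^sup>2 / (1 + y)" using y by (simp add: field_simps power2_eq_square)
    then have "0 \<le> 1 / (1 + y) - 1 + y" using y by simp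
    ultimately show "\<exists>z. (?f has_real_derivative z) (at y) \<and> 0 \<le> z" by blast
  qed
  then show ?thesis by simp
qed

text \<open>One-step ratios that decrease by the factor \<open>exp (- \<mu>)\<close> give the second-difference bound for steps of any
length.\<close>

lemma log_concave_step_to_multistep:
  fixes g :: "nat \<Rightarrow> real"
  assumes pos: "\<And>k. k \<le> n \<Longrightarrow> g k > 0"
    and step: "\<And>k. Suc (Suc k) \<le> n \<Longrightarrow> g (Suc (Suc k)) / g (Suc k) \<le> g (Suc k) / g k * exp (- \<mu>)"
  shows "i \<le> j \<Longrightarrow> j + l \<le> n \<Longrightarrow> g i * g (j + l) * exp (\<mu> * real l * real (j - i)) \<le> g j * g (i + l)"
proof (induction l)
  case (Suc l)
  have ratio: "g (Suc (m + d)) / g (m + d) \<le> g (Suc m) / g m * exp (- \<mu> * real d)" if "Suc (m + d) \<le> n" for m d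
    using that
  proof (induction d)
    case (Suc d)
    have "g (Suc (m + Suc d)) / g (m + Suc d) \<le> g (Suc (m + d)) / g (m + d) * exp (- \<mu>)"
      using step[of "m + d"] Suc.prems by simp
    also have "\<dots> \<le> g (Suc m) / g m * exp (- \<mu> * real d) * exp (- \<mu>)"
      using Suc by (intro mult_right_mono) auto
    also have "\<dots> = g (Suc m) / g m * exp (- \<mu> * real (Suc d))"
      by (simp add: algebra_simps flip: exp_add)
    finally show ?case .
  qed simp
  let ?E = "\<lambda>t. exp (\<mu> * t * real (j - i))"
  have p: "g i > 0" "g (j + l) > 0" "g (i + l) > 0" "g j > 0" using Suc.prems by (auto intro!: pos)
  have "g (Suc (j + l)) / g (j + l) \<le> g (Suc (i + l)) / g (i + l) * exp (- \<mu> * real (j - i))"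
    using ratio[of "i + l" "j - i"] Suc.prems by (simp add: add.commute add.left_commute)
  then have 1: "g (Suc (j + l)) \<le> g (j + l) * (g (Suc (i + l)) / g (i + l) * exp (- \<mu> * real (j - i)))"
    using p by (simp add: divide_le_eq mult.commute)
  have "g i * g (j + Suc l) * ?E (real (Suc l))
     \<le> g i * (g (j + l) * (g (Suc (i + l)) / g (i + l) * exp (- \<mu> * real (j - i)))) * ?E (real (Suc l))"
    using 1 p by (intro mult_right_mono mult_left_mono) auto
  also have "\<dots> = (g i * g (j + l) * ?E (real l)) * (g (Suc (i + l)) / g (i + l))"
  proof -
    have "exp (- \<mu> * real (j - i)) * ?E (real (Suc l)) = ?E (real l)"
      by (simp add: algebra_simps flip: exp_add)
    then show ?thesis by (simp add: mult_ac)
  qed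
  also have "\<dots> \<le> (g j * g (i + l)) * (g (Suc (i + l)) / g (i + l))"
    using Suc p pos[of "Suc (i + l)"] by (intro mult_right_mono) auto
  also have "\<dots> = g j * g (i + Suc l)" using p by simp
  finally show ?case .
qed simp

definition binom_pt :: "nat \<Rightarrow> nat \<Rightarrow> real" where
  "binom_pt n k = (2 * real k - real n) / sqrt (real n)"

definition binom_pts :: "nat \<Rightarrow> real set" where
  "binom_pts n = binom_pt n ` {..n}"

text \<open>The rounding recovers the index \<open>k\<close> from the point \<open>binom_pt n k\<close> and makes the weight a
function on the reals.\<close>

definition binom_wt :: "nat \<Rightarrow> real \<Rightarrow> real" where
  "binom_wt n t = real (n choose nat \<lfloor>(t * sqrt (real n) + real n) / 2\<rfloor>) / 2 ^ n"

context
  fixes n :: nat assumes n: "n > 0"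
begin

lemma binom_pt_inverse: "(binom_pt n k * sqrt (real n) + real n) / 2 = real k"
  using n by (simp add: binom_pt_def)

lemma binom_wt_pt: "binom_wt n (binom_pt n k) = real (n choose k) / 2 ^ n"
  by (simp add: binom_wt_def binom_pt_inverse)

lemma binom_pt_shift: "binom_pt n k + 2 / sqrt (real n) * real l = binom_pt n (k + l)"
  by (simp add: binom_pt_def add_divide_distrib diff_divide_distrib algebra_simps)

lemma binom_pt_le: "binom_pt n k \<le> binom_pt n k' \<longleftrightarrow> k \<le> k'"
  using n by (simp add: binom_pt_def divide_le_cancel)

lemma binom_pt_inj: "binom_pt n k = binom_pt n k' \<longleftrightarrow> k = k'"
  using binom_pt_le[of k k'] binom_pt_le[of k' k] by auto

lemma binom_pts_shift: "binom_pt n k \<in> binom_pts n \<longleftrightarrow> k \<le> n"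
  by (auto simp: binom_pts_def image_iff binom_pt_inj)

lemma lattice_segment_binom: "lattice_segment (2 / sqrt (real n)) (binom_pts n)"
  unfolding lattice_segment_def
proof (intro conjI ballI allI impI)
  show "finite (binom_pts n)" "binom_pts n \<noteq> {}" "0 < 2 / sqrt (real n)" using n by (auto simp: binom_pts_def)
  fix x y l assume "x \<in> binom_pts n" "y \<in> binom_pts n" and le: "x + 2 / sqrt (real n) * real l \<le> y"
  then obtain k k' where k: "x = binom_pt n k" "k \<le> n" "y = binom_pt n k'" "k' \<le> n"
    unfolding binom_pts_def by auto
  have kk: "k + l \<le> k'" using le unfolding k binom_pt_shift binom_pt_le .
  then show "x + 2 / sqrt (real n) * real l \<in> binom_pts n" using k unfolding k binom_pt_shift binom_pts_shift by simp
  have "y = binom_pt n (k' - l) + 2 / sqrt (real n) * real l" using kk unfolding k binom_pt_shift by simp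
  then show "y - 2 / sqrt (real n) * real l \<in> binom_pts n" using k by (simp add: binom_pts_shift)
qed

text \<open>The ratio of consecutive ratios of binomial coefficients is \<open>1 - (n + 1) / ((k + 2) (n - k))\<close>, and the
denominator is at most \<open>((n + 2) / 2)\<^sup>2\<close>.\<close>

lemma binomial_ratio_step:
  assumes "Suc (Suc k) \<le> n"
  shows "real (n choose Suc (Suc k)) / real (n choose Suc k)
    \<le> real (n choose Suc k) / real (n choose k) * exp (- (4 * (real n + 1) / (real n + 2)\<^sup>2))"
proof -
  have r: "real (n choose Suc m) / real (n choose m) = (real n - real m) / (real m + 1)" if "Suc m \<le> n" for m
  proof -
    have "real (Suc m) * real (n choose Suc m) = real (n - m) * real (n choose m)"
      using binomial_absorb_comp[of n m] binomial_absorption[of m n] that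
      by (metis Suc_le_lessD binomial_absorption binomial_absorb_comp of_nat_mult)
    moreover have "real (n choose m) > 0" using that by simp
    ultimately show ?thesis using that by (simp add: field_simps of_nat_diff)
  qed
  define x where "x = real k"
  define N where "N = real n"
  have xN: "0 \<le> x" "x + 2 \<le> N" using assms by (simp_all add: x_def N_def)
  \<comment> \<open>Arithmetic and geometric mean of \<open>x + 2\<close> and \<open>N - x\<close>.\<close>
  have amgm: "4 * ((x + 2) * (N - x)) \<le> (N + 2)\<^sup>2"
    using sum_squares_ge_zero[of "2 * x + 2 - N" 0] by (simp add: power2_eq_square algebra_simps)
  have d: "(x + 2) * (N - x) > 0" using xN by simp
  have "4 * (N + 1) / (N + 2)\<^sup>2 \<le> 4 * (N + 1) / (4 * ((x + 2) * (N - x)))"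
    using amgm d xN by (intro divide_left_mono) auto
  also have "\<dots> = (N + 1) / ((x + 2) * (N - x))" by (rule mult_divide_mult_cancel_left) simp
  finally have "1 - (N + 1) / ((x + 2) * (N - x)) \<le> 1 + - (4 * (N + 1) / (N + 2)\<^sup>2)" by simp
  also have "\<dots> \<le> exp (- (4 * (N + 1) / (N + 2)\<^sup>2))" by (rule exp_ge_add_one_self)
  finally have e: "1 - (N + 1) / ((x + 2) * (N - x)) \<le> exp (- (4 * (N + 1) / (N + 2)\<^sup>2))" .
  have "(N - (x + 1)) / (x + 1 + 1) = (N - x) / (x + 1) * (1 - (N + 1) / ((x + 2) * (N - x)))"
  proof -
    have "(x + 2) * (N - x) - (N + 1) = (N - (x + 1)) * (x + 1)" by (simp add: algebra_simps)
    then have "1 - (N + 1) / ((x + 2) * (N - x)) = (N - (x + 1)) * (x + 1) / ((x + 2) * (N - x))"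
      using xN by (simp add: diff_divide_eq_iff)
    then show ?thesis using xN by (simp add: add.assoc)
  qed
  also have "\<dots> \<le> (N - x) / (x + 1) * exp (- (4 * (N + 1) / (N + 2)\<^sup>2))"
    using e xN by (intro mult_left_mono) auto
  finally show ?thesis using r[of "Suc k"] r[of k] assms by (simp add: x_def N_def add.commute)
qed

text \<open>The rescaled binomial distribution has curvature tending to one, as the standard Gaussian has. It
has finite support, which the conditional expectations require.\<close>

lemma curved_binom:
  "curved_weight (real n * (real n + 1) / (real n + 2)\<^sup>2) (2 / sqrt (real n)) (binom_pts n) (binom_wt n)"
  unfolding curved_weight_def
proof (intro conjI ballI allI impI)
  let ?g = "\<lambda>k. real (n choose k) / 2 ^ n" and ?\<mu> = "4 * (real n + 1) / (real n + 2)\<^sup>2"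
  show "0 < binom_wt n x" if "x \<in> binom_pts n" for x
    using that by (auto simp: binom_pts_def binom_wt_pt)
  fix u v l assume u: "u \<in> binom_pts n" and v: "v \<in> binom_pts n" and uv: "u \<le> v"
    and ul: "u + 2 / sqrt (real n) * real l \<in> binom_pts n" and vl: "v + 2 / sqrt (real n) * real l \<in> binom_pts n"
  obtain i j where ij: "u = binom_pt n i" "v = binom_pt n j" using u v by (auto simp: binom_pts_def)
  have le: "i \<le> j" "j + l \<le> n" using uv vl unfolding ij binom_pt_shift binom_pt_le binom_pts_shift by auto
  have "?g i * ?g (j + l) * exp (?\<mu> * real l * real (j - i)) \<le> ?g j * ?g (i + l)"
    by (rule log_concave_step_to_multistep[OF _ _ le]) (use binomial_ratio_step in simp_all)
  moreover have "real n * (real n + 1) / (real n + 2)\<^sup>2 * (2 / sqrt (real n) * real l) * (v - u) = ?\<mu> * real l * real (j - i)"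
  proof -
    define s where "s = sqrt (real n)"
    have s: "s > 0" "real n = s * s" using n by (simp_all add: s_def)
    have vu: "v - u = 2 / s * real (j - i)"
      using le by (simp add: ij binom_pt_def of_nat_diff s_def[symmetric] diff_divide_distrib algebra_simps)
    have "real n * X / Y * (2 / s * real l) * (2 / s * d) = 4 * X / Y * real l * d" for X Y d
      using s(1) unfolding s(2) by simp
    then show ?thesis unfolding vu s_def[symmetric] by blast
  qed
  ultimately show "binom_wt n u * binom_wt n (v + 2 / sqrt (real n) * real l) *
        exp (real n * (real n + 1) / (real n + 2)\<^sup>2 * (2 / sqrt (real n) * real l) * (v - u))
      \<le> binom_wt n v * binom_wt n (u + 2 / sqrt (real n) * real l)"
    by (simp only: ij binom_pt_shift binom_wt_pt)
qed

lemma binom_symmetric: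
  assumes "t \<in> binom_pts n"
  shows "- t \<in> binom_pts n" "binom_wt n (- t) = binom_wt n t"
proof -
  obtain k where k: "k \<le> n" "t = binom_pt n k" using assms by (auto simp: binom_pts_def)
  have e: "- t = binom_pt n (n - k)" unfolding k(2) binom_pt_def minus_divide_left
    using k(1) by (intro arg_cong2[where f = "(/)"]) (simp_all add: of_nat_diff)
  show "- t \<in> binom_pts n" unfolding e binom_pts_shift by simp
  show "binom_wt n (- t) = binom_wt n t"
    unfolding e unfolding k(2) binom_wt_pt using binomial_symmetric[OF k(1)] by simp
qed

lemma binom_pts_bound: "t \<in> binom_pts n \<Longrightarrow> \<bar>t\<bar> \<le> sqrt (real n)"
proof -
  assume "t \<in> binom_pts n"
  then obtain k where k: "k \<le> n" "t = binom_pt n k" by (auto simp: binom_pts_def)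
  have "\<bar>t\<bar> = \<bar>2 * real k - real n\<bar> / sqrt (real n)" using n by (simp add: k binom_pt_def)
  also have "\<dots> \<le> real n / sqrt (real n)" using k n by (intro divide_right_mono) auto
  also have "\<dots> = sqrt (real n)" by (simp add: real_div_sqrt)
  finally show ?thesis .
qed

lemma binom_moment_generating:
  "(\<Sum>t\<in>binom_pts n. binom_wt n t * exp (y * t)) = cosh (y / sqrt (real n)) ^ n"
proof -
  let ?s = "y / sqrt (real n)"
  have "(\<Sum>t\<in>binom_pts n. binom_wt n t * exp (y * t))
      = (\<Sum>k\<le>n. real (n choose k) / 2 ^ n * exp (y * binom_pt n k))"
    unfolding binom_pts_def by (subst sum.reindex) (auto simp: inj_on_def binom_pt_inj binom_wt_pt)
  also have "\<dots> = (\<Sum>k\<le>n. of_nat (n choose k) * (exp ?s / 2) ^ k * (exp (- ?s) / 2) ^ (n - k))"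
  proof (intro sum.cong refl)
    fix k assume "k \<in> {..n}"
    then have k: "k \<le> n" by simp
    have "y * binom_pt n k = real k * ?s + real (n - k) * (- ?s)"
      using k by (simp add: binom_pt_def of_nat_diff algebra_simps add_divide_distrib diff_divide_distrib)
    then have "exp (y * binom_pt n k) = exp ?s ^ k * exp (- ?s) ^ (n - k)"
      by (simp only: exp_add exp_of_nat_mult)
    moreover have "(2::real) ^ n = 2 ^ k * 2 ^ (n - k)" using k by (simp flip: power_add)
    ultimately show "real (n choose k) / 2 ^ n * exp (y * binom_pt n k)
      = of_nat (n choose k) * (exp ?s / 2) ^ k * (exp (- ?s) / 2) ^ (n - k)"
      by (simp add: power_divide)
  qed
  also have "\<dots> = (exp ?s / 2 + exp (- ?s) / 2) ^ n"
    by (simp only: binomial_ring)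
  also have "exp ?s / 2 + exp (- ?s) / 2 = cosh ?s" by (simp add: cosh_field_def add_divide_distrib)
  finally show ?thesis .
qed

text \<open>The moment generating function of the rescaled binomial distribution against that of the standard
Gaussian.\<close>

lemma binom_near_Gaussian:
  "exp (y\<^sup>2 / 2 - y ^ 4 / (8 * real n)) \<le> cosh (y / sqrt (real n)) ^ n"
  "cosh (y / sqrt (real n)) ^ n \<le> exp (y\<^sup>2 / 2)"
proof -
  define t where "t = y / sqrt (real n)"
  have t2: "t\<^sup>2 = y\<^sup>2 / real n" using n by (simp add: t_def power_divide)
  have t4: "t ^ 4 = y ^ 4 / (real n)\<^sup>2"
  proof -
    have "t ^ 4 = (t\<^sup>2)\<^sup>2" by simp
    also have "\<dots> = (y\<^sup>2)\<^sup>2 / (real n)\<^sup>2" by (simp only: t2 power_divide)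
    finally show ?thesis by simp
  qed
  show "cosh (y / sqrt (real n)) ^ n \<le> exp (y\<^sup>2 / 2)"
  proof -
    have "cosh t \<le> exp (t\<^sup>2 / 2)" by (rule cosh_le_exp_half_square)
    then have "cosh t ^ n \<le> exp (t\<^sup>2 / 2) ^ n" by (intro power_mono) auto
    also have "\<dots> = exp (real n * (t\<^sup>2 / 2))" by (simp only: exp_of_nat_mult)
    also have "real n * (t\<^sup>2 / 2) = y\<^sup>2 / 2" using n by (simp add: t2)
    finally show ?thesis by (simp only: t_def)
  qed
  show "exp (y\<^sup>2 / 2 - y ^ 4 / (8 * real n)) \<le> cosh (y / sqrt (real n)) ^ n"
  proof -
    have "exp (t\<^sup>2 / 2 - (t\<^sup>2 / 2)\<^sup>2 / 2) \<le> 1 + t\<^sup>2 / 2"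
    proof -
      have "t\<^sup>2 / 2 - (t\<^sup>2 / 2)\<^sup>2 / 2 \<le> ln (1 + t\<^sup>2 / 2)" by (rule ln_one_plus_ge_quadratic) simp
      then have "exp (t\<^sup>2 / 2 - (t\<^sup>2 / 2)\<^sup>2 / 2) \<le> exp (ln (1 + t\<^sup>2 / 2))" by simp
      also have "\<dots> = 1 + t\<^sup>2 / 2" by (rule exp_ln) (simp add: add_pos_nonneg)
      finally show ?thesis .
    qed
    also have "\<dots> \<le> cosh t" by (rule cosh_ge_quadratic)
    finally have "exp (t\<^sup>2 / 2 - (t\<^sup>2 / 2)\<^sup>2 / 2) ^ n \<le> cosh t ^ n" by (intro power_mono) auto
    moreover have "exp (t\<^sup>2 / 2 - (t\<^sup>2 / 2)\<^sup>2 / 2) ^ n = exp (real n * (t\<^sup>2 / 2 - (t\<^sup>2 / 2)\<^sup>2 / 2))"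
      by (simp only: exp_of_nat_mult)
    moreover have "real n * (t\<^sup>2 / 2 - (t\<^sup>2 / 2)\<^sup>2 / 2) = y\<^sup>2 / 2 - y ^ 4 / (8 * real n)"
    proof -
      have e: "(t\<^sup>2 / 2)\<^sup>2 / 2 = t ^ 4 / 8" by (simp add: power_divide)
      have "real n * (t\<^sup>2 / 2) = y\<^sup>2 / 2" "real n * (t ^ 4 / 8) = y ^ 4 / (8 * real n)"
        unfolding t4 unfolding t2 using n by (simp_all add: power2_eq_square)
      then show ?thesis unfolding e by (simp only: right_diff_distrib)
    qed
    ultimately show ?thesis by (simp only: t_def)
  qed
qed

end

text \<open>\<open>ln cosh\<close> has second derivative at most one, so a factor \<open>cosh\<close> reduces log-concavity by at most one.\<close>

lemma cosh_log_curvature: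
  fixes u v d :: real
  assumes "u \<le> v" "0 \<le> d"
  shows "cosh u * cosh (v + d) \<le> cosh v * cosh (u + d) * exp (d * (v - u))"
proof -
  let ?f = "\<lambda>s. ln (cosh (v + s)) - ln (cosh (u + s)) - s * (v - u)"
  have "?f d \<le> ?f 0"
  proof (rule DERIV_nonpos_imp_nonincreasing[OF assms(2)])
    fix s :: real
    have "(?f has_real_derivative sinh (v + s) / cosh (v + s) - sinh (u + s) / cosh (u + s) - (v - u)) (at s)"
      by (auto intro!: derivative_eq_intros)
    then have "(?f has_real_derivative tanh (v + s) - tanh (u + s) - (v - u)) (at s)" by (simp only: tanh_def)
    moreover have "tanh (v + s) - tanh (u + s) - (v - u) \<le> 0" using tanh_lipschitz[of "u + s" "v + s"] assms by simp
    ultimately show "\<exists>y. (?f has_real_derivative y) (at s) \<and> y \<le> 0" by blast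
  qed
  then have "ln (cosh (v + d)) + ln (cosh u) \<le> ln (cosh v) + ln (cosh (u + d)) + d * (v - u)" by simp
  then have "exp (ln (cosh (v + d)) + ln (cosh u)) \<le> exp (ln (cosh v) + ln (cosh (u + d)) + d * (v - u))" by simp
  then show ?thesis by (simp add: exp_add mult.commute)
qed

text \<open>A Gaussian of curvature \<open>c\<close> times a function whose logarithm has second derivative at most one.\<close>

lemma curved_Gaussian_times:
  fixes \<phi> :: "real \<Rightarrow> real"
  assumes pos: "\<And>x. \<phi> x > 0"
    and \<phi>: "\<And>u v d. u \<le> v \<Longrightarrow> 0 \<le> d \<Longrightarrow> \<phi> u * \<phi> (v + d) \<le> \<phi> v * \<phi> (u + d) * exp (d * (v - u))"
    and e: "e > 0"
  shows "curved_weight (c - 1) e S (\<lambda>x. exp (- c * x\<^sup>2 / 2) * \<phi> x)"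
  unfolding curved_weight_def
proof (intro conjI ballI allI impI)
  show "0 < exp (- c * x\<^sup>2 / 2) * \<phi> x" for x using pos by simp
  fix u v l assume uv: "u \<le> (v :: real)"
  let ?d = "e * real l"
  have d: "0 \<le> ?d" using e by simp
  let ?E = "\<lambda>x. exp (- c * x\<^sup>2 / 2)"
  have E: "?E u * ?E (v + ?d) * exp ((c - 1) * ?d * (v - u)) = ?E v * ?E (u + ?d) * exp (- (?d * (v - u)))"
    by (simp add: power2_eq_square algebra_simps add_divide_distrib diff_divide_distrib flip: exp_add)
  have "?E u * \<phi> u * (?E (v + ?d) * \<phi> (v + ?d)) * exp ((c - 1) * ?d * (v - u))
      = (?E u * ?E (v + ?d) * exp ((c - 1) * ?d * (v - u))) * (\<phi> u * \<phi> (v + ?d))" by (simp only: mult_ac)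
  also have "\<dots> = (?E v * ?E (u + ?d) * exp (- (?d * (v - u)))) * (\<phi> u * \<phi> (v + ?d))" by (simp only: E)
  also have "\<dots> \<le> (?E v * ?E (u + ?d) * exp (- (?d * (v - u)))) * (\<phi> v * \<phi> (u + ?d) * exp (?d * (v - u)))"
    by (intro mult_left_mono \<phi>[OF uv d]) simp
  also have "\<dots> = ?E v * \<phi> v * (?E (u + ?d) * \<phi> (u + ?d)) * (exp (- (?d * (v - u))) * exp (?d * (v - u)))"
    by (simp only: mult_ac)
  also have "exp (- (?d * (v - u))) * exp (?d * (v - u)) = 1" by (simp flip: exp_add)
  finally show "?E u * \<phi> u * (?E (v + ?d) * \<phi> (v + ?d)) * exp ((c - 1) * ?d * (v - u))
      \<le> ?E v * \<phi> v * (?E (u + ?d) * \<phi> (u + ?d))" by simp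
qed

section \<open>Lattice partition functions are local\<close>

lemma ln_ratio_bound:
  assumes "0 < A" "exp (- c) * B \<le> A" "A \<le> exp c * B" "0 < B"
  shows "\<bar>ln A - ln B\<bar> \<le> (c::real)"
proof -
  have "ln (exp (- c) * B) \<le> ln A" using assms by simp
  moreover have "ln A \<le> ln (exp c * B)" using assms by simp
  ultimately show ?thesis using assms(4) by (simp add: ln_mult abs_le_iff)
qed

lemma sum_halves: "a + (c / 2 + b) + c / 2 = c + a + (b :: real)"
  by simp

context bounded_graphs
begin

abbreviation Bop :: "real list \<Rightarrow> wgraph \<Rightarrow> (nat \<Rightarrow> real) \<Rightarrow> nat \<Rightarrow> real" where
  "Bop p G \<equiv> op_poly (sz G) (ew G) p"

text \<open>The free energy density of real spins in \<open>S\<close> with site weights \<open>r\<close> and interaction \<open>|B x|\<^sup>2 / 2\<close>.\<close>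

definition log_partition :: "(real \<Rightarrow> real \<Rightarrow> real) \<Rightarrow> real set \<Rightarrow> real list \<Rightarrow> wgraph \<Rightarrow> real" where
  "log_partition r S p G =
     ln (\<Sum>x\<in>{..<sz G} \<rightarrow>\<^sub>E S. (\<Prod>i<sz G. r (vw G i) (x i)) * exp ((\<Sum>i<sz G. (Bop p G x i)\<^sup>2) / 2)) / real (sz G)"

text \<open>One double step of the alternating chain, as an operation on families of observables indexed by
graphs.\<close>

definition chain_op :: "(real \<Rightarrow> real \<Rightarrow> real) \<Rightarrow> real set \<Rightarrow> (real \<Rightarrow> real) \<Rightarrow> real set \<Rightarrow> real list \<Rightarrow> real \<Rightarrow>
    (wgraph \<Rightarrow> (nat \<Rightarrow> real) \<Rightarrow> real) \<Rightarrow> wgraph \<Rightarrow> (nat \<Rightarrow> real) \<Rightarrow> real" where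
  "chain_op r S \<gamma> T p s F = (\<lambda>G x. gibbs (sz G) T (\<lambda>_. \<gamma>) (zval s p G x)
      (\<lambda>w. gibbs (sz G) S (\<lambda>i. r (vw G i)) (zval s p G w) (F G)))"

definition bond_mean :: "(real \<Rightarrow> real) \<Rightarrow> real set \<Rightarrow> real list \<Rightarrow> real \<Rightarrow> wgraph \<Rightarrow> (nat \<Rightarrow> real) \<Rightarrow> real" where
  "bond_mean \<gamma> T p s = (\<lambda>G x. gibbs (sz G) T (\<lambda>_. \<gamma>) (zval s p G x) (\<lambda>w. (\<Sum>i<sz G. w i * Bop p G x i) / real (sz G)))"

lemma lapprox_chain_op:
  assumes S: "finite S" "S \<noteq> {}" and T: "finite T" "T \<noteq> {}"
    and r: "\<And>h x. x \<in> S \<Longrightarrow> r h x > 0" "\<And>x. x \<in> S \<Longrightarrow> continuous_on UNIV (\<lambda>h. r h x)"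
    and \<gamma>: "\<And>x. x \<in> T \<Longrightarrow> \<gamma> x > 0" and F: "lapprox S F"
  shows "lapprox S ((chain_op r S \<gamma> T p s ^^ k) F)"
proof (induction k)
  case 0
  then show ?case using F by simp
next
  case (Suc k)
  have 1: "lapprox T (\<lambda>G w. gibbs (sz G) S (\<lambda>i. r (vw G i)) (zval s p G w) ((chain_op r S \<gamma> T p s ^^ k) F G))"
    by (rule lapprox_gibbs[OF S T(1) r Suc])
  have "lapprox S (\<lambda>G y. gibbs (sz G) T (\<lambda>i. (\<lambda>h. \<gamma>) (vw G i)) (zval s p G y)
      (\<lambda>w. gibbs (sz G) S (\<lambda>i. r (vw G i)) (zval s p G w) ((chain_op r S \<gamma> T p s ^^ k) F G)))"
    by (rule lapprox_gibbs[OF T S(1) \<gamma> continuous_on_const 1])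
  then show ?case by (simp only: funpow.simps o_apply chain_op_def[of r S \<gamma> T p s "(chain_op r S \<gamma> T p s ^^ k) F"])
qed

lemma lapprox_bond_mean:
  assumes S: "finite S" and T: "finite T" "T \<noteq> {}" and \<gamma>: "\<And>x. x \<in> T \<Longrightarrow> \<gamma> x > 0"
  shows "lapprox S (bond_mean \<gamma> T p s)"
proof -
  let ?mean = "\<lambda>(h::real) z. \<Sum>a\<in>T. tilt T \<gamma> z a * a"
  let ?m = "\<lambda>(h::real) z. z * ?mean h (s * z)"
  have c0: "cont2 ?mean"
    by (rule cont2_tilt[where r = "\<lambda>h. \<gamma>" and \<phi> = "\<lambda>h a. a", OF T \<gamma>]) auto
  have "continuous_on UNIV (\<lambda>q :: real \<times> real. (fst q, s * snd q))" by (intro continuous_intros)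
  then have c1: "continuous_on UNIV (\<lambda>q :: real \<times> real. ?mean (fst q) (s * snd q))"
    using continuous_on_compose2[OF c0, of UNIV "\<lambda>q. (fst q, s * snd q)"] by simp
  have c2: "continuous_on UNIV (\<lambda>q :: real \<times> real. snd q)" by (intro continuous_intros)
  have m: "cont2 ?m" using continuous_on_mult[OF c2 c1] by simp
  show ?thesis
  proof (rule lapprox_cong[OF lapprox_site_average[OF S m, of 1 p]])
    fix G x assume "G \<in> GG"
    let ?z = "zval s p G x"
    have "gibbs (sz G) T (\<lambda>_. \<gamma>) ?z (\<lambda>w. w i) = ?mean 0 (?z i)" if "i < sz G" for i
      using gibbs_inj_prod[of T "sz G" "\<lambda>_. \<gamma>" "{i}" id ?z "\<lambda>_ a. a"] T \<gamma> that by simp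
    then have one: "gibbs (sz G) T (\<lambda>_. \<gamma>) ?z (\<lambda>w. (Bop p G x i / real (sz G)) * w i)
        = ?m (vw G i) (zval 1 p G x i) / real (sz G)" if "i < sz G" for i
      unfolding gibbs_scale using that by (simp add: zval_def)
    have "(\<lambda>w. (\<Sum>i<sz G. w i * Bop p G x i) / real (sz G))
        = (\<lambda>w. \<Sum>i<sz G. (Bop p G x i / real (sz G)) * w i)"
      by (simp add: fun_eq_iff sum_divide_distrib mult.commute)
    then have "bond_mean \<gamma> T p s G x
        = (\<Sum>i<sz G. gibbs (sz G) T (\<lambda>_. \<gamma>) ?z (\<lambda>w. (Bop p G x i / real (sz G)) * w i))"
      unfolding bond_mean_def by (simp only: gibbs_sum)
    also have "\<dots> = (\<Sum>i<sz G. ?m (vw G i) (zval 1 p G x i) / real (sz G))"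
      by (intro sum.cong refl) (simp only: one lessThan_iff)
    finally show "bond_mean \<gamma> T p s G x = (\<Sum>i<sz G. ?m (vw G i) (zval 1 p G x i)) / real (sz G)"
      by (simp only: sum_divide_distrib)
  qed
qed

lemma span_approximable_free_sites:
  fixes S :: "real set"
  assumes S: "finite S" "S \<noteq> {}"
    and r: "\<And>h x. x \<in> S \<Longrightarrow> r h x > 0" "\<And>x. x \<in> S \<Longrightarrow> continuous_on UNIV (\<lambda>h. r h x)"
  shows "span_approximable (\<lambda>G. (\<Sum>i<sz G. ln (\<Sum>a\<in>S. r (vw G i) a)) / real (sz G))"
proof -
  have pos: "(\<Sum>a\<in>S. r h a) > 0" for h using S r(1) by (intro sum_pos) auto
  have c: "continuous_on UNIV (\<lambda>q :: real \<times> real. r (fst q) x)" if "x \<in> S" for x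
    by (rule continuous_on_compose2[OF r(2)[OF that]]) (auto intro!: continuous_intros)
  have nz: "(\<Sum>a\<in>S. r h a) \<noteq> 0" for h using pos[of h] by simp
  have m: "cont2 (\<lambda>h (z::real). ln (\<Sum>a\<in>S. r h a))"
    by (intro continuous_intros c nz ballI) auto
  obtain a where "a \<in> S" using S(2) by auto
  from lapprox_evaluated[OF lapprox_site_average[where m = "\<lambda>h (z::real). ln (\<Sum>a\<in>S. r h a)" and s = 0 and p = "[]", OF S(1) m] this]
  show ?thesis .
qed

lemma span_approximable_sum:
  assumes "finite K" "\<And>k. k \<in> K \<Longrightarrow> span_approximable (F k)"
  shows "span_approximable (\<lambda>G. \<Sum>k\<in>K. F k G)"
  using assms
proof (induction K)
  case empty
  have "span_approximable (\<lambda>G. 0)"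
    unfolding span_approximable_def using density_span_zero by (intro allI impI bexI[of _ "\<lambda>G. 0"]) auto
  then show ?case by simp
next
  case (insert k K)
  have "span_approximable (\<lambda>G. F k G + (\<Sum>k\<in>K. F k G))"
    using insert by (intro span_approximable_add) auto
  then show ?case using insert.hyps by simp
qed

text \<open>The interaction \<open>exp (|B x|\<^sup>2 / 2)\<close> is linearised by \<open>n\<close>-step binomial variables, and the resulting
two-layer free energy is computed by the alternating chain. The error consists of the replacement
of the Gaussian, \<open>Y ^ 4 / (8 n)\<close>, and of the two lattice spacings; the number of chain steps and of
subdivisions of \<open>[0, 1]\<close> only enters \<open>\<eta>\<close>.\<close>

theorem log_partition_near_span:
  fixes r :: "real \<Rightarrow> real \<Rightarrow> real" and \<epsilon> \<kappa> \<beta> R Y \<eta> :: real and K n :: nat and p :: "real list"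
  defines "S \<equiv> lat \<epsilon> K" and "\<kappa>' \<equiv> real n * (real n + 1) / (real n + 2)\<^sup>2" and "e' \<equiv> 2 / sqrt (real n)"
  defines "L \<equiv> \<beta> * (2 * \<beta> * R / \<kappa>' + e')"
  assumes \<epsilon>: "\<epsilon> > 0" and n: "n > 0" and R: "\<epsilon> * real K \<le> R"
    and curv: "\<And>h. curved_weight \<kappa> \<epsilon> S (r h)" and cont: "\<And>x. continuous_on UNIV (\<lambda>h. r h x)"
    and \<kappa>: "\<kappa> > 0" and \<beta>: "\<beta> \<ge> 0" and q: "\<beta>\<^sup>2 < \<kappa> * \<kappa>'"
    and sym_norm: "\<And>G v. G \<in> GG \<Longrightarrow> l2n (sz G) (Bop p G v) \<le> \<beta> * l2n (sz G) v"
    and Y: "\<And>G x i. G \<in> GG \<Longrightarrow> \<forall>i<sz G. \<bar>x i\<bar> \<le> R \<Longrightarrow> i < sz G \<Longrightarrow> \<bar>Bop p G x i\<bar> \<le> Y"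
    and \<eta>: "\<eta> > 0"
  shows "\<exists>\<phi>\<in>density_span. \<forall>G\<in>GG. \<bar>log_partition r S p G - \<phi> G\<bar>
     \<le> \<eta> + Y ^ 4 / (8 * real n) + (\<beta> * R * e' + L * (\<epsilon> + \<beta> * e' / \<kappa>) / (1 - \<beta>\<^sup>2 / (\<kappa> * \<kappa>')))"
proof -
  define T where "T = binom_pts n"
  define \<gamma> where "\<gamma> = binom_wt n"
  let ?q = "\<beta>\<^sup>2 / (\<kappa> * \<kappa>')"
  let ?err = "\<beta> * R * e' + L * (\<epsilon> + \<beta> * e' / \<kappa>) / (1 - ?q)"
  have \<kappa>': "\<kappa>' > 0" using n by (simp add: \<kappa>'_def)
  have latS: "lattice_segment \<epsilon> S" unfolding S_def by (rule lattice_segment_lat[OF \<epsilon>])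
  have latT: "lattice_segment e' T" unfolding T_def e'_def by (rule lattice_segment_binom[OF n])
  have curvT: "curved_weight \<kappa>' e' T \<gamma>" unfolding T_def \<gamma>_def \<kappa>'_def e'_def by (rule curved_binom[OF n])
  have S: "finite S" "S \<noteq> {}" using latS by (simp_all add: lattice_segment_def)
  have T: "finite T" "T \<noteq> {}" using latT by (simp_all add: lattice_segment_def)
  have rpos: "r h x > 0" if "x \<in> S" for h x using curv[of h] that by (simp add: curved_weight_def)
  have \<gamma>pos: "\<gamma> x > 0" if "x \<in> T" for x using curvT that by (simp add: curved_weight_def)
  have R0: "R \<ge> 0" using \<epsilon> R by (meson mult_nonneg_nonneg less_imp_le of_nat_0_le_iff order_trans)
  have SR: "\<bar>a\<bar> \<le> R" if "a \<in> S" for a using lat_bound[of \<epsilon> a K] \<epsilon> R that unfolding S_def by linarith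
  have q0: "0 \<le> ?q" "?q < 1" using \<kappa> \<kappa>' q by simp_all
  obtain m :: nat where m: "m > 0" "2 * (sqrt (real n) * (\<beta> * R)) / real m \<le> \<eta> / 4"
  proof -
    obtain m :: nat where m: "real m > 2 * (sqrt (real n) * (\<beta> * R)) / (\<eta> / 4)" using reals_Archimedean2 by blast
    have "0 \<le> 2 * (sqrt (real n) * (\<beta> * R)) / (\<eta> / 4)" using \<beta> R0 \<eta> by simp
    then have "m > 0" using m by (metis of_nat_0_less_iff order_le_less_trans)
    with m show thesis using \<eta> by (intro that[of m]) (auto simp: field_simps)
  qed
  obtain k where k: "2 * R * L * ?q ^ k \<le> \<eta> / 4"
  proof -
    have "(\<lambda>k. 2 * R * L * ?q ^ k) \<longlonglongrightarrow> 2 * R * L * 0"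
      by (intro tendsto_intros LIMSEQ_realpow_zero q0)
    then have "\<forall>\<^sub>F k in sequentially. 2 * R * L * ?q ^ k < \<eta> / 4"
      using \<eta> by (intro order_tendstoD) auto
    then obtain k where "2 * R * L * ?q ^ k < \<eta> / 4" unfolding eventually_sequentially by blast
    then show thesis by (intro that[of k]) simp
  qed
  have zS: "0 \<in> S" unfolding S_def by (rule zero_in_lat)
  let ?s = "\<lambda>j. real j / real m"
  let ?ch = "\<lambda>j. (chain_op r S \<gamma> T p (?s j) ^^ k) (bond_mean \<gamma> T p (?s j))"
  let ?x0 = "\<lambda>G. \<lambda>i\<in>{..<sz G}. 0 :: real"
  define H where "H G = (\<Sum>i<sz G. ln (\<Sum>a\<in>S. r (vw G i) a)) / real (sz G) + (1 / real m) * (\<Sum>j<m. ?ch j G (?x0 G))" for G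
  \<comment> \<open>\<open>H\<close> is the free energy at coupling zero plus the Riemann sum of the chain values.\<close>
  have "span_approximable H"
    unfolding H_def
  proof (intro span_approximable_add span_approximable_scale span_approximable_sum)
    show "span_approximable (\<lambda>G. (\<Sum>i<sz G. ln (\<Sum>a\<in>S. r (vw G i) a)) / real (sz G))"
      by (rule span_approximable_free_sites[OF S rpos cont])
    show "span_approximable (\<lambda>G. ?ch j G (?x0 G))" for j
      by (rule lapprox_evaluated[OF lapprox_chain_op[OF S T rpos cont \<gamma>pos lapprox_bond_mean[OF S(1) T \<gamma>pos]] zS])
  qed simp
  then obtain \<phi> where \<phi>: "\<phi> \<in> density_span" "\<And>G. G \<in> GG \<Longrightarrow> \<bar>H G - \<phi> G\<bar> \<le> \<eta> / 2"
    by (rule span_approximableE[of _ "\<eta> / 2"]) (use \<eta> in simp, rule that)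
  show ?thesis
  proof (intro bexI[OF _ \<phi>(1)] ballI)
    fix G assume G: "G \<in> GG"
    let ?N = "sz G" and ?B = "Bop p G" and ?\<rho> = "\<lambda>i. r (vw G i)" and ?X = "{..<sz G} \<rightarrow>\<^sub>E S"
    have N: "?N > 0" by (rule size_pos[OF G])
    interpret tl: two_layer ?N S T ?\<rho> "\<lambda>_. \<gamma>" ?B \<epsilon> e' \<kappa> \<kappa>' \<beta>
    proof
      show "?B u i - ?B v i = ?B (\<lambda>j. u j - v j) i" if "i < ?N" for u v i
        using linear_opD(1)[OF linear_op_poly that, of "ew G" p 1 u "-1" v] by simp
      show "(\<Sum>i<?N. u i * ?B v i) = (\<Sum>i<?N. v i * ?B u i)" for u v
        using op_poly_symmetric[where N = ?N and A = "ew G" and p = p and u = u and v = v] ew_sym[OF G]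
        unfolding ip_def by blast
    qed (use N latS latT curv curvT \<kappa> \<kappa>' \<beta> q sym_norm[OF G] in auto)
    have x0: "?x0 G \<in> ?X" using zS by auto
    have chain_eq: "?ch j G = ((\<lambda>F. tl.down (?s j) (tl.up (?s j) F)) ^^ k) (\<lambda>x. tl.down (?s j) (tl.bond x) x)" for j
    proof -
      have "(chain_op r S \<gamma> T p s ^^ k') F G = ((\<lambda>F. tl.down s (tl.up s F)) ^^ k') (F G)" for s k' F
        by (induction k') (simp_all add: chain_op_def tl.down_def tl.up_def zval_def[abs_def])
      moreover have "bond_mean \<gamma> T p s G = (\<lambda>x. tl.down s (tl.bond x) x)" for s
        by (simp add: bond_mean_def tl.down_def tl.bond_def[abs_def] zval_def[abs_def])
      ultimately show ?thesis by (simp only:)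
    qed
    have "\<bar>(ln (tl.Zs 1) - ln (tl.Zs 0)) / real ?N
       - (\<Sum>j<m. ((\<lambda>F. tl.down (?s j) (tl.up (?s j) F)) ^^ k) (\<lambda>x. tl.down (?s j) (tl.bond x) x) (?x0 G)) / real m\<bar>
       \<le> 2 * (sqrt (real n) * (\<beta> * R)) / real m + (2 * R * L * ?q ^ k + \<beta> * R * e' + L * (\<epsilon> + \<beta> * e' / \<kappa>) / (1 - ?q))"
      unfolding L_def
      by (rule tl.free_energy_by_chain[OF m(1) SR _ _ _ x0])
         (use binom_pts_bound[OF n] binom_symmetric[OF n] in \<open>auto simp: T_def \<gamma>_def\<close>)
    then have main: "\<bar>(ln (tl.Zs 1) - ln (tl.Zs 0)) / real ?N - (\<Sum>j<m. ?ch j G (?x0 G)) / real m\<bar> \<le> \<eta> / 2 + ?err"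
      unfolding chain_eq using m(2) k by linarith
    have Zs: "tl.Zs s = (\<Sum>x\<in>?X. (\<Prod>i<?N. ?\<rho> i (x i)) * (\<Prod>i<?N. cosh (s * ?B x i / sqrt (real n)) ^ n))" for s
    proof -
      have "(\<Sum>w\<in>{..<?N} \<rightarrow>\<^sub>E T. tl.wt s x w)
          = (\<Prod>i<?N. ?\<rho> i (x i)) * (\<Prod>i<?N. cosh (s * ?B x i / sqrt (real n)) ^ n)" for x
      proof -
        have "tl.wt s x w = (\<Prod>i<?N. ?\<rho> i (x i)) * (\<Prod>i<?N. \<gamma> (w i) * exp (s * ?B x i * w i))" for w
          unfolding tl.wt_def by (simp add: prod.distrib exp_sum sum_distrib_left mult_ac)
        then have "(\<Sum>w\<in>{..<?N} \<rightarrow>\<^sub>E T. tl.wt s x w)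
           = (\<Prod>i<?N. ?\<rho> i (x i)) * (\<Sum>w\<in>{..<?N} \<rightarrow>\<^sub>E T. \<Prod>i<?N. \<gamma> (w i) * exp (s * ?B x i * w i))"
          by (simp only: sum_distrib_left)
        also have "(\<Sum>w\<in>{..<?N} \<rightarrow>\<^sub>E T. \<Prod>i<?N. \<gamma> (w i) * exp (s * ?B x i * w i))
           = (\<Prod>i<?N. \<Sum>t\<in>T. \<gamma> t * exp (s * ?B x i * t))"
          using T by (intro prod_sum_PiE[symmetric]) auto
        also have "\<dots> = (\<Prod>i<?N. cosh (s * ?B x i / sqrt (real n)) ^ n)"
          unfolding T_def \<gamma>_def by (simp only: binom_moment_generating[OF n])
        finally show ?thesis .
      qed
      then show ?thesis unfolding tl.Zs_def by (simp only:)
    qed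
    have Z0: "ln (tl.Zs 0) / real ?N = (\<Sum>i<?N. ln (\<Sum>a\<in>S. r (vw G i) a)) / real ?N"
    proof -
      have "tl.Zs 0 = (\<Prod>i<?N. \<Sum>a\<in>S. ?\<rho> i a)"
        unfolding Zs using S by (simp add: prod_sum_PiE)
      moreover have "(\<Sum>a\<in>S. ?\<rho> i a) > 0" for i using S rpos by (intro sum_pos) auto
      then have "(\<Sum>a\<in>S. ?\<rho> i a) \<noteq> 0" for i by (metis less_irrefl)
      then have "ln (\<Prod>i<?N. \<Sum>a\<in>S. ?\<rho> i a) = (\<Sum>i<?N. ln (\<Sum>a\<in>S. ?\<rho> i a))"
        by (rule ln_prod[OF finite_lessThan])
      ultimately show ?thesis by (simp only:)
    qed
    let ?Z = "\<Sum>x\<in>?X. (\<Prod>i<?N. ?\<rho> i (x i)) * exp ((\<Sum>i<?N. (?B x i)\<^sup>2) / 2)"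
    \<comment> \<open>Replacement of the binomial by the Gaussian moment generating function, site by site.\<close>
    have Z1: "\<bar>ln (tl.Zs 1) - ln ?Z\<bar> \<le> real ?N * (Y ^ 4 / (8 * real n))"
    proof (rule ln_ratio_bound)
      show "tl.Zs 1 > 0" by (rule tl.Zs_pos)
      have P: "(\<Prod>i<?N. ?\<rho> i (x i)) > 0" if "x \<in> ?X" for x using that by (intro prod_pos) (auto intro!: rpos)
      show "?Z > 0" using P by (intro sum_pos tl.layers_finite(5,7)) simp
      have ex: "(\<Prod>i<?N. exp (f i)) = exp (\<Sum>i<?N. f i)" for f :: "nat \<Rightarrow> real" by (simp add: exp_sum)
      have up: "(\<Prod>i<?N. cosh (1 * ?B x i / sqrt (real n)) ^ n) \<le> exp ((\<Sum>i<?N. (?B x i)\<^sup>2) / 2)" for x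
        unfolding sum_divide_distrib ex[symmetric] mult_1
        by (intro prod_mono conjI binom_near_Gaussian(2)[OF n] zero_le_power cosh_real_nonneg)
      have lo: "exp (- (real ?N * (Y ^ 4 / (8 * real n)))) * exp ((\<Sum>i<?N. (?B x i)\<^sup>2) / 2)
          \<le> (\<Prod>i<?N. cosh (1 * ?B x i / sqrt (real n)) ^ n)" if x: "x \<in> ?X" for x
      proof -
        have "(\<Prod>i<?N. exp ((?B x i)\<^sup>2 / 2 - Y ^ 4 / (8 * real n))) \<le> (\<Prod>i<?N. cosh (1 * ?B x i / sqrt (real n)) ^ n)"
        proof (intro prod_mono conjI)
          fix i assume "i \<in> {..<?N}"
          then have i: "i < ?N" by simp
          have "\<forall>i<?N. \<bar>x i\<bar> \<le> R" using x SR by auto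
          from Y[OF G this i] have "\<bar>?B x i\<bar> ^ 4 \<le> Y ^ 4" by (intro power_mono) auto
          then have "(?B x i) ^ 4 / (8 * real n) \<le> Y ^ 4 / (8 * real n)" by (intro divide_right_mono) auto
          then have "exp ((?B x i)\<^sup>2 / 2 - Y ^ 4 / (8 * real n)) \<le> exp ((?B x i)\<^sup>2 / 2 - (?B x i) ^ 4 / (8 * real n))" by simp
          also have "\<dots> \<le> cosh (1 * ?B x i / sqrt (real n)) ^ n" unfolding mult_1 by (rule binom_near_Gaussian(1)[OF n])
          finally show "exp ((?B x i)\<^sup>2 / 2 - Y ^ 4 / (8 * real n)) \<le> cosh (1 * ?B x i / sqrt (real n)) ^ n" .
        qed simp
        moreover have "(\<Prod>i<?N. exp ((?B x i)\<^sup>2 / 2 - Y ^ 4 / (8 * real n)))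
           = exp (- (real ?N * (Y ^ 4 / (8 * real n)))) * exp ((\<Sum>i<?N. (?B x i)\<^sup>2) / 2)"
          unfolding ex exp_add[symmetric] by (simp add: sum_subtractf sum_divide_distrib)
        ultimately show ?thesis by simp
      qed
      show "exp (- (real ?N * (Y ^ 4 / (8 * real n)))) * ?Z \<le> tl.Zs 1"
        unfolding Zs sum_distrib_left
      proof (rule sum_mono)
        fix x assume x: "x \<in> ?X"
        from mult_left_mono[OF lo[OF x] less_imp_le[OF P[OF x]]]
        show "exp (- (real ?N * (Y ^ 4 / (8 * real n)))) * ((\<Prod>i<?N. ?\<rho> i (x i)) * exp ((\<Sum>i<?N. (?B x i)\<^sup>2) / 2))
          \<le> (\<Prod>i<?N. ?\<rho> i (x i)) * (\<Prod>i<?N. cosh (1 * ?B x i / sqrt (real n)) ^ n)" by (simp only: mult_ac)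
      qed
      have "tl.Zs 1 \<le> ?Z" unfolding Zs
        by (intro sum_mono mult_left_mono up less_imp_le[OF P])
      also have "\<dots> \<le> exp (real ?N * (Y ^ 4 / (8 * real n))) * ?Z"
      proof -
        have "0 \<le> real ?N * (Y ^ 4 / (8 * real n))" by simp
        then have "1 \<le> exp (real ?N * (Y ^ 4 / (8 * real n)))" by simp
        from mult_right_mono[OF this less_imp_le[OF \<open>?Z > 0\<close>]] show ?thesis by simp
      qed
      finally show "tl.Zs 1 \<le> exp (real ?N * (Y ^ 4 / (8 * real n))) * ?Z" .
    qed
    have a: "\<bar>log_partition r S p G - ln (tl.Zs 1) / real ?N\<bar> \<le> Y ^ 4 / (8 * real n)"
    proof -
      have "\<bar>log_partition r S p G - ln (tl.Zs 1) / real ?N\<bar> = \<bar>ln (tl.Zs 1) - ln ?Z\<bar> / real ?N"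
        by (simp add: log_partition_def abs_minus_commute flip: diff_divide_distrib)
      also have "\<dots> \<le> (real ?N * (Y ^ 4 / (8 * real n))) / real ?N" by (rule divide_right_mono[OF Z1]) simp
      also have "\<dots> = Y ^ 4 / (8 * real n)" using N by simp
      finally show ?thesis .
    qed
    have b: "\<bar>ln (tl.Zs 1) / real ?N - H G\<bar> \<le> \<eta> / 2 + ?err"
    proof -
      have "ln (tl.Zs 1) / real ?N - H G = (ln (tl.Zs 1) - ln (tl.Zs 0)) / real ?N - (\<Sum>j<m. ?ch j G (?x0 G)) / real m"
        unfolding H_def Z0[symmetric] diff_divide_distrib by simp
      with main show ?thesis by (simp only:)
    qed
    have "\<bar>log_partition r S p G - \<phi> G\<bar> \<le> Y ^ 4 / (8 * real n) + (\<eta> / 2 + ?err) + \<eta> / 2"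
      by (rule abs_diff_le_trans[OF abs_diff_le_trans[OF a b] \<phi>(2)[OF G]])
    also have "\<dots> = \<eta> + Y ^ 4 / (8 * real n) + ?err" by (rule sum_halves)
    finally show "\<bar>log_partition r S p G - \<phi> G\<bar> \<le> \<eta> + Y ^ 4 / (8 * real n) + ?err" .
  qed
qed

end

section \<open>The lattice Gaussian transform\<close>

lemma l2n_ip: "l2n N v = sqrt (ip N v v / real N)"
  by (simp add: l2n_def L2_set_def ip_def power2_eq_square real_sqrt_divide)

lemma l2n_le_if_ip_le:
  assumes "ip N u u \<le> k\<^sup>2 * ip N v v" "0 \<le> k"
  shows "l2n N u \<le> k * l2n N v"
proof -
  have "l2n N u \<le> sqrt (k\<^sup>2 * (ip N v v / real N))"
    unfolding l2n_ip using assms(1) by (intro real_sqrt_le_mono) (simp add: divide_right_mono)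
  also have "\<dots> = k * l2n N v" using assms(2) by (simp only: l2n_ip real_sqrt_mult real_sqrt_abs abs_of_nonneg)
  finally show ?thesis .
qed

lemma ip_le_l2n: "N > 0 \<Longrightarrow> \<bar>ip N u v\<bar> \<le> real N * (l2n N u * l2n N v)"
  unfolding ip_def by (rule l2n_Cauchy_Schwarz)

lemma ip_self_le: "(\<And>i. i < N \<Longrightarrow> \<bar>x i\<bar> \<le> r) \<Longrightarrow> ip N x x \<le> real N * r\<^sup>2"
proof -
  assume x: "\<And>i. i < N \<Longrightarrow> \<bar>x i\<bar> \<le> r"
  have "ip N x x \<le> (\<Sum>i<N. r\<^sup>2)"
    unfolding ip_def
  proof (rule sum_mono)
    fix i assume "i \<in> {..<N}"
    then have "\<bar>x i\<bar> \<le> \<bar>r\<bar>" using x[of i] by auto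
    then show "x i * x i \<le> r\<^sup>2" by (simp add: abs_le_square_iff power2_eq_square)
  qed
  then show ?thesis by simp
qed

text \<open>\<open>A\<close> stands for the edge operator after the shift by \<open>t\<close>; \<open>c - B\<^sup>2\<close> is an approximate inverse of it. Configurations \<open>x\<close> have
values in the lattice of spacing \<open>\<epsilon>\<close>, and \<open>M\<close> is the number of lattice steps that bounds \<open>A \<sigma>\<close>.\<close>

locale shifted_Gaussian =
  fixes N :: nat and A B :: "(nat \<Rightarrow> real) \<Rightarrow> nat \<Rightarrow> real" and c \<tau> \<epsilon> :: real and M :: nat
  assumes N: "N > 0" and c: "c \<ge> 0" and \<epsilon>: "\<epsilon> > 0" and \<tau>: "\<tau> \<ge> 0"
    and B_lin: "linear_op N B" and B_sym: "\<And>u v. ip N u (B v) = ip N v (B u)"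
    and B_norm: "\<And>v. ip N (B v) (B v) \<le> c * ip N v v"
    and A_bound: "\<And>\<sigma> i. \<sigma> \<in> {..<N} \<rightarrow>\<^sub>E {-1, 1} \<Longrightarrow> i < N \<Longrightarrow> \<bar>A \<sigma> i\<bar> + \<epsilon> \<le> \<epsilon> * real M"
    and inverse: "\<And>v. l2n N (\<lambda>i. v i - (c * A v i - B (B (A v)) i)) \<le> \<tau> * l2n N v"
begin

text \<open>The quadratic form of \<open>Q = c - B\<^sup>2\<close>, defined next.\<close>

definition energy :: "(nat \<Rightarrow> real) \<Rightarrow> real" where
  "energy x = c * ip N x x - ip N (B x) (B x)"

definition Q :: "(nat \<Rightarrow> real) \<Rightarrow> nat \<Rightarrow> real" where
  "Q x i = c * x i - B (B x) i"

lemma energy_nonneg: "0 \<le> energy x"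
  using B_norm by (simp add: energy_def)

lemma energy_le: "energy x \<le> c * ip N x x"
  by (simp add: energy_def ip_self_nonneg)

lemma energy_cong: "(\<And>i. i < N \<Longrightarrow> x i = y i) \<Longrightarrow> energy x = energy y"
  unfolding energy_def
  by (intro arg_cong2[where f = "(-)"] arg_cong2[where f = "(*)"] ip_cong refl linear_opD(2)[OF B_lin]) auto

lemma ip_Q: "ip N x (Q v) = c * ip N x v - ip N (B x) (B v)"
proof -
  have "ip N x (Q v) = ip N x (\<lambda>i. c * v i + (-1) * B (B v) i)" by (simp add: Q_def[abs_def])
  also have "\<dots> = c * ip N x v + (-1) * ip N x (B (B v))" by (rule ip_lin)
  also have "ip N x (B (B v)) = ip N (B v) (B x)" by (rule B_sym)
  finally show ?thesis by (simp add: ip_commute)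
qed

lemma ip_add_add: "ip N (\<lambda>i. x i + v i) (\<lambda>i. x i + v i) = ip N x x + 2 * ip N x v + ip N v v"
  using ip_lin[of N "\<lambda>i. x i + v i" 1 x 1 v] ip_lin_left[of N 1 x 1 v x] ip_lin_left[of N 1 x 1 v v]
    ip_commute[of N v x] by simp

lemma energy_shift: "energy (\<lambda>i. x i + v i) = energy x + 2 * ip N x (Q v) + energy v"
proof -
  have "ip N (B (\<lambda>i. x i + v i)) (B (\<lambda>i. x i + v i)) = ip N (\<lambda>i. B x i + B v i) (\<lambda>i. B x i + B v i)"
    using linear_opD(1)[OF B_lin, of _ 1 x 1 v] by (intro ip_cong) simp_all
  then show ?thesis
    unfolding energy_def ip_Q ip_add_add by (simp add: algebra_simps)
qed

lemma l2n_B: "l2n N (B v) \<le> sqrt c * l2n N v"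
  by (rule l2n_le_if_ip_le) (use B_norm c in simp_all)

lemma l2n_Q: "l2n N (Q v) \<le> 2 * c * l2n N v"
proof -
  have "l2n N (B (B v)) \<le> sqrt c * (sqrt c * l2n N v)"
    using order_trans[OF l2n_B mult_left_mono[OF l2n_B]] c by simp
  then have 1: "l2n N (B (B v)) \<le> c * l2n N v" using c by (simp flip: mult.assoc)
  have "l2n N (Q v) = l2n N (\<lambda>i. c * v i + (-1) * B (B v) i)" by (simp add: Q_def[abs_def])
  also have "\<dots> \<le> l2n N (\<lambda>i. c * v i) + l2n N (\<lambda>i. (-1) * B (B v) i)" by (rule l2n_triangle)
  also have "\<dots> = c * l2n N v + l2n N (B (B v))" using c by (simp only: l2n_scale, simp?)
  finally show ?thesis using 1 by simp
qed

definition err :: "real \<Rightarrow> real" where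
  "err R = (\<tau> + 2 * c * \<epsilon>) * (R + \<epsilon> * real M) + \<epsilon>"

text \<open>Completing the square: for \<open>v = A \<sigma>\<close> and \<open>Q A = 1\<close> the two exponents would agree. The deviation is measured
by the defect of the inverse and by the rounding of \<open>A \<sigma>\<close> to the lattice.\<close>

lemma shift_exponent:
  assumes \<sigma>: "\<sigma> \<in> {..<N} \<rightarrow>\<^sub>E {-1, 1}" and v: "\<And>i. i < N \<Longrightarrow> \<bar>v i - A \<sigma> i\<bar> \<le> \<epsilon>"
    and vM: "\<And>i. i < N \<Longrightarrow> \<bar>v i\<bar> \<le> \<epsilon> * real M" and x: "\<And>i. i < N \<Longrightarrow> \<bar>x i\<bar> \<le> R" and R: "R \<ge> 0"
  shows "\<bar>(ip N \<sigma> (\<lambda>i. x i + v i) - energy (\<lambda>i. x i + v i) / 2) - (ip N \<sigma> (A \<sigma>) / 2 - energy x / 2)\<bar>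
    \<le> real N * err R"
proof -
  \<comment> \<open>\<open>g\<close> is the defect of the inverse, \<open>w\<close> the rounding error.\<close>
  define g where "g i = \<sigma> i - Q v i" for i
  define w where "w i = v i - A \<sigma> i" for i
  let ?V = "\<epsilon> * real M"
  have s1: "\<bar>\<sigma> i\<bar> = 1" if "i < N" for i
  proof -
    have "\<sigma> i \<in> {-1, 1}" using PiE_mem[OF \<sigma>] that by simp
    then show ?thesis by auto
  qed
  have l\<sigma>: "l2n N \<sigma> \<le> 1" using s1 by (intro l2n_bound N) auto
  have lx: "l2n N x \<le> R" by (intro l2n_bound N R x)
  have lv: "l2n N v \<le> ?V" using \<epsilon> by (intro l2n_bound N vM) simp_all
  have lw: "l2n N w \<le> \<epsilon>" unfolding w_def using \<epsilon> v by (intro l2n_bound N) simp_all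
  have lg: "l2n N g \<le> \<tau> + 2 * c * \<epsilon>"
  proof -
    have Qw: "Q w i = Q v i - Q (A \<sigma>) i" if i: "i < N" for i
    proof -
      have 1: "B w j = 1 * B v j + (-1) * B (A \<sigma>) j" if "j < N" for j
        using linear_opD(1)[OF B_lin that, of 1 v "-1" "A \<sigma>"] by (simp add: w_def[abs_def])
      have "B (B w) i = B (\<lambda>j. 1 * B v j + (-1) * B (A \<sigma>) j) i" by (rule linear_opD(2)[OF B_lin 1 i])
      also have "\<dots> = 1 * B (B v) i + (-1) * B (B (A \<sigma>)) i" by (rule linear_opD(1)[OF B_lin i])
      finally show ?thesis by (simp add: Q_def w_def algebra_simps)
    qed
    have "l2n N g = l2n N (\<lambda>i. (\<sigma> i - Q (A \<sigma>) i) + (-1) * Q w i)"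
      by (rule l2n_cong) (simp add: g_def Qw)
    also have "\<dots> \<le> l2n N (\<lambda>i. \<sigma> i - Q (A \<sigma>) i) + l2n N (\<lambda>i. (-1) * Q w i)" by (rule l2n_triangle)
    also have "\<dots> = l2n N (\<lambda>i. \<sigma> i - Q (A \<sigma>) i) + l2n N (Q w)" by (simp only: l2n_scale, simp?)
    also have "\<dots> \<le> \<tau> * 1 + 2 * c * \<epsilon>"
    proof (rule add_mono)
      have "l2n N (\<lambda>i. \<sigma> i - Q (A \<sigma>) i) \<le> \<tau> * l2n N \<sigma>" unfolding Q_def by (rule inverse)
      also have "\<dots> \<le> \<tau> * 1" by (rule mult_left_mono[OF l\<sigma> \<tau>])
      finally show "l2n N (\<lambda>i. \<sigma> i - Q (A \<sigma>) i) \<le> \<tau> * 1" .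
      have "2 * c * l2n N w \<le> 2 * c * \<epsilon>" using lw c by (intro mult_left_mono) auto
      then show "l2n N (Q w) \<le> 2 * c * \<epsilon>" using l2n_Q[of w] by linarith
    qed
    finally show ?thesis by simp
  qed
  have ipg: "ip N u (Q v) = ip N u \<sigma> - ip N u g" for u
  proof -
    have "ip N u (Q v) = ip N u (\<lambda>i. 1 * \<sigma> i + (-1) * g i)" by (simp add: g_def[abs_def])
    then show ?thesis by (simp only: ip_lin)
  qed
  have e1: "energy v = ip N v (Q v)" by (simp add: energy_def ip_Q)
  have e2: "ip N \<sigma> (A \<sigma>) = ip N \<sigma> v - ip N \<sigma> w"
  proof -
    have "ip N \<sigma> (A \<sigma>) = ip N \<sigma> (\<lambda>i. 1 * v i + (-1) * w i)" by (simp add: w_def[abs_def])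
    then show ?thesis by (simp only: ip_lin)
  qed
  have e3: "ip N \<sigma> (\<lambda>i. x i + v i) = ip N \<sigma> x + ip N \<sigma> v"
    using ip_lin[of N \<sigma> 1 x 1 v] by simp
  have main: "(ip N \<sigma> (\<lambda>i. x i + v i) - energy (\<lambda>i. x i + v i) / 2) - (ip N \<sigma> (A \<sigma>) / 2 - energy x / 2)
      = ip N x g + ip N v g / 2 + ip N \<sigma> w / 2"
    unfolding e3 energy_shift e1 ipg e2 ip_commute[of N \<sigma> x] ip_commute[of N \<sigma> v] by (simp add: field_simps)
  have 1: "\<bar>ip N x g\<bar> \<le> real N * (R * (\<tau> + 2 * c * \<epsilon>))"
    by (rule order_trans[OF ip_le_l2n[OF N]]) (intro mult_left_mono mult_mono lx lg l2n_nonneg R of_nat_0_le_iff)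
  have 2: "\<bar>ip N v g\<bar> \<le> real N * (?V * (\<tau> + 2 * c * \<epsilon>))"
    using \<epsilon> by (intro order_trans[OF ip_le_l2n[OF N]] mult_left_mono mult_mono lv lg l2n_nonneg) simp_all
  have 3: "\<bar>ip N \<sigma> w\<bar> \<le> real N * (1 * \<epsilon>)"
    using \<epsilon> by (intro order_trans[OF ip_le_l2n[OF N]] mult_left_mono mult_mono l\<sigma> lw l2n_nonneg) simp_all
  have "\<bar>ip N x g + ip N v g / 2 + ip N \<sigma> w / 2\<bar> \<le> \<bar>ip N x g\<bar> + \<bar>ip N v g\<bar> + \<bar>ip N \<sigma> w\<bar>" by linarith
  also have "\<dots> \<le> real N * (R * (\<tau> + 2 * c * \<epsilon>)) + real N * (?V * (\<tau> + 2 * c * \<epsilon>)) + real N * (1 * \<epsilon>)"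
    by (intro add_mono 1 2 3)
  also have "\<dots> = real N * err R" by (simp add: err_def algebra_simps)
  finally show ?thesis unfolding main .
qed

definition grid :: "nat \<Rightarrow> (nat \<Rightarrow> real) set" where
  "grid K = {..<N} \<rightarrow>\<^sub>E lat \<epsilon> K"

definition I :: "nat \<Rightarrow> real" where
  "I K = (\<Sum>x\<in>grid K. exp (- energy x / 2))"

text \<open>The Gaussian transform of \<open>exp (\<langle>\<sigma>, A \<sigma>\<rangle> / 2)\<close>, before division by the normalisation \<open>I\<close>.\<close>

definition J :: "nat \<Rightarrow> (nat \<Rightarrow> real) \<Rightarrow> real" where
  "J K \<sigma> = (\<Sum>x\<in>grid K. exp (ip N \<sigma> x - energy x / 2))"

lemma finite_grid: "finite (grid K)"
  unfolding grid_def by (intro finite_PiE finite_lat) simp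

lemma grid_bound: "x \<in> grid K \<Longrightarrow> i < N \<Longrightarrow> \<bar>x i\<bar> \<le> \<epsilon> * real K"
  unfolding grid_def using \<epsilon> by (intro lat_bound) (auto simp: PiE_iff)

lemma lat_add: "x \<in> lat \<epsilon> K \<Longrightarrow> y \<in> lat \<epsilon> K' \<Longrightarrow> x + y \<in> lat \<epsilon> (K + K')"
proof -
  assume "x \<in> lat \<epsilon> K" "y \<in> lat \<epsilon> K'"
  then obtain k k' :: int where k: "x = \<epsilon> * of_int k" "\<bar>k\<bar> \<le> int K" "y = \<epsilon> * of_int k'" "\<bar>k'\<bar> \<le> int K'"
    unfolding lat_iff by blast
  have "x + y = \<epsilon> * of_int (k + k')" "\<bar>k + k'\<bar> \<le> int (K + K')" using k by (simp_all add: algebra_simps)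
  then show ?thesis unfolding lat_iff by blast
qed

lemma lat_uminus: "x \<in> lat \<epsilon> K \<Longrightarrow> - x \<in> lat \<epsilon> K"
proof -
  assume "x \<in> lat \<epsilon> K"
  then obtain k :: int where k: "x = \<epsilon> * of_int k" "\<bar>k\<bar> \<le> int K" unfolding lat_iff by blast
  then have "- x = \<epsilon> * of_int (- k)" "\<bar>- k\<bar> \<le> int K" by simp_all
  then show ?thesis unfolding lat_iff by blast
qed

lemma rounded_shift:
  assumes \<sigma>: "\<sigma> \<in> {..<N} \<rightarrow>\<^sub>E {-1, 1}"
  obtains v where "\<And>i. i < N \<Longrightarrow> v i \<in> lat \<epsilon> M" "\<And>i. i < N \<Longrightarrow> \<bar>v i - A \<sigma> i\<bar> \<le> \<epsilon>"
proof
  \<comment> \<open>Rounding to the nearest lattice point; the summand \<open>\<epsilon>\<close> in \<open>A_bound\<close> leaves room for it inside \<open>lat \<epsilon> M\<close>.\<close>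
  let ?v = "\<lambda>i. \<epsilon> * of_int (round (A \<sigma> i / \<epsilon>))"
  fix i assume i: "i < N"
  have r: "\<bar>of_int (round (A \<sigma> i / \<epsilon>)) - A \<sigma> i / \<epsilon>\<bar> \<le> 1"
    using of_int_round_abs_le[of "A \<sigma> i / \<epsilon>"] by linarith
  have "?v i - A \<sigma> i = \<epsilon> * (of_int (round (A \<sigma> i / \<epsilon>)) - A \<sigma> i / \<epsilon>)" using \<epsilon> by (simp add: right_diff_distrib)
  then have "\<bar>?v i - A \<sigma> i\<bar> = \<epsilon> * \<bar>of_int (round (A \<sigma> i / \<epsilon>)) - A \<sigma> i / \<epsilon>\<bar>" using \<epsilon> by (simp add: abs_mult)
  then show d: "\<bar>?v i - A \<sigma> i\<bar> \<le> \<epsilon>" using r \<epsilon> mult_left_mono[OF r, of \<epsilon>] by simp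
  have "\<bar>?v i\<bar> \<le> \<epsilon> * real M" using d A_bound[OF \<sigma> i] by linarith
  then have "\<epsilon> * \<bar>of_int (round (A \<sigma> i / \<epsilon>))\<bar> \<le> \<epsilon> * real M" using \<epsilon> by (simp add: abs_mult)
  then have "\<bar>of_int (round (A \<sigma> i / \<epsilon>)) :: real\<bar> \<le> real M" using \<epsilon> by simp
  then have "\<bar>round (A \<sigma> i / \<epsilon>)\<bar> \<le> int M" by linarith
  then show "?v i \<in> lat \<epsilon> M" unfolding lat_iff by blast
qed

lemma shifted_grid_sum:
  fixes v :: "nat \<Rightarrow> real" and F :: "(nat \<Rightarrow> real) \<Rightarrow> real"
  assumes v: "\<And>i. i < N \<Longrightarrow> v i \<in> lat \<epsilon> M" and F: "\<And>x. x \<in> grid (K + M) \<Longrightarrow> 0 \<le> F x"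
  shows "(\<Sum>x\<in>grid K. F (\<lambda>i\<in>{..<N}. x i + v i)) \<le> (\<Sum>x\<in>grid (K + M). F x)"
proof -
  let ?s = "\<lambda>x. \<lambda>i\<in>{..<N}. x i + v i"
  have inj: "inj_on ?s (grid K)"
  proof (rule inj_onI)
    fix x y assume x: "x \<in> grid K" and y: "y \<in> grid K" and e: "?s x = ?s y"
    show "x = y"
    proof
      fix i show "x i = y i"
      proof (cases "i < N")
        case True
        then show ?thesis using fun_cong[OF e, of i] by simp
      next
        case False
        then show ?thesis using x y by (simp add: grid_def PiE_def extensional_def)
      qed
    qed
  qed
  have "(\<Sum>x\<in>grid K. F (?s x)) = sum F (?s ` grid K)" by (simp add: sum.reindex[OF inj])
  also have "\<dots> \<le> sum F (grid (K + M))"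
  proof (rule sum_mono2[OF finite_grid])
    show "?s ` grid K \<subseteq> grid (K + M)"
    proof
      fix y assume "y \<in> ?s ` grid K"
      then obtain x where x: "x \<in> grid K" "y = ?s x" by blast
      have "x i + v i \<in> lat \<epsilon> (K + M)" if "i < N" for i
        using x(1) that by (intro lat_add v) (auto simp: grid_def PiE_iff)
      then show "y \<in> grid (K + M)" unfolding x(2) grid_def by (auto simp: PiE_iff)
    qed
  qed (use F in auto)
  finally show ?thesis .
qed

text \<open>The shift by \<open>v\<close> maps the box of size \<open>K\<close> into the one of size \<open>K + M\<close>, not onto it; so the normalisation
on the left belongs to a smaller box.\<close>

lemma J_lower:
  assumes \<sigma>: "\<sigma> \<in> {..<N} \<rightarrow>\<^sub>E {-1, 1}" and R: "\<epsilon> * real K \<le> R"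
  shows "exp (ip N \<sigma> (A \<sigma>) / 2 - real N * err R) * I K \<le> J (K + M) \<sigma>"
proof -
  obtain v where v: "\<And>i. i < N \<Longrightarrow> v i \<in> lat \<epsilon> M" "\<And>i. i < N \<Longrightarrow> \<bar>v i - A \<sigma> i\<bar> \<le> \<epsilon>"
    by (rule rounded_shift[OF \<sigma>]) (rule that)
  have R0: "R \<ge> 0" using R \<epsilon> by (meson mult_nonneg_nonneg less_imp_le of_nat_0_le_iff order_trans)
  let ?s = "\<lambda>x. \<lambda>i\<in>{..<N}. x i + v i"
  have "exp (ip N \<sigma> (A \<sigma>) / 2 - real N * err R) * I K
      = (\<Sum>x\<in>grid K. exp (ip N \<sigma> (A \<sigma>) / 2 - real N * err R + - energy x / 2))"
    by (simp only: I_def sum_distrib_left exp_add)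
  also have "\<dots> \<le> (\<Sum>x\<in>grid K. exp (ip N \<sigma> (?s x) - energy (?s x) / 2))"
  proof (rule sum_mono)
    fix x assume x: "x \<in> grid K"
    have "\<bar>(ip N \<sigma> (\<lambda>i. x i + v i) - energy (\<lambda>i. x i + v i) / 2) - (ip N \<sigma> (A \<sigma>) / 2 - energy x / 2)\<bar> \<le> real N * err R"
    proof (rule shift_exponent[OF \<sigma> v(2) _ _ R0])
      show "\<bar>v i\<bar> \<le> \<epsilon> * real M" if "i < N" for i using v(1)[OF that] \<epsilon> by (intro lat_bound) auto
      show "\<bar>x i\<bar> \<le> R" if "i < N" for i using grid_bound[OF x that] R by linarith
    qed
    moreover have "ip N \<sigma> (?s x) = ip N \<sigma> (\<lambda>i. x i + v i)" by (intro ip_cong) simp_all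
    moreover have "energy (?s x) = energy (\<lambda>i. x i + v i)" by (intro energy_cong) simp
    ultimately show "exp (ip N \<sigma> (A \<sigma>) / 2 - real N * err R + - energy x / 2) \<le> exp (ip N \<sigma> (?s x) - energy (?s x) / 2)"
      unfolding exp_le_cancel_iff by linarith
  qed
  also have "\<dots> \<le> J (K + M) \<sigma>" unfolding J_def by (rule shifted_grid_sum[OF v(1)]) simp_all
  finally show ?thesis .
qed

lemma J_upper:
  assumes \<sigma>: "\<sigma> \<in> {..<N} \<rightarrow>\<^sub>E {-1, 1}" and R: "\<epsilon> * real (K + M) \<le> R"
  shows "J K \<sigma> \<le> exp (ip N \<sigma> (A \<sigma>) / 2 + real N * err R) * I (K + M)"
proof -
  obtain v where v: "\<And>i. i < N \<Longrightarrow> v i \<in> lat \<epsilon> M" "\<And>i. i < N \<Longrightarrow> \<bar>v i - A \<sigma> i\<bar> \<le> \<epsilon>"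
    by (rule rounded_shift[OF \<sigma>]) (rule that)
  have R0: "R \<ge> 0" using R \<epsilon> by (meson mult_nonneg_nonneg less_imp_le of_nat_0_le_iff order_trans)
  let ?s = "\<lambda>x. \<lambda>i\<in>{..<N}. x i + - v i"
  have "J K \<sigma> \<le> (\<Sum>x\<in>grid K. exp (ip N \<sigma> (A \<sigma>) / 2 + real N * err R) * exp (- energy (?s x) / 2))"
    unfolding J_def
  proof (rule sum_mono)
    fix x assume x: "x \<in> grid K"
    have vM: "\<bar>v i\<bar> \<le> \<epsilon> * real M" if "i < N" for i using v(1)[OF that] \<epsilon> by (intro lat_bound) auto
    have sx: "\<bar>?s x i\<bar> \<le> R" if "i < N" for i
    proof -
      have "\<bar>?s x i\<bar> \<le> \<bar>x i\<bar> + \<bar>v i\<bar>" using that by simp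
      also have "\<dots> \<le> \<epsilon> * real K + \<epsilon> * real M" by (intro add_mono grid_bound[OF x that] vM[OF that])
      also have "\<dots> \<le> R" using R by (simp add: algebra_simps)
      finally show ?thesis .
    qed
    have "\<bar>(ip N \<sigma> (\<lambda>i. ?s x i + v i) - energy (\<lambda>i. ?s x i + v i) / 2) - (ip N \<sigma> (A \<sigma>) / 2 - energy (?s x) / 2)\<bar> \<le> real N * err R"
      by (rule shift_exponent[OF \<sigma> v(2) vM sx R0])
    moreover have "ip N \<sigma> (\<lambda>i. ?s x i + v i) = ip N \<sigma> x" by (intro ip_cong) simp_all
    moreover have "energy (\<lambda>i. ?s x i + v i) = energy x" by (intro energy_cong) simp
    ultimately have "ip N \<sigma> x - energy x / 2 \<le> (ip N \<sigma> (A \<sigma>) / 2 + real N * err R) + - energy (?s x) / 2"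
      by linarith
    then show "exp (ip N \<sigma> x - energy x / 2) \<le> exp (ip N \<sigma> (A \<sigma>) / 2 + real N * err R) * exp (- energy (?s x) / 2)"
      unfolding exp_add[symmetric] exp_le_cancel_iff .
  qed
  also have "\<dots> = exp (ip N \<sigma> (A \<sigma>) / 2 + real N * err R) * (\<Sum>x\<in>grid K. exp (- energy (?s x) / 2))"
    by (rule sum_distrib_left[symmetric])
  also have "\<dots> \<le> exp (ip N \<sigma> (A \<sigma>) / 2 + real N * err R) * I (K + M)"
    unfolding I_def by (intro mult_left_mono shifted_grid_sum[where v = "\<lambda>i. - v i"] lat_uminus v(1)) simp_all
  finally show ?thesis .
qed

lemma grid_mono: "K \<le> K' \<Longrightarrow> grid K \<subseteq> grid K'"
  unfolding grid_def by (intro PiE_mono) (auto simp: lat_def)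

lemma I_mono: "K \<le> K' \<Longrightarrow> I K \<le> I K'"
  unfolding I_def by (intro sum_mono2 finite_grid grid_mono) simp_all

lemma I_pos: "I K > 0"
proof -
  have "(\<lambda>i\<in>{..<N}. 0) \<in> grid K" using zero_in_lat by (simp add: grid_def)
  then show ?thesis unfolding I_def by (intro sum_pos finite_grid) auto
qed

lemma I_upper: "I K \<le> (2 * real K + 1) ^ N"
proof -
  have "card (lat \<epsilon> K) \<le> 2 * K + 1"
    unfolding lat_def by (rule order_trans[OF card_image_le]) auto
  then have "real (card (lat \<epsilon> K)) ^ N \<le> (2 * real K + 1) ^ N"
    by (intro power_mono) (simp_all flip: of_nat_Suc)
  moreover have "real (card (grid K)) = real (card (lat \<epsilon> K)) ^ N"
    unfolding grid_def by (simp add: card_PiE)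
  moreover have "I K \<le> (\<Sum>x\<in>grid K. 1)" unfolding I_def using energy_nonneg by (intro sum_mono) simp
  ultimately show ?thesis by simp
qed

text \<open>Only the points with all coordinates in \<open>[-1, 1]\<close> are counted; their energy is at most \<open>c N\<close>.\<close>

lemma I_lower:
  assumes m: "\<epsilon> * real m \<le> 1" "m \<le> K"
  shows "real m ^ N * exp (- c * real N / 2) \<le> I K"
proof -
  have inj: "inj_on (\<lambda>k::int. \<epsilon> * of_int k) {- int m..int m}" using \<epsilon> by (auto simp: inj_on_def)
  have "card (lat \<epsilon> m) = card {- int m..int m}" unfolding lat_def by (rule card_image[OF inj])
  then have cl: "real m \<le> real (card (lat \<epsilon> m))" by simp
  have "real m ^ N \<le> real (card (grid m))"
    unfolding grid_def using power_mono[OF cl, of N] by (simp add: card_PiE)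
  then have "real m ^ N * exp (- c * real N / 2) \<le> real (card (grid m)) * exp (- c * real N / 2)"
    by (intro mult_right_mono) simp_all
  also have "\<dots> = (\<Sum>x\<in>grid m. exp (- c * real N / 2))" by simp
  also have "\<dots> \<le> I m"
    unfolding I_def
  proof (rule sum_mono)
    fix x assume x: "x \<in> grid m"
    have "ip N x x \<le> real N * 1\<^sup>2" using grid_bound[OF x] m(1) by (intro ip_self_le) (meson order_trans)
    then have "energy x \<le> c * real N" using energy_le[of x] mult_left_mono[of "ip N x x" "real N" c] c by simp
    then show "exp (- c * real N / 2) \<le> exp (- energy x / 2)" by simp
  qed
  also have "\<dots> \<le> I K" by (rule I_mono[OF m(2)])
  finally show ?thesis .
qed

end

section \<open>Ingredients for the free energy\<close>

context bounded_graphs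
begin

text \<open>The number \<open>n\<close> of binomial steps is taken so large that the curvature of the binomial layer still
exceeds \<open>\<beta>\<^sup>2 / \<kappa>\<close> and the errors depending on \<open>n\<close> are small; then the lattice spacing is chosen.\<close>

lemma log_partition_approximable:
  fixes \<beta> \<kappa> R \<eta> :: real
  assumes \<kappa>: "\<kappa> > 0" and \<beta>: "\<beta> \<ge> 0" and q: "\<beta>\<^sup>2 < \<kappa>" and R0: "R \<ge> 0"
    and norm: "\<And>G v. G \<in> GG \<Longrightarrow> l2n (sz G) (Bop p G v) \<le> \<beta> * l2n (sz G) v" and \<eta>: "\<eta> > 0"
  obtains \<epsilon>0 where "\<epsilon>0 > 0"
    "\<And>\<epsilon> K (r :: real \<Rightarrow> real \<Rightarrow> real). 0 < \<epsilon> \<Longrightarrow> \<epsilon> \<le> \<epsilon>0 \<Longrightarrow> \<epsilon> * real K \<le> R \<Longrightarrow> (\<And>h. curved_weight \<kappa> \<epsilon> (lat \<epsilon> K) (r h)) \<Longrightarrow>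
       (\<And>x. continuous_on UNIV (\<lambda>h. r h x)) \<Longrightarrow>
       \<exists>\<phi>\<in>density_span. \<forall>G\<in>GG. \<bar>log_partition r (lat \<epsilon> K) p G - \<phi> G\<bar> \<le> \<eta>"
proof -
  obtain Y where Y: "\<And>G x i. G \<in> GG \<Longrightarrow> \<forall>i<sz G. \<bar>x i\<bar> \<le> R \<Longrightarrow> i < sz G \<Longrightarrow> \<bar>Bop p G x i\<bar> \<le> Y"
    using op_poly_bounded[of R p] by blast
  define k where "k n = real n * (real n + 1) / (real n + 2)\<^sup>2" for n :: nat
  define e where "e n = 2 / sqrt (real n)" for n :: nat
  define L where "L n = \<beta> * (2 * \<beta> * R / k n + e n)" for n
  define E where "E n = Y ^ 4 / (8 * real n) + (\<beta> * R * e n + L n * (\<beta> * e n / \<kappa>) / (1 - \<beta>\<^sup>2 / (\<kappa> * k n)))" for n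
  have kl: "k \<longlonglongrightarrow> 1" unfolding k_def by real_asymp
  have el: "e \<longlonglongrightarrow> 0" unfolding e_def by real_asymp
  have yl: "(\<lambda>n. Y ^ 4 / (8 * real n)) \<longlonglongrightarrow> 0" by real_asymp
  have "E \<longlonglongrightarrow> 0 + (\<beta> * R * 0 + \<beta> * (2 * \<beta> * R / 1 + 0) * (\<beta> * 0 / \<kappa>) / (1 - \<beta>\<^sup>2 / (\<kappa> * 1)))"
    unfolding E_def[abs_def] L_def using \<kappa> q
    by (intro tendsto_add yl tendsto_mult tendsto_divide tendsto_diff tendsto_const kl el) auto
  then have "E \<longlonglongrightarrow> 0" by simp
  then have ev1: "\<forall>\<^sub>F n in sequentially. E n < \<eta> / 4" using \<eta> by (intro order_tendstoD) auto
  have "(\<lambda>n. \<kappa> * k n) \<longlonglongrightarrow> \<kappa> * 1" by (intro tendsto_mult tendsto_const kl)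
  then have ev2: "\<forall>\<^sub>F n in sequentially. \<beta>\<^sup>2 < \<kappa> * k n" using q by (intro order_tendstoD) auto
  obtain n where n: "n > 0" "E n < \<eta> / 4" "\<beta>\<^sup>2 < \<kappa> * k n"
    using eventually_happens[OF eventually_conj[OF eventually_gt_at_top[of 0] eventually_conj[OF ev1 ev2]]]
    by auto
  have kn: "k n > 0" using n(1) by (simp add: k_def)
  have en: "e n > 0" using n(1) by (simp add: e_def)
  have L0: "L n \<ge> 0" unfolding L_def using \<beta> R0 kn en by simp
  define d where "d = 1 - \<beta>\<^sup>2 / (\<kappa> * k n)"
  have d: "d > 0" unfolding d_def using n(3) kn \<kappa> by simp
  define \<epsilon>0 where "\<epsilon>0 = \<eta> / 4 * d / (L n + 1)"
  have \<epsilon>0: "\<epsilon>0 > 0" unfolding \<epsilon>0_def using \<eta> d L0 by simp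
  show thesis
  proof (rule that[OF \<epsilon>0])
    fix \<epsilon> :: real and K :: nat and r :: "real \<Rightarrow> real \<Rightarrow> real"
    assume \<epsilon>: "0 < \<epsilon>" "\<epsilon> \<le> \<epsilon>0" and RK: "\<epsilon> * real K \<le> R"
      and curv: "\<And>h. curved_weight \<kappa> \<epsilon> (lat \<epsilon> K) (r h)" and cont: "\<And>x. continuous_on UNIV (\<lambda>h. r h x)"
    have "\<eta> / 4 > 0" using \<eta> by simp
    from log_partition_near_span[OF \<epsilon>(1) n(1) RK curv cont \<kappa> \<beta> n(3)[unfolded k_def] norm Y this]
    obtain \<phi> where \<phi>: "\<phi> \<in> density_span" "\<And>G. G \<in> GG \<Longrightarrow> \<bar>log_partition r (lat \<epsilon> K) p G - \<phi> G\<bar>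
       \<le> \<eta> / 4 + Y ^ 4 / (8 * real n) + (\<beta> * R * e n + L n * (\<epsilon> + \<beta> * e n / \<kappa>) / d)"
      unfolding L_def d_def k_def e_def by blast
    have "L n * \<epsilon> / d \<le> (L n + 1) * \<epsilon>0 / d"
      using \<epsilon> L0 d \<epsilon>0 by (intro divide_right_mono mult_mono) auto
    also have "\<dots> = \<eta> / 4"
    proof -
      have "l * (x * d / l) / d = x" if "l > 0" for l x using that d by simp
      from this[of "L n + 1" "\<eta> / 4"] show ?thesis unfolding \<epsilon>0_def using L0 by simp
    qed
    finally have a: "L n * \<epsilon> / d \<le> \<eta> / 4" .
    have "\<eta> / 4 + Y ^ 4 / (8 * real n) + (\<beta> * R * e n + L n * (\<epsilon> + \<beta> * e n / \<kappa>) / d)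
       = \<eta> / 4 + E n + L n * \<epsilon> / d"
      unfolding E_def d_def[symmetric] by (simp add: distrib_left add_divide_distrib)
    also have "\<dots> \<le> \<eta>" using a n(2) \<eta> by linarith
    finally show "\<exists>\<phi>\<in>density_span. \<forall>G\<in>GG. \<bar>log_partition r (lat \<epsilon> K) p G - \<phi> G\<bar> \<le> \<eta>"
      using \<phi> by (intro bexI[OF _ \<phi>(1)]) (auto intro: order_trans)
  qed
qed

text \<open>The density of a single vertex.\<close>

lemma one_in_span:
  obtains \<phi> where "\<phi> \<in> density_span" "\<And>G. G \<in> GG \<Longrightarrow> \<phi> G = 1"
proof -
  have tree: "rooted_tree {0} []" by (simp add: rooted_tree_def)
  obtain X where X: "test_graph X" "\<And>G. G \<in> GG \<Longrightarrow> hom_density X G = msum {0} [] (\<lambda>_. 0) G"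
    by (rule msum_is_density[OF tree, of "\<lambda>_. 0"]) (rule that)
  have "hom_density X G = 1" if G: "G \<in> GG" for G
    using X(2)[OF G] size_pos[OF G] by (simp add: msum_def card_PiE)
  then show thesis by (intro that[OF hom_density_in_span[OF X(1)]])
qed

end

lemma val_poly_map: "val_poly (map f [0..<m]) x = (\<Sum>k<m. f k * x ^ k)"
proof (induction m arbitrary: f)
  case (Suc m)
  have "map f [0..<Suc m] = f 0 # map (f \<circ> Suc) [0..<m]"
    by (simp only: upt_conv_Cons[OF zero_less_Suc] list.map map_Suc_upt[symmetric] map_map)
  then have "val_poly (map f [0..<Suc m]) x = f 0 + x * (\<Sum>k<m. f (Suc k) * x ^ k)"
    by (simp only: val_poly.simps Suc.IH o_apply)
  also have "\<dots> = (\<Sum>k<Suc m. f k * x ^ k)"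
    by (simp only: sum.lessThan_Suc_shift sum_distrib_left power_Suc power_0 mult_1_right mult_ac)
  finally show ?case .
qed simp

lemma polynomial_approximation:
  fixes g :: "real \<Rightarrow> real"
  assumes "continuous_on {a..b} g" "\<tau> > 0"
  obtains p where "\<And>x. x \<in> {a..b} \<Longrightarrow> \<bar>g x - val_poly p x\<bar> < \<tau>"
proof -
  obtain P where P: "real_polynomial_function P" "\<And>x. x \<in> {a..b} \<Longrightarrow> \<bar>g x - P x\<bar> < \<tau>"
    by (rule Stone_Weierstrass_real_polynomial_function[OF compact_Icc assms]) (rule that)
  then obtain c n where "P = (\<lambda>x. \<Sum>k\<le>n. c k * x ^ k)" unfolding real_polynomial_function_iff_sum by blast
  then have "P x = val_poly (map c [0..<Suc n]) x" for x by (simp only: val_poly_map lessThan_Suc_atMost)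
  then show thesis using P(2) by (intro that[of "map c [0..<Suc n]"]) simp
qed

text \<open>If \<open>g (j + 2)\<close> lies between \<open>z + f (j + 1)\<close> and \<open>z + f (j + 3)\<close>, up to an error, then the average of the
differences \<open>g - f\<close> determines \<open>z\<close> up to the total growth of \<open>f\<close> divided by the number of terms.\<close>

lemma telescoping_average:
  fixes f g :: "nat \<Rightarrow> real"
  assumes m: "m > 0" and mono: "\<And>i j. i \<le> j \<Longrightarrow> f i \<le> f j"
    and lo: "\<And>j. j < m \<Longrightarrow> z - d + f (j + 1) \<le> g (j + 2)"
    and hi: "\<And>j. j < m \<Longrightarrow> g (j + 2) \<le> z + d + f (j + 3)"
  shows "\<bar>(\<Sum>j<m. g (j + 2) - f (j + 2)) / real m - z\<bar> \<le> d + (f (m + 2) - f 1) / real m"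
proof -
  let ?D = "\<Sum>j<m. g (j + 2) - f (j + 2)"
  have t1: "(\<Sum>j<m. f (j + 3) - f (j + 2)) = f (m + 2) - f 2"
    using sum_lessThan_telescope[of "\<lambda>j. f (j + 2)" m] by (simp add: numeral_3_eq_3 numeral_2_eq_2)
  have t2: "(\<Sum>j<m. f (j + 2) - f (j + 1)) = f (m + 1) - f 1"
    using sum_lessThan_telescope[of "\<lambda>j. f (j + 1)" m] by simp
  have "?D \<le> (\<Sum>j<m. (z + d) + (f (j + 3) - f (j + 2)))" using hi by (intro sum_mono) (simp add: algebra_simps)
  also have "\<dots> = real m * (z + d) + (f (m + 2) - f 2)" unfolding sum.distrib t1 by (simp add: distrib_left)
  also have "\<dots> \<le> real m * (z + d) + (f (m + 2) - f 1)" using mono[of 1 2] by simp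
  finally have U: "?D \<le> real m * (z + d) + (f (m + 2) - f 1)" .
  have "real m * (z - d) - (f (m + 2) - f 1) \<le> real m * (z - d) - (f (m + 1) - f 1)" using mono[of "m + 1" "m + 2"] by simp
  also have "\<dots> = (\<Sum>j<m. (z - d) - (f (j + 2) - f (j + 1)))" unfolding sum_subtractf t2[unfolded sum_subtractf] by (simp add: right_diff_distrib)
  also have "\<dots> \<le> ?D" using lo by (intro sum_mono) (simp add: algebra_simps)
  finally have Lo: "real m * (z - d) - (f (m + 2) - f 1) \<le> ?D" .
  define X D r where "X = f (m + 2) - f 1" and "D = ?D" and "r = real m"
  have "r * (z - d) - X \<le> D" "D \<le> r * (z + d) + X" "r > 0" using Lo U m by (simp_all only: X_def D_def r_def of_nat_0_less_iff)
  then have "(r * (z - d) - X) / r \<le> D / r" "D / r \<le> (r * (z + d) + X) / r" "r \<noteq> 0"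
    by (auto intro: divide_right_mono)
  then have "(z - d) - X / r \<le> D / r" "D / r \<le> (z + d) + X / r"
    by (simp_all add: diff_divide_distrib add_divide_distrib)
  then have "\<bar>D / r - z\<bar> \<le> d + X / r" by linarith
  then show ?thesis by (simp only: X_def D_def r_def)
qed

lemma eigenvalue_of_mv:
  assumes G: "weighted_graph G" and v: "ip (sz G) v v > 0"
    and eig: "\<And>i. i < sz G \<Longrightarrow> mv (sz G) (ew G) v i = l * v i"
  shows "eigenvalue (edge_weights G) l"
proof -
  let ?N = "sz G"
  have d: "dim_row (edge_weights G) = ?N" "dim_col (edge_weights G) = ?N"
    using G by (auto simp: weighted_graph_def)
  have "vec ?N v \<noteq> 0\<^sub>v ?N"
  proof
    assume e: "vec ?N v = 0\<^sub>v ?N"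
    have "v i = 0" if "i < ?N" for i using arg_cong[OF e, of "\<lambda>w. w $ i"] that by simp
    then show False using v by (simp add: ip_def)
  qed
  moreover have "edge_weights G *\<^sub>v vec ?N v = l \<cdot>\<^sub>v vec ?N v"
    using eig by (intro eq_vecI) (auto simp: d scalar_prod_def mv_def ew_def atLeast0LessThan)
  ultimately show ?thesis unfolding eigenvalue_def eigenvector_def d by (intro exI[of _ "vec ?N v"]) simp
qed

lemma partition_function_eq:
  assumes G: "weighted_graph G"
  shows "partition_function G = (\<Sum>\<sigma>\<in>{..<sz G} \<rightarrow>\<^sub>E {-1, 1}.
      exp (ip (sz G) \<sigma> (mv (sz G) (ew G) \<sigma>) / 2 + (\<Sum>i<sz G. vw G i * \<sigma> i)))"
proof -
  let ?N = "sz G"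
  have d: "dim_row (edge_weights G) = ?N" "dim_col (edge_weights G) = ?N" "dim_vec (vertex_weights G) = ?N"
    using G by (auto simp: weighted_graph_def)
  show ?thesis
    unfolding partition_function_def
  proof (rule sum.reindex_bij_witness[of _ "\<lambda>\<sigma>. vec ?N \<sigma>" "\<lambda>w. \<lambda>i\<in>{..<?N}. w $ i"])
    fix w assume w: "w \<in> spin_configurations ?N"
    then have dw: "dim_vec w = ?N" and wi: "\<And>i. i < ?N \<Longrightarrow> w $ i \<in> {-1, 1}"
      by (auto simp: spin_configurations_def)
    show "vec ?N (\<lambda>i\<in>{..<?N}. w $ i) = w" using dw by (intro eq_vecI) auto
    show "(\<lambda>i\<in>{..<?N}. w $ i) \<in> {..<?N} \<rightarrow>\<^sub>E {-1, 1}" using wi by (intro restrict_PiE_iff[THEN iffD2]) auto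
    have "w \<bullet> (edge_weights G *\<^sub>v w) = ip ?N (\<lambda>i\<in>{..<?N}. w $ i) (mv ?N (ew G) (\<lambda>i\<in>{..<?N}. w $ i))"
      by (simp add: scalar_prod_def ip_def mv_def ew_def d dw atLeast0LessThan)
    moreover have "vertex_weights G \<bullet> w = (\<Sum>i<?N. vw G i * (\<lambda>i\<in>{..<?N}. w $ i) i)"
      by (simp add: scalar_prod_def vw_def dw atLeast0LessThan)
    ultimately show "exp (ip ?N (\<lambda>i\<in>{..<?N}. w $ i) (mv ?N (ew G) (\<lambda>i\<in>{..<?N}. w $ i)) / 2 + (\<Sum>i<?N. vw G i * (\<lambda>i\<in>{..<?N}. w $ i) i))
      = exp (1 / 2 * (w \<bullet> (edge_weights G *\<^sub>v w)) + vertex_weights G \<bullet> w)" by simp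
  next
    fix \<sigma> assume \<sigma>: "\<sigma> \<in> {..<?N} \<rightarrow>\<^sub>E {- 1, 1 :: real}"
    show "(\<lambda>i\<in>{..<?N}. vec ?N \<sigma> $ i) = \<sigma>"
    proof
      fix i show "(\<lambda>i\<in>{..<?N}. vec ?N \<sigma> $ i) i = \<sigma> i"
        using \<sigma> by (cases "i < ?N") (auto simp: PiE_def extensional_def)
    qed
    show "vec ?N \<sigma> \<in> spin_configurations ?N"
      unfolding spin_configurations_def using PiE_mem[OF \<sigma>] by auto
  qed
qed

text \<open>Summing \<open>exp (\<langle>\<sigma>, x + h\<rangle>)\<close> over the spins decouples the sites.\<close>

lemma ising_as_Gaussian_mixture:
  fixes x h :: "nat \<Rightarrow> real"
  shows "(\<Prod>i<N. exp (- c * (x i)\<^sup>2 / 2) * (exp (x i + h i) + exp (- (x i + h i))))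
    = exp (- c * ip N x x / 2) * (\<Sum>\<sigma>\<in>{..<N} \<rightarrow>\<^sub>E {-1, 1}. exp (\<Sum>i<N. h i * \<sigma> i) * exp (ip N \<sigma> x))"
proof -
  have "(\<Prod>i<N. exp (x i + h i) + exp (- (x i + h i))) = (\<Prod>i<N. \<Sum>s\<in>{-1, 1}. exp (s * (x i + h i)))"
    by (intro prod.cong refl) (simp add: add.commute)
  also have "\<dots> = (\<Sum>\<sigma>\<in>{..<N} \<rightarrow>\<^sub>E {-1, 1}. \<Prod>i<N. exp (\<sigma> i * (x i + h i)))"
    by (intro prod_sum_PiE) auto
  also have "\<dots> = (\<Sum>\<sigma>\<in>{..<N} \<rightarrow>\<^sub>E {-1, 1}. exp (\<Sum>i<N. h i * \<sigma> i) * exp (ip N \<sigma> x))"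
    by (intro sum.cong refl)
       (simp add: ip_def exp_sum[symmetric] exp_add[symmetric] sum.distrib[symmetric] algebra_simps)
  finally have "(\<Prod>i<N. exp (x i + h i) + exp (- (x i + h i)))
    = (\<Sum>\<sigma>\<in>{..<N} \<rightarrow>\<^sub>E {-1, 1}. exp (\<Sum>i<N. h i * \<sigma> i) * exp (ip N \<sigma> x))" .
  moreover have "(\<Prod>i<N. exp (- c * (x i)\<^sup>2 / 2)) = exp (- c * ip N x x / 2)"
    by (simp add: exp_sum[symmetric] ip_def power2_eq_square sum_distrib_left sum_divide_distrib sum_negf mult.assoc)
  ultimately show ?thesis by (simp add: prod.distrib)
qed

section \<open>The transform with a polynomial of the edge weights\<close>

lemma polynomial_norm_le_spectrum:
  assumes A: "\<And>i j. i < N \<Longrightarrow> j < N \<Longrightarrow> A i j = A j i"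
    and spec: "\<And>l v. ip N v v > 0 \<Longrightarrow> (\<And>i. i < N \<Longrightarrow> mv N A v i = l * v i) \<Longrightarrow> \<bar>val_poly p l\<bar> \<le> D"
  shows "ip N (op_poly N A p v) (op_poly N A p v) \<le> D\<^sup>2 * ip N v v"
proof (rule symmetric_op_norm_le_spectrum[OF A linear_op_poly])
  show "ip N u (op_poly N A p v) = ip N v (op_poly N A p u)" for u v by (rule op_poly_symmetric[OF A])
  show "mv N A (op_poly N A p v) i = op_poly N A p (mv N A v) i" if "i < N" for v i by (rule op_poly_commutes[OF that])
  fix l v assume v: "ip N v v > 0" "\<And>i. i < N \<Longrightarrow> mv N A v i = l * v i"
  have "\<forall>i<N. op_poly N A p v i = val_poly p l * v i" by (intro allI impI op_poly_eigenvector v(2))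
  with spec[OF v] show "\<exists>t. \<bar>t\<bar> \<le> D \<and> (\<forall>i<N. op_poly N A p v i = t * v i)" by blast
qed

text \<open>On an eigenvector of \<open>A\<close> with eigenvalue \<open>l\<close> the operator is multiplication by the number bounded in
\<open>spec\<close>.\<close>

lemma approximate_inverse_norm:
  fixes N :: nat and A :: "nat \<Rightarrow> nat \<Rightarrow> real" and p :: "real list" and c t \<tau> :: real
  defines "A' \<equiv> \<lambda>v i. mv N A v i + t * v i" and "B \<equiv> op_poly N A p"
  assumes A: "\<And>i j. i < N \<Longrightarrow> j < N \<Longrightarrow> A i j = A j i"
    and spec: "\<And>l v. ip N v v > 0 \<Longrightarrow> (\<And>i. i < N \<Longrightarrow> mv N A v i = l * v i) \<Longrightarrow>
       \<bar>1 - (c - (val_poly p l)\<^sup>2) * (l + t)\<bar> \<le> \<tau>"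
  shows "ip N (\<lambda>i. v i - (c * A' v i - B (B (A' v)) i)) (\<lambda>i. v i - (c * A' v i - B (B (A' v)) i)) \<le> \<tau>\<^sup>2 * ip N v v"
proof -
  have Bl: "linear_op N B" unfolding B_def by (rule linear_op_poly)
  have Bs: "ip N u (B v) = ip N v (B u)" for u v unfolding B_def by (rule op_poly_symmetric[OF A])
  have Bc: "mv N A (B v) i = B (mv N A v) i" if "i < N" for v i unfolding B_def by (rule op_poly_commutes[OF that])
  have A'l: "linear_op N A'"
    using linear_op_comb[OF linear_op_mv linear_op_id, of N 1 A t] by (simp add: A'_def)
  have A's: "ip N u (A' v) = ip N v (A' u)" for u v
  proof -
    have "ip N u (A' v) = ip N u (mv N A v) + t * ip N u v" for u v
      using ip_lin[of N u 1 "mv N A v" t v] by (simp add: A'_def)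
    moreover have "ip N u (mv N A v) = ip N v (mv N A u)" by (rule ip_mv_sym[OF A])
    ultimately show ?thesis using ip_commute[of N u v] by simp
  qed
  have AA': "mv N A (A' v) i = A' (mv N A v) i" for v i
    using mv_lin[of N A 1 "mv N A v" t v i] by (simp add: A'_def)
  have A'B: "A' (B v) i = B (A' v) i" if "i < N" for v i
    using linear_opD(1)[OF Bl that, of 1 "mv N A v" t v] Bc[OF that, of v] by (simp add: A'_def)
  define T where "T v i = 1 * v i + (-1) * (c * A' v i + (-1) * B (B (A' v)) i)" for v i
  have Tl: "linear_op N T"
    unfolding T_def[abs_def]
    by (intro linear_op_comb linear_op_id linear_op_comp[OF Bl linear_op_comp[OF Bl A'l]] A'l)
  have BBA: "ip N u (B (B (A' v))) = ip N v (B (B (A' u)))" for u v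
  proof -
    have "ip N u (B (B (A' v))) = ip N (B u) (B (A' v))" unfolding Bs[of u] by (rule ip_commute)
    also have "\<dots> = ip N (A' v) (B (B u))" by (rule Bs)
    also have "\<dots> = ip N (B (B u)) (A' v)" by (rule ip_commute)
    also have "\<dots> = ip N v (A' (B (B u)))" by (rule A's)
    also have "\<dots> = ip N v (B (B (A' u)))"
    proof (rule ip_cong[OF refl])
      fix i assume i: "i < N"
      have "B (A' (B u)) i = B (B (A' u)) i" by (rule linear_opD(2)[OF Bl A'B i])
      then show "A' (B (B u)) i = B (B (A' u)) i" by (simp only: A'B[OF i])
    qed
    finally show ?thesis .
  qed
  have ipT: "ip N u (T v) = ip N u v - (c * ip N u (A' v) - ip N u (B (B (A' v))))" for u v
    unfolding T_def[abs_def] ip_lin by simp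
  have "ip N (T v) (T v) \<le> \<tau>\<^sup>2 * ip N v v"
  proof (rule symmetric_op_norm_le_spectrum[OF A Tl])
    show "ip N u (T v) = ip N v (T u)" for u v
      unfolding ipT using A's[of u v] BBA[of u v] ip_commute[of N u v] by simp
    show "mv N A (T v) i = T (mv N A v) i" if i: "i < N" for v i
    proof -
      have "mv N A (B (B (A' v))) i = B (mv N A (B (A' v))) i" by (rule Bc[OF i])
      also have "\<dots> = B (B (mv N A (A' v))) i" by (rule linear_opD(2)[OF Bl Bc i])
      also have "\<dots> = B (B (A' (mv N A v))) i" by (simp only: AA'[abs_def])
      finally show ?thesis unfolding T_def[abs_def] mv_lin AA' by simp
    qed
    fix l v assume v: "ip N v v > 0" "\<And>i. i < N \<Longrightarrow> mv N A v i = l * v i"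
    have b: "B v i = val_poly p l * v i" if "i < N" for i unfolding B_def using v(2) that by (rule op_poly_eigenvector)
    have a: "A' v i = (l + t) * v i" if "i < N" for i using v(2)[OF that] by (simp add: A'_def distrib_right)
    have sc: "B (\<lambda>j. s * w j) i = s * B w i" if "i < N" for s w i
      using linear_opD(1)[OF Bl that, of s w 0 w] by simp
    have ba: "B (A' v) i = ((l + t) * val_poly p l) * v i" if "i < N" for i
      using linear_opD(2)[OF Bl a that] sc[OF that] b[OF that] by simp
    have bba: "B (B (A' v)) i = ((l + t) * val_poly p l) * (val_poly p l * v i)" if "i < N" for i
      using linear_opD(2)[OF Bl ba that] sc[OF that] b[OF that] by simp
    have "T v i = (1 - (c - (val_poly p l)\<^sup>2) * (l + t)) * v i" if "i < N" for i
      unfolding T_def bba[OF that] a[OF that] by (simp add: algebra_simps power2_eq_square)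
    with spec[OF v] show "\<exists>s. \<bar>s\<bar> \<le> \<tau> \<and> (\<forall>i<N. T v i = s * v i)" by blast
  qed
  moreover have "T v = (\<lambda>i. v i - (c * A' v i - B (B (A' v)) i))" by (simp add: T_def fun_eq_iff)
  ultimately show ?thesis by simp
qed

text \<open>The energy must be of the form \<open>c |x|\<^sup>2 - |B x|\<^sup>2\<close>, hence the approximation of a square root.\<close>

lemma polynomial_near_square_root:
  fixes s :: "real \<Rightarrow> real"
  assumes "continuous_on {a..b} s" and s: "\<And>x. x \<in> {a..b} \<Longrightarrow> 0 \<le> s x \<and> s x \<le> c" and \<tau>: "\<tau> > 0" and c: "c \<ge> 0"
  obtains p where "\<And>x. x \<in> {a..b} \<Longrightarrow> \<bar>s x - (val_poly p x)\<^sup>2\<bar> \<le> \<tau>"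
proof -
  define e where "e = min 1 (\<tau> / (2 * sqrt c + 1))"
  have d: "2 * sqrt c + 1 > 0" using c by (simp add: add_nonneg_pos)
  \<comment> \<open>From \<open>|g - p| \<le> e \<le> 1\<close> follows \<open>|g + p| \<le> 2 |g| + 1\<close>.\<close>
  have e: "e > 0" "e \<le> 1" using \<tau> d by (simp_all add: e_def)
  have "e \<le> \<tau> / (2 * sqrt c + 1)" by (simp add: e_def)
  then have e3: "e * (2 * sqrt c + 1) \<le> \<tau>" using d by (simp only: pos_le_divide_eq)
  obtain p where p: "\<And>x. x \<in> {a..b} \<Longrightarrow> \<bar>sqrt (s x) - val_poly p x\<bar> < e"
    by (rule polynomial_approximation[OF continuous_on_real_sqrt[OF assms(1)] e(1)]) (rule that)
  show thesis
  proof (rule that)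
    fix x assume x: "x \<in> {a..b}"
    let ?g = "sqrt (s x)" and ?p = "val_poly p x"
    have g: "0 \<le> ?g" "?g \<le> sqrt c" using s[OF x] by simp_all
    have "s x = ?g\<^sup>2" using s[OF x] by simp
    then have "\<bar>s x - ?p\<^sup>2\<bar> = \<bar>?g - ?p\<bar> * \<bar>?g + ?p\<bar>" by (simp add: abs_mult[symmetric] power2_eq_square algebra_simps)
    also have "\<dots> \<le> e * (2 * sqrt c + 1)"
    proof (rule mult_mono)
      show "\<bar>?g - ?p\<bar> \<le> e" using p[OF x] by simp
      show "\<bar>?g + ?p\<bar> \<le> 2 * sqrt c + 1" using p[OF x] e(2) g by linarith
    qed (use e in simp_all)
    finally show "\<bar>s x - ?p\<^sup>2\<bar> \<le> \<tau>" using e3 by linarith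
  qed
qed

context shifted_Gaussian
begin

lemma finite_spins: "finite ({..<N} \<rightarrow>\<^sub>E {-1, 1 :: real})"
  by (intro finite_PiE) auto

lemma Gaussian_factor:
  "exp (- c * ip N x x / 2) * exp ((\<Sum>i<N. (B x i)\<^sup>2) / 2) = exp (- energy x / 2)"
  by (simp add: energy_def ip_def power2_eq_square diff_divide_distrib flip: exp_add)

lemma I_eq: "I K = (\<Sum>x\<in>{..<N} \<rightarrow>\<^sub>E lat \<epsilon> K. (\<Prod>i<N. exp (- c * (x i)\<^sup>2 / 2) * 1) * exp ((\<Sum>i<N. (B x i)\<^sup>2) / 2))"
proof -
  have "(\<Prod>i<N. exp (- c * (x i)\<^sup>2 / 2)) = exp (- c * ip N x x / 2)" for x :: "nat \<Rightarrow> real"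
    by (simp add: exp_sum[symmetric] ip_def power2_eq_square sum_distrib_left sum_divide_distrib sum_negf mult.assoc)
  then show ?thesis unfolding I_def grid_def mult_1_right by (simp only: Gaussian_factor)
qed

text \<open>The transformed Ising partition function on a box, not yet normalised; \<open>Z\<close> is the Ising partition
function itself.\<close>

definition W :: "(nat \<Rightarrow> real) \<Rightarrow> nat \<Rightarrow> real" where
  "W h K = (\<Sum>\<sigma>\<in>{..<N} \<rightarrow>\<^sub>E {-1, 1}. exp (\<Sum>i<N. h i * \<sigma> i) * J K \<sigma>)"

definition Z :: "(nat \<Rightarrow> real) \<Rightarrow> real" where
  "Z h = (\<Sum>\<sigma>\<in>{..<N} \<rightarrow>\<^sub>E {-1, 1}. exp (ip N \<sigma> (A \<sigma>) / 2 + (\<Sum>i<N. h i * \<sigma> i)))"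

lemma W_eq:
  "W h K = (\<Sum>x\<in>{..<N} \<rightarrow>\<^sub>E lat \<epsilon> K. (\<Prod>i<N. exp (- c * (x i)\<^sup>2 / 2) * (exp (x i + h i) + exp (- (x i + h i))))
      * exp ((\<Sum>i<N. (B x i)\<^sup>2) / 2))"
proof -
  have "W h K = (\<Sum>\<sigma>\<in>{..<N} \<rightarrow>\<^sub>E {-1, 1}. \<Sum>x\<in>grid K. exp (\<Sum>i<N. h i * \<sigma> i) * exp (ip N \<sigma> x - energy x / 2))"
    unfolding W_def J_def sum_distrib_left ..
  also have "\<dots> = (\<Sum>x\<in>grid K. \<Sum>\<sigma>\<in>{..<N} \<rightarrow>\<^sub>E {-1, 1}. exp (\<Sum>i<N. h i * \<sigma> i) * exp (ip N \<sigma> x - energy x / 2))"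
    by (rule sum.swap)
  also have "\<dots> = (\<Sum>x\<in>grid K. (exp (- c * ip N x x / 2) * (\<Sum>\<sigma>\<in>{..<N} \<rightarrow>\<^sub>E {-1, 1}. exp (\<Sum>i<N. h i * \<sigma> i) * exp (ip N \<sigma> x)))
      * exp ((\<Sum>i<N. (B x i)\<^sup>2) / 2))"
  proof (rule sum.cong[OF refl])
    fix x
    have "exp (ip N \<sigma> x - energy x / 2) = exp (ip N \<sigma> x) * exp (- energy x / 2)" for \<sigma>
      by (simp flip: exp_add)
    then have "(\<Sum>\<sigma>\<in>{..<N} \<rightarrow>\<^sub>E {-1, 1}. exp (\<Sum>i<N. h i * \<sigma> i) * exp (ip N \<sigma> x - energy x / 2))
      = (\<Sum>\<sigma>\<in>{..<N} \<rightarrow>\<^sub>E {-1, 1}. exp (\<Sum>i<N. h i * \<sigma> i) * exp (ip N \<sigma> x)) * exp (- energy x / 2)"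
      by (simp only: sum_distrib_right mult.assoc)
    also have "\<dots> = (exp (- c * ip N x x / 2) * (\<Sum>\<sigma>\<in>{..<N} \<rightarrow>\<^sub>E {-1, 1}. exp (\<Sum>i<N. h i * \<sigma> i) * exp (ip N \<sigma> x)))
      * exp ((\<Sum>i<N. (B x i)\<^sup>2) / 2)"
      unfolding Gaussian_factor[symmetric] by (simp only: mult_ac)
    finally show "(\<Sum>\<sigma>\<in>{..<N} \<rightarrow>\<^sub>E {-1, 1}. exp (\<Sum>i<N. h i * \<sigma> i) * exp (ip N \<sigma> x - energy x / 2)) = \<dots>" .
  qed
  finally show ?thesis by (simp only: ising_as_Gaussian_mixture grid_def)
qed

lemma W_pos: "W h K > 0" and Z_pos: "Z h > 0"
proof -
  have "(\<lambda>i\<in>{..<N}. 1) \<in> {..<N} \<rightarrow>\<^sub>E {-1, 1 :: real}" by simp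
  then have ne: "{..<N} \<rightarrow>\<^sub>E {-1, 1 :: real} \<noteq> {}" by blast
  have g: "grid K \<noteq> {}" for K using I_pos[of K] by (auto simp: I_def)
  show "Z h > 0" unfolding Z_def by (intro sum_pos finite_spins ne) simp
  have "J K \<sigma> > 0" for \<sigma> unfolding J_def by (intro sum_pos finite_grid g) simp
  then show "W h K > 0" unfolding W_def by (intro sum_pos finite_spins ne) simp
qed

lemma W_lower:
  assumes "\<epsilon> * real K \<le> R"
  shows "exp (- (real N * err R)) * Z h * I K \<le> W h (K + M)"
proof -
  have "exp (- (real N * err R)) * Z h * I K
    = (\<Sum>\<sigma>\<in>{..<N} \<rightarrow>\<^sub>E {-1, 1}. exp (\<Sum>i<N. h i * \<sigma> i) * (exp (ip N \<sigma> (A \<sigma>) / 2 - real N * err R) * I K))"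
    unfolding Z_def sum_distrib_left sum_distrib_right
    by (intro sum.cong refl) (simp add: mult.assoc[symmetric] exp_add[symmetric] add_ac)
  also have "\<dots> \<le> W h (K + M)"
    unfolding W_def by (intro sum_mono mult_left_mono J_lower assms) simp_all
  finally show ?thesis .
qed

lemma W_upper:
  assumes "\<epsilon> * real (K + M) \<le> R"
  shows "W h K \<le> exp (real N * err R) * Z h * I (K + M)"
proof -
  have "W h K \<le> (\<Sum>\<sigma>\<in>{..<N} \<rightarrow>\<^sub>E {-1, 1}. exp (\<Sum>i<N. h i * \<sigma> i) * (exp (ip N \<sigma> (A \<sigma>) / 2 + real N * err R) * I (K + M)))"
    unfolding W_def by (intro sum_mono mult_left_mono J_upper assms) simp_all
  also have "\<dots> = exp (real N * err R) * Z h * I (K + M)"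
    unfolding Z_def sum_distrib_left sum_distrib_right
    by (intro sum.cong refl) (simp add: exp_add mult_ac)
  finally show ?thesis .
qed

text \<open>Per vertex, the growth from the box \<open>M\<close> to \<open>n M\<close> is only logarithmic in \<open>n\<close>. The number \<open>q\<close> of lattice points per unit length
cancels, so the bound does not depend on the spacing.\<close>

lemma ln_I_growth:
  assumes q: "\<epsilon> * real q = 1" and M: "M = \<mu> * q" "\<mu> > 0"
  shows "ln (I (n * M)) - ln (I M) \<le> real N * (ln (2 * real n * real \<mu> + 1) + c / 2)"
proof -
  have q0: "real q \<ge> 1" using q by (cases q) auto
  have "ln (I (n * M)) \<le> ln ((2 * real (n * M) + 1) ^ N)"
    using I_upper[of "n * M"] I_pos[of "n * M"] by (simp add: add_nonneg_pos)
  also have "\<dots> = real N * ln (2 * real (n * M) + 1)" by (rule ln_realpow)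
  also have "\<dots> \<le> real N * (ln ((2 * real n * real \<mu> + 1) * real q))"
  proof -
    have "2 * real (n * M) + 1 \<le> (2 * real n * real \<mu> + 1) * real q" using q0 by (simp add: M algebra_simps)
    then have "ln (2 * real (n * M) + 1) \<le> ln ((2 * real n * real \<mu> + 1) * real q)"
      by (intro ln_mono) (simp_all add: add_nonneg_pos)
    then show ?thesis by (rule mult_left_mono) simp
  qed
  also have "ln ((2 * real n * real \<mu> + 1) * real q) = ln (2 * real n * real \<mu> + 1) + ln (real q)"
    using q0 by (intro ln_mult_pos) (simp_all add: add_nonneg_pos)
  finally have U: "ln (I (n * M)) \<le> real N * (ln (2 * real n * real \<mu> + 1) + ln (real q))" .
  have "q \<le> M" using M by simp
  then have "real q ^ N * exp (- c * real N / 2) \<le> I M" using q by (intro I_lower) simp_all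
  then have "ln (real q ^ N * exp (- c * real N / 2)) \<le> ln (I M)" using q0 I_pos[of M] by simp
  moreover have "ln (real q ^ N * exp (- c * real N / 2)) = real N * ln (real q) + - c * real N / 2"
    using q0 by (subst ln_mult) (simp_all add: ln_realpow)
  ultimately have "real N * ln (real q) + - c * real N / 2 \<le> ln (I M)" by simp
  with U show ?thesis by (simp add: algebra_simps)
qed

text \<open>\<open>W\<close> on a box lies between \<open>Z I\<close> on the previous and on the next box.\<close>

theorem log_ratio_average:
  assumes m: "m > 0" and q: "\<epsilon> * real q = 1" and M: "M = \<mu> * q" "\<mu> > 0"
  shows "\<bar>(\<Sum>j<m. ln (W h ((j + 2) * M)) - ln (I ((j + 2) * M))) / real m - ln (Z h)\<bar>
    \<le> real N * (err (real (m + 2) * real \<mu>) + (ln (2 * real (m + 2) * real \<mu> + 1) + c / 2) / real m)"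
proof -
  let ?R = "real (m + 2) * real \<mu>"
  have R: "\<epsilon> * real (j * M) \<le> ?R" if "j \<le> m + 2" for j
  proof -
    have "\<epsilon> * real (j * M) = real j * real \<mu> * (\<epsilon> * real q)" by (simp add: M mult_ac)
    also have "\<dots> \<le> ?R" unfolding q using that by (intro mult_right_mono order_trans[OF eq_refl[OF mult_1_right]]) simp_all
    finally show ?thesis .
  qed
  have mono: "ln (I (i * M)) \<le> ln (I (j * M))" if "i \<le> j" for i j
    using I_mono[of "i * M" "j * M"] I_pos[of "i * M"] I_pos[of "j * M"] that by simp
  have lo: "ln (Z h) - real N * err ?R + ln (I ((j + 1) * M)) \<le> ln (W h ((j + 2) * M))" if "j < m" for j
  proof -
    have k: "(j + 1) * M + M = (j + 2) * M" by (simp add: algebra_simps)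
    have "exp (- (real N * err ?R)) * Z h * I ((j + 1) * M) \<le> W h ((j + 2) * M)"
      using W_lower[OF R, of "j + 1" h] that unfolding k by simp
    then have "ln (exp (- (real N * err ?R)) * Z h * I ((j + 1) * M)) \<le> ln (W h ((j + 2) * M))"
      using Z_pos[of h] I_pos W_pos by (subst ln_le_cancel_iff) simp_all
    moreover have "ln (exp (- (real N * err ?R)) * Z h * I ((j + 1) * M)) = - (real N * err ?R) + ln (Z h) + ln (I ((j + 1) * M))"
      using Z_pos[of h] I_pos[of "(j + 1) * M"] by (simp add: ln_mult del: of_nat_add mult_Suc)
    ultimately show ?thesis by linarith
  qed
  have hi: "ln (W h ((j + 2) * M)) \<le> ln (Z h) + real N * err ?R + ln (I ((j + 3) * M))" if "j < m" for j
  proof -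
    have k: "(j + 2) * M + M = (j + 3) * M" by (simp add: algebra_simps)
    have "W h ((j + 2) * M) \<le> exp (real N * err ?R) * Z h * I ((j + 3) * M)"
      using W_upper[of "(j + 2) * M" ?R h] R[of "j + 3"] that unfolding k by simp
    then have "ln (W h ((j + 2) * M)) \<le> ln (exp (real N * err ?R) * Z h * I ((j + 3) * M))"
      using Z_pos[of h] I_pos W_pos by (subst ln_le_cancel_iff) simp_all
    moreover have "ln (exp (real N * err ?R) * Z h * I ((j + 3) * M)) = real N * err ?R + ln (Z h) + ln (I ((j + 3) * M))"
      using Z_pos[of h] I_pos[of "(j + 3) * M"] by (simp add: ln_mult del: of_nat_add mult_Suc)
    ultimately show ?thesis by linarith
  qed
  have "\<bar>(\<Sum>j<m. ln (W h ((j + 2) * M)) - ln (I ((j + 2) * M))) / real m - ln (Z h)\<bar>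
    \<le> real N * err ?R + (ln (I ((m + 2) * M)) - ln (I (1 * M))) / real m"
    by (rule telescoping_average[where f = "\<lambda>j. ln (I (j * M))" and g = "\<lambda>j. ln (W h (j * M))", OF m mono lo hi])
  also have "\<dots> \<le> real N * err ?R + real N * (ln (2 * real (m + 2) * real \<mu> + 1) + c / 2) / real m"
    using ln_I_growth[OF q M, of "m + 2"] by (intro add_left_mono divide_right_mono) simp_all
  finally show ?thesis by (simp add: distrib_left)
qed

end

section \<open>The Ising free energy\<close>

text \<open>The number of averaged boxes can be chosen before the lattice spacing.\<close>

lemma vanishing_entropy:
  fixes \<mu> :: nat and c \<eta> :: real
  assumes "\<mu> > 0" "\<eta> > 0"
  obtains m :: nat where "m > 0" "(ln (2 * real (m + 2) * real \<mu> + 1) + c / 2) / real m \<le> \<eta>"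
proof -
  have \<mu>: "real \<mu> > 0" using assms by simp
  have "(\<lambda>m. (ln (2 * (real m + 2) * real \<mu> + 1) + c / 2) / real m) \<longlonglongrightarrow> 0"
    using \<mu> by real_asymp
  then have "\<forall>\<^sub>F m in sequentially. (ln (2 * (real m + 2) * real \<mu> + 1) + c / 2) / real m < \<eta>"
    using assms(2) by (intro order_tendstoD) auto
  from eventually_happens[OF eventually_conj[OF eventually_gt_at_top[of 0] this]]
  obtain m :: nat where "m > 0" "(ln (2 * (real m + 2) * real \<mu> + 1) + c / 2) / real m < \<eta>" by auto
  then show thesis by (intro that[of m]) (simp_all add: add.commute)
qed

text \<open>The weight of the normalisation \<open>I\<close>, written as a product so that the two site weights are treated alike.\<close>

definition free_weight :: "real \<Rightarrow> real \<Rightarrow> real \<Rightarrow> real" where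
  "free_weight c h x = exp (- c * x\<^sup>2 / 2) * 1"

definition spin_weight :: "real \<Rightarrow> real \<Rightarrow> real \<Rightarrow> real" where
  "spin_weight c h x = exp (- c * x\<^sup>2 / 2) * (exp (x + h) + exp (- (x + h)))"

lemma curved_free_weight: "\<epsilon> > 0 \<Longrightarrow> curved_weight (c - 1) \<epsilon> S (free_weight c h)"
  unfolding free_weight_def[abs_def] by (intro curved_Gaussian_times) simp_all

lemma curved_spin_weight: "\<epsilon> > 0 \<Longrightarrow> curved_weight (c - 1) \<epsilon> S (spin_weight c h)"
  unfolding spin_weight_def[abs_def]
proof (intro curved_Gaussian_times)
  show "0 < exp (x + h) + exp (- (x + h))" for x by (simp add: add_pos_pos)
  fix u v d :: real assume "u \<le> v" "0 \<le> d"
  then have "cosh (u + h) * cosh (v + h + d) \<le> cosh (v + h) * cosh (u + h + d) * exp (d * ((v + h) - (u + h)))"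
    by (intro cosh_log_curvature) auto
  then have k: "4 * (cosh (u + h) * cosh (v + d + h)) \<le> 4 * (cosh (v + h) * cosh (u + d + h) * exp (d * (v - u)))"
    by (simp add: add_ac)
  have two: "exp y + exp (- y) = 2 * cosh y" for y :: real by (simp add: cosh_field_def)
  show "(exp (u + h) + exp (- (u + h))) * (exp (v + d + h) + exp (- (v + d + h)))
      \<le> (exp (v + h) + exp (- (v + h))) * (exp (u + d + h) + exp (- (u + d + h))) * exp (d * (v - u))"
    unfolding two using k by (simp only: mult_ac)
qed

context bounded_graphs
begin

lemma shifted_row_bound:
  assumes G: "G \<in> GG" and \<sigma>: "\<sigma> \<in> {..<sz G} \<rightarrow>\<^sub>E {-1, 1 :: real}" and i: "i < sz G"
  shows "\<bar>mv (sz G) (ew G) \<sigma> i + t * \<sigma> i\<bar> \<le> C + \<bar>t\<bar>"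
proof -
  have s: "\<bar>\<sigma> j\<bar> = 1" if "j < sz G" for j
  proof -
    have "\<sigma> j \<in> {-1, 1}" using PiE_mem[OF \<sigma>] that by simp
    then show ?thesis by auto
  qed
  have "\<bar>mv (sz G) (ew G) \<sigma> i\<bar> \<le> (\<Sum>j<sz G. \<bar>ew G i j * \<sigma> j\<bar>)" unfolding mv_def by (rule sum_abs)
  also have "\<dots> = (\<Sum>j<sz G. \<bar>ew G i j\<bar>)" by (intro sum.cong refl) (simp add: abs_mult s)
  also have "\<dots> \<le> C" by (rule row_sum[OF G i])
  finally have "\<bar>mv (sz G) (ew G) \<sigma> i\<bar> \<le> C" .
  moreover have "\<bar>t * \<sigma> i\<bar> = \<bar>t\<bar>" by (simp add: abs_mult s[OF i])
  ultimately show ?thesis using abs_triangle_ineq[of "mv (sz G) (ew G) \<sigma> i" "t * \<sigma> i"] by linarith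
qed

text \<open>The summand \<open>t / 2\<close> stems from \<open>\<langle>\<sigma>, t \<sigma>\<rangle> / 2 = N t / 2\<close>.\<close>

lemma free_energy_near_log_partitions:
  assumes G: "G \<in> GG" and spec: "\<And>l. eigenvalue (edge_weights G) l \<Longrightarrow> l \<in> {a..b}"
    and t: "\<And>l. l \<in> {a..b} \<Longrightarrow> 0 < l + t \<and> l + t \<le> 1"
    and p: "\<And>l. l \<in> {a..b} \<Longrightarrow> \<bar>c - 1 / (l + t) - (val_poly p l)\<^sup>2\<bar> \<le> \<tau>"
    and pc: "\<And>l. l \<in> {a..b} \<Longrightarrow> (val_poly p l)\<^sup>2 \<le> c" and c: "c \<ge> 0" and \<tau>: "\<tau> \<ge> 0"
    and \<epsilon>q: "\<epsilon> * real q = 1" and \<mu>: "C + \<bar>t\<bar> + 1 \<le> real \<mu>" and m: "m > 0"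
  shows "\<bar>(\<Sum>j<m. log_partition (spin_weight c) (lat \<epsilon> ((j + 2) * (\<mu> * q))) p G
        - log_partition (free_weight c) (lat \<epsilon> ((j + 2) * (\<mu> * q))) p G) / real m - (free_energy G + t / 2)\<bar>
    \<le> (\<tau> + 2 * c * \<epsilon>) * (real (m + 2) * real \<mu> + real \<mu>) + \<epsilon>
       + (ln (2 * real (m + 2) * real \<mu> + 1) + c / 2) / real m"
proof -
  let ?N = "sz G"
  define A where "A v i = mv ?N (ew G) v i + t * v i" for v i
  have q: "real q \<ge> 1" using \<epsilon>q by (cases q) auto
  have "\<epsilon> = 1 / real q" using \<epsilon>q q by (simp add: field_simps)
  then have \<epsilon>1: "\<epsilon> > 0" "\<epsilon> \<le> 1" using q by auto
  have \<mu>0: "\<mu> > 0" using \<mu> C_pos by (cases \<mu>) auto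
  have \<epsilon>M: "\<epsilon> * real (\<mu> * q) = real \<mu>"
  proof -
    have "\<epsilon> * real (\<mu> * q) = real \<mu> * (\<epsilon> * real q)" by simp
    then show ?thesis by (simp only: \<epsilon>q mult_1_right)
  qed
  have sp: "l \<in> {a..b}" if "ip ?N v v > 0" "\<And>i. i < ?N \<Longrightarrow> mv ?N (ew G) v i = l * v i" for l v
    by (rule spec[OF eigenvalue_of_mv[OF graph[OF G] that]])
  interpret shifted_Gaussian ?N A "Bop p G" c \<tau> \<epsilon> "\<mu> * q"
  proof
    show "0 < ?N" by (rule size_pos[OF G])
    show "0 \<le> c" "0 < \<epsilon>" "0 \<le> \<tau>" by (fact c \<epsilon>1 \<tau>)+
    show "linear_op ?N (Bop p G)" by (rule linear_op_poly)
    show "ip ?N u (Bop p G v) = ip ?N v (Bop p G u)" for u v by (rule op_poly_symmetric[OF ew_sym[OF G]])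
    have "ip ?N (Bop p G v) (Bop p G v) \<le> (sqrt c)\<^sup>2 * ip ?N v v" for v
    proof (rule polynomial_norm_le_spectrum[OF ew_sym[OF G]])
      fix l w assume w: "ip ?N w w > 0" "\<And>i. i < ?N \<Longrightarrow> mv ?N (ew G) w i = l * w i"
      show "\<bar>val_poly p l\<bar> \<le> sqrt c" using pc[OF sp[OF w]] by (rule real_le_rsqrt[of "\<bar>val_poly p l\<bar>" c, simplified])
    qed
    then show "ip ?N (Bop p G v) (Bop p G v) \<le> c * ip ?N v v" for v using c by simp
    show "\<bar>A \<sigma> i\<bar> + \<epsilon> \<le> \<epsilon> * real (\<mu> * q)" if "\<sigma> \<in> {..<?N} \<rightarrow>\<^sub>E {-1, 1}" "i < ?N" for \<sigma> i
      using shifted_row_bound[OF G that, of t] \<mu> \<epsilon>1(2) unfolding A_def \<epsilon>M by linarith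
    show "l2n ?N (\<lambda>i. v i - (c * A v i - Bop p G (Bop p G (A v)) i)) \<le> \<tau> * l2n ?N v" for v
    proof (rule l2n_le_if_ip_le[OF _ \<tau>])
      show "ip ?N (\<lambda>i. v i - (c * A v i - Bop p G (Bop p G (A v)) i)) (\<lambda>i. v i - (c * A v i - Bop p G (Bop p G (A v)) i))
        \<le> \<tau>\<^sup>2 * ip ?N v v"
        unfolding A_def[abs_def]
      proof (rule approximate_inverse_norm[OF ew_sym[OF G]])
        fix l w assume w: "ip ?N w w > 0" "\<And>i. i < ?N \<Longrightarrow> mv ?N (ew G) w i = l * w i"
        have l: "l \<in> {a..b}" by (rule sp[OF w])
        have tl: "0 < l + t" "l + t \<le> 1" using t[OF l] by auto
        \<comment> \<open>The factor \<open>l + t \<le> 1\<close> only improves the accuracy of \<open>p\<^sup>2\<close>.\<close>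
        have "1 - (c - (val_poly p l)\<^sup>2) * (l + t) = - ((c - 1 / (l + t) - (val_poly p l)\<^sup>2) * (l + t))"
          using tl by (simp add: left_diff_distrib)
        then have "\<bar>1 - (c - (val_poly p l)\<^sup>2) * (l + t)\<bar> = \<bar>c - 1 / (l + t) - (val_poly p l)\<^sup>2\<bar> * (l + t)"
          using tl by (simp add: abs_mult)
        also have "\<dots> \<le> \<tau> * 1" using p[OF l] tl \<tau> by (intro mult_mono) auto
        finally show "\<bar>1 - (c - (val_poly p l)\<^sup>2) * (l + t)\<bar> \<le> \<tau>" by simp
      qed
    qed
  qed
  have lp1: "log_partition (spin_weight c) (lat \<epsilon> K) p G = ln (W (vw G) K) / real ?N" for K
    unfolding log_partition_def W_eq spin_weight_def ..
  have lp0: "log_partition (free_weight c) (lat \<epsilon> K) p G = ln (I K) / real ?N" for K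
    unfolding log_partition_def I_eq free_weight_def ..
  have Zeq: "Z (vw G) = exp (real ?N * (t / 2)) * partition_function G"
  proof -
    have "exp (ip ?N \<sigma> (A \<sigma>) / 2 + (\<Sum>i<?N. vw G i * \<sigma> i))
        = exp (real ?N * (t / 2)) * exp (ip ?N \<sigma> (mv ?N (ew G) \<sigma>) / 2 + (\<Sum>i<?N. vw G i * \<sigma> i))"
      if \<sigma>: "\<sigma> \<in> {..<?N} \<rightarrow>\<^sub>E {-1, 1}" for \<sigma>
    proof -
      have "\<sigma> i * \<sigma> i = 1" if "i < ?N" for i
      proof -
        have "\<sigma> i \<in> {-1, 1}" using PiE_mem[OF \<sigma>] that by simp
        then show ?thesis by auto
      qed
      then have "ip ?N \<sigma> \<sigma> = real ?N" by (simp add: ip_def)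
      then have "ip ?N \<sigma> (A \<sigma>) = ip ?N \<sigma> (mv ?N (ew G) \<sigma>) + t * real ?N"
        using ip_lin[of ?N \<sigma> 1 "mv ?N (ew G) \<sigma>" t \<sigma>] by (simp add: A_def[abs_def])
      then show ?thesis by (simp add: add_divide_distrib mult.commute flip: exp_add)
    qed
    then show ?thesis unfolding Z_def partition_function_eq[OF graph[OF G]] sum_distrib_left
      by (intro sum.cong refl)
  qed
  have Np: "real ?N > 0" using size_pos[OF G] by simp
  have pf: "partition_function G > 0" using Z_pos[of "vw G"] unfolding Zeq by (simp add: zero_less_mult_iff)
  have lnZ: "ln (Z (vw G)) / real ?N = free_energy G + t / 2"
    using pf Np by (simp add: Zeq ln_mult free_energy_def add_divide_distrib)
  let ?S = "(\<Sum>j<m. ln (W (vw G) ((j + 2) * (\<mu> * q))) - ln (I ((j + 2) * (\<mu> * q)))) / real m"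
  let ?e = "err (real (m + 2) * real \<mu>) + (ln (2 * real (m + 2) * real \<mu> + 1) + c / 2) / real m"
  have "\<bar>?S - ln (Z (vw G))\<bar> \<le> real ?N * ?e" by (rule log_ratio_average[OF m \<epsilon>q refl \<mu>0])
  then have "\<bar>?S - ln (Z (vw G))\<bar> / real ?N \<le> ?e" using Np by (simp add: pos_divide_le_eq mult.commute)
  then have "\<bar>?S / real ?N - (free_energy G + t / 2)\<bar> \<le> ?e"
    unfolding lnZ[symmetric] diff_divide_distrib[symmetric] abs_divide using Np by simp
  moreover have "?S / real ?N = (\<Sum>j<m. log_partition (spin_weight c) (lat \<epsilon> ((j + 2) * (\<mu> * q))) p G
        - log_partition (free_weight c) (lat \<epsilon> ((j + 2) * (\<mu> * q))) p G) / real m"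
    unfolding lp1 lp0 diff_divide_distrib[symmetric] sum_divide_distrib[symmetric] by (simp add: mult.commute)
  ultimately show ?thesis unfolding err_def \<epsilon>M by simp
qed

lemma log_partition_difference_average:
  assumes m: "m > 0" and \<eta>: "\<eta> > 0"
    and r: "\<And>j. j < m \<Longrightarrow> \<exists>\<phi>\<in>density_span. \<forall>G\<in>GG. \<bar>F j G - \<phi> G\<bar> \<le> \<eta>"
    and r': "\<And>j. j < m \<Longrightarrow> \<exists>\<phi>\<in>density_span. \<forall>G\<in>GG. \<bar>F' j G - \<phi> G\<bar> \<le> \<eta>"
  shows "\<exists>\<phi>\<in>density_span. \<forall>G\<in>GG. \<bar>(\<Sum>j<m. F j G - F' j G) / real m - s - \<phi> G\<bar> \<le> 2 * \<eta>"
proof -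
  have "\<forall>j\<in>{..<m}. \<exists>\<phi>. \<phi> \<in> density_span \<and> (\<forall>G\<in>GG. \<bar>F j G - \<phi> G\<bar> \<le> \<eta>)" using r by blast
  from bchoice[OF this] obtain f where f: "\<And>j. j < m \<Longrightarrow> f j \<in> density_span" "\<And>j G. j < m \<Longrightarrow> G \<in> GG \<Longrightarrow> \<bar>F j G - f j G\<bar> \<le> \<eta>" by auto
  have "\<forall>j\<in>{..<m}. \<exists>\<phi>. \<phi> \<in> density_span \<and> (\<forall>G\<in>GG. \<bar>F' j G - \<phi> G\<bar> \<le> \<eta>)" using r' by blast
  from bchoice[OF this] obtain f' where f': "\<And>j. j < m \<Longrightarrow> f' j \<in> density_span" "\<And>j G. j < m \<Longrightarrow> G \<in> GG \<Longrightarrow> \<bar>F' j G - f' j G\<bar> \<le> \<eta>" by auto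
  obtain u where u: "u \<in> density_span" "\<And>G. G \<in> GG \<Longrightarrow> u G = 1" by (rule one_in_span) (rule that)
  let ?\<phi> = "\<lambda>G. 1 / real m * (\<Sum>j<m. f j G + (-1) * f' j G) + (- s) * u G"
  show ?thesis
  proof (intro bexI ballI)
    show "?\<phi> \<in> density_span"
      using f(1) f'(1) by (intro density_span_add density_span_scale density_span_sum u(1)) auto
    fix G assume G: "G \<in> GG"
    let ?D = "\<Sum>j<m. F j G - F' j G" and ?d = "\<Sum>j<m. f j G + (-1) * f' j G"
    have "\<bar>?D - ?d\<bar> \<le> (\<Sum>j<m. 2 * \<eta>)"
      unfolding sum_subtractf[symmetric]
    proof (rule order_trans[OF sum_abs sum_mono])
      fix j assume "j \<in> {..<m}"
      then have j: "j < m" by simp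
      show "\<bar>F j G - F' j G - (f j G + (-1) * f' j G)\<bar> \<le> 2 * \<eta>" using f(2)[OF j G] f'(2)[OF j G] by linarith
    qed
    then have "\<bar>?D - ?d\<bar> / real m \<le> 2 * \<eta>" using m by (simp add: pos_divide_le_eq mult.commute)
    moreover have "?D / real m - s - ?\<phi> G = (?D - ?d) / real m" using u(2)[OF G] by (simp add: diff_divide_distrib)
    ultimately show "\<bar>?D / real m - s - ?\<phi> G\<bar> \<le> 2 * \<eta>" by (simp only: abs_divide abs_of_nat)
  qed
qed

text \<open>The parameters depend on each other in the order \<open>\<mu>\<close>, \<open>m\<close>, \<open>\<tau>\<close>, \<open>p\<close>, \<open>q\<close>: the bound \<open>\<mu>\<close> on the shift, the number
\<open>m\<close> of boxes, which bounds all spins by \<open>R\<close>; then the accuracy \<open>\<tau>\<close> of the approximate inverse, relative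
to \<open>R\<close>, and the polynomial \<open>p\<close>; finally the spacing \<open>1 / q\<close>, which depends on all the others.\<close>

theorem free_energy_span_approximable:
  assumes spec: "\<And>G l. G \<in> GG \<Longrightarrow> eigenvalue (edge_weights G) l \<Longrightarrow> l \<in> {a..b}"
    and ab: "a \<le> b" "b - a < 1"
  shows "span_approximable free_energy"
  unfolding span_approximable_def
proof (intro allI impI)
  fix \<eta> :: real assume \<eta>: "\<eta> > 0"
  \<comment> \<open>The shift \<open>t\<close> moves \<open>[a, b]\<close> to \<open>[\<delta>, 1 - \<delta>]\<close>, and \<open>c = 2 / \<delta>\<close> exceeds the largest eigenvalue \<open>1 / \<delta>\<close> of the inverse.\<close>
  define \<delta> where "\<delta> = (1 - (b - a)) / 2"
  define t where "t = \<delta> - a"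
  define c where "c = 2 / \<delta>"
  have \<delta>: "\<delta> > 0" "\<delta> \<le> 1 / 2" using ab by (simp_all add: \<delta>_def)
  have t: "\<delta> \<le> l + t \<and> l + t \<le> 1 - \<delta>" if "l \<in> {a..b}" for l using that by (auto simp: t_def \<delta>_def field_simps)
  have c4: "c \<ge> 4" using \<delta> by (simp add: c_def field_simps)
  \<comment> \<open>Half of the gap between the least eigenvalue of the inverse and one, the curvature lost to \<open>cosh\<close>; the other half keeps \<open>\<beta>\<^sup>2 < c - 1\<close>.\<close>
  define \<tau>0 where "\<tau>0 = (1 / (1 - \<delta>) - 1) / 2"
  have \<tau>0: "\<tau>0 > 0" "1 / (1 - \<delta>) - \<tau>0 > 1" "1 / (1 - \<delta>) \<le> 2"
  proof -
    have "1 < 1 / (1 - \<delta>)" "1 / (1 - \<delta>) \<le> 2" using \<delta> by (simp_all add: field_simps)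
    then show "\<tau>0 > 0" "1 / (1 - \<delta>) - \<tau>0 > 1" "1 / (1 - \<delta>) \<le> 2" unfolding \<tau>0_def by (simp_all add: field_simps)
  qed
  define \<beta> where "\<beta> = sqrt (c - 1 / (1 - \<delta>) + \<tau>0)"
  have b0: "c - 1 / (1 - \<delta>) + \<tau>0 \<ge> 0" using c4 \<tau>0 by linarith
  have \<beta>2: "\<beta>\<^sup>2 = c - 1 / (1 - \<delta>) + \<tau>0" "\<beta> \<ge> 0" using b0 by (simp_all add: \<beta>_def)
  have \<beta>c: "\<beta>\<^sup>2 < c - 1" "\<beta>\<^sup>2 \<le> c" unfolding \<beta>2 using \<tau>0 by linarith+
  obtain \<mu> :: nat where \<mu>: "C + \<bar>t\<bar> + 1 \<le> real \<mu>" using real_arch_simple by blast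
  have \<mu>0: "\<mu> > 0" using \<mu> C_pos by (cases \<mu>) auto
  obtain m :: nat where m: "m > 0" "(ln (2 * real (m + 2) * real \<mu> + 1) + c / 2) / real m \<le> \<eta> / 8"
    by (rule vanishing_entropy[OF \<mu>0, of "\<eta> / 8" c]) (use \<eta> in simp, rule that)
  define R where "R = real (m + 2) * real \<mu>"
  have R: "R \<ge> 0" by (simp add: R_def)
  define P where "P = R + real \<mu>"
  have P: "P > 0" using R \<mu>0 by (simp add: P_def)
  define \<tau> where "\<tau> = min \<tau>0 (\<eta> / 8 / P)"
  have \<tau>: "\<tau> > 0" "\<tau> \<le> \<tau>0" using \<tau>0 \<eta> P by (simp_all add: \<tau>_def)
  have "\<tau> \<le> \<eta> / 8 / P" by (simp add: \<tau>_def)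
  then have \<tau>P: "\<tau> * P \<le> \<eta> / 8" using P by (simp only: pos_le_divide_eq)
  obtain p where p: "\<And>l. l \<in> {a..b} \<Longrightarrow> \<bar>c - 1 / (l + t) - (val_poly p l)\<^sup>2\<bar> \<le> \<tau>"
  proof (rule polynomial_near_square_root[of a b "\<lambda>l. c - 1 / (l + t)" c \<tau>])
    have "l + t \<noteq> 0" if "l \<in> {a..b}" for l using t[OF that] \<delta> by linarith
    then show "continuous_on {a..b} (\<lambda>l. c - 1 / (l + t))" by (intro continuous_intros) auto
    show "0 \<le> c - 1 / (l + t) \<and> c - 1 / (l + t) \<le> c" if l: "l \<in> {a..b}" for l
    proof -
      have "0 < l + t" using t[OF l] \<delta> by linarith
      moreover have "1 / (l + t) \<le> 1 / \<delta>" using t[OF l] \<delta> by (intro divide_left_mono) auto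
      moreover have "1 / \<delta> \<le> c" using \<delta> by (simp add: c_def divide_right_mono)
      ultimately show ?thesis by simp
    qed
  qed (use \<tau> c4 in auto)
  have p\<beta>: "(val_poly p l)\<^sup>2 \<le> \<beta>\<^sup>2" if l: "l \<in> {a..b}" for l
  proof -
    have "0 < l + t" "l + t \<le> 1 - \<delta>" using t[OF l] \<delta> by linarith+
    then have "1 / (1 - \<delta>) \<le> 1 / (l + t)" by (intro divide_left_mono) auto
    with p[OF l] \<tau>(2) show ?thesis unfolding \<beta>2 by linarith
  qed
  have norm: "l2n (sz G) (Bop p G v) \<le> \<beta> * l2n (sz G) v" if G: "G \<in> GG" for G v
  proof (rule l2n_le_if_ip_le[OF polynomial_norm_le_spectrum[OF ew_sym[OF G]] \<beta>2(2)])
    fix l w assume w: "ip (sz G) w w > 0" "\<And>i. i < sz G \<Longrightarrow> mv (sz G) (ew G) w i = l * w i"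
    have "l \<in> {a..b}" by (rule spec[OF G eigenvalue_of_mv[OF graph[OF G] w]])
    from p\<beta>[OF this] show "\<bar>val_poly p l\<bar> \<le> \<beta>" using \<beta>2(2) by (simp add: abs_le_square_iff[symmetric])
  qed
  have "c - 1 > 0" "\<eta> / 8 > 0" using c4 \<eta> by auto
  from log_partition_approximable[OF this(1) \<beta>2(2) \<beta>c(1) R norm this(2)]
  obtain \<epsilon>0 where \<epsilon>0: "\<epsilon>0 > 0"
    "\<And>\<epsilon> K (r :: real \<Rightarrow> real \<Rightarrow> real). 0 < \<epsilon> \<Longrightarrow> \<epsilon> \<le> \<epsilon>0 \<Longrightarrow> \<epsilon> * real K \<le> R \<Longrightarrow> (\<And>h. curved_weight (c - 1) \<epsilon> (lat \<epsilon> K) (r h)) \<Longrightarrow>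
       (\<And>x. continuous_on UNIV (\<lambda>h. r h x)) \<Longrightarrow>
       \<exists>\<phi>\<in>density_span. \<forall>G\<in>GG. \<bar>log_partition r (lat \<epsilon> K) p G - \<phi> G\<bar> \<le> \<eta> / 8" by blast
  \<comment> \<open>\<open>\<epsilon> Y\<close> is the part of \<open>err\<close> that is due to the spacing.\<close>
  define Y where "Y = 2 * c * P + 1"
  have Y: "Y > 0" using c4 P by (simp add: Y_def add_pos_pos)
  obtain q :: nat where q: "max (1 / \<epsilon>0) (8 * Y / \<eta>) \<le> real q" using real_arch_simple by blast
  have q0: "real q > 0" using q \<epsilon>0(1) zero_less_divide_1_iff[of \<epsilon>0] by linarith
  define \<epsilon> where "\<epsilon> = 1 / real q"
  have \<epsilon>: "\<epsilon> > 0" "\<epsilon> * real q = 1" using q0 by (simp_all add: \<epsilon>_def)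
  have \<epsilon>s: "\<epsilon> \<le> \<epsilon>0" "\<epsilon> * Y \<le> \<eta> / 8"
    using q q0 \<epsilon>0(1) \<eta> by (simp_all add: \<epsilon>_def field_simps)
  let ?K = "\<lambda>j. (j + 2) * (\<mu> * q)"
  have K: "\<epsilon> * real (?K j) \<le> R" if "j < m" for j
  proof -
    have "\<epsilon> * real (?K j) = real (j + 2) * real \<mu> * (\<epsilon> * real q)" by (simp only: of_nat_mult mult_ac)
    also have "\<dots> = real (j + 2) * real \<mu>" by (simp only: \<epsilon>(2) mult_1_right)
    also have "\<dots> \<le> R" unfolding R_def using that by (intro mult_right_mono) auto
    finally show ?thesis .
  qed
  have cont: "continuous_on UNIV (\<lambda>h. free_weight c h x)" "continuous_on UNIV (\<lambda>h. spin_weight c h x)" for x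
    unfolding free_weight_def spin_weight_def by (intro continuous_intros)+
  have spin: "\<exists>\<phi>\<in>density_span. \<forall>G\<in>GG. \<bar>log_partition (spin_weight c) (lat \<epsilon> (?K j)) p G - \<phi> G\<bar> \<le> \<eta> / 8"
    if "j < m" for j by (rule \<epsilon>0(2)[OF \<epsilon>(1) \<epsilon>s(1) K[OF that] curved_spin_weight[OF \<epsilon>(1)] cont(2)])
  have free: "\<exists>\<phi>\<in>density_span. \<forall>G\<in>GG. \<bar>log_partition (free_weight c) (lat \<epsilon> (?K j)) p G - \<phi> G\<bar> \<le> \<eta> / 8"
    if "j < m" for j by (rule \<epsilon>0(2)[OF \<epsilon>(1) \<epsilon>s(1) K[OF that] curved_free_weight[OF \<epsilon>(1)] cont(1)])
  have "\<exists>\<phi>\<in>density_span. \<forall>G\<in>GG. \<bar>(\<Sum>j<m. log_partition (spin_weight c) (lat \<epsilon> (?K j)) p G - log_partition (free_weight c) (lat \<epsilon> (?K j)) p G) / real m - t / 2 - \<phi> G\<bar> \<le> 2 * (\<eta> / 8)"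
    by (intro log_partition_difference_average m(1) \<open>\<eta> / 8 > 0\<close> spin free)
  then obtain \<phi> where \<phi>: "\<phi> \<in> density_span"
    "\<And>G. G \<in> GG \<Longrightarrow> \<bar>(\<Sum>j<m. log_partition (spin_weight c) (lat \<epsilon> (?K j)) p G - log_partition (free_weight c) (lat \<epsilon> (?K j)) p G) / real m - t / 2 - \<phi> G\<bar> \<le> 2 * (\<eta> / 8)"
    by blast
  show "\<exists>\<phi>\<in>density_span. \<forall>G\<in>GG. \<bar>free_energy G - \<phi> G\<bar> \<le> \<eta>"
  proof (intro bexI[OF _ \<phi>(1)] ballI)
    fix G assume G: "G \<in> GG"
    let ?S = "(\<Sum>j<m. log_partition (spin_weight c) (lat \<epsilon> (?K j)) p G - log_partition (free_weight c) (lat \<epsilon> (?K j)) p G) / real m"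
    let ?L = "(ln (2 * real (m + 2) * real \<mu> + 1) + c / 2) / real m"
    have "\<bar>?S - (free_energy G + t / 2)\<bar> \<le> (\<tau> + 2 * c * \<epsilon>) * (real (m + 2) * real \<mu> + real \<mu>) + \<epsilon> + ?L"
    proof (rule free_energy_near_log_partitions[OF G spec[OF G] _ p _ _ _ \<epsilon>(2) \<mu> m(1)])
      show "0 < l + t \<and> l + t \<le> 1" if "l \<in> {a..b}" for l using t[OF that] \<delta> by linarith
      show "(val_poly p l)\<^sup>2 \<le> c" if "l \<in> {a..b}" for l using p\<beta>[OF that] \<beta>c(2) by linarith
    qed (use \<tau> c4 in auto)
    also have "(\<tau> + 2 * c * \<epsilon>) * (real (m + 2) * real \<mu> + real \<mu>) + \<epsilon> + ?L = \<tau> * P + \<epsilon> * Y + ?L"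
      by (simp add: P_def R_def Y_def algebra_simps)
    also have "\<dots> \<le> 3 * (\<eta> / 8)" using \<tau>P \<epsilon>s(2) m(2) by linarith
    finally have "\<bar>?S - (free_energy G + t / 2)\<bar> \<le> 3 * (\<eta> / 8)" .
    with \<phi>(2)[OF G] show "\<bar>free_energy G - \<phi> G\<bar> \<le> \<eta>" using \<eta> by linarith
  qed
qed

end

theorem theorem1:
  fixes C a b :: real
  assumes "C > 0" and "a \<le> b" and "b - a < 1"
  shows "free_energy \<in> local_functions (graph_class {a..b} C)"
proof -
  interpret bounded_graphs "graph_class {a..b} C" C
    by unfold_locales (use assms(1) in \<open>auto simp: graph_class_def\<close>)
  have "span_approximable free_energy"
    by (rule free_energy_span_approximable[OF _ assms(2,3)]) (auto simp: graph_class_def)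
  then show ?thesis by (simp only: local_functions_iff)
qed

end
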